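(* Let $a\in A$ have degree $d\ge1$, let $k\in\mathbb{N}$, and let $\mathbf{x}\in\mathcal{BT}(\mathbb{Q})$. The following are equivalent: (A) there exists $\omega\in\Omega_{\mathbf{x}}=\lambda^{-1}(\mathbf{x})$ with ${}_a\ell_k(\omega)=0$; (B) there exists $\omega\in\Omega_{\mathbf{x}}$ such that the $\mathbb{F}$-lattice ${}_a\phi^\omega$ is $k$-inseparable; (C) for every $\omega\in\Omega_{\mathbf{x}}$, ${}_a\phi^\omega$ is $k$-inseparable.
   Context: $\mathbb{F}=\mathbb{F}_q$, $A=\mathbb{F}[T]$, $K_\infty=\mathbb{F}((T^{-1}))$ with $|T|=q$, uniformizer $\pi=T^{-1}$, $C_\infty$ the completed algebraic closure, $r\ge2$. $\Omega=\{(\omega_1:\dots:\omega_r)\in\mathbb{P}^{r-1}(C_\infty):\omega_i\ K_\infty\text{-linearly independent}\}$ with $\omega_r=1$; $\Lambda_\omega=\sum A\omega_i$ with exponential $e_\omega(z)=z\prod_{0\ne\lambda\in\Lambda_\omega}(1-z/\lambda)$. The Drinfeld module $\phi^\omega$ of rank $r$ is determined by $e_\omega(az)=\phi^\omega_a(e_\omega(z))$, where $\phi^\omega_a(X)=\sum_{0\le k\le rd}{}_a\ell_k(\omega)X^{q^k}$, $d=\deg a$; the functions ${}_a\ell_k$ on $\Omega$ are the coefficient forms. ${}_a\phi^\omega=\{z\in C_\infty:\phi^\omega_a(z)=0\}$ is an $\mathbb{F}$-vector space of dimension $rd$. For a finite $\mathbb{F}$-subspace $\Lambda\subset C_\infty$,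 an $\mathbb{F}$-successive minimum basis is an ordered basis $(\mu_1,\mu_2,\dots)$ with each $\mu_j$ of minimal absolute value in $\Lambda\setminus\sum_{l<j}\mathbb{F}\mu_l$; the values $|\mu_j|$ are independent of the choice, and $\Lambda$ is $k$-inseparable if $|\mu_k|=|\mu_{k+1}|$. $\mathcal{BT}$ is the Bruhat–Tits building of $\mathrm{PGL}(r,K_\infty)$ (vertices: similarity classes of $O_\infty$-lattices in $K_\infty^r$; points of the realization: similarity classes of non-archimedean norms on $K_\infty^r$), $\mathcal{BT}(\mathbb{Q})$ its points with rational barycentric coordinates, and $\lambda:\Omega\to\mathcal{BT}(\mathbb{Q})$ the (surjective) building map sending $\omega$ to the class of the norm $v\mapsto|\sum v_i\omega_i|$. *)

theory Defs
  imports
    "HOL-Analysis.Analysis"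
    "HOL-Computational_Algebra.Computational_Algebra"
begin

unbundle no fps_syntax

section \<open>The fields\<close>

text \<open>
  The finite field is a type \<open>'f :: {field, finite}\<close>, so that q is \<open>CARD('f)\<close>, and
  \<open>A = F[T]\<close> is \<open>'f poly\<close>.  The field of Laurent series in \<open>1/T\<close> is \<open>'f fls\<close>:
  the variable \<open>fls_X\<close> is the uniformizer \<open>1/T\<close> and \<open>fls_X_inv\<close> is \<open>T\<close>.
\<close>

text \<open>The metric of \<open>'f fls\<close> in the library is normalized by 2 instead of q; it is not used.\<close>

definition absK :: "'f::{field,finite} fls \<Rightarrow> real" where
  "absK x = (if x = 0 then 0 else real CARD('f) powi (- fls_subdegree x))"

definition O_infty :: "'f::{field,finite} fls set" where
  "O_infty = {x. absK x \<le> 1}"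

definition A_to_K :: "'f::{field,finite} poly \<Rightarrow> 'f fls" where
  "A_to_K a = poly (map_poly fls_const a) fls_X_inv"

definition absC :: "'c::{field,metric_space} \<Rightarrow> real" where
  "absC z = dist z 0"

text \<open>
  The library has no completed algebraic closure of a valued field, so it is given by the
  properties that determine it up to isometric isomorphism over \<open>'f fls\<close>: an algebraically closed
  field, complete for a non-archimedean absolute value that induces its metric, with an isometric
  embedding of \<open>'f fls\<close> over which the algebraic elements are dense.  Algebraic closedness and
  completeness are the sort constraint on \<open>'c\<close>.
\<close>

locale C_infty =
  fixes \<iota> :: "'f::{field,finite} fls \<Rightarrow> 'c::{alg_closed_field,complete_space}"
  assumes embed_one: "\<iota> 1 = 1"
    and embed_add: "\<iota> (x + y) = \<iota> x + \<iota> y"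
    and embed_mult: "\<iota> (x * y) = \<iota> x * \<iota> y"
    and embed_abs: "absC (\<iota> x) = absK x"
    and dist_eq_abs: "dist z w = absC (z - w :: 'c)"
    and abs_mult: "absC (z * w :: 'c) = absC z * absC w"
    and abs_add: "absC (z + w :: 'c) \<le> max (absC z) (absC w)"
    and algebraic_dense: "closure {z :: 'c. \<exists>p. p \<noteq> 0 \<and> poly (map_poly \<iota> p) z = 0} = UNIV"


section \<open>Drinfeld modules and coefficient forms\<close>

text \<open>
  The rank r is \<open>CARD('r)\<close> for a finite linearly ordered index type \<open>'r\<close>; the last index is
  \<open>Max UNIV\<close>.
\<close>

definition Omega :: "('f::{field,finite} fls \<Rightarrow> 'c::{alg_closed_field,complete_space})
    \<Rightarrow> ('c ^ 'r::{finite,linorder}) set" where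
  "Omega \<iota> = {\<omega>. (\<forall>v. (\<Sum>i\<in>UNIV. \<iota> (v $ i) * \<omega> $ i) = 0 \<longrightarrow> v = 0)
                \<and> \<omega> $ Max UNIV = 1}"

definition A_lattice :: "('f::{field,finite} fls \<Rightarrow> 'c::{alg_closed_field,complete_space})
    \<Rightarrow> 'c ^ 'r::finite \<Rightarrow> 'c set" where
  "A_lattice \<iota> \<omega> = range (\<lambda>b. \<Sum>i\<in>UNIV. \<iota> (A_to_K (b $ i)) * \<omega> $ i)"

text \<open>The infinite product is the limit of the finite partial products, in the net sense.\<close>

definition lattice_exp :: "('f::{field,finite} fls \<Rightarrow> 'c::{alg_closed_field,complete_space})
    \<Rightarrow> 'c ^ 'r::finite \<Rightarrow> 'c \<Rightarrow> 'c" where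
  "lattice_exp \<iota> \<omega> z =
     z * Lim (finite_subsets_at_top (A_lattice \<iota> \<omega> - {0})) (\<lambda>S. \<Prod>u\<in>S. 1 - z / u)"

definition drinfeld_module :: "('f::{field,finite} fls \<Rightarrow> 'c::{alg_closed_field,complete_space})
    \<Rightarrow> 'c ^ 'r::finite \<Rightarrow> 'f poly \<Rightarrow> 'c poly" where
  "drinfeld_module \<iota> \<omega> a =
     (THE p. (\<exists>l :: nat \<Rightarrow> 'c. p = (\<Sum>k\<le>CARD('r) * degree a. monom (l k) (CARD('f) ^ k)))
           \<and> (\<forall>z. lattice_exp \<iota> \<omega> (\<iota> (A_to_K a) * z) = poly p (lattice_exp \<iota> \<omega> z)))"

definition coeff_form :: "('f::{field,finite} fls \<Rightarrow> 'c::{alg_closed_field,complete_space})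
    \<Rightarrow> 'f poly \<Rightarrow> nat \<Rightarrow> 'c ^ 'r::finite \<Rightarrow> 'c" where
  "coeff_form \<iota> a k \<omega> = coeff (drinfeld_module \<iota> \<omega> a) (CARD('f) ^ k)"

definition torsion :: "('f::{field,finite} fls \<Rightarrow> 'c::{alg_closed_field,complete_space})
    \<Rightarrow> 'f poly \<Rightarrow> 'c ^ 'r::finite \<Rightarrow> 'c set" where
  "torsion \<iota> a \<omega> = {z. poly (drinfeld_module \<iota> \<omega> a) z = 0}"


section \<open>Successive minima\<close>

definition F_scale :: "('f::{field,finite} fls \<Rightarrow> 'c::{alg_closed_field,complete_space})
    \<Rightarrow> 'f \<Rightarrow> 'c \<Rightarrow> 'c" where
  "F_scale \<iota> c z = \<iota> (fls_const c) * z"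

text \<open>The list is 0-based: \<open>ms ! j\<close> is the (j+1)-st basis vector.\<close>

definition is_smb :: "('f::{field,finite} fls \<Rightarrow> 'c::{alg_closed_field,complete_space})
    \<Rightarrow> 'c set \<Rightarrow> 'c list \<Rightarrow> bool" where
  "is_smb \<iota> \<Lambda> ms \<longleftrightarrow>
     module.span (F_scale \<iota>) (set ms) = \<Lambda>
     \<and> (\<forall>j<length ms. is_arg_min absC (\<lambda>z. z \<in> \<Lambda> - module.span (F_scale \<iota>) (set (take j ms))) (ms ! j))"

text \<open>
  The k-th and (k+1)-st basis vectors must both exist.  The absolute values do not depend on the
  basis, so it does not matter whether the basis is quantified existentially or universally.
\<close>

definition k_inseparable :: "('f::{field,finite} fls \<Rightarrow> 'c::{alg_closed_field,complete_space})
    \<Rightarrow> nat \<Rightarrow> 'c set \<Rightarrow> bool" where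
  "k_inseparable \<iota> k \<Lambda> \<longleftrightarrow>
     (\<exists>ms. is_smb \<iota> \<Lambda> ms \<and> 1 \<le> k \<and> k < length ms \<and> absC (ms ! (k - 1)) = absC (ms ! k))"


section \<open>The building\<close>

definition na_norm :: "('f::{field,finite} fls ^ 'r::finite \<Rightarrow> real) \<Rightarrow> bool" where
  "na_norm \<nu> \<longleftrightarrow>
     (\<forall>v. 0 \<le> \<nu> v) \<and> (\<forall>v. \<nu> v = 0 \<longleftrightarrow> v = 0)
     \<and> (\<forall>c v. \<nu> (c *s v) = absK c * \<nu> v)
     \<and> (\<forall>v w. \<nu> (v + w) \<le> max (\<nu> v) (\<nu> w))"

definition norm_similarity ::
    "(('f::{field,finite} fls ^ 'r::finite \<Rightarrow> real) \<times> ('f fls ^ 'r \<Rightarrow> real)) set" where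
  "norm_similarity = {(\<nu>, \<mu>). na_norm \<nu> \<and> na_norm \<mu> \<and> (\<exists>s>0. \<forall>v. \<mu> v = s * \<nu> v)}"

definition BT :: "('f::{field,finite} fls ^ 'r::finite \<Rightarrow> real) set set" where
  "BT = {\<nu>. na_norm \<nu>} // norm_similarity"

definition O_lattice :: "('f::{field,finite} fls ^ 'r::finite) set \<Rightarrow> bool" where
  "O_lattice L \<longleftrightarrow>
     (\<exists>e :: 'r \<Rightarrow> 'f fls ^ 'r. inj e \<and> vec.independent (range e)
        \<and> L = {\<Sum>i\<in>UNIV. c i *s e i | c. \<forall>i. c i \<in> O_infty})"

definition lattice_norm :: "('f::{field,finite} fls ^ 'r::finite) set \<Rightarrow> 'f fls ^ 'r \<Rightarrow> real" where
  "lattice_norm L v = Inf {absK x | x. v \<in> (*s) x ` L}"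

text \<open>
  A simplex of dimension m is given by a chain of lattices
  \<open>L 0 \<supset> L 1 \<supset> ... \<supset> L m \<supset> \<pi> L 0\<close>; its vertices are the classes of the \<open>L j\<close>.
\<close>

definition simplex_chain :: "nat \<Rightarrow> (nat \<Rightarrow> ('f::{field,finite} fls ^ 'r::finite) set) \<Rightarrow> bool" where
  "simplex_chain m L \<longleftrightarrow>
     (\<forall>j\<le>m. O_lattice (L j)) \<and> (\<forall>j<m. L (Suc j) \<subset> L j) \<and> (*s) fls_X ` L 0 \<subset> L m"

text \<open>
  The norm attached by Goldman and Iwahori to the point with barycentric coordinates
  \<open>t 0, ..., t m\<close> in that simplex.  In a basis \<open>e\<close> of \<open>L 0\<close> adapted to the chain,
  it is the norm for which \<open>e\<close> is orthogonal and, with logarithms to the base q,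
  \<open>log (\<nu> e\<^sub>i) = (\<Sum>j\<le>m. t j * log (lattice_norm (L j) e\<^sub>i))\<close>: if \<open>e\<^sub>i\<close> lies in \<open>L j\<close>
  exactly for \<open>j < n\<close>, then both sides equal \<open>\<Sum>j=n..m. t j\<close>, and the maximum defining
  the left-hand side is attained at \<open>j = n\<close>, or at \<open>j = 0\<close> if \<open>n = m + 1\<close>.
\<close>

definition barycentric_norm ::
    "nat \<Rightarrow> (nat \<Rightarrow> ('f::{field,finite} fls ^ 'r::finite) set) \<Rightarrow> (nat \<Rightarrow> real) \<Rightarrow> 'f fls ^ 'r \<Rightarrow> real" where
  "barycentric_norm m L t v =
     Max ((\<lambda>j. real CARD('f) powr (- (\<Sum>i<j. t i)) * lattice_norm (L j) v) ` {..m})"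

definition BT_rat :: "('f::{field,finite} fls ^ 'r::finite \<Rightarrow> real) set set" where
  "BT_rat = {x \<in> BT. \<exists>m L t. simplex_chain m L
      \<and> (\<forall>i\<le>m. 0 \<le> t i \<and> t i \<in> \<rat>) \<and> (\<Sum>i\<le>m. t i) = 1 \<and> barycentric_norm m L t \<in> x}"

definition building_map :: "('f::{field,finite} fls \<Rightarrow> 'c::{alg_closed_field,complete_space})
    \<Rightarrow> 'c ^ 'r::finite \<Rightarrow> ('f fls ^ 'r \<Rightarrow> real) set" where
  "building_map \<iota> \<omega> = norm_similarity `` {\<lambda>v. absC (\<Sum>i\<in>UNIV. \<iota> (v $ i) * \<omega> $ i)}"

definition Omega_fibre :: "('f::{field,finite} fls \<Rightarrow> 'c::{alg_closed_field,complete_space})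
    \<Rightarrow> ('f fls ^ 'r::{finite,linorder} \<Rightarrow> real) set \<Rightarrow> ('c ^ 'r::{finite,linorder}) set" where
  "Omega_fibre \<iota> x = {\<omega> \<in> Omega \<iota>. building_map \<iota> \<omega> = x}"

end

theory Submission
  imports Defs
begin

text \<open>
  Fix the norm \<open>\<nu>\<close> in the class \<open>x\<close> with value 1 at the last unit vector, and consider all
  \<open>\<omega>\<close> with \<open>\<bar>\<Sum>v\<^sub>i \<omega>\<^sub>i\<bar> = \<nu> v\<close>. The condition \<open>\<omega>\<^sub>r = 1\<close> can be restored at the end by
  dividing by the unit \<open>\<omega>\<^sub>r\<close>. The torsion \<open>W\<close> is the image of \<open>a\<inverse>\<Lambda>/\<Lambda>\<close> under the exponential,
  and the k-th coefficient form is \<open>a\<close> times the coefficient \<open>c\<^sub>k\<close> of \<open>X\<close> to the power \<open>q\<^sup>k\<close> in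
  \<open>X \<Prod>(1 - X/w)\<close>, where \<open>w\<close> runs through \<open>W - {0}\<close>.

  The absolute value of the exponential at a reduced vector \<open>v\<close> depends only on \<open>\<nu>\<close>, so (B) and
  (C) are equivalent. If \<open>W\<close> is not k-inseparable, it has a ball of \<open>q\<^sup>k\<close> elements, and this ball
  contributes the strictly dominant term of \<open>c\<^sub>k\<close>; hence (A) implies (B).

  Let \<open>W\<close> be k-inseparable and let \<open>m\<close> be the critical absolute value. The elements of \<open>W\<close> of
  absolute value at most \<open>m\<close>, modulo the smaller ones, form after scaling a residual
  \<open>F\<close>-space \<open>Y\<close>, and up to smaller terms \<open>c\<^sub>k\<close> is a power of a coefficient of the polynomial with
  the zeros \<open>Y\<close>. By orthogonality, the values of \<open>\<omega>\<close> on minimal representatives can be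
  prescribed so that \<open>Y\<close> is a finite field, for which the coefficient vanishes, or a slightly
  different space, for which it is a unit; the two \<open>\<omega>\<close> may be taken to differ by \<open>t p\<close> with a
  fixed vector \<open>p\<close> over \<open>F((1/T))\<close>. On the line of all \<open>\<omega> + t p\<close> the coefficient \<open>c\<^sub>k\<close> is a uniform limit of
  rational functions of \<open>t\<close> on a set that looks like a disc from outside. A limit of this kind
  whose absolute value is not constant has a zero, which gives (A).
\<close>

text \<open>A ball of q^i smaller torsion points raises the residual coefficients to the power q^i
  and shifts their index by i. So c_k with k = j + i is governed by the j-th coefficient of
  \<open>Y\<close>, where 0 < j < h and \<open>Y\<close> has dimension h. For the field with q^h
  elements the polynomial is a multiple of X - X^{q^h}, which has no middle terms; this is why a
  finite field is chosen. It makes c_k small, but not zero, since c_k is only a limit of rational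
  functions of \<omega>. A second \<omega> of the same norm with larger c_k is what forces a zero.
  To work in one variable, the two must lie on one line; therefore they differ at a single
  prescribed vector and are extended to the whole space simultaneously, with common values at all
  new vectors. The zeros of the approximating rational functions are counted by comparing absolute
  values on two circles. Their number and the leading constant become stationary, so the zeros can
  be followed, and completeness yields a limit.\<close>

no_notation fps_nth (infixl "$" 75)

section \<open>Absolute values\<close>

context C_infty
begin

lemma absC_nonneg [simp]: "0 \<le> absC (z :: 'c)"
  by (simp add: absC_def)

lemma absC_0 [simp]: "absC (0 :: 'c) = 0"
  by (simp add: absC_def)

lemma absC_eq_0_iff [simp]: "absC (z :: 'c) = 0 \<longleftrightarrow> z = 0"
  by (simp add: absC_def)

lemma absC_pos_iff [simp]: "0 < absC (z :: 'c) \<longleftrightarrow> z \<noteq> 0"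
  using absC_nonneg[of z] absC_eq_0_iff[of z] by linarith

lemma absC_1 [simp]: "absC (1 :: 'c) = 1"
  using abs_mult[of 1 1] by simp

lemma absC_uminus [simp]: "absC (- z :: 'c) = absC z"
  using dist_eq_abs[of 0 z] by (simp add: absC_def dist_commute)

lemma absC_minus_commute: "absC (x - y :: 'c) = absC (y - x)"
  using absC_uminus[of "x - y"] by simp

lemma absC_diff: "absC (x - y :: 'c) \<le> max (absC x) (absC y)"
  using abs_add[of x "- y"] by simp

lemma absC_add_less: "absC (x :: 'c) < e \<Longrightarrow> absC y < e \<Longrightarrow> absC (x + y) < e"
  using abs_add[of x y] by simp

lemma absC_diff_less: "absC (x :: 'c) < e \<Longrightarrow> absC y < e \<Longrightarrow> absC (x - y) < e"
  using absC_diff[of x y] by simp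

lemma absC_add_le: "absC (x :: 'c) \<le> e \<Longrightarrow> absC y \<le> e \<Longrightarrow> absC (x + y) \<le> e"
  using abs_add[of x y] by simp

lemma absC_diff_le: "absC (x :: 'c) \<le> e \<Longrightarrow> absC y \<le> e \<Longrightarrow> absC (x - y) \<le> e"
  using absC_diff[of x y] by simp

lemma absC_add_eq: "absC (x :: 'c) < absC y \<Longrightarrow> absC (x + y) = absC y"
  using abs_add[of x y] absC_diff[of "x + y" x] by (simp add: max_def split: if_splits)

lemma absC_diff_eq: "absC (x :: 'c) < absC y \<Longrightarrow> absC (x - y) = absC y"
  using absC_add_eq[of x "- y"] by simp

lemma absC_near: "absC (x - y :: 'c) < absC y \<Longrightarrow> absC x = absC y"
  using absC_add_eq[of "x - y" y] by simp

lemma absC_power [simp]: "absC (z ^ n :: 'c) = absC z ^ n"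
  by (induction n) (simp_all add: abs_mult)

lemma absC_inverse [simp]: "absC (inverse z :: 'c) = inverse (absC z)"
proof (cases "z = 0")
  case False
  then show ?thesis
    using abs_mult[of z "inverse z"] by (simp add: field_simps)
qed simp

lemma absC_divide [simp]: "absC (x / y :: 'c) = absC x / absC y"
  by (simp add: divide_inverse abs_mult)

lemma absC_prod: "absC (\<Prod>i\<in>S. f i :: 'c) = (\<Prod>i\<in>S. absC (f i))"
  by (induction S rule: infinite_finite_induct) (simp_all add: abs_mult)

lemma absC_sum_le: "(\<And>i. i \<in> S \<Longrightarrow> absC (f i :: 'c) \<le> e) \<Longrightarrow> 0 \<le> e \<Longrightarrow> absC (\<Sum>i\<in>S. f i) \<le> e"
  by (induction S rule: infinite_finite_induct) (auto intro: absC_add_le)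

lemma absC_sum_less: "(\<And>i. i \<in> S \<Longrightarrow> absC (f i :: 'c) < e) \<Longrightarrow> 0 < e \<Longrightarrow> absC (\<Sum>i\<in>S. f i) < e"
  by (induction S rule: infinite_finite_induct) (auto intro: absC_add_less)

lemma embed_0 [simp]: "\<iota> 0 = 0"
  using embed_add[of 0 0] by (simp only: add_0_left add_cancel_right_right)

lemma embed_uminus [simp]: "\<iota> (- x) = - \<iota> x"
  using embed_add[of x "- x"] by (simp add: eq_neg_iff_add_eq_0 add.commute)

lemma embed_diff: "\<iota> (x - y) = \<iota> x - \<iota> y"
  using embed_add[of x "- y"] by simp

lemma embed_eq_0_iff [simp]: "\<iota> x = 0 \<longleftrightarrow> x = 0"
proof -
  have "absC (\<iota> x) = 0 \<longleftrightarrow> absK x = 0"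
    by (simp add: embed_abs)
  moreover have "absK x = 0 \<longleftrightarrow> x = 0"
    by (simp add: absK_def power_int_def)
  ultimately show ?thesis by simp
qed

lemma embed_eq_iff [simp]: "\<iota> x = \<iota> y \<longleftrightarrow> x = y"
  using embed_eq_0_iff[of "x - y"] by (simp add: embed_diff)

lemma embed_power: "\<iota> (x ^ n) = \<iota> x ^ n"
  by (induction n) (simp_all add: embed_mult embed_one)

lemma embed_sum: "\<iota> (\<Sum>i\<in>S. f i) = (\<Sum>i\<in>S. \<iota> (f i))"
  by (induction S rule: infinite_finite_induct) (simp_all add: embed_add)

lemma embed_inverse: "\<iota> (inverse x) = inverse (\<iota> x)"
proof (cases "x = 0")
  case False
  then have "\<iota> x * \<iota> (inverse x) = 1"
    by (simp add: embed_mult[symmetric] embed_one)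
  then show ?thesis
    using inverse_unique by metis
qed simp

lemma embed_divide: "\<iota> (x / y) = \<iota> x / \<iota> y"
  by (simp add: divide_inverse embed_mult embed_inverse)

lemma absK_nonneg [simp]: "0 \<le> absK (x :: 'f fls)"
  by (simp add: embed_abs[symmetric])

lemma absK_0 [simp]: "absK (0 :: 'f fls) = 0"
  by (simp add: embed_abs[symmetric])

lemma absK_eq_0_iff [simp]: "absK (x :: 'f fls) = 0 \<longleftrightarrow> x = 0"
  by (simp add: embed_abs[symmetric])

lemma absK_pos_iff [simp]: "0 < absK (x :: 'f fls) \<longleftrightarrow> x \<noteq> 0"
  by (simp add: embed_abs[symmetric])

lemma absK_1 [simp]: "absK (1 :: 'f fls) = 1"
  by (simp add: embed_abs[symmetric] embed_one)

lemma absK_mult: "absK (x * y :: 'f fls) = absK x * absK y"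
  by (simp add: embed_abs[symmetric] embed_mult abs_mult)

lemma absK_inverse [simp]: "absK (inverse x :: 'f fls) = inverse (absK x)"
  by (simp add: embed_abs[symmetric] embed_inverse)

lemma absK_divide [simp]: "absK (x / y :: 'f fls) = absK x / absK y"
  by (simp add: embed_abs[symmetric] embed_divide)

lemma absK_power [simp]: "absK (x ^ n :: 'f fls) = absK x ^ n"
  by (simp add: embed_abs[symmetric] embed_power)

lemma absK_uminus [simp]: "absK (- x :: 'f fls) = absK x"
  by (simp add: embed_abs[symmetric])

lemma absK_add: "absK (x + y :: 'f fls) \<le> max (absK x) (absK y)"
  by (simp add: embed_abs[symmetric] embed_add abs_add)

lemma absK_diff: "absK (x - y :: 'f fls) \<le> max (absK x) (absK y)"
  using absK_add[of x "- y"] by simp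

lemma absK_diff_less: "absK (x :: 'f fls) < e \<Longrightarrow> absK y < e \<Longrightarrow> absK (x - y) < e"
  using absK_diff[of x y] by simp

lemma absK_add_less: "absK (x :: 'f fls) < e \<Longrightarrow> absK y < e \<Longrightarrow> absK (x + y) < e"
  using absK_add[of x y] by simp

lemma absK_near: "absK (x - y :: 'f fls) < absK y \<Longrightarrow> absK x = absK y"
  using absC_near[of "\<iota> x" "\<iota> y"] by (simp add: embed_abs embed_diff[symmetric])

lemma absK_sum_le: "(\<And>i. i \<in> S \<Longrightarrow> absK (f i :: 'f fls) \<le> e) \<Longrightarrow> 0 \<le> e \<Longrightarrow> absK (\<Sum>i\<in>S. f i) \<le> e"
  using absC_sum_le[of S "\<lambda>i. \<iota> (f i)" e] by (simp add: embed_abs embed_sum[symmetric])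

lemma absK_const [simp]: "absK (fls_const (c :: 'f)) = (if c = 0 then 0 else 1)"
  by (simp add: absK_def)

lemma q_ge_2: "2 \<le> CARD('f)"
proof -
  have "card {0 :: 'f, 1} \<le> CARD('f)"
    by (intro card_mono) auto
  then show ?thesis by simp
qed

lemma q_gt_1 [simp]: "1 < CARD('f)" "Suc 0 < CARD('f)" "0 < CARD('f)"
  using q_ge_2 by simp_all

lemma q_neq [simp]: "CARD('f) \<noteq> Suc 0" "CARD('f) \<noteq> 0"
  using q_ge_2 by linarith+

lemma q_real_gt_1 [simp]: "1 < real CARD('f)"
  using q_ge_2 by linarith

lemma q_power_inject [simp]: "CARD('f) ^ m = CARD('f) ^ n \<longleftrightarrow> m = n"
  by (rule power_inject_exp) simp

lemma absK_X_inv [simp]: "absK (fls_X_inv :: 'f fls) = CARD('f)"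
  by (simp add: absK_def)

section \<open>Polynomials inside Laurent series\<close>

abbreviation T :: "'f fls" where "T \<equiv> fls_X_inv"

lemma map_poly_const_add: "map_poly fls_const (p + r) = map_poly fls_const p + map_poly fls_const (r :: 'f poly)"
  by (rule poly_eqI) (simp add: coeff_map_poly fls_plus_const)

lemma map_poly_const_smult: "map_poly fls_const (smult c r) = smult (fls_const c) (map_poly fls_const (r :: 'f poly))"
  by (rule poly_eqI) (simp add: coeff_map_poly fls_const_mult_const)

lemma A_to_K_0 [simp]: "A_to_K (0 :: 'f poly) = 0"
  by (simp add: A_to_K_def)

lemma A_to_K_add: "A_to_K (p + r) = A_to_K p + A_to_K (r :: 'f poly)"
  by (simp add: A_to_K_def map_poly_const_add)

lemma A_to_K_pCons: "A_to_K (pCons c p) = fls_const c + T * A_to_K (p :: 'f poly)"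
  by (cases "pCons c p = 0") (simp_all add: A_to_K_def map_poly_pCons)

lemma A_to_K_smult: "A_to_K (smult c p) = fls_const c * A_to_K (p :: 'f poly)"
  by (simp add: A_to_K_def map_poly_const_smult)

lemma A_to_K_mult: "A_to_K (p * r) = A_to_K p * A_to_K (r :: 'f poly)"
  by (induction p) (simp_all add: A_to_K_pCons A_to_K_add A_to_K_smult algebra_simps)

lemma A_to_K_uminus: "A_to_K (- p) = - A_to_K (p :: 'f poly)"
  using A_to_K_add[of p "- p"] by (simp add: eq_neg_iff_add_eq_0 add.commute)

lemma A_to_K_const: "A_to_K [:c:] = fls_const (c :: 'f)"
  by (simp add: A_to_K_pCons)

lemma A_to_K_monom: "A_to_K (monom c n) = fls_const (c :: 'f) * T ^ n"
  by (induction n) (simp_all add: monom_0 monom_Suc A_to_K_const A_to_K_pCons algebra_simps)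

lemma absK_A_to_K: "p \<noteq> 0 \<Longrightarrow> absK (A_to_K p) = real CARD('f) ^ degree (p :: 'f poly)"
proof (induction p)
  case (pCons c p)
  show ?case
  proof (cases "p = 0")
    case True
    with pCons show ?thesis by (auto simp: A_to_K_const)
  next
    case False
    with pCons have "absK (T * A_to_K p) = real CARD('f) ^ Suc (degree p)"
      by (simp add: absK_mult)
    moreover have "absK (A_to_K (pCons c p) - T * A_to_K p) \<le> 1"
      by (simp add: A_to_K_pCons)
    moreover have "1 < real CARD('f) ^ Suc (degree p)"
      by (rule one_less_power) simp_all
    ultimately show ?thesis
      using absK_near[of "A_to_K (pCons c p)" "T * A_to_K p"] False by simp
  qed
qed simp

lemma A_to_K_eq_0_iff [simp]: "A_to_K p = 0 \<longleftrightarrow> (p :: 'f poly) = 0"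
proof (cases "p = 0")
  case False
  then have "0 < absK (A_to_K p)" by (simp add: absK_A_to_K)
  with False show ?thesis by simp
qed simp

lemma A_to_K_inject [simp]: "A_to_K p = A_to_K r \<longleftrightarrow> p = (r :: 'f poly)"
  using A_to_K_eq_0_iff[of "p - r"] A_to_K_add[of "p - r" r] by auto

lemma absK_A_to_K_ge_1: "p \<noteq> 0 \<Longrightarrow> 1 \<le> absK (A_to_K (p :: 'f poly))"
  by (simp add: absK_A_to_K one_le_power q_ge_2 order_less_imp_le)

lemma absK_A_to_K_less_iff: "absK (A_to_K (p :: 'f poly)) < real CARD('f) ^ n \<longleftrightarrow> p = 0 \<or> degree p < n"
  by (cases "p = 0") (simp_all add: absK_A_to_K)

text \<open>A leading term of absolute value at least 1 is a monomial in T, and subtracting it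
  raises the subdegree. The 1 in the measure makes it drop even when the subdegree passes from 0 to
  a positive value.\<close>

lemma polynomial_part: "\<exists>p :: 'f poly. absK (x - A_to_K p) < 1"
proof (induction "nat (1 - fls_subdegree x)" arbitrary: x rule: less_induct)
  case less
  show ?case
  proof (cases "absK x < 1")
    case True
    then show ?thesis by (intro exI[of _ 0]) simp
  next
    case False
    then have x0: "x \<noteq> 0" by auto
    have "fls_subdegree x \<le> 0"
    proof (rule ccontr)
      assume "\<not> fls_subdegree x \<le> 0"
      then have "real CARD('f) powi (- fls_subdegree x) < real CARD('f) powi 0"
        by (intro power_int_strict_increasing) simp_all
      with False x0 show False by (simp add: absK_def)
    qed
    define n where "n = nat (- fls_subdegree x)"
    have n: "fls_subdegree x = - int n"
      using \<open>fls_subdegree x \<le> 0\<close> by (simp add: n_def)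
    define c where "c = fls_nth x (- int n)"
    define y where "y = x - A_to_K (monom c n)"
    have y_nth: "fls_nth y k = (if k = - int n then 0 else fls_nth x k)" for k
      by (simp add: y_def A_to_K_monom c_def)
    show ?thesis
    proof (cases "y = 0")
      case True
      then show ?thesis by (intro exI[of _ "monom c n"]) (simp add: y_def)
    next
      case False
      have "fls_subdegree y > - int n"
      proof -
        have "fls_subdegree y \<ge> - int n + 1"
          using False
          by (intro fls_subdegree_geI) (auto simp: y_nth n[symmetric])
        then show ?thesis by simp
      qed
      then have "nat (1 - fls_subdegree y) < nat (1 - fls_subdegree x)"
        using n by simp
      from less[OF this] obtain p where "absK (y - A_to_K p) < 1"
        by blast
      then show ?thesis
        by (intro exI[of _ "monom c n + p"]) (simp add: y_def A_to_K_add algebra_simps)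
    qed
  qed
qed

end

section \<open>Finite subspaces and their polynomials\<close>

text \<open>The finite analogue of the lattice exponential: simple zeros on \<open>V\<close> and
  linear coefficient 1. This normalization, unlike the monic one, survives the passage to infinite
  lattices.\<close>

definition fexp :: "'a::field set \<Rightarrow> 'a \<Rightarrow> 'a" where
  "fexp V z = z * (\<Prod>v\<in>V - {0}. 1 - z / v)"

definition lpoly :: "'a::field set \<Rightarrow> 'a poly" where
  "lpoly V = [:0, 1:] * (\<Prod>v\<in>V - {0}. [:1, - inverse v:])"

lemma poly_lpoly [simp]: "poly (lpoly V) z = fexp V z"
  by (simp add: lpoly_def fexp_def poly_prod divide_inverse)

lemma degree_lpoly:
  fixes V :: "'a::field set"
  assumes "finite V" "0 \<in> V"
  shows "degree (lpoly V) = card V"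
proof -
  have "degree (\<Prod>v\<in>V - {0}. [:1, - inverse v:]) = (\<Sum>v\<in>V - {0}. degree [:1, - inverse v:])"
    by (rule degree_prod_eq_sum_degree) auto
  also have "\<dots> = (\<Sum>v\<in>V - {0}. 1)"
    by (rule sum.cong) auto
  also have "\<dots> = card V - 1"
    using assms by simp
  finally have deg: "degree (\<Prod>v\<in>V - {0}. [:1, - inverse v:]) = card V - 1" .
  have "degree (lpoly V) = degree ([:0, 1:] :: 'a poly) + degree (\<Prod>v\<in>V - {0}. [:1, - inverse v:])"
    unfolding lpoly_def by (rule degree_mult_eq) (use assms(1) in auto)
  then show ?thesis
    using deg assms card_gt_0_iff[of V] by auto
qed

lemma coeff_lpoly_1 [simp]: "finite V \<Longrightarrow> coeff (lpoly V) (Suc 0) = 1"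
  by (simp add: lpoly_def coeff_pCons poly_0_coeff_0[symmetric] poly_prod)

lemma fexp_eq_0_iff:
  assumes "finite V" "0 \<in> V"
  shows "fexp V z = 0 \<longleftrightarrow> z \<in> V"
  using assms by (auto simp: fexp_def)

lemma fexp_0 [simp]: "fexp V 0 = 0"
  by (simp add: fexp_def)

lemma fexp_altdef:
  assumes "finite V" "0 \<in> V"
  shows "fexp V z = (\<Prod>v\<in>V - {0}. - inverse v) * (\<Prod>v\<in>V. z - v)"
proof -
  have "(\<Prod>v\<in>V. z - v) = z * (\<Prod>v\<in>V - {0}. z - v)"
    using assms by (subst prod.remove[of V 0]) auto
  moreover have "(\<Prod>v\<in>V - {0}. - inverse v) * (\<Prod>v\<in>V - {0}. z - v) = (\<Prod>v\<in>V - {0}. 1 - z / v)"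
    unfolding prod.distrib[symmetric] by (rule prod.cong) (auto simp: field_simps)
  ultimately show ?thesis
    by (simp add: fexp_def mult.left_commute)
qed

lemma lpoly_singleton [simp]: "lpoly {0} = [:0, 1:]"
  by (simp add: lpoly_def)

lemma fexp_scale:
  assumes "s \<noteq> (0 :: 'a::field)"
  shows "fexp ((*) s ` V) (s * z) = s * fexp V z"
proof -
  have "(*) s ` V - {0} = (*) s ` (V - {0})"
    using assms by auto
  then have "(\<Prod>v\<in>(*) s ` V - {0}. 1 - s * z / v) = (\<Prod>v\<in>V - {0}. 1 - z / v)"
    using assms by (simp add: prod.reindex inj_on_def)
  then show ?thesis by (simp add: fexp_def)
qed

text \<open>If P is the polynomial of V, that of s V is s P(X / s). In the product the leading
  factor X stays outside the substitution, hence the exponent n - 1.\<close>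

lemma coeff_lpoly_scale:
  assumes "s \<noteq> (0 :: 'a::field)" "0 < n"
  shows "coeff (lpoly ((*) s ` V)) n = coeff (lpoly V) n / s ^ (n - 1)"
proof -
  have "(*) s ` V - {0} = (*) s ` (V - {0})"
    using assms by auto
  then have "(\<Prod>v\<in>(*) s ` V - {0}. [:1, - inverse v:]) = (\<Prod>v\<in>V - {0}. [:1, - inverse (s * v):])"
    using assms by (simp add: prod.reindex inj_on_def)
  also have "\<dots> = (\<Prod>v\<in>V - {0}. pcompose [:1, - inverse v:] [:0, inverse s:])"
    by (rule prod.cong) (simp_all add: pcompose_pCons inverse_mult_distrib)
  also have "\<dots> = pcompose (\<Prod>v\<in>V - {0}. [:1, - inverse v:]) [:0, inverse s:]"
    by (simp add: pcompose_prod)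
  finally show ?thesis
    using assms(2) by (cases n) (simp_all add: lpoly_def coeff_pcompose_linear power_inverse divide_inverse)
qed

context C_infty
begin

lemma embed_const_add: "\<iota> (fls_const (c + d)) = \<iota> (fls_const c) + \<iota> (fls_const d)"
  by (simp only: fls_plus_const[symmetric] embed_add)

lemma embed_const_mult: "\<iota> (fls_const (c * d)) = \<iota> (fls_const c) * \<iota> (fls_const d)"
  by (simp only: fls_const_mult_const[symmetric] embed_mult)

sublocale F: vector_space "F_scale \<iota>"
  by unfold_locales
    (simp_all add: F_scale_def embed_const_add embed_const_mult embed_one distrib_left distrib_right mult.assoc)

lemma absC_F_scale [simp]: "absC (F_scale \<iota> c z) = (if c = 0 then 0 else absC z)"
  by (simp add: F_scale_def abs_mult embed_abs)

lemma infinite_UNIV_c [simp]: "infinite (UNIV :: 'c set)"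
proof -
  have "inj (\<lambda>n. \<iota> (T ^ n))"
  proof (rule injI)
    fix m n assume "\<iota> (T ^ m) = \<iota> (T ^ n)"
    then have "absK (T ^ m) = absK (T ^ n)" by simp
    then show "m = n"
      using power_inject_exp[of "real CARD('f)" m n] by simp
  qed
  then have "infinite (range (\<lambda>n. \<iota> (T ^ n)))"
    by (rule range_inj_infinite)
  then show ?thesis
    using finite_subset subset_UNIV by blast
qed

lemma poly_ext: "(\<And>z. poly p z = poly r z) \<Longrightarrow> p = (r :: 'c poly)"
proof (rule ccontr)
  assume "\<And>z. poly p z = poly r z" "p \<noteq> r"
  then have "{z. poly (p - r) z = 0} = UNIV" "p - r \<noteq> 0" by auto
  then show False
    using poly_roots_finite[of "p - r"] by simp
qed

definition fsub :: "'c set \<Rightarrow> bool" where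
  "fsub V \<longleftrightarrow> F.subspace V \<and> finite V"

lemma fsubD:
  assumes "fsub V"
  shows "finite V" "0 \<in> V" "x \<in> V \<Longrightarrow> y \<in> V \<Longrightarrow> x + y \<in> V" "x \<in> V \<Longrightarrow> y \<in> V \<Longrightarrow> x - y \<in> V"
    "x \<in> V \<Longrightarrow> F_scale \<iota> c x \<in> V" "x \<in> V \<Longrightarrow> - x \<in> V"
  using assms by (auto simp: fsub_def F.subspace_0 F.subspace_add F.subspace_diff F.subspace_scale F.subspace_neg)

lemma fsub_singleton [simp]: "fsub {0}"
  by (simp add: fsub_def)

lemma fexp_translate:
  assumes "fsub V" "v \<in> V"
  shows "fexp V (z + v) = fexp V z"
proof -
  have "(\<Prod>u\<in>V. z + v - u) = (\<Prod>u\<in>V. z - u)"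
    by (rule prod.reindex_bij_witness[of _ "\<lambda>u. u + v" "\<lambda>u. u - v"])
      (use assms in \<open>auto simp: fsubD algebra_simps\<close>)
  then show ?thesis
    using assms by (simp add: fexp_altdef fsubD)
qed

text \<open>The polynomials P(X + y) and P(X) + P(y) have the same degree and leading coefficient,
  and they agree at the points of V, whose number is the degree.\<close>

lemma fexp_add:
  assumes "fsub V"
  shows "fexp V (x + y) = fexp V x + fexp V y"
proof -
  let ?p = "lpoly V"
  have deg: "degree ?p = card V" and pos: "0 < card V"
    using assms fsubD card_gt_0_iff[of V] by (auto intro: degree_lpoly)
  have "?p \<circ>\<^sub>p [:y, 1:] = ?p + [:poly ?p y:]"
  proof (rule poly_eqI_degree_lead_coeff[where n = "card V" and A = V])
    have "lead_coeff (?p \<circ>\<^sub>p [:y, 1:]) = lead_coeff ?p"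
      by (subst lead_coeff_comp) simp_all
    then show "coeff (?p \<circ>\<^sub>p [:y, 1:]) (card V) = coeff (?p + [:poly ?p y:]) (card V)"
      using pos deg by (simp add: degree_pcompose coeff_pCons split: nat.splits)
    show "poly (?p \<circ>\<^sub>p [:y, 1:]) z = poly (?p + [:poly ?p y:]) z" if "z \<in> V" for z
      using fexp_translate[OF assms that, of y] that assms fexp_eq_0_iff[of V z]
      by (simp add: poly_pcompose fsubD)
  qed (use deg in \<open>auto simp: degree_pcompose intro!: degree_add_le\<close>)
  then have "poly (?p \<circ>\<^sub>p [:y, 1:]) x = poly (?p + [:poly ?p y:]) x" by simp
  then show ?thesis by (simp add: poly_pcompose add.commute)
qed

lemma fexp_F_scale:
  assumes "fsub V"
  shows "fexp V (F_scale \<iota> c z) = F_scale \<iota> c (fexp V z)"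
proof (cases "c = 0")
  case False
  let ?s = "\<iota> (fls_const c)"
  have s: "?s \<noteq> 0" using False by simp
  have "(*) ?s ` V = V"
  proof -
    have "(*) ?s ` V \<subseteq> V"
      using fsubD(5)[OF assms] by (auto simp: F_scale_def)
    moreover have "card ((*) ?s ` V) = card V"
      using s by (intro card_image) (auto simp: inj_on_def)
    ultimately show ?thesis
      using assms fsubD(1) card_subset_eq by metis
  qed
  with fexp_scale[OF s, of V z] show ?thesis by (simp add: F_scale_def)
qed (simp add: F_scale_def)

lemma fexp_uminus: "fsub V \<Longrightarrow> fexp V (- x) = - fexp V x"
  using fexp_add[of V x "- x"] by (simp add: eq_neg_iff_add_eq_0 add.commute)

lemma fexp_diff: "fsub V \<Longrightarrow> fexp V (x - y) = fexp V x - fexp V y"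
  using fexp_add[of V x "- y"] by (simp add: fexp_uminus)

text \<open>The factors of \<open>V'\<close> are grouped by cosets of \<open>V\<close>. Over the
  coset with image \<open>w\<close> they collapse to \<open>1 - fexp V z / w\<close>, because
  numerators and denominators multiply to values of the monic product over \<open>V\<close>.\<close>

lemma fexp_fexp:
  assumes "fsub V" "fsub V'" "V \<subseteq> V'"
  shows "fexp V' z = fexp (fexp V ` V') (fexp V z)"
proof -
  let ?W = "fexp V ` V'"
  have fin: "finite V" "finite V'" and V0: "0 \<in> V" "0 \<in> V'"
    using assms fsubD by auto
  have fibre: "(\<Prod>u\<in>{u \<in> V' - V. fexp V u = w}. 1 - z / u) = 1 - fexp V z / w" if w: "w \<in> ?W - {0}" for w
  proof -
    obtain v' where v': "v' \<in> V'" "w = fexp V v'" using w by auto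
    then have "v' \<notin> V" using w fexp_eq_0_iff[of V v'] fin V0 by auto
    have "{u \<in> V' - V. fexp V u = w} = (\<lambda>v. v' - v) ` V" (is "?L = ?R")
    proof
      show "?L \<subseteq> ?R"
      proof
        fix u assume u: "u \<in> ?L"
        then have "fexp V (v' - u) = 0"
          using v' assms by (simp add: fexp_diff)
        then have "v' - u \<in> V" using fexp_eq_0_iff fin V0 by auto
        then show "u \<in> ?R" by (intro image_eqI[of _ _ "v' - u"]) auto
      qed
      show "?R \<subseteq> ?L"
      proof
        fix u assume "u \<in> ?R"
        then obtain v where v: "v \<in> V" "u = v' - v" by auto
        have "u \<in> V'" using v v' assms fsubD(4) by blast
        moreover have "fexp V u = w"
          using v v' assms fexp_eq_0_iff[of V v] fin V0 by (simp add: fexp_diff)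
        moreover have "u \<notin> V"
          using \<open>fexp V u = w\<close> w fexp_eq_0_iff[of V u] fin V0 by auto
        ultimately show "u \<in> ?L" by auto
      qed
    qed
    then have "(\<Prod>u\<in>{u \<in> V' - V. fexp V u = w}. 1 - z / u) = (\<Prod>v\<in>V. 1 - z / (v' - v))"
      by (simp add: prod.reindex inj_on_def)
    also have "\<dots> = (\<Prod>v\<in>V. (v' - z - v) / (v' - v))"
    proof (rule prod.cong)
      fix v assume "v \<in> V"
      then have "v' - v \<noteq> 0" using \<open>v' \<notin> V\<close> by auto
      then show "1 - z / (v' - v) = (v' - z - v) / (v' - v)"
        by (simp add: divide_simps)
    qed simp
    also have "\<dots> = fexp V (v' - z) / fexp V v'"
      using fin by (simp add: fexp_altdef V0 prod_dividef)
    also have "\<dots> = 1 - fexp V z / w"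
      using w v' assms by (simp add: fexp_diff diff_divide_distrib)
    finally show ?thesis .
  qed
  have "(\<Prod>u\<in>V' - V. 1 - z / u) = (\<Prod>w\<in>?W - {0}. \<Prod>u\<in>{u \<in> V' - V. fexp V u = w}. 1 - z / u)"
    by (rule prod.group[symmetric]) (use fin V0 fexp_eq_0_iff in auto)
  also have "\<dots> = (\<Prod>w\<in>?W - {0}. 1 - fexp V z / w)"
    using fibre by (intro prod.cong) auto
  finally have *: "(\<Prod>u\<in>V' - V. 1 - z / u) = (\<Prod>w\<in>?W - {0}. 1 - fexp V z / w)" .
  have "(\<Prod>u\<in>V' - {0}. 1 - z / u) = (\<Prod>u\<in>V - {0}. 1 - z / u) * (\<Prod>u\<in>V' - V. 1 - z / u)"
  proof -
    have "V' - {0} = (V - {0}) \<union> (V' - V)" using assms(3) V0 by auto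
    moreover have "(V - {0}) \<inter> (V' - V) = {}" by auto
    ultimately show ?thesis using fin by (simp add: prod.union_disjoint)
  qed
  then show ?thesis by (simp add: fexp_def * mult.assoc)
qed

section \<open>Frobenius and q-polynomials\<close>

lemma const_power_q: "(c :: 'f) ^ CARD('f) = c"
proof (cases "c = 0")
  case False
  let ?P = "\<Prod>y\<in>UNIV - {0 :: 'f}. y"
  have "?P = (\<Prod>y\<in>UNIV - {0}. c * y)"
    by (rule prod.reindex_bij_witness[of _ "\<lambda>y. c * y" "\<lambda>y. y / c"]) (use False in auto)
  also have "\<dots> = c ^ (CARD('f) - 1) * ?P"
    by (simp add: prod.distrib)
  finally have "c ^ (CARD('f) - 1) = 1" by simp
  then have "c * c ^ (CARD('f) - 1) = c" by simp
  then show ?thesis by (simp add: power_Suc[symmetric] del: power_Suc)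
qed simp

definition line :: "'c \<Rightarrow> 'c set" where
  "line w = range (\<lambda>c. F_scale \<iota> c w)"

lemma fls_const_inject [simp]: "fls_const c = fls_const d \<longleftrightarrow> c = (d :: 'f)"
  by (metis fls_const_nth)

lemma card_line: "w \<noteq> 0 \<Longrightarrow> card (line w) = CARD('f)"
  unfolding line_def by (subst card_image) (auto simp: F_scale_def inj_on_def)

lemma fsub_line [simp]: "fsub (line w)"
  by (auto simp: fsub_def F.subspace_def line_def F.scale_left_distrib[symmetric] intro: range_eqI[of _ _ 0])

lemma line_1_power: "x \<in> line 1 \<Longrightarrow> x ^ CARD('f) = x"
proof -
  assume "x \<in> line 1"
  then obtain c where "x = \<iota> (fls_const c)" by (auto simp: line_def F_scale_def)
  moreover have "fls_const c ^ CARD('f) = fls_const (c ^ CARD('f))"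
    by (simp only: fls_const_power)
  ultimately show ?thesis
    by (simp add: embed_power[symmetric] const_power_q)
qed

lemma fexp_line_1: "fexp (line 1) z = z - z ^ CARD('f)"
proof -
  let ?r = "[:0, 1:] - monom 1 CARD('f) :: 'c poly"
  define k where "k = - coeff (lpoly (line 1)) CARD('f)"
  have deg: "degree (lpoly (line 1)) = CARD('f)"
    by (simp add: degree_lpoly fsubD card_line)
  have "lpoly (line 1) = smult k ?r"
  proof (rule poly_eqI_degree_lead_coeff[where n = "CARD('f)" and A = "line 1"])
    show "coeff (lpoly (line 1)) CARD('f) = coeff (smult k ?r) CARD('f)"
      using q_gt_1 by (simp add: k_def coeff_pCons split: nat.splits)
    show "degree (smult k ?r) \<le> CARD('f)"
      using q_gt_1 by (intro order.trans[OF degree_smult_le] degree_diff_le) (simp_all add: degree_monom_le)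
    show "poly (lpoly (line 1)) z = poly (smult k ?r) z" if "z \<in> line 1" for z
      using that line_1_power[OF that] by (simp add: poly_monom fexp_eq_0_iff fsubD)
  qed (simp_all add: deg card_line)
  moreover from arg_cong[OF this, of "\<lambda>p. coeff p 1"] have "k = 1"
    using q_gt_1 by (simp add: fsubD coeff_pCons)
  ultimately have "poly (lpoly (line 1)) z = poly ?r z" by simp
  then show ?thesis by (simp add: poly_monom)
qed

lemma line_eq: "line w = (*) w ` line 1"
  by (auto simp: line_def F_scale_def image_iff mult.commute)

lemma fexp_line: "w \<noteq> 0 \<Longrightarrow> fexp (line w) z = z - z ^ CARD('f) / w ^ (CARD('f) - 1)"
proof -
  assume w: "w \<noteq> 0"
  have "fexp (line w) (w * (z / w)) = w * fexp (line 1) (z / w)"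
    using fexp_scale[OF w] line_eq[of w] by metis
  moreover have "w ^ CARD('f) = w * w ^ (CARD('f) - 1)"
    using q_gt_1 by (simp add: power_Suc[symmetric] del: power_Suc)
  ultimately show ?thesis
    using w by (simp add: fexp_line_1 power_divide right_diff_distrib)
qed

text \<open>By \<open>fexp_line_1\<close> the q-th power is the identity minus an additive function;
  the characteristic of the field never has to be identified.\<close>

lemma frob_add: "(x + y :: 'c) ^ CARD('f) = x ^ CARD('f) + y ^ CARD('f)"
  using fexp_add[OF fsub_line, of 1 x y] by (simp add: fexp_line_1 algebra_simps)

lemma frob_sum: "(\<Sum>i\<in>S. f i :: 'c) ^ (CARD('f) ^ n) = (\<Sum>i\<in>S. f i ^ (CARD('f) ^ n))"
proof -
  have add: "(x + y :: 'c) ^ (CARD('f) ^ n) = x ^ (CARD('f) ^ n) + y ^ (CARD('f) ^ n)" for x y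
    by (induction n arbitrary: x y) (simp_all add: frob_add power_mult)
  show ?thesis
    by (induction S rule: infinite_finite_induct) (simp_all add: add power_0_left)
qed

definition adjoin :: "'c set \<Rightarrow> 'c \<Rightarrow> 'c set" where
  "adjoin V y = (\<lambda>(v, c). v + F_scale \<iota> c y) ` (V \<times> UNIV)"

lemma adjoin_iff: "x \<in> adjoin V y \<longleftrightarrow> (\<exists>v\<in>V. \<exists>c. x = v + F_scale \<iota> c y)"
  by (auto simp: adjoin_def)

lemma fsub_adjoin:
  assumes "fsub V"
  shows "fsub (adjoin V y)"
  unfolding fsub_def
proof
  show "F.subspace (adjoin V y)"
    unfolding F.subspace_def
  proof (intro conjI ballI allI)
    show "0 \<in> adjoin V y"
      unfolding adjoin_iff using fsubD(2)[OF assms] by (intro bexI[of _ 0] exI[of _ 0]) simp_all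
  next
    fix x x' assume "x \<in> adjoin V y" "x' \<in> adjoin V y"
    then obtain v c v' c' where "v \<in> V" "v' \<in> V" "x = v + F_scale \<iota> c y" "x' = v' + F_scale \<iota> c' y"
      by (auto simp: adjoin_iff)
    then show "x + x' \<in> adjoin V y"
      unfolding adjoin_iff using fsubD(3)[OF assms]
      by (intro bexI[of _ "v + v'"] exI[of _ "c + c'"]) (simp_all add: F.scale_left_distrib)
  next
    fix d x assume "x \<in> adjoin V y"
    then obtain v c where "v \<in> V" "x = v + F_scale \<iota> c y" by (auto simp: adjoin_iff)
    then show "F_scale \<iota> d x \<in> adjoin V y"
      unfolding adjoin_iff using fsubD(5)[OF assms]
      by (intro bexI[of _ "F_scale \<iota> d v"] exI[of _ "d * c"]) (simp_all add: F.scale_right_distrib)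
  qed
  show "finite (adjoin V y)" using fsubD(1)[OF assms] by (simp add: adjoin_def)
qed

lemma adjoin_superset: "V \<subseteq> adjoin V y"
proof
  fix v assume "v \<in> V"
  then show "v \<in> adjoin V y" unfolding adjoin_iff by (intro bexI[of _ v] exI[of _ 0]) simp_all
qed

lemma adjoin_self: "fsub V \<Longrightarrow> y \<in> adjoin V y"
  unfolding adjoin_iff by (intro bexI[of _ 0] exI[of _ 1]) (simp_all add: fsubD)

lemma adjoin_least: "fsub U \<Longrightarrow> V \<subseteq> U \<Longrightarrow> y \<in> U \<Longrightarrow> adjoin V y \<subseteq> U"
  by (auto simp: adjoin_iff intro!: fsubD)

lemma F_scale_in_iff: "fsub V \<Longrightarrow> c \<noteq> 0 \<Longrightarrow> F_scale \<iota> c y \<in> V \<longleftrightarrow> y \<in> V"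
  using fsubD(5)[of V "F_scale \<iota> c y" "inverse c"] fsubD(5)[of V y c] by auto

lemma card_adjoin:
  assumes "fsub V" "y \<notin> V"
  shows "card (adjoin V y) = CARD('f) * card V"
proof -
  have "inj_on (\<lambda>(v, c). v + F_scale \<iota> c y) (V \<times> UNIV)"
  proof (rule inj_onI, clarsimp)
    fix v c v' c' assume *: "v \<in> V" "v' \<in> V" "v + F_scale \<iota> c y = v' + F_scale \<iota> c' y"
    then have "F_scale \<iota> (c - c') y = v' - v"
      by (simp add: F.scale_left_diff_distrib algebra_simps)
    then have "c = c'"
      using * assms F_scale_in_iff[of V "c - c'" y] fsubD(4)[OF assms(1)] by (cases "c = c'") auto
    then show "v = v' \<and> c = c'" using * by simp
  qed
  then show ?thesis
    unfolding adjoin_def by (simp add: card_image card_cartesian_product)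
qed

text \<open>A maximal subspace of \<open>V\<close> with \<open>P\<close> must be \<open>V\<close>
  itself, since otherwise a line could be adjoined. Statements on q-polynomials are proved along
  such flags.\<close>

lemma fsub_induct [consumes 1, case_names zero adjoin]:
  assumes V: "fsub V" and zero: "P {0}"
    and adj: "\<And>V' y. fsub V' \<Longrightarrow> V' \<subseteq> V \<Longrightarrow> y \<in> V \<Longrightarrow> y \<notin> V' \<Longrightarrow> P V' \<Longrightarrow> P (adjoin V' y)"
  shows "P V"
proof -
  let ?S = "{V'. V' \<subseteq> V \<and> fsub V' \<and> P V'}"
  have "finite ?S" using fsubD(1)[OF V] by (intro finite_subset[of ?S "Pow V"]) auto
  moreover have "{0} \<in> ?S" using V zero by (simp add: fsubD)
  ultimately have "\<exists>V'\<in>?S. {0} \<subseteq> V' \<and> (\<forall>U\<in>?S. V' \<subseteq> U \<longrightarrow> V' = U)"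
    by (rule finite_has_maximal2)
  then obtain V' where V'1: "V' \<in> ?S" and V'2: "{0} \<subseteq> V' \<and> (\<forall>U\<in>?S. V' \<subseteq> U \<longrightarrow> V' = U)"
    by (rule bexE)
  note V' = V'1 conjunct2[OF V'2, rule_format]
  have "V' = V"
  proof (rule ccontr)
    assume "V' \<noteq> V"
    then obtain y where y: "y \<in> V" "y \<notin> V'" using V' by auto
    have "adjoin V' y \<in> ?S"
      using V' y adj[of V' y] adjoin_least[OF V] fsub_adjoin by auto
    then have "V' = adjoin V' y" using V'(2) adjoin_superset by blast
    then show False using y V' adjoin_self by blast
  qed
  then show ?thesis using V' by simp
qed

lemma card_fsub: "fsub V \<Longrightarrow> \<exists>n. card V = CARD('f) ^ n"
proof (induction rule: fsub_induct)
  case zero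
  then show ?case by (intro exI[of _ 0]) simp
next
  case (adjoin V' y)
  then obtain n where "card V' = CARD('f) ^ n" by blast
  with adjoin show ?case by (intro exI[of _ "Suc n"]) (simp add: card_adjoin)
qed

text \<open>\<open>fexp V\<close> maps the larger space onto the line through
  \<open>fexp V y\<close>, whose exponential is explicit; \<open>fexp_fexp\<close> composes the two.
  This is the source of the recursion for the coefficients.\<close>

lemma lpoly_adjoin:
  assumes "fsub V" "y \<notin> V"
  shows "lpoly (adjoin V y) = lpoly V - smult (inverse (fexp V y ^ (CARD('f) - 1))) (lpoly V ^ CARD('f))"
proof (rule poly_ext)
  fix z
  have "fexp V ` adjoin V y = line (fexp V y)"
  proof -
    have "fexp V (v + F_scale \<iota> c y) = F_scale \<iota> c (fexp V y)" if "v \<in> V" for v c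
      using that assms fexp_eq_0_iff[of V v] by (simp add: fexp_add fexp_F_scale fsubD)
    then have "fexp V ` adjoin V y = (\<lambda>(v, c). F_scale \<iota> c (fexp V y)) ` (V \<times> UNIV)"
      unfolding adjoin_def image_image by (intro image_cong) auto
    also have "\<dots> = line (fexp V y)"
      unfolding line_def using fsubD(2)[OF assms(1)] by force
    finally show ?thesis .
  qed
  moreover have "fexp V y \<noteq> 0" using assms by (simp add: fexp_eq_0_iff fsubD)
  ultimately show "poly (lpoly (adjoin V y)) z =
    poly (lpoly V - smult (inverse (fexp V y ^ (CARD('f) - 1))) (lpoly V ^ CARD('f))) z"
    using fexp_fexp[OF assms(1) fsub_adjoin[OF assms(1), of y] adjoin_superset, of z]
    by (simp add: fexp_line divide_inverse mult.commute)
qed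

definition qcoeff :: "'c set \<Rightarrow> nat \<Rightarrow> 'c" where
  "qcoeff V k = coeff (lpoly V) (CARD('f) ^ k)"

lemma qcoeff_0 [simp]: "finite V \<Longrightarrow> qcoeff V 0 = 1"
  by (simp add: qcoeff_def)

lemma coeff_qpoly:
  "coeff (\<Sum>k\<le>n. monom (l k :: 'c) (CARD('f) ^ k)) (CARD('f) ^ j) = (if j \<le> n then l j else 0)"
proof -
  have "coeff (\<Sum>k\<le>n. monom (l k) (CARD('f) ^ k)) (CARD('f) ^ j) = (\<Sum>k\<le>n. if k = j then l k else 0)"
    by (simp add: coeff_sum)
  then show ?thesis by simp
qed

lemma qpoly_power:
  "(\<Sum>k\<le>n. monom (l k :: 'c) (CARD('f) ^ k)) ^ (CARD('f) ^ i) = (\<Sum>k\<le>n. monom (l k ^ (CARD('f) ^ i)) (CARD('f) ^ (k + i)))"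
  by (rule poly_ext) (simp add: poly_sum poly_monom frob_sum power_mult_distrib power_mult[symmetric] power_add)

text \<open>The recursion in \<open>lpoly_adjoin\<close> preserves this form, since q-th powers act
  on a q-polynomial term by term.\<close>

lemma lpoly_eq:
  assumes "fsub V" "card V = CARD('f) ^ n"
  shows "lpoly V = (\<Sum>k\<le>n. monom (qcoeff V k) (CARD('f) ^ k))"
proof -
  have "\<exists>n l. card V = CARD('f) ^ n \<and> lpoly V = (\<Sum>k\<le>n. monom (l k) (CARD('f) ^ k))"
    using assms(1)
  proof (induction rule: fsub_induct)
    case zero
    then show ?case by (intro exI[of _ 0] exI[of _ "\<lambda>_. 1"]) (simp add: monom_altdef)
  next
    case (adjoin V' y)
    then obtain n l where nl: "card V' = CARD('f) ^ n" "lpoly V' = (\<Sum>k\<le>n. monom (l k) (CARD('f) ^ k))"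
      by blast
    let ?a = "inverse (fexp V' y ^ (CARD('f) - 1))"
    let ?l = "\<lambda>k. (if k \<le> n then l k else 0) - (if k = 0 then 0 else ?a * l (k - 1) ^ CARD('f))"
    have "(\<Sum>k\<le>Suc n. monom (?l k) (CARD('f) ^ k)) =
        (\<Sum>k\<le>Suc n. monom (if k \<le> n then l k else 0) (CARD('f) ^ k)) -
        (\<Sum>k\<le>Suc n. monom (if k = 0 then 0 else ?a * l (k - 1) ^ CARD('f)) (CARD('f) ^ k))"
      by (simp only: sum_subtractf[symmetric] diff_monom)
    also have "(\<Sum>k\<le>Suc n. monom (if k \<le> n then l k else 0) (CARD('f) ^ k)) = lpoly V'"
      by (simp add: nl)
    also have "(\<Sum>k\<le>Suc n. monom (if k = 0 then 0 else ?a * l (k - 1) ^ CARD('f)) (CARD('f) ^ k)) =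
        smult ?a (lpoly V' ^ CARD('f))"
    proof -
      have "lpoly V' ^ CARD('f) = (\<Sum>k\<le>n. monom (l k ^ CARD('f)) (CARD('f) ^ Suc k))"
        using qpoly_power[of l n 1] by (simp add: nl(2))
      then have "smult ?a (lpoly V' ^ CARD('f)) = (\<Sum>k\<le>n. monom (?a * l k ^ CARD('f)) (CARD('f) ^ Suc k))"
        by (intro poly_ext) (simp add: poly_sum poly_monom sum_distrib_left mult.assoc)
      then show ?thesis by (simp only: sum.atMost_Suc_shift) simp
    qed
    also have "lpoly V' - smult ?a (lpoly V' ^ CARD('f)) = lpoly (adjoin V' y)"
      by (rule lpoly_adjoin[OF adjoin(1,4), symmetric])
    finally have "(\<Sum>k\<le>Suc n. monom (?l k) (CARD('f) ^ k)) = lpoly (adjoin V' y)" .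
    moreover have "card (adjoin V' y) = CARD('f) ^ Suc n"
      using adjoin nl by (simp add: card_adjoin)
    ultimately show ?case by (intro exI conjI) (assumption, rule sym)
  qed
  then obtain m l where ml: "card V = CARD('f) ^ m" "lpoly V = (\<Sum>k\<le>m. monom (l k) (CARD('f) ^ k))"
    by blast
  then have "m = n" using assms by simp
  then have "qcoeff V k = l k" if "k \<le> n" for k
    using that unfolding qcoeff_def ml(2) by (subst coeff_qpoly) simp
  then show ?thesis using ml(2) \<open>m = n\<close> by simp
qed

lemma qcoeff_eq_0:
  assumes "fsub V" "card V < CARD('f) ^ k"
  shows "qcoeff V k = 0"
  unfolding qcoeff_def using assms by (intro coeff_eq_0) (simp add: degree_lpoly fsubD)

text \<open>Frobenius acts term by term, so the index moves by i while the coefficient is raised to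
  the power q^i. For k beyond the degree both sides are zero.\<close>

lemma coeff_lpoly_power:
  assumes "fsub V"
  shows "coeff (lpoly V ^ (CARD('f) ^ i)) (CARD('f) ^ (k + i)) = qcoeff V k ^ (CARD('f) ^ i)"
proof -
  obtain n where n: "card V = CARD('f) ^ n" using card_fsub[OF assms] by blast
  show ?thesis
  proof (cases "k \<le> n")
    case True
    have "coeff (\<Sum>j\<le>n. monom (qcoeff V j ^ (CARD('f) ^ i)) (CARD('f) ^ (j + i))) (CARD('f) ^ (k + i)) =
        (\<Sum>j\<le>n. if j = k then qcoeff V j ^ (CARD('f) ^ i) else 0)"
      by (simp only: coeff_sum coeff_monom q_power_inject add_right_cancel)
    with True show ?thesis by (simp only: lpoly_eq[OF assms n] qpoly_power) simp
  next
    case False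
    have "coeff (\<Sum>j\<le>n. monom (qcoeff V j ^ (CARD('f) ^ i)) (CARD('f) ^ (j + i))) (CARD('f) ^ (k + i)) =
        (\<Sum>j\<le>n. if j = k then qcoeff V j ^ (CARD('f) ^ i) else 0)"
      by (simp only: coeff_sum coeff_monom q_power_inject add_right_cancel)
    also have "\<dots> = 0" using False by simp
    finally have "coeff (lpoly V ^ (CARD('f) ^ i)) (CARD('f) ^ (k + i)) = 0"
      by (simp only: lpoly_eq[OF assms n] qpoly_power)
    moreover have "qcoeff V k = 0"
      using False n by (intro qcoeff_eq_0 assms) (simp add: power_strict_increasing)
    ultimately show ?thesis by (simp add: power_0_left)
  qed
qed

lemma qcoeff_adjoin:
  assumes "fsub V" "y \<notin> V"
  shows "qcoeff (adjoin V y) (Suc k) = qcoeff V (Suc k) - qcoeff V k ^ CARD('f) / fexp V y ^ (CARD('f) - 1)"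
  using coeff_lpoly_power[OF assms(1), of 1 k]
  by (simp add: qcoeff_def[of "adjoin V y"] lpoly_adjoin[OF assms] divide_inverse mult.commute)
    (simp add: qcoeff_def)

text \<open>Used for the torsion points of critical absolute value modulo the smaller ones and, with
  \<open>V0 = {0}\<close>, for finite fields. The induction enlarges \<open>V0\<close> by a line and
  keeps the new vector as the last coordinate.\<close>

lemma relative_basis:
  assumes "fsub V0" "fsub V" "V0 \<subseteq> V" "card V = CARD('f) ^ h * card V0"
  shows "\<exists>g :: nat \<Rightarrow> 'c. (\<forall>l<h. g l \<in> V)
    \<and> (\<forall>x\<in>V. \<exists>\<gamma>. \<exists>v\<in>V0. x = (\<Sum>l<h. F_scale \<iota> (\<gamma> l) (g l)) + v)
    \<and> (\<forall>\<gamma>. (\<Sum>l<h. F_scale \<iota> (\<gamma> l) (g l)) \<in> V0 \<longrightarrow> (\<forall>l<h. \<gamma> l = 0))"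
  using assms
proof (induction h arbitrary: V0)
  case 0
  then have "V0 = V" using card_subset_eq[of V V0] fsubD(1)[of V] by simp
  then show ?case by simp
next
  case (Suc h)
  have "0 < card V0" using Suc.prems fsubD[of V0] by (auto simp: card_gt_0_iff)
  have "card V0 < card V"
  proof -
    have "1 < CARD('f) ^ Suc h" by (rule one_less_power) simp_all
    then show ?thesis using Suc.prems(4) \<open>0 < card V0\<close> by (simp only: n_less_m_mult_n)
  qed
  then obtain y where y: "y \<in> V" "y \<notin> V0" using Suc.prems(3) card_mono[of V0 V] fsubD(1)[OF Suc.prems(1)] by fastforce
  have "card V = CARD('f) ^ h * card (adjoin V0 y)"
    using Suc.prems y by (simp add: card_adjoin)
  then obtain g where g: "\<forall>l<h. g l \<in> V"
    "\<forall>x\<in>V. \<exists>\<gamma>. \<exists>v\<in>adjoin V0 y. x = (\<Sum>l<h. F_scale \<iota> (\<gamma> l) (g l)) + v"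
    "\<forall>\<gamma>. (\<Sum>l<h. F_scale \<iota> (\<gamma> l) (g l)) \<in> adjoin V0 y \<longrightarrow> (\<forall>l<h. \<gamma> l = 0)"
    using Suc.IH[of "adjoin V0 y"] Suc.prems y fsub_adjoin adjoin_least by blast
  let ?g = "g(h := y)"
  have S: "(\<Sum>l<Suc h. F_scale \<iota> (\<gamma> l) (?g l)) = (\<Sum>l<h. F_scale \<iota> (\<gamma> l) (g l)) + F_scale \<iota> (\<gamma> h) y" for \<gamma>
    by simp
  show ?case
  proof (intro exI[of _ ?g] conjI)
    show "\<forall>l<Suc h. ?g l \<in> V" using g(1) y by (simp add: less_Suc_eq)
    show "\<forall>x\<in>V. \<exists>\<gamma>. \<exists>v\<in>V0. x = (\<Sum>l<Suc h. F_scale \<iota> (\<gamma> l) (?g l)) + v"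
    proof
      fix x assume "x \<in> V"
      then obtain \<gamma> v' where "v' \<in> adjoin V0 y" "x = (\<Sum>l<h. F_scale \<iota> (\<gamma> l) (g l)) + v'"
        using g(2) by blast
      then obtain v c where *: "v \<in> V0" "x = (\<Sum>l<h. F_scale \<iota> (\<gamma> l) (g l)) + (v + F_scale \<iota> c y)"
        unfolding adjoin_iff by blast
      then have "x = (\<Sum>l<Suc h. F_scale \<iota> ((\<gamma>(h := c)) l) (?g l)) + v"
        by (subst S) (simp add: algebra_simps)
      then show "\<exists>\<gamma>. \<exists>v\<in>V0. x = (\<Sum>l<Suc h. F_scale \<iota> (\<gamma> l) (?g l)) + v" using * by blast
    qed
    show "\<forall>\<gamma>. (\<Sum>l<Suc h. F_scale \<iota> (\<gamma> l) (?g l)) \<in> V0 \<longrightarrow> (\<forall>l<Suc h. \<gamma> l = 0)"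
    proof (intro allI impI)
      fix \<gamma> l assume *: "(\<Sum>l<Suc h. F_scale \<iota> (\<gamma> l) (?g l)) \<in> V0" and l: "l < Suc h"
      then have "(\<Sum>l<h. F_scale \<iota> (\<gamma> l) (g l)) + F_scale \<iota> (\<gamma> h) y \<in> V0" by (simp only: S)
      then have "(\<Sum>l<h. F_scale \<iota> (\<gamma> l) (g l)) \<in> adjoin V0 y"
        unfolding adjoin_iff by (intro bexI[of _ "(\<Sum>l<h. F_scale \<iota> (\<gamma> l) (g l)) + F_scale \<iota> (\<gamma> h) y"] exI[of _ "- \<gamma> h"])
          (simp_all add: F.scale_minus_left)
      then have z: "\<forall>l<h. \<gamma> l = 0" using g(3) by blast
      then have "F_scale \<iota> (\<gamma> h) y \<in> V0" using * by (simp only: S) simp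
      then have "\<gamma> h = 0" using y F_scale_in_iff[OF Suc.prems(1)] by blast
      with z l show "\<gamma> l = 0" by (auto simp: less_Suc_eq)
    qed
  qed
qed

end

section \<open>Uniform limits\<close>

context C_infty
begin

text \<open>The parameter type is arbitrary: over \<open>unit\<close> this is convergence of a
  single sequence, over a set of parameters it controls a whole family of \<omega>.\<close>

definition uconv :: "'t set \<Rightarrow> (nat \<Rightarrow> 't \<Rightarrow> 'c) \<Rightarrow> ('t \<Rightarrow> 'c) \<Rightarrow> bool" where
  "uconv X f L \<longleftrightarrow> (\<forall>e>0. \<exists>N. \<forall>n\<ge>N. \<forall>t\<in>X. absC (f n t - L t) < e)"

definition ubdd :: "'t set \<Rightarrow> ('t \<Rightarrow> 'c) \<Rightarrow> bool" where
  "ubdd X L \<longleftrightarrow> (\<exists>B>0. \<forall>t\<in>X. absC (L t) \<le> B)"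

lemma uconvD: "uconv X f L \<Longrightarrow> 0 < e \<Longrightarrow> \<exists>N. \<forall>n\<ge>N. \<forall>t\<in>X. absC (f n t - L t) < e"
  by (simp add: uconv_def)

lemma uconv_const [simp]: "uconv X (\<lambda>n. L) L"
  by (simp add: uconv_def)

lemma ubdd_const [simp]: "ubdd X (\<lambda>t. c)"
  unfolding ubdd_def by (intro exI[of _ "absC c + 1"]) (simp add: add_nonneg_pos)

lemma uconv_diff:
  assumes "uconv X f L" "uconv X g M"
  shows "uconv X (\<lambda>n t. f n t - g n t) (\<lambda>t. L t - M t)"
  unfolding uconv_def
proof (intro allI impI)
  fix e :: real assume "0 < e"
  then obtain N1 N2 where N: "\<forall>n\<ge>N1. \<forall>t\<in>X. absC (f n t - L t) < e" "\<forall>n\<ge>N2. \<forall>t\<in>X. absC (g n t - M t) < e"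
    using uconvD assms by metis
  show "\<exists>N. \<forall>n\<ge>N. \<forall>t\<in>X. absC (f n t - g n t - (L t - M t)) < e"
  proof (intro exI[of _ "max N1 N2"] allI impI ballI)
    fix n t assume "max N1 N2 \<le> n" "t \<in> X"
    then have "absC ((f n t - L t) - (g n t - M t)) < e"
      using N by (intro absC_diff_less[of "f n t - L t"]) (simp_all del: absC_diff_less)
    then show "absC (f n t - g n t - (L t - M t)) < e" by (simp add: algebra_simps)
  qed
qed

lemma uconv_add:
  assumes "uconv X f L" "uconv X g M"
  shows "uconv X (\<lambda>n t. f n t + g n t) (\<lambda>t. L t + M t)"
proof -
  have "uconv X (\<lambda>n t. 0 - g n t) (\<lambda>t. 0 - M t)"
    by (rule uconv_diff) (simp_all add: assms)
  from uconv_diff[OF assms(1) this] show ?thesis by simp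
qed

lemma ubdd_diff:
  assumes "ubdd X L" "ubdd X M"
  shows "ubdd X (\<lambda>t. L t - M t)"
proof -
  obtain B C where B: "0 < B" "\<forall>t\<in>X. absC (L t) \<le> B" and C: "0 < C" "\<forall>t\<in>X. absC (M t) \<le> C"
    using assms by (auto simp: ubdd_def)
  show ?thesis
    unfolding ubdd_def
  proof (intro exI[of _ "max B C"] conjI ballI)
    fix t assume "t \<in> X"
    then show "absC (L t - M t) \<le> max B C" using B C by (intro absC_diff_le) (auto simp: le_max_iff_disj)
  qed (use B in auto)
qed

lemma ubdd_mult:
  assumes "ubdd X L" "ubdd X M"
  shows "ubdd X (\<lambda>t. L t * M t)"
proof -
  obtain B C where B: "0 < B" "\<forall>t\<in>X. absC (L t) \<le> B" and C: "0 < C" "\<forall>t\<in>X. absC (M t) \<le> C"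
    using assms by (auto simp: ubdd_def)
  then show ?thesis
    unfolding ubdd_def by (intro exI[of _ "B * C"]) (auto simp: abs_mult intro!: mult_mono)
qed

lemma uconv_mult:
  assumes f: "uconv X f L" and g: "uconv X g M" and bL: "ubdd X L" and bM: "ubdd X M"
  shows "uconv X (\<lambda>n t. f n t * g n t) (\<lambda>t. L t * M t)"
  unfolding uconv_def
proof (intro allI impI)
  fix e :: real assume e: "0 < e"
  obtain B C where B: "0 < B" "\<forall>t\<in>X. absC (L t) \<le> B" and C: "0 < C" "\<forall>t\<in>X. absC (M t) \<le> C"
    using bL bM by (auto simp: ubdd_def)
  \<comment> \<open>The error is x y + L y + x M. The bounds with B + 1 and C + 1 make the last two
    terms strictly smaller than e; the bounds 1 and e / 2 take care of the first.\<close>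
  define d where "d = min 1 (min (e / (B + 1)) (min (e / (C + 1)) (e / 2)))"
  have d: "0 < d" "d \<le> 1" "d \<le> e / (B + 1)" "d \<le> e / (C + 1)" "d \<le> e / 2"
  proof -
    show "d \<le> e / 2" unfolding d_def by linarith
  qed (use e B(1) C(1) in \<open>simp_all add: d_def\<close>)
  have dB: "d * (B + 1) \<le> e" and dC: "d * (C + 1) \<le> e"
    using d(3,4) B(1) C(1) by (simp_all add: pos_le_divide_eq)
  obtain N1 N2 where N: "\<forall>n\<ge>N1. \<forall>t\<in>X. absC (f n t - L t) < d" "\<forall>n\<ge>N2. \<forall>t\<in>X. absC (g n t - M t) < d"
    using uconvD[OF f d(1)] uconvD[OF g d(1)] by metis
  show "\<exists>N. \<forall>n\<ge>N. \<forall>t\<in>X. absC (f n t * g n t - L t * M t) < e"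
  proof (intro exI[of _ "max N1 N2"] allI impI ballI)
    fix n t assume n: "max N1 N2 \<le> n" and t: "t \<in> X"
    define x where "x = f n t - L t"
    define y where "y = g n t - M t"
    have x: "absC x < d" and y: "absC y < d" using N n t by (auto simp: x_def y_def)
    have LB: "absC (L t) \<le> B" and MC: "absC (M t) \<le> C" using B C t by auto
    have eq: "f n t * g n t - L t * M t = (x * y + L t * y) + x * M t"
      by (simp add: x_def y_def algebra_simps)
    have "absC (x * y) < e"
    proof -
      have "absC x * absC y \<le> d * 1" using x y d by (intro mult_mono) auto
      then show ?thesis using d e by (simp add: abs_mult)
    qed
    moreover have "absC (L t * y) < e"
    proof -
      have "absC (L t) * absC y \<le> B * d" using LB y B by (intro mult_mono) auto
      moreover have "B * d < e" using dB d by (simp add: algebra_simps)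
      ultimately show ?thesis by (simp add: abs_mult)
    qed
    moreover have "absC (x * M t) < e"
    proof -
      have "absC x * absC (M t) \<le> d * C" using MC x d by (intro mult_mono) auto
      moreover have "d * C < e" using dC d by (simp add: algebra_simps)
      ultimately show ?thesis by (simp add: abs_mult)
    qed
    ultimately show "absC (f n t * g n t - L t * M t) < e"
      unfolding eq by (intro absC_add_less)
  qed
qed

lemma uconv_inverse:
  assumes f: "uconv X f L" and b: "0 < b" "\<forall>t\<in>X. b \<le> absC (L t)"
  shows "uconv X (\<lambda>n t. inverse (f n t)) (\<lambda>t. inverse (L t))"
  unfolding uconv_def
proof (intro allI impI)
  fix e :: real assume e: "0 < e"
  \<comment> \<open>The bound b gives \<open>f n t\<close> and \<open>L t\<close> the same absolute
    value; the bound e b^2 then controls the difference of the inverses.\<close>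
  define d where "d = min b (e * b * b)"
  have "0 < d" using e b by (simp add: d_def)
  then obtain N where N: "\<forall>n\<ge>N. \<forall>t\<in>X. absC (f n t - L t) < d"
    using uconvD[OF f] by blast
  show "\<exists>N. \<forall>n\<ge>N. \<forall>t\<in>X. absC (inverse (f n t) - inverse (L t)) < e"
  proof (intro exI[of _ N] allI impI ballI)
    fix n t assume n: "N \<le> n" and t: "t \<in> X"
    have *: "absC (f n t - L t) < d" and L: "b \<le> absC (L t)" using N n t b by auto
    then have eq: "absC (f n t) = absC (L t)"
      by (intro absC_near) (simp add: d_def)
    have nz: "f n t \<noteq> 0" "L t \<noteq> 0" using eq L b by auto
    have "inverse (f n t) - inverse (L t) = (L t - f n t) / (f n t * L t)"
      using nz by (simp add: field_simps)
    then have "absC (inverse (f n t) - inverse (L t)) = absC (f n t - L t) / (absC (L t) * absC (L t))"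
      by (simp add: abs_mult eq absC_minus_commute)
    also have "\<dots> < e"
    proof -
      have "absC (f n t - L t) < e * (b * b)" using * by (simp add: d_def mult.assoc)
      also have "\<dots> \<le> e * (absC (L t) * absC (L t))"
        using L b e by (intro mult_left_mono mult_mono) auto
      finally show ?thesis using nz by (simp add: pos_divide_less_eq)
    qed
    finally show "absC (inverse (f n t) - inverse (L t)) < e" .
  qed
qed

lemma ubdd_inverse: "0 < b \<Longrightarrow> \<forall>t\<in>X. b \<le> absC (L t) \<Longrightarrow> ubdd X (\<lambda>t. inverse (L t))"
  unfolding ubdd_def by (intro exI[of _ "inverse b"]) (auto intro: le_imp_inverse_le)

lemma uconv_unique:
  assumes "uconv X f L" "uconv X f M" "t \<in> X"
  shows "L t = M t"
proof (rule ccontr)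
  assume "L t \<noteq> M t"
  then have e: "0 < absC (L t - M t)" by simp
  from uconvD[OF uconv_diff[OF assms(1,2)] e] assms(3)
  have "absC (0 - (L t - M t)) < absC (L t - M t)" by auto
  then show False by (simp only: diff_0 absC_uminus less_irrefl)
qed

lemma uconv_coeff_prod:
  assumes "finite S"
    and "\<And>v. v \<in> S \<Longrightarrow> uconv X (\<alpha> v) (\<beta> v)" "\<And>v. v \<in> S \<Longrightarrow> ubdd X (\<beta> v)"
  shows "uconv X (\<lambda>n t. coeff (\<Prod>v\<in>S. [:1, - \<alpha> v n t:]) k) (\<lambda>t. coeff (\<Prod>v\<in>S. [:1, - \<beta> v t:]) k)
    \<and> ubdd X (\<lambda>t. coeff (\<Prod>v\<in>S. [:1, - \<beta> v t:]) k)"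
  using assms
proof (induction S arbitrary: k rule: finite_induct)
  case (insert v S)
  have c: "coeff ([:1, - x:] * p) k = coeff p k - x * (if k = 0 then 0 else coeff p (k - 1))" for x :: 'c and p
    by (cases k) simp_all
  have "uconv X (\<lambda>n t. coeff (\<Prod>v\<in>S. [:1, - \<alpha> v n t:]) k) (\<lambda>t. coeff (\<Prod>v\<in>S. [:1, - \<beta> v t:]) k)
    \<and> ubdd X (\<lambda>t. coeff (\<Prod>v\<in>S. [:1, - \<beta> v t:]) k)" for k
    using insert by auto
  note IH = conjunct1[OF this] conjunct2[OF this]
  have IH': "uconv X (\<lambda>n t. if k = 0 then 0 else coeff (\<Prod>v\<in>S. [:1, - \<alpha> v n t:]) (k - 1))
      (\<lambda>t. if k = 0 then 0 else coeff (\<Prod>v\<in>S. [:1, - \<beta> v t:]) (k - 1))"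
    "ubdd X (\<lambda>t. if k = 0 then 0 else coeff (\<Prod>v\<in>S. [:1, - \<beta> v t:]) (k - 1))"
    by (cases "k = 0"; simp add: IH)+
  show ?case
    unfolding prod.insert[OF insert.hyps] c
    using insert IH IH' by (intro conjI uconv_diff uconv_mult ubdd_diff ubdd_mult) auto
qed simp

lemma absC_prod_near_1:
  assumes "\<And>u. u \<in> S \<Longrightarrow> absC (\<alpha> u) \<le> e" "e \<le> 1" "0 \<le> e"
  shows "absC ((\<Prod>u\<in>S. 1 - \<alpha> u) - 1 :: 'c) \<le> e"
  using assms(1)
proof (induction S rule: infinite_finite_induct)
  case (insert u S)
  let ?p = "\<Prod>u\<in>S. 1 - \<alpha> u"
  have "absC (1 - \<alpha> u) \<le> 1"
    using insert.prems[of u] assms(2) by (intro absC_diff_le) auto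
  then have "absC ((1 - \<alpha> u) * (?p - 1)) \<le> 1 * e"
    unfolding abs_mult using insert by (intro mult_mono) auto
  moreover have "absC (\<alpha> u) \<le> e" using insert by auto
  moreover have "(1 - \<alpha> u) * (?p - 1) - \<alpha> u = (\<Prod>u\<in>insert u S. 1 - \<alpha> u) - 1"
    using insert.hyps by (simp add: algebra_simps)
  ultimately show ?case
    using absC_diff_le[of "(1 - \<alpha> u) * (?p - 1)" e "\<alpha> u"] by (simp only: mult_1)
qed (use assms in auto)

section \<open>Vectors over the Laurent series field\<close>

definition ev :: "'c ^ 'r::finite \<Rightarrow> 'f fls ^ 'r \<Rightarrow> 'c" where
  "ev \<omega> v = (\<Sum>i\<in>UNIV. \<iota> (v $ i) * \<omega> $ i)"

lemma ev_add: "ev \<omega> (v + w) = ev \<omega> v + ev \<omega> w"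
  by (simp add: ev_def embed_add distrib_right sum.distrib)

lemma ev_diff: "ev \<omega> (v - w) = ev \<omega> v - ev \<omega> w"
  by (simp add: ev_def embed_diff left_diff_distrib sum_subtractf)

lemma ev_0 [simp]: "ev \<omega> 0 = 0"
  by (simp add: ev_def)

lemma ev_scale: "ev \<omega> (c *s v) = \<iota> c * ev \<omega> v"
  by (simp add: ev_def embed_mult sum_distrib_left mult.assoc)

lemma ev_sum: "ev \<omega> (\<Sum>l\<in>S. f l) = (\<Sum>l\<in>S. ev \<omega> (f l))"
  by (induction S rule: infinite_finite_induct) (simp_all add: ev_add)

lemma ev_const: "ev \<omega> (fls_const c *s v) = F_scale \<iota> c (ev \<omega> v)"
  by (simp add: ev_scale F_scale_def)

lemma ev_axis: "ev \<omega> (axis i 1) = \<omega> $ i"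
proof -
  have "ev \<omega> (axis i 1) = (\<Sum>j\<in>UNIV. if j = i then \<omega> $ j else 0)"
    unfolding ev_def by (rule sum.cong) (auto simp: axis_def embed_one)
  then show ?thesis by simp
qed

definition A_vecs :: "('f fls ^ 'r::finite) set" where
  "A_vecs = {v. \<forall>i. v $ i \<in> range A_to_K}"

text \<open>An exhaustion of A^r by finite F-spaces that is chosen in coordinates, hence common to
  all \<omega>; later limits can therefore be uniform in \<omega>.\<close>

definition A_box :: "nat \<Rightarrow> ('f fls ^ 'r::finite) set" where
  "A_box n = {v \<in> A_vecs. \<forall>i. absK (v $ i) < real CARD('f) ^ n}"

text \<open>The reduced representatives of a^{-1} A^r modulo A^r. They do not depend on \<omega>, so
  torsion points of different Drinfeld modules can be compared one by one.\<close>

definition tors_coords :: "'f poly \<Rightarrow> ('f fls ^ 'r::finite) set" where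
  "tors_coords a = {v. A_to_K a *s v \<in> A_vecs \<and> (\<forall>i. absK (v $ i) < 1)}"

lemma A_vecs_iff: "v \<in> A_vecs \<longleftrightarrow> (\<exists>b. \<forall>i. v $ i = A_to_K (b i))"
proof
  assume "v \<in> A_vecs"
  then have "\<forall>i. \<exists>p. v $ i = A_to_K p" by (auto simp: A_vecs_def)
  then show "\<exists>b. \<forall>i. v $ i = A_to_K (b i)" by metis
qed (auto simp: A_vecs_def)

lemma A_vecs_add: "v \<in> A_vecs \<Longrightarrow> w \<in> A_vecs \<Longrightarrow> v + w \<in> A_vecs"
  unfolding A_vecs_iff
proof (elim exE)
  fix b b' assume "\<forall>i. v $ i = A_to_K (b i)" "\<forall>i. w $ i = A_to_K (b' i)"
  then show "\<exists>b. \<forall>i. (v + w) $ i = A_to_K (b i)"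
    by (intro exI[of _ "\<lambda>i. b i + b' i"]) (simp add: A_to_K_add)
qed

lemma A_vecs_scale: "v \<in> A_vecs \<Longrightarrow> A_to_K p *s v \<in> A_vecs"
  unfolding A_vecs_iff
proof (elim exE)
  fix b assume "\<forall>i. v $ i = A_to_K (b i)"
  then show "\<exists>b. \<forall>i. (A_to_K p *s v) $ i = A_to_K (b i)"
    by (intro exI[of _ "\<lambda>i. p * b i"]) (simp add: A_to_K_mult)
qed

lemma A_vecs_const: "v \<in> A_vecs \<Longrightarrow> fls_const c *s v \<in> A_vecs"
  using A_vecs_scale[of v "[:c:]"] by (simp add: A_to_K_const)

lemma A_vecs_uminus: "v \<in> A_vecs \<Longrightarrow> - v \<in> A_vecs"
  unfolding A_vecs_iff
proof (elim exE)
  fix b assume "\<forall>i. v $ i = A_to_K (b i)"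
  then show "\<exists>b. \<forall>i. (- v) $ i = A_to_K (b i)"
    by (intro exI[of _ "\<lambda>i. - b i"]) (simp add: A_to_K_uminus)
qed

lemma A_vecs_diff: "v \<in> A_vecs \<Longrightarrow> w \<in> A_vecs \<Longrightarrow> v - w \<in> A_vecs"
  using A_vecs_add[of v "- w"] A_vecs_uminus[of w] by simp

lemma A_vecs_0 [simp]: "0 \<in> A_vecs"
  unfolding A_vecs_iff by (intro exI[of _ "\<lambda>_. 0"]) simp

lemma A_lattice_eq:
  fixes \<omega> :: "'c ^ 'r::finite"
  shows "A_lattice \<iota> \<omega> = ev \<omega> ` A_vecs"
proof -
  have L: "(A_vecs :: ('f fls ^ 'r) set) = range (\<lambda>b :: 'f poly ^ 'r. \<chi> i. A_to_K (b $ i))"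
  proof
    show "A_vecs \<subseteq> range (\<lambda>b :: 'f poly ^ 'r. \<chi> i. A_to_K (b $ i))"
    proof
      fix v :: "'f fls ^ 'r" assume "v \<in> A_vecs"
      then obtain b where "\<forall>i. v $ i = A_to_K (b i)" by (auto simp: A_vecs_iff)
      then show "v \<in> range (\<lambda>b :: 'f poly ^ 'r. \<chi> i. A_to_K (b $ i))"
        by (intro range_eqI[of _ _ "\<chi> i. b i"]) (simp add: vec_eq_iff)
    qed
  qed (auto simp: A_vecs_def)
  have "ev \<omega> ` A_vecs = range (\<lambda>b :: 'f poly ^ 'r. ev \<omega> (\<chi> i. A_to_K (b $ i)))"
    unfolding L image_image by (rule refl)
  then show ?thesis by (simp add: A_lattice_def ev_def)
qed

definition fsub_vec :: "('f fls ^ 'r::finite) set \<Rightarrow> bool" where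
  "fsub_vec S \<longleftrightarrow> finite S \<and> 0 \<in> S \<and> (\<forall>x\<in>S. \<forall>y\<in>S. x + y \<in> S) \<and> (\<forall>c. \<forall>x\<in>S. fls_const c *s x \<in> S)"

lemma fsub_vec_uminus: "fsub_vec S \<Longrightarrow> x \<in> S \<Longrightarrow> - x \<in> S"
proof -
  assume "fsub_vec S" "x \<in> S"
  then have "fls_const (- 1) *s x \<in> S" unfolding fsub_vec_def by blast
  moreover have "fls_const (- 1) *s x = - x" 
    using fls_minus_const[of "0 :: 'f" 1] by (simp add: vec_eq_iff)
  ultimately show ?thesis by simp
qed

lemma fsub_vec_diff: "fsub_vec S \<Longrightarrow> x \<in> S \<Longrightarrow> y \<in> S \<Longrightarrow> x - y \<in> S"
  using fsub_vec_uminus[of S y] unfolding fsub_vec_def by (metis add_uminus_conv_diff)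

lemma fsub_ev: "fsub_vec S \<Longrightarrow> fsub (ev \<omega> ` S)"
  unfolding fsub_vec_def fsub_def F.subspace_def
  by (auto simp: ev_add[symmetric] ev_const[symmetric] intro: rev_image_eqI)

section \<open>Counting the division vectors\<close>

definition polys_below :: "nat \<Rightarrow> 'f poly set" where
  "polys_below n = {p. p = 0 \<or> degree p < n}"

lemma card_polys_below: "finite (polys_below n) \<and> card (polys_below n) = CARD('f) ^ n"
proof (induction n)
  case 0
  have "polys_below 0 = {0}" by (auto simp: polys_below_def)
  then show ?case by simp
next
  case (Suc n)
  have "polys_below (Suc n) = (\<lambda>(c, p). pCons c p) ` (UNIV \<times> polys_below n)"
  proof
    show "polys_below (Suc n) \<subseteq> (\<lambda>(c, p). pCons c p) ` (UNIV \<times> polys_below n)"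
    proof
      fix p :: "'f poly" assume p: "p \<in> polys_below (Suc n)"
      obtain c p' where "p = pCons c p'" by (cases p)
      with p show "p \<in> (\<lambda>(c, p). pCons c p) ` (UNIV \<times> polys_below n)"
        by (intro image_eqI[of _ _ "(c, p')"]) (auto simp: polys_below_def split: if_splits)
    qed
  next
    have "degree (pCons c p) < Suc n" if "p \<in> polys_below n" for c and p :: "'f poly"
      using that by (cases "p = 0") (auto simp: polys_below_def)
    then show "(\<lambda>(c, p). pCons c p) ` (UNIV \<times> polys_below n) \<subseteq> polys_below (Suc n)"
      by (auto simp: polys_below_def)
  qed
  moreover have "inj_on (\<lambda>(c, p). pCons c p) (UNIV \<times> polys_below n)"
    by (auto simp: inj_on_def)
  ultimately show ?case using Suc by (simp add: card_image card_cartesian_product)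
qed

lemma card_vec:
  fixes S :: "'x set"
  assumes "finite S"
  shows "finite {b :: 'x ^ 'r::finite. \<forall>i. b $ i \<in> S} \<and> card {b :: 'x ^ 'r. \<forall>i. b $ i \<in> S} = card S ^ CARD('r)"
proof -
  have "bij_betw vec_nth {b :: 'x ^ 'r. \<forall>i. b $ i \<in> S} (UNIV \<rightarrow>\<^sub>E S)"
    by (rule bij_betw_byWitness[where f' = vec_lambda]) auto
  note bij = bij_betw_same_card[OF this] bij_betw_finite[OF this]
  have "finite ((UNIV :: 'r set) \<rightarrow>\<^sub>E S)" "card ((UNIV :: 'r set) \<rightarrow>\<^sub>E S) = card S ^ CARD('r)"
    using assms by (simp_all add: card_PiE finite_PiE)
  then show ?thesis by (simp add: bij)
qed

lemma finite_A_box: "finite (A_box n :: ('f fls ^ 'r::finite) set)"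
proof -
  have "A_box n \<subseteq> {b :: 'f fls ^ 'r. \<forall>i. b $ i \<in> A_to_K ` polys_below n}"
  proof
    fix v :: "'f fls ^ 'r" assume v: "v \<in> A_box n"
    then obtain b where b: "\<forall>i. v $ i = A_to_K (b i)" by (auto simp: A_box_def A_vecs_iff)
    then have "b i \<in> polys_below n" for i
      using v absK_A_to_K_less_iff[of "b i" n] by (simp add: A_box_def polys_below_def)
    with b show "v \<in> {b. \<forall>i. b $ i \<in> A_to_K ` polys_below n}" by simp
  qed
  then show ?thesis
    using finite_subset card_vec[of "A_to_K ` polys_below n"] card_polys_below[of n] by blast
qed

lemma card_tors_coords:
  assumes "a \<noteq> 0"
  shows "finite (tors_coords a :: ('f fls ^ 'r::finite) set)"
    "card (tors_coords a :: ('f fls ^ 'r::finite) set) = CARD('f) ^ (CARD('r) * degree a)"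
proof -
  let ?a = "A_to_K a"
  let ?S = "{b :: 'f poly ^ 'r. \<forall>i. b $ i \<in> polys_below (degree a)}"
  have a: "?a \<noteq> 0" "absK ?a = real CARD('f) ^ degree a" using assms by (simp_all add: absK_A_to_K)
  have less: "absK (?a * x) < real CARD('f) ^ degree a \<longleftrightarrow> absK x < 1" for x
    by (simp add: absK_mult a)
  have "bij_betw (\<lambda>b. \<chi> i. A_to_K (b $ i) / ?a) ?S (tors_coords a)"
    unfolding bij_betw_def
  proof
    show "inj_on (\<lambda>b. \<chi> i. A_to_K (b $ i) / ?a) ?S"
      using a by (auto simp: inj_on_def vec_eq_iff)
    show "(\<lambda>b. \<chi> i. A_to_K (b $ i) / ?a) ` ?S = tors_coords a"
    proof
      show "(\<lambda>b. \<chi> i. A_to_K (b $ i) / ?a) ` ?S \<subseteq> tors_coords a"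
      proof
        fix v assume "v \<in> (\<lambda>b. \<chi> i. A_to_K (b $ i) / ?a) ` ?S"
        then obtain b where b: "b \<in> ?S" "v = (\<chi> i. A_to_K (b $ i) / ?a)" by auto
        then have vi: "?a * v $ i = A_to_K (b $ i)" for i using a by simp
        have "absK (v $ i) < 1" for i
          using b(1) absK_A_to_K_less_iff[of "b $ i" "degree a"] less[of "v $ i", unfolded vi] by (simp add: polys_below_def)
        then show "v \<in> tors_coords a" by (simp add: tors_coords_def A_vecs_def vi)
      qed
      show "tors_coords a \<subseteq> (\<lambda>b. \<chi> i. A_to_K (b $ i) / ?a) ` ?S"
      proof
        fix v :: "'f fls ^ 'r" assume v: "v \<in> tors_coords a"
        then have "\<forall>i. \<exists>p. ?a * v $ i = A_to_K p" by (auto simp: tors_coords_def A_vecs_def)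
        then obtain b where b: "\<forall>i. ?a * v $ i = A_to_K (b i)" by metis
        have "b i \<in> polys_below (degree a)" for i
          using b less[of "v $ i"] absK_A_to_K_less_iff[of "b i" "degree a"] v by (simp add: polys_below_def tors_coords_def)
        moreover have "v $ i = A_to_K (b i) / ?a" for i
          using b a by (metis nonzero_mult_div_cancel_left)
        ultimately show "v \<in> (\<lambda>b. \<chi> i. A_to_K (b $ i) / ?a) ` ?S"
          by (intro image_eqI[of _ _ "\<chi> i. b i"]) (simp_all add: vec_eq_iff)
      qed
    qed
  qed
  then show "finite (tors_coords a :: ('f fls ^ 'r::finite) set)"
    "card (tors_coords a :: ('f fls ^ 'r::finite) set) = CARD('f) ^ (CARD('r) * degree a)"
    using card_vec[of "polys_below (degree a)", where 'r = 'r] card_polys_below[of "degree a"]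
    by (auto dest: bij_betw_same_card bij_betw_finite simp: power_mult[symmetric] mult.commute)
qed

lemma fsub_vec_A_box: "fsub_vec (A_box n)"
  unfolding fsub_vec_def A_box_def
  by (auto simp: A_vecs_add A_vecs_const absK_mult absK_add_less finite_A_box[unfolded A_box_def])

lemma fsub_vec_tors_coords: "a \<noteq> 0 \<Longrightarrow> fsub_vec (tors_coords a)"
  unfolding fsub_vec_def
proof (intro conjI ballI allI)
  fix x y :: "'f fls ^ 'a" assume "x \<in> tors_coords a" "y \<in> tors_coords a"
  then show "x + y \<in> tors_coords a"
    using A_vecs_add[of "A_to_K a *s x" "A_to_K a *s y"] by (auto simp: tors_coords_def absK_add_less vec.scale_right_distrib)
next
  fix c and x :: "'f fls ^ 'a" assume "x \<in> tors_coords a"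
  then show "fls_const c *s x \<in> tors_coords a"
    using A_vecs_const[of "A_to_K a *s x" c] by (auto simp: tors_coords_def absK_mult mult.commute)
next
  assume "a \<noteq> 0" then show "finite (tors_coords a :: ('f fls ^ 'a) set)" by (rule card_tors_coords)
qed (auto simp: tors_coords_def)

lemma A_vecs_tors_coords:
  assumes "v \<in> A_vecs" "v \<in> tors_coords a"
  shows "v = 0"
proof -
  have "v $ i = 0" for i
  proof -
    obtain p where p: "v $ i = A_to_K p" using assms by (auto simp: A_vecs_def)
    moreover have "absK (v $ i) < 1" using assms by (simp add: tors_coords_def)
    ultimately show ?thesis using absK_A_to_K_ge_1[of p] by (cases "p = 0") auto
  qed
  then show ?thesis by (simp add: vec_eq_iff)
qed

text \<open>The box of index \<open>n + degree a\<close>, divided by \<open>a\<close>. For nonzero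
  \<open>a\<close> it is the sum of \<open>tors_coords a\<close> and \<open>A_box n\<close>, which
  brings the division vectors into a finite stage of the exponential.\<close>

definition tors_box :: "'f poly \<Rightarrow> nat \<Rightarrow> ('f fls ^ 'r::finite) set" where
  "tors_box a n = {v. A_to_K a *s v \<in> A_box (n + degree a)}"

lemma tors_box_eq: "a \<noteq> 0 \<Longrightarrow> v \<in> tors_box a n \<longleftrightarrow> A_to_K a *s v \<in> A_vecs \<and> (\<forall>i. absK (v $ i) < real CARD('f) ^ n)"
  by (auto simp: tors_box_def A_box_def absK_mult absK_A_to_K power_add mult.commute[of "real CARD('f) ^ degree a"])

lemma tors_box_decomp:
  assumes "a \<noteq> 0" "v \<in> tors_box a n"
  shows "\<exists>e\<in>tors_coords a. \<exists>b\<in>A_box n. v = e + b"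
proof -
  have "\<forall>i. \<exists>p. absK (v $ i - A_to_K p) < 1" using polynomial_part by blast
  then obtain p where p: "\<And>i. absK (v $ i - A_to_K (p i)) < 1" by metis
  define b where "b = (\<chi> i. A_to_K (p i))"
  have b: "b \<in> A_vecs" by (simp add: b_def A_vecs_def)
  have "A_to_K a *s v - A_to_K a *s b \<in> A_vecs"
    using assms b A_vecs_scale[of b a] by (intro A_vecs_diff) (simp_all add: tors_box_eq)
  then have "v - b \<in> tors_coords a"
    using p by (simp add: tors_coords_def vec.scale_right_diff_distrib) (simp add: b_def)
  moreover have "absK (b $ i) < real CARD('f) ^ n" for i
  proof (cases "p i = 0")
    case False
    then have "absK (A_to_K (p i) - v $ i) < absK (A_to_K (p i))"
      using p[of i] absK_A_to_K_ge_1[of "p i"] absK_uminus[of "v $ i - A_to_K (p i)"] by simp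
    then have "absK (v $ i) = absK (A_to_K (p i))"
      using absK_near[of "v $ i" "A_to_K (p i)"] absK_uminus[of "v $ i - A_to_K (p i)"] by simp
    then show ?thesis using assms by (simp add: tors_box_eq b_def) metis
  qed (simp add: b_def)
  ultimately show ?thesis
    using b by (intro bexI[of _ "v - b"] bexI[of _ b]) (simp_all add: A_box_def)
qed

lemma fsub_vec_tors_box: "a \<noteq> 0 \<Longrightarrow> fsub_vec (tors_box a n)"
  unfolding fsub_vec_def
proof (intro conjI ballI allI)
  assume a: "a \<noteq> 0"
  have "tors_box a n \<subseteq> (\<lambda>(e, b). e + b) ` (tors_coords a \<times> A_box n)"
    using tors_box_decomp[OF a] by fastforce
  then show "finite (tors_box a n :: ('f fls ^ 'a) set)"
    using card_tors_coords(1)[OF a] finite_A_box by (rule finite_subset[OF _ finite_imageI[OF finite_cartesian_product]])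
next
  fix x y :: "'f fls ^ 'a" assume "x \<in> tors_box a n" "y \<in> tors_box a n"
  then show "x + y \<in> tors_box a n"
    using fsub_vec_A_box by (auto simp: tors_box_def vec.scale_right_distrib fsub_vec_def)
next
  fix c and x :: "'f fls ^ 'a" assume "x \<in> tors_box a n"
  then have "fls_const c *s (A_to_K a *s x) \<in> A_box (n + degree a)"
    using fsub_vec_A_box[of "n + degree a", unfolded fsub_vec_def] unfolding tors_box_def by blast
  then show "fls_const c *s x \<in> tors_box a n" by (simp add: tors_box_def mult.commute)
qed (auto simp: tors_box_def A_box_def)

lemma tors_coords_subset_tors_box: "a \<noteq> 0 \<Longrightarrow> tors_coords a \<subseteq> tors_box a n"
proof -
  assume a: "a \<noteq> 0"
  have "1 \<le> real CARD('f) ^ n" by (rule one_le_power) (simp add: order_less_imp_le)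
  then have "x < 1 \<Longrightarrow> x < real CARD('f) ^ n" for x by linarith
  then show ?thesis using a by (auto simp: tors_box_eq tors_coords_def)
qed

lemma A_box_subset_tors_box: "a \<noteq> 0 \<Longrightarrow> A_box n \<subseteq> tors_box a n"
  by (auto simp: tors_box_eq A_box_def A_vecs_scale)

end

section \<open>The lattice exponential\<close>

context C_infty
begin

text \<open>An explicit lower bound for \<open>absC (ev \<omega> v)\<close>. It gives injectivity
  and discreteness of the lattice, and one \<kappa> serves for all \<omega> that induce the same
  norm.\<close>

definition good :: "real \<Rightarrow> 'c ^ 'r::finite \<Rightarrow> bool" where
  "good \<kappa> \<omega> \<longleftrightarrow> 0 < \<kappa> \<and> (\<forall>v i. \<kappa> * absK (v $ i) \<le> absC (ev \<omega> v))"

lemma good_ge: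
  assumes "good \<kappa> \<omega>" "v \<in> A_vecs" "v \<notin> A_box n"
  shows "\<kappa> * real CARD('f) ^ n \<le> absC (ev \<omega> v)"
proof -
  obtain i where "real CARD('f) ^ n \<le> absK (v $ i)"
    using assms by (auto simp: A_box_def not_less)
  then have "\<kappa> * real CARD('f) ^ n \<le> \<kappa> * absK (v $ i)"
    using assms by (simp add: good_def)
  also have "\<dots> \<le> absC (ev \<omega> v)" using assms by (simp add: good_def)
  finally show ?thesis .
qed

lemma good_ev_eq_0:
  assumes "good \<kappa> \<omega>"
  shows "ev \<omega> v = 0 \<longleftrightarrow> v = 0"
proof
  assume "ev \<omega> v = 0"
  then have "\<kappa> * absK (v $ i) \<le> 0" for i
    using assms unfolding good_def by (metis absC_0)
  then have "absK (v $ i) \<le> 0" for i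
    using assms by (auto simp: good_def mult_le_0_iff)
  then have "v $ i = 0" for i
    using absK_nonneg[of "v $ i"] by (metis absK_eq_0_iff order_antisym)
  then show "v = 0" by (simp add: vec_eq_iff)
qed simp

lemma good_ev_eq:
  assumes "good \<kappa> \<omega>"
  shows "ev \<omega> v = ev \<omega> w \<longleftrightarrow> v = w"
  using good_ev_eq_0[OF assms, of "v - w"] by (simp add: ev_diff)

lemma good_inj: "good \<kappa> \<omega> \<Longrightarrow> inj_on (ev \<omega>) S"
  by (simp add: inj_on_def good_ev_eq)

lemma large_radius: "0 < \<kappa> \<Longrightarrow> \<exists>N. \<forall>n\<ge>N. B < \<kappa> * real CARD('f) ^ n"
proof -
  assume k: "0 < \<kappa>"
  obtain N where N: "B / \<kappa> < real CARD('f) ^ N"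
    using real_arch_pow[OF q_real_gt_1] by blast
  have "B < \<kappa> * real CARD('f) ^ n" if "N \<le> n" for n
  proof -
    have "real CARD('f) ^ N \<le> real CARD('f) ^ n"
      using that by (intro power_increasing) (simp_all add: order_less_imp_le)
    with N have "B / \<kappa> < real CARD('f) ^ n" by linarith
    then show ?thesis using k by (simp add: pos_divide_less_eq mult.commute)
  qed
  then show ?thesis by blast
qed

definition partial_prod :: "'c set \<Rightarrow> 'c \<Rightarrow> 'c" where
  "partial_prod S z = (\<Prod>u\<in>S. 1 - z / u)"

text \<open>Every additional factor differs from 1 by at most |z| / R, and a product of such factors
  is as close to 1 as the worst of them.\<close>

lemma partial_prod_near:
  assumes "finite S'" "S \<subseteq> S'" "\<And>u. u \<in> S' - S \<Longrightarrow> R \<le> absC u" "0 < R" "absC z \<le> R"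
  shows "absC (partial_prod S' z - partial_prod S z) \<le> absC (partial_prod S z) * (absC z / R)"
proof -
  have *: "absC ((\<Prod>u\<in>S' - S. 1 - z / u) - 1) \<le> absC z / R"
  proof (rule absC_prod_near_1)
    fix u assume "u \<in> S' - S"
    then show "absC (z / u) \<le> absC z / R"
      using assms(3)[of u] assms(4) by (auto intro!: divide_left_mono mult_pos_pos)
  qed (use assms in auto)
  have "partial_prod S' z = partial_prod S z * (\<Prod>u\<in>S' - S. 1 - z / u)"
    unfolding partial_prod_def using assms(1,2) by (metis mult.commute prod.subset_diff)
  then have "partial_prod S' z - partial_prod S z = partial_prod S z * ((\<Prod>u\<in>S' - S. 1 - z / u) - 1)"
    by (simp add: algebra_simps)
  then show ?thesis using mult_left_mono[OF *, of "absC (partial_prod S z)"] by (simp add: abs_mult)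
qed

text \<open>The boxes give a Cauchy sequence. The estimate holds for every finite set that contains
  a box, so the limit of the sequence is also the limit of the net.\<close>

lemma lattice_product_limit:
  fixes \<omega> :: "'c ^ 'r::finite"
  assumes "good \<kappa> \<omega>"
  shows "\<exists>L. ((\<lambda>S. partial_prod S z) \<longlongrightarrow> L) (finite_subsets_at_top (ev \<omega> ` A_vecs - {0}))"
proof -
  let ?\<Lambda> = "ev \<omega> ` A_vecs - {0}"
  define B where "B n = ev \<omega> ` A_box n - {0}" for n
  have k: "0 < \<kappa>" using assms by (simp add: good_def)
  have far: "\<kappa> * real CARD('f) ^ n \<le> absC u" if "u \<in> ?\<Lambda> - B n" for u n
    using that good_ge[OF assms] by (auto simp: B_def)
  have B: "finite (B n)" "B n \<subseteq> ?\<Lambda>" for n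
    using finite_A_box by (auto simp: B_def A_box_def)
  have near: "absC (partial_prod S z - partial_prod (B n) z) \<le> absC (partial_prod (B n) z) * (absC z / (\<kappa> * real CARD('f) ^ n))"
    if "finite S" "B n \<subseteq> S" "S \<subseteq> ?\<Lambda>" "absC z \<le> \<kappa> * real CARD('f) ^ n" for S n
  proof (rule partial_prod_near)
    show "\<kappa> * real CARD('f) ^ n \<le> absC u" if "u \<in> S - B n" for u
      using that far[of u n] \<open>S \<subseteq> ?\<Lambda>\<close> by blast
    show "0 < \<kappa> * real CARD('f) ^ n" using k by simp
  qed (use that in auto)
  obtain N0 where N0: "\<forall>n\<ge>N0. absC z < \<kappa> * real CARD('f) ^ n"
    using large_radius[OF k] by blast
  have mono: "B m \<subseteq> B n" if "m \<le> n" for m n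
  proof -
    have "real CARD('f) ^ m \<le> real CARD('f) ^ n"
      using that by (intro power_increasing) (simp_all add: order_less_imp_le)
    then show ?thesis by (force simp: B_def A_box_def intro: order.strict_trans2)
  qed
  \<comment> \<open>From \<open>N0\<close> on the new factors have absolute value at most 1. So the
    partial products stay bounded, and the relative error becomes an absolute one.\<close>
  have bd: "absC (partial_prod (B n) z) \<le> absC (partial_prod (B N0) z)" if "N0 \<le> n" for n
  proof -
    have "absC (partial_prod (B n) z - partial_prod (B N0) z) \<le> absC (partial_prod (B N0) z) * (absC z / (\<kappa> * real CARD('f) ^ N0))"
      using B mono[OF that] N0 by (intro near) (auto simp: order_less_imp_le)
    also have "\<dots> \<le> absC (partial_prod (B N0) z) * 1"
      using N0 k by (intro mult_left_mono) (auto simp: pos_divide_le_eq order_less_imp_le)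
    finally have "absC ((partial_prod (B n) z - partial_prod (B N0) z) + partial_prod (B N0) z) \<le> absC (partial_prod (B N0) z)"
      by (intro absC_add_le) simp_all
    then show ?thesis by simp
  qed
  define M where "M = absC (partial_prod (B N0) z) * absC z"
  have step: "\<exists>N\<ge>N0. \<forall>n\<ge>N. \<forall>S. finite S \<and> B n \<subseteq> S \<and> S \<subseteq> ?\<Lambda> \<longrightarrow> absC (partial_prod S z - partial_prod (B n) z) < e" if e: "0 < e" for e
  proof -
    obtain N1 where N1: "\<forall>n\<ge>N1. M / e < \<kappa> * real CARD('f) ^ n"
      using large_radius[OF k] by blast
    show ?thesis
    proof (intro exI[of _ "max N0 N1"] conjI allI impI; (elim conjE)?)
      fix n S assume n: "max N0 N1 \<le> n" and S: "finite S" "B n \<subseteq> S" "S \<subseteq> ?\<Lambda>"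
      have "absC (partial_prod S z - partial_prod (B n) z) \<le> absC (partial_prod (B n) z) * (absC z / (\<kappa> * real CARD('f) ^ n))"
        using S N0 n by (intro near) (auto simp: order_less_imp_le)
      also have "\<dots> \<le> absC (partial_prod (B N0) z) * (absC z / (\<kappa> * real CARD('f) ^ n))"
        using bd[of n] n k by (intro mult_right_mono) auto
      also have "\<dots> = M / (\<kappa> * real CARD('f) ^ n)" by (simp add: M_def)
      also have "\<dots> < e"
      proof -
        have "M / e < \<kappa> * real CARD('f) ^ n" using N1 n by simp
        then have "M < e * (\<kappa> * real CARD('f) ^ n)" using e by (simp add: pos_divide_less_eq mult.commute)
        then show ?thesis using k by (subst pos_divide_less_eq) (simp_all add: mult.commute)
      qed
      finally show "absC (partial_prod S z - partial_prod (B n) z) < e" .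
    qed simp
  qed
  have "Cauchy (\<lambda>n. partial_prod (B n) z)"
  proof (rule metric_CauchyI)
    fix e :: real assume "0 < e"
    from step[OF this] obtain N where
      N: "\<forall>n\<ge>N. \<forall>S. finite S \<and> B n \<subseteq> S \<and> S \<subseteq> ?\<Lambda> \<longrightarrow> absC (partial_prod S z - partial_prod (B n) z) < e" by blast
    show "\<exists>M. \<forall>m\<ge>M. \<forall>n\<ge>M. dist (partial_prod (B m) z) (partial_prod (B n) z) < e"
    proof (intro exI[of _ N] allI impI)
      fix m n assume "N \<le> m" "N \<le> n"
      then have "absC (partial_prod (B m) z - partial_prod (B N) z) < e" "absC (partial_prod (B n) z - partial_prod (B N) z) < e"
        using N B mono by auto
      then have "absC ((partial_prod (B m) z - partial_prod (B N) z) - (partial_prod (B n) z - partial_prod (B N) z)) < e"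
        by (rule absC_diff_less)
      then show "dist (partial_prod (B m) z) (partial_prod (B n) z) < e" by (simp add: dist_eq_abs)
    qed
  qed
  then obtain L where L: "(\<lambda>n. partial_prod (B n) z) \<longlonglongrightarrow> L"
    using Cauchy_convergent convergent_def by blast
  have "((\<lambda>S. partial_prod S z) \<longlongrightarrow> L) (finite_subsets_at_top ?\<Lambda>)"
  proof (rule tendstoI)
    fix e :: real assume e: "0 < e"
    from step[OF this] obtain N where
      N: "\<forall>n\<ge>N. \<forall>S. finite S \<and> B n \<subseteq> S \<and> S \<subseteq> ?\<Lambda> \<longrightarrow> absC (partial_prod S z - partial_prod (B n) z) < e" by blast
    obtain N' where N': "\<forall>n\<ge>N'. dist (partial_prod (B n) z) L < e"
      using L e by (auto simp: lim_sequentially)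
    define n where "n = max N N'"
    show "\<forall>\<^sub>F S in finite_subsets_at_top ?\<Lambda>. dist (partial_prod S z) L < e"
      unfolding eventually_finite_subsets_at_top
    proof (intro exI[of _ "B n"] conjI allI impI)
      fix S assume "finite S \<and> B n \<subseteq> S \<and> S \<subseteq> ?\<Lambda>"
      then have "absC (partial_prod S z - partial_prod (B n) z) < e" using N by (simp add: n_def)
      moreover have "absC (partial_prod (B n) z - L) < e" using N' by (simp add: n_def dist_eq_abs)
      ultimately have "absC ((partial_prod S z - partial_prod (B n) z) + (partial_prod (B n) z - L)) < e" by (rule absC_add_less)
      then show "dist (partial_prod S z) L < e" by (simp add: dist_eq_abs)
    qed (use B in auto)
  qed
  then show ?thesis by blast
qed

abbreviation lexp :: "'c ^ 'r::finite \<Rightarrow> 'c \<Rightarrow> 'c" where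
  "lexp \<equiv> lattice_exp \<iota>"

text \<open>\<open>G\<close> may be any finite set containing 0 and all lattice vectors shorter than
  R: the lemma is applied to boxes and, at the critical radius, to a ball of the norm.\<close>

lemma lexp_approx:
  fixes \<omega> :: "'c ^ 'r::finite"
  assumes "good \<kappa> \<omega>" and G: "finite G" "0 \<in> G" "G \<subseteq> A_vecs"
    and R: "\<And>\<mu>. \<mu> \<in> A_vecs - G \<Longrightarrow> R \<le> absC (ev \<omega> \<mu>)" "0 < R" "absC z \<le> R"
  shows "absC (lexp \<omega> z - fexp (ev \<omega> ` G) z) \<le> absC (fexp (ev \<omega> ` G) z) * (absC z / R)"
proof -
  let ?\<Lambda> = "ev \<omega> ` A_vecs - {0}"
  let ?G = "ev \<omega> ` G - {0}"
  obtain L where L: "((\<lambda>S. partial_prod S z) \<longlongrightarrow> L) (finite_subsets_at_top ?\<Lambda>)"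
    using lattice_product_limit[OF assms(1)] by blast
  have "Lim (finite_subsets_at_top ?\<Lambda>) (\<lambda>S. \<Prod>u\<in>S. 1 - z / u) = L"
    using tendsto_Lim[OF finite_subsets_at_top_neq_bot L] by (simp add: partial_prod_def)
  then have lexp: "lexp \<omega> z = z * L"
    by (simp add: lattice_exp_def A_lattice_eq)
  \<comment> \<open>The net limit controls sets above some \<open>X\<close>, the product estimate
    sets above \<open>?G\<close>. Their union serves both, at the cost of an e that tends to
    0.\<close>
  have bound: "absC (L - partial_prod ?G z) \<le> absC (partial_prod ?G z) * (absC z / R) + e" if e: "0 < e" for e
  proof -
    have "\<forall>\<^sub>F S in finite_subsets_at_top ?\<Lambda>. dist (partial_prod S z) L < e"
      using L e by (rule tendstoD)
    then obtain X where X': "finite X \<and> X \<subseteq> ?\<Lambda> \<and> (\<forall>S. finite S \<and> X \<subseteq> S \<and> S \<subseteq> ?\<Lambda> \<longrightarrow> dist (partial_prod S z) L < e)"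
      unfolding eventually_finite_subsets_at_top by (rule exE)
    then have X: "finite X" "X \<subseteq> ?\<Lambda>" "\<And>S. finite S \<Longrightarrow> X \<subseteq> S \<Longrightarrow> S \<subseteq> ?\<Lambda> \<Longrightarrow> dist (partial_prod S z) L < e"
      by simp_all
    let ?S = "X \<union> ?G"
    have "dist (partial_prod ?S z) L < e" using X G by (intro X(3)) auto
    then have "absC (L - partial_prod ?S z) < e" by (simp add: dist_eq_abs absC_minus_commute)
    moreover have "absC (partial_prod ?S z - partial_prod ?G z) \<le> absC (partial_prod ?G z) * (absC z / R)"
    proof (rule partial_prod_near)
      fix u assume "u \<in> ?S - ?G"
      then obtain \<mu> where "\<mu> \<in> A_vecs" "u = ev \<omega> \<mu>" "\<mu> \<notin> G" using X(2) by auto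
      then show "R \<le> absC u" using R(1) by simp
    qed (use X G R in auto)
    ultimately have "max (absC (L - partial_prod ?S z)) (absC (partial_prod ?S z - partial_prod ?G z)) \<le> absC (partial_prod ?G z) * (absC z / R) + e"
      using e R(2) by (auto intro: add_increasing)
    then show ?thesis
      using abs_add[of "L - partial_prod ?S z" "partial_prod ?S z - partial_prod ?G z"] by (simp only: diff_add_cancel diff_add_eq add_diff_eq)
  qed
  have "absC (L - partial_prod ?G z) \<le> absC (partial_prod ?G z) * (absC z / R)"
    by (rule field_le_epsilon) (use bound in auto)
  then have "absC (z * (L - partial_prod ?G z)) \<le> absC z * (absC (partial_prod ?G z) * (absC z / R))"
    unfolding abs_mult by (rule mult_left_mono) simp
  moreover have "fexp (ev \<omega> ` G) z = z * partial_prod ?G z" by (simp add: fexp_def partial_prod_def)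
  moreover have "lexp \<omega> z - z * partial_prod ?G z = z * (L - partial_prod ?G z)" by (simp add: lexp algebra_simps)
  ultimately show ?thesis by (simp add: abs_mult)
qed

section \<open>Approximation by boxes and additivity of the exponential\<close>

definition box_exp :: "'c ^ 'r::finite \<Rightarrow> nat \<Rightarrow> 'c \<Rightarrow> 'c" where
  "box_exp \<omega> n = fexp (ev \<omega> ` A_box n)"

lemma fsub_A_box: "fsub (ev \<omega> ` A_box n)"
  by (rule fsub_ev[OF fsub_vec_A_box])

lemma box_exp_approx:
  assumes "good \<kappa> \<omega>" "absC z \<le> \<kappa> * real CARD('f) ^ n"
  shows "absC (lexp \<omega> z - box_exp \<omega> n z) \<le> absC (box_exp \<omega> n z) * (absC z / (\<kappa> * real CARD('f) ^ n))"
  unfolding box_exp_def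
proof (rule lexp_approx[OF assms(1) finite_A_box])
  show "\<kappa> * real CARD('f) ^ n \<le> absC (ev \<omega> \<mu>)" if "\<mu> \<in> A_vecs - A_box n" for \<mu>
    using that good_ge[OF assms(1)] by blast
qed (use assms in \<open>auto simp: good_def A_box_def\<close>)

text \<open>The relative error is smaller than 1, so the absolute value is already exact at a finite
  stage.\<close>

lemma box_exp_abs:
  assumes "good \<kappa> \<omega>" "absC z < \<kappa> * real CARD('f) ^ n"
  shows "absC (lexp \<omega> z) = absC (box_exp \<omega> n z)"
proof (cases "box_exp \<omega> n z = 0")
  case True
  then show ?thesis
    using box_exp_approx[OF assms(1), of z n] assms(2) absC_nonneg[of "lexp \<omega> z"] by simp
next
  case False
  have k: "0 < \<kappa> * real CARD('f) ^ n" using assms by (simp add: good_def)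
  have "absC (box_exp \<omega> n z) * (absC z / (\<kappa> * real CARD('f) ^ n)) < absC (box_exp \<omega> n z) * 1"
    using False assms(2) k by (intro mult_strict_left_mono) simp_all
  then show ?thesis
    using box_exp_approx[OF assms(1), of z n] assms(2) by (intro absC_near) simp
qed

lemma lexp_eq_0_iff:
  assumes "good \<kappa> \<omega>"
  shows "lexp \<omega> (ev \<omega> v) = 0 \<longleftrightarrow> v \<in> A_vecs"
proof -
  have k: "0 < \<kappa>" using assms by (simp add: good_def)
  obtain n where n: "absC (ev \<omega> v) < \<kappa> * real CARD('f) ^ n" using large_radius[OF k] by blast
  have "lexp \<omega> (ev \<omega> v) = 0 \<longleftrightarrow> box_exp \<omega> n (ev \<omega> v) = 0"
    using box_exp_abs[OF assms n] by (metis absC_eq_0_iff)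
  also have "\<dots> \<longleftrightarrow> ev \<omega> v \<in> ev \<omega> ` A_box n"
    unfolding box_exp_def using fsub_A_box[of \<omega> n] by (intro fexp_eq_0_iff) (auto dest: fsubD)
  also have "\<dots> \<longleftrightarrow> v \<in> A_box n"
    using good_ev_eq[OF assms] by auto
  also have "\<dots> \<longleftrightarrow> v \<in> A_vecs"
    using good_ge[OF assms, of v n] n by (auto simp: A_box_def)
  finally show ?thesis .
qed

text \<open>The error in \<open>box_exp_approx\<close> depends on t only through the sizes of the
  argument and of the value; common bounds for both make the convergence uniform.\<close>

lemma uconv_lexp:
  assumes good: "\<And>t. t \<in> X \<Longrightarrow> good \<kappa> (\<omega> t)" and b: "\<And>t. t \<in> X \<Longrightarrow> absC (z t) \<le> b"
    and B: "\<And>t. t \<in> X \<Longrightarrow> absC (lexp (\<omega> t) (z t)) \<le> B" and k: "0 < \<kappa>"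
  shows "uconv X (\<lambda>n t. box_exp (\<omega> t) n (z t)) (\<lambda>t. lexp (\<omega> t) (z t))"
  unfolding uconv_def
proof (intro allI impI)
  fix e :: real assume e: "0 < e"
  obtain N1 where N1: "\<forall>n\<ge>N1. b < \<kappa> * real CARD('f) ^ n" using large_radius[OF k] by blast
  obtain N2 where N2: "\<forall>n\<ge>N2. B * b / e < \<kappa> * real CARD('f) ^ n" using large_radius[OF k] by blast
  show "\<exists>N. \<forall>n\<ge>N. \<forall>t\<in>X. absC (box_exp (\<omega> t) n (z t) - lexp (\<omega> t) (z t)) < e"
  proof (intro exI[of _ "max N1 N2"] allI impI ballI)
    fix n t assume n: "max N1 N2 \<le> n" and t: "t \<in> X"
    let ?R = "\<kappa> * real CARD('f) ^ n"
    have z: "absC (z t) < ?R" using N1 n b[OF t] by fastforce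
    have R: "0 < ?R" using k by simp
    have "absC (lexp (\<omega> t) (z t) - box_exp (\<omega> t) n (z t)) \<le> absC (box_exp (\<omega> t) n (z t)) * (absC (z t) / ?R)"
      using z by (intro box_exp_approx good[OF t]) simp
    also have "\<dots> = absC (lexp (\<omega> t) (z t)) * absC (z t) / ?R"
      using box_exp_abs[OF good[OF t] z] by simp
    also have "\<dots> \<le> B * b / ?R"
      using B[OF t] b[OF t] R order_trans[OF absC_nonneg B[OF t]]
      by (intro divide_right_mono mult_mono) auto
    also have "\<dots> < e"
    proof -
      have "B * b / e < ?R" using N2 n by simp
      then have "B * b < e * ?R" using e by (simp add: pos_divide_less_eq mult.commute)
      then show ?thesis using R by (subst pos_divide_less_eq) (simp_all add: mult.commute)
    qed
    finally show "absC (box_exp (\<omega> t) n (z t) - lexp (\<omega> t) (z t)) < e"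
      by (simp add: absC_minus_commute)
  qed
qed

lemma lexp_lim:
  assumes "good \<kappa> \<omega>"
  shows "uconv (UNIV :: unit set) (\<lambda>n t. box_exp \<omega> n z) (\<lambda>t. lexp \<omega> z)"
  using assms by (intro uconv_lexp[where b = "absC z" and B = "absC (lexp \<omega> z)" and \<kappa> = \<kappa>]) (auto simp: good_def)

lemma lexp_add:
  assumes "good \<kappa> \<omega>"
  shows "lexp \<omega> (x + y) = lexp \<omega> x + lexp \<omega> y"
proof -
  have "uconv (UNIV :: unit set) (\<lambda>n t. box_exp \<omega> n x + box_exp \<omega> n y) (\<lambda>t. lexp \<omega> x + lexp \<omega> y)"
    by (intro uconv_add lexp_lim[OF assms])
  then have "uconv (UNIV :: unit set) (\<lambda>n t. box_exp \<omega> n (x + y)) (\<lambda>t. lexp \<omega> x + lexp \<omega> y)"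
    by (simp add: box_exp_def fexp_add[OF fsub_A_box])
  from uconv_unique[OF lexp_lim[OF assms] this] show ?thesis by simp
qed

lemma lexp_F_scale:
  assumes "good \<kappa> \<omega>"
  shows "lexp \<omega> (F_scale \<iota> c x) = F_scale \<iota> c (lexp \<omega> x)"
proof -
  have "uconv (UNIV :: unit set) (\<lambda>n t. \<iota> (fls_const c) * box_exp \<omega> n x) (\<lambda>t. \<iota> (fls_const c) * lexp \<omega> x)"
    by (intro uconv_mult lexp_lim[OF assms]) simp_all
  then have "uconv (UNIV :: unit set) (\<lambda>n t. box_exp \<omega> n (F_scale \<iota> c x)) (\<lambda>t. F_scale \<iota> c (lexp \<omega> x))"
    by (simp add: box_exp_def fexp_F_scale[OF fsub_A_box]) (simp add: F_scale_def)
  from uconv_unique[OF lexp_lim[OF assms] this] show ?thesis by simp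
qed

lemma lexp_0 [simp]: "lexp \<omega> 0 = 0"
  by (simp add: lattice_exp_def)

lemma lexp_diff: "good \<kappa> \<omega> \<Longrightarrow> lexp \<omega> (x - y) = lexp \<omega> x - lexp \<omega> y"
  using lexp_add[of \<kappa> \<omega> "x - y" y] by (simp add: eq_diff_eq)

lemma lexp_sum: "good \<kappa> \<omega> \<Longrightarrow> lexp \<omega> (\<Sum>i\<in>S. f i) = (\<Sum>i\<in>S. lexp \<omega> (f i))"
  by (induction S rule: infinite_finite_induct) (simp_all add: lexp_add)

lemma lexp_translate:
  assumes "good \<kappa> \<omega>" "\<mu> \<in> A_vecs"
  shows "lexp \<omega> (ev \<omega> (v + \<mu>)) = lexp \<omega> (ev \<omega> v)"
  using lexp_eq_0_iff[OF assms(1), of \<mu>] assms by (simp add: ev_add lexp_add)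

section \<open>The torsion and the Drinfeld module\<close>

text \<open>The torsion as an image of division vectors, available before the Drinfeld module is
  known; \<open>torsion_eq\<close> identifies it with the zeros of the polynomial.\<close>

definition tors :: "'f poly \<Rightarrow> 'c ^ 'r::finite \<Rightarrow> 'c set" where
  "tors a \<omega> = (\<lambda>v. lexp \<omega> (ev \<omega> v)) ` tors_coords a"

lemma zero_in_tors_coords [simp]: "0 \<in> tors_coords a"
  by (simp add: tors_coords_def)

lemma inj_tors:
  assumes "good \<kappa> \<omega>" "a \<noteq> 0"
  shows "inj_on (\<lambda>v. lexp \<omega> (ev \<omega> v)) (tors_coords a)"
proof (rule inj_onI)
  fix v w assume vw: "v \<in> tors_coords a" "w \<in> tors_coords a" "lexp \<omega> (ev \<omega> v) = lexp \<omega> (ev \<omega> w)"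
  then have "lexp \<omega> (ev \<omega> (v - w)) = 0"
    using assms by (simp add: ev_diff lexp_diff)
  then have "v - w \<in> A_vecs" using lexp_eq_0_iff[OF assms(1)] by blast
  then have "v - w = 0"
    using fsub_vec_diff[OF fsub_vec_tors_coords[OF assms(2)] vw(1,2)] by (rule A_vecs_tors_coords)
  then show "v = w" by simp
qed

lemma card_tors:
  fixes \<omega> :: "'c ^ 'r::finite"
  assumes "good \<kappa> \<omega>" "a \<noteq> 0"
  shows "card (tors a \<omega>) = CARD('f) ^ (CARD('r) * degree a)"
  unfolding tors_def by (simp add: card_image[OF inj_tors[OF assms]] card_tors_coords[OF assms(2)])

lemma fsub_tors:
  assumes "good \<kappa> \<omega>" "a \<noteq> 0"
  shows "fsub (tors a \<omega>)"
proof -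
  have "fsub_vec (tors_coords a)" using assms fsub_vec_tors_coords by blast
  then show ?thesis
    unfolding tors_def fsub_vec_def fsub_def F.subspace_def
    by (auto simp: ev_add[symmetric] ev_const[symmetric] lexp_add[OF assms(1), symmetric]
          lexp_F_scale[OF assms(1), symmetric] simp del: zero_in_tors_coords intro: rev_image_eqI)
qed

lemma fexp_image_eq:
  assumes "inj_on f S" "0 \<in> S" "f 0 = 0"
  shows "fexp (f ` S) z = z * (\<Prod>v\<in>S - {0}. 1 - z / f v)"
    and "lpoly (f ` S) = [:0, 1:] * (\<Prod>v\<in>S - {0}. [:1, - inverse (f v):])"
proof -
  have *: "f ` S - {0} = f ` (S - {0})"
  proof -
    have "f x \<noteq> 0" if "x \<in> S - {0}" for x
      using inj_onD[OF assms(1), of x 0] assms(2,3) that by auto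
    then show ?thesis using assms(3) by auto
  qed
  have inj: "inj_on f (S - {0})" using assms(1) by (rule inj_on_subset) auto
  show "fexp (f ` S) z = z * (\<Prod>v\<in>S - {0}. 1 - z / f v)"
    unfolding fexp_def * by (simp add: prod.reindex[OF inj])
  show "lpoly (f ` S) = [:0, 1:] * (\<Prod>v\<in>S - {0}. [:1, - inverse (f v):])"
    unfolding lpoly_def * by (simp add: prod.reindex[OF inj])
qed

text \<open>The larger box is \<open>a\<close> times \<open>tors_box a n\<close>, and the
  exponential of that space factors through the exponential of its subspace \<open>A_box n\<close>.
  This is why the index rises by \<open>degree a\<close>.\<close>

lemma box_exp_functional:
  fixes \<omega> :: "'c ^ 'r::finite"
  assumes "good \<kappa> \<omega>" "a \<noteq> 0"
  shows "box_exp \<omega> (n + degree a) (\<iota> (A_to_K a) * z) =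
    \<iota> (A_to_K a) * fexp ((\<lambda>v. box_exp \<omega> n (ev \<omega> v)) ` tors_coords a) (box_exp \<omega> n z)"
proof -
  let ?a = "\<iota> (A_to_K a)"
  have a: "?a \<noteq> 0" using assms by simp
  have B: "A_box (n + degree a) = (*s) (A_to_K a) ` (tors_box a n :: ('f fls ^ 'r) set)"
  proof
    show "A_box (n + degree a) \<subseteq> (*s) (A_to_K a) ` tors_box a n"
    proof
      fix v assume "v \<in> A_box (n + degree a)"
      then show "v \<in> (*s) (A_to_K a) ` tors_box a n"
        using assms(2) by (intro image_eqI[of _ _ "inverse (A_to_K a) *s v"]) (simp_all add: tors_box_def)
    qed
  qed (auto simp: tors_box_def)
  have "ev \<omega> ` A_box (n + degree a) = (*) ?a ` (ev \<omega> ` tors_box a n)"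
    unfolding B image_image ev_scale by (rule refl)
  then have "box_exp \<omega> (n + degree a) (?a * z) = ?a * fexp (ev \<omega> ` tors_box a n) z"
    unfolding box_exp_def by (simp add: fexp_scale[OF a])
  also have "fexp (ev \<omega> ` tors_box a n) z = fexp (fexp (ev \<omega> ` A_box n) ` (ev \<omega> ` tors_box a n)) (fexp (ev \<omega> ` A_box n) z)"
    by (rule fexp_fexp) (auto intro!: fsub_A_box fsub_ev fsub_vec_tors_box image_mono A_box_subset_tors_box assms)
  also have "fexp (ev \<omega> ` A_box n) ` (ev \<omega> ` tors_box a n) = (\<lambda>v. box_exp \<omega> n (ev \<omega> v)) ` tors_coords a"
  proof
    show "fexp (ev \<omega> ` A_box n) ` (ev \<omega> ` tors_box a n) \<subseteq> (\<lambda>v. box_exp \<omega> n (ev \<omega> v)) ` tors_coords a"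
    proof
      fix x assume "x \<in> fexp (ev \<omega> ` A_box n) ` (ev \<omega> ` tors_box a n)"
      then obtain u where u: "u \<in> tors_box a n" "x = fexp (ev \<omega> ` A_box n) (ev \<omega> u)" by auto
      obtain e b where "e \<in> tors_coords a" "b \<in> A_box n" "u = e + b" using tors_box_decomp[OF assms(2) u(1)] by blast
      then have "x = box_exp \<omega> n (ev \<omega> e)"
        using u fexp_translate[OF fsub_A_box, of "ev \<omega> b" \<omega> n "ev \<omega> e"] by (simp add: box_exp_def ev_add)
      then show "x \<in> (\<lambda>v. box_exp \<omega> n (ev \<omega> v)) ` tors_coords a" using \<open>e \<in> tors_coords a\<close> by blast
    qed
    show "(\<lambda>v. box_exp \<omega> n (ev \<omega> v)) ` tors_coords a \<subseteq> fexp (ev \<omega> ` A_box n) ` (ev \<omega> ` tors_box a n)"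
      using tors_coords_subset_tors_box[OF assms(2), of n] by (auto simp: box_exp_def)
  qed
  finally show ?thesis by (simp add: box_exp_def)
qed

lemma box_exp_inj:
  assumes "good \<kappa> \<omega>" "a \<noteq> 0"
  shows "inj_on (\<lambda>v. box_exp \<omega> n (ev \<omega> v)) (tors_coords a)"
proof (rule inj_onI)
  fix v w assume vw: "v \<in> tors_coords a" "w \<in> tors_coords a" "box_exp \<omega> n (ev \<omega> v) = box_exp \<omega> n (ev \<omega> w)"
  then have "box_exp \<omega> n (ev \<omega> (v - w)) = 0" by (simp add: box_exp_def ev_diff fexp_diff[OF fsub_A_box])
  then have "ev \<omega> (v - w) \<in> ev \<omega> ` A_box n"
    unfolding box_exp_def using fexp_eq_0_iff[OF fsubD(1,2)[OF fsub_A_box[of \<omega> n]]] by simp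
  then have "v - w \<in> A_vecs" using good_ev_eq[OF assms(1)] by (auto simp: A_box_def)
  then have "v - w = 0"
    using fsub_vec_diff[OF fsub_vec_tors_coords[OF assms(2)] vw(1,2)] by (rule A_vecs_tors_coords)
  then show "v = w" by simp
qed

lemma uconv_prod:
  assumes "finite S"
    and "\<And>v. v \<in> S \<Longrightarrow> uconv X (\<alpha> v) (\<beta> v)" "\<And>v. v \<in> S \<Longrightarrow> ubdd X (\<beta> v)"
  shows "uconv X (\<lambda>n t. \<Prod>v\<in>S. \<alpha> v n t) (\<lambda>t. \<Prod>v\<in>S. \<beta> v t) \<and> ubdd X (\<lambda>t. \<Prod>v\<in>S. \<beta> v t)"
  using assms
  by (induction S rule: finite_induct) (auto intro!: uconv_mult ubdd_mult)

lemma lexp_tors_coords_nonzero: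
  assumes "good \<kappa> \<omega>" "v \<in> tors_coords a - {0}"
  shows "lexp \<omega> (ev \<omega> v) \<noteq> 0"
  using assms lexp_eq_0_iff[OF assms(1)] A_vecs_tors_coords by blast

text \<open>The limit of \<open>box_exp_functional\<close>, taken factor by factor; the inverses
  converge because the exponential does not vanish at nonzero reduced division vectors.\<close>

lemma lexp_functional:
  fixes \<omega> :: "'c ^ 'r::finite"
  assumes "good \<kappa> \<omega>" "a \<noteq> 0"
  shows "lexp \<omega> (\<iota> (A_to_K a) * z) = \<iota> (A_to_K a) * fexp (tors a \<omega>) (lexp \<omega> z)"
proof -
  let ?a = "\<iota> (A_to_K a)"
  let ?U = "UNIV :: unit set"
  have E0: "0 \<in> (tors_coords a :: ('f fls ^ 'r) set)" by simp
  have "uconv ?U (\<lambda>n t. box_exp \<omega> (n + degree a) (?a * z)) (\<lambda>t. lexp \<omega> (?a * z))"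
    unfolding uconv_def
  proof (intro allI impI)
    fix e :: real assume "0 < e"
    then obtain N where "\<forall>n\<ge>N. \<forall>t\<in>?U. absC (box_exp \<omega> n (?a * z) - lexp \<omega> (?a * z)) < e"
      using uconvD[OF lexp_lim[OF assms(1)]] by blast
    then show "\<exists>N. \<forall>n\<ge>N. \<forall>t\<in>?U. absC (box_exp \<omega> (n + degree a) (?a * z) - lexp \<omega> (?a * z)) < e"
      by (intro exI[of _ N]) simp
  qed
  then have 1: "uconv ?U (\<lambda>n t. ?a * (box_exp \<omega> n z * (\<Prod>v\<in>tors_coords a - {0}. 1 - box_exp \<omega> n z * inverse (box_exp \<omega> n (ev \<omega> v)))))
      (\<lambda>t. lexp \<omega> (?a * z))"
    using fexp_image_eq(1)[OF box_exp_inj[OF assms] E0] by (simp add: box_exp_functional[OF assms] divide_inverse) (simp add: box_exp_def)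
  have "uconv ?U (\<lambda>n t. \<Prod>v\<in>tors_coords a - {0}. 1 - box_exp \<omega> n z * inverse (box_exp \<omega> n (ev \<omega> v)))
      (\<lambda>t. \<Prod>v\<in>tors_coords a - {0}. 1 - lexp \<omega> z * inverse (lexp \<omega> (ev \<omega> v)))"
  proof (rule conjunct1[OF uconv_prod])
    fix v :: "'f fls ^ 'r" assume v: "v \<in> tors_coords a - {0}"
    have "uconv ?U (\<lambda>n t. inverse (box_exp \<omega> n (ev \<omega> v))) (\<lambda>t. inverse (lexp \<omega> (ev \<omega> v)))"
      by (rule uconv_inverse[OF lexp_lim[OF assms(1)], of "absC (lexp \<omega> (ev \<omega> v))"])
        (use lexp_tors_coords_nonzero[OF assms(1) v] in auto)
    then show "uconv ?U (\<lambda>n t. 1 - box_exp \<omega> n z * inverse (box_exp \<omega> n (ev \<omega> v)))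
      (\<lambda>t. 1 - lexp \<omega> z * inverse (lexp \<omega> (ev \<omega> v)))"
      by (intro uconv_diff uconv_const uconv_mult lexp_lim[OF assms(1)]) simp_all
  qed (use card_tors_coords[OF assms(2)] in auto)
  then have 2: "uconv ?U (\<lambda>n t. ?a * (box_exp \<omega> n z * (\<Prod>v\<in>tors_coords a - {0}. 1 - box_exp \<omega> n z * inverse (box_exp \<omega> n (ev \<omega> v)))))
      (\<lambda>t. ?a * (lexp \<omega> z * (\<Prod>v\<in>tors_coords a - {0}. 1 - lexp \<omega> z * inverse (lexp \<omega> (ev \<omega> v)))))"
    by (intro uconv_mult uconv_const lexp_lim[OF assms(1)]) simp_all
  from uconv_unique[OF 1 2, of "()"] show ?thesis
    unfolding tors_def fexp_image_eq(1)[OF inj_tors[OF assms] E0, simplified]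
    by (simp add: divide_inverse)
qed

text \<open>Needed for the uniqueness of the polynomial in \<open>drinfeld_module\<close>. Small
  multiples of a unit vector have different images, because their differences are too short to be
  nonzero lattice vectors.\<close>

lemma infinite_range_lexp:
  fixes \<omega> :: "'c ^ 'r::finite"
  assumes "good \<kappa> \<omega>"
  shows "infinite (range (lexp \<omega>))"
proof
  assume fin: "finite (range (lexp \<omega>))"
  let ?v = "\<lambda>n. (inverse T ^ Suc n) *s (axis undefined 1 :: 'f fls ^ 'r)"
  have "inj (\<lambda>n. lexp \<omega> (ev \<omega> (?v n)))"
  proof (rule injI)
    fix m n assume "lexp \<omega> (ev \<omega> (?v m)) = lexp \<omega> (ev \<omega> (?v n))"
    then have "lexp \<omega> (ev \<omega> (?v m - ?v n)) = 0"
      using assms by (simp only: ev_diff lexp_diff) simp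
    then have "?v m - ?v n \<in> A_vecs" using lexp_eq_0_iff[OF assms] by blast
    then have "(?v m - ?v n) $ undefined \<in> range A_to_K" by (simp only: A_vecs_def) blast
    then obtain p where p: "inverse T ^ Suc m - inverse T ^ Suc n = A_to_K p"
      by (auto simp: axis_def)
    have "absK (inverse T ^ Suc k) < 1" for k
      by (simp only: absK_power absK_inverse absK_X_inv) (rule power_Suc_less_one, simp_all add: inverse_less_1_iff)
    then have "absK (A_to_K p) < 1" unfolding p[symmetric] by (intro absK_diff_less)
    then have "p = 0" using absK_A_to_K_ge_1[of p] by auto
    then have "absK (inverse T ^ Suc m) = absK (inverse T ^ Suc n)" using p by simp
    then have "real CARD('f) ^ Suc m = real CARD('f) ^ Suc n"
      by (simp only: absK_power absK_inverse absK_X_inv power_inverse inverse_eq_iff_eq)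
    then show "m = n" using power_inject_exp[of "real CARD('f)" "Suc m" "Suc n"] by simp
  qed
  then have "infinite (range (\<lambda>n. lexp \<omega> (ev \<omega> (?v n))))" by (rule range_inj_infinite)
  moreover have "range (\<lambda>n. lexp \<omega> (ev \<omega> (?v n))) \<subseteq> range (lexp \<omega>)" by auto
  ultimately show False using fin finite_subset by blast
qed

text \<open>The functional equation provides a polynomial of the required form, and two such
  polynomials agree on the infinite range of the exponential; so the definite description is
  determined.\<close>

lemma drinfeld_module_eq:
  fixes \<omega> :: "'c ^ 'r::finite"
  assumes "good \<kappa> \<omega>" "a \<noteq> 0"
  shows "drinfeld_module \<iota> \<omega> a = smult (\<iota> (A_to_K a)) (lpoly (tors a \<omega>))"
  unfolding drinfeld_module_def
proof (rule the_equality)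
  let ?a = "\<iota> (A_to_K a)"
  have "smult ?a (lpoly (tors a \<omega>)) = (\<Sum>k\<le>CARD('r) * degree a. monom (?a * qcoeff (tors a \<omega>) k) (CARD('f) ^ k))"
    by (subst lpoly_eq[OF fsub_tors card_tors, OF assms assms])
      (rule poly_ext, simp add: poly_sum poly_monom sum_distrib_left mult.assoc)
  moreover have "poly (smult ?a (lpoly (tors a \<omega>))) (lexp \<omega> z) = ?a * fexp (tors a \<omega>) (lexp \<omega> z)" for z
    by simp
  ultimately show "(\<exists>l. smult ?a (lpoly (tors a \<omega>)) = (\<Sum>k\<le>CARD('r) * degree a. monom (l k) (CARD('f) ^ k)))
      \<and> (\<forall>z. lexp \<omega> (?a * z) = poly (smult ?a (lpoly (tors a \<omega>))) (lexp \<omega> z))"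
    using lexp_functional[OF assms] by (intro conjI exI allI) (assumption, simp only:)
next
  fix p
  assume p: "(\<exists>l. p = (\<Sum>k\<le>CARD('r) * degree a. monom (l k) (CARD('f) ^ k)))
      \<and> (\<forall>z. lexp \<omega> (\<iota> (A_to_K a) * z) = poly p (lexp \<omega> z))"
  let ?r = "p - smult (\<iota> (A_to_K a)) (lpoly (tors a \<omega>))"
  have "range (lexp \<omega>) \<subseteq> {z. poly ?r z = 0}"
    using p lexp_functional[OF assms] by auto
  then have "infinite {z. poly ?r z = 0}"
    using infinite_range_lexp[OF assms(1)] finite_subset by blast
  then have "?r = 0" using poly_roots_finite by blast
  then show "p = smult (\<iota> (A_to_K a)) (lpoly (tors a \<omega>))" by simp
qed

lemma torsion_eq:
  assumes "good \<kappa> \<omega>" "a \<noteq> 0"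
  shows "torsion \<iota> a \<omega> = tors a \<omega>"
proof -
  have "finite (tors a \<omega>)" "0 \<in> tors a \<omega>" using fsubD[OF fsub_tors[OF assms]] by auto
  then show ?thesis
    using assms by (auto simp: torsion_def drinfeld_module_eq[OF assms] fexp_eq_0_iff)
qed

lemma coeff_form_eq:
  assumes "good \<kappa> \<omega>" "a \<noteq> 0"
  shows "coeff_form \<iota> a k \<omega> = \<iota> (A_to_K a) * qcoeff (tors a \<omega>) k"
  by (simp add: coeff_form_def drinfeld_module_eq[OF assms] qcoeff_def)

end

section \<open>Zeros of uniform limits of rational functions\<close>

context C_infty
begin

text \<open>Denominators have no zeros on \<open>X\<close>; for the sets \<open>X\<close> considered
  below this makes their absolute value constant there.\<close>

definition ratfun :: "'c set \<Rightarrow> ('c \<Rightarrow> 'c) \<Rightarrow> bool" where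
  "ratfun X f \<longleftrightarrow> (\<exists>n d. \<forall>t\<in>X. poly d t \<noteq> 0 \<and> f t = poly n t / poly d t)"

lemma ratfun_const [simp]: "ratfun X (\<lambda>t. c)"
  unfolding ratfun_def by (intro exI[of _ "[:c:]"] exI[of _ 1]) simp

lemma ratfun_affine: "ratfun X (\<lambda>t. c + t * d)"
  unfolding ratfun_def by (intro exI[of _ "[:c, d:]"] exI[of _ 1]) simp

lemma ratfun_diff:
  assumes "ratfun X f" "ratfun X g"
  shows "ratfun X (\<lambda>t. f t - g t)"
proof -
  obtain n d where f: "\<forall>t\<in>X. poly d t \<noteq> 0 \<and> f t = poly n t / poly d t"
    using assms(1) by (auto simp: ratfun_def)
  obtain n' d' where g: "\<forall>t\<in>X. poly d' t \<noteq> 0 \<and> g t = poly n' t / poly d' t"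
    using assms(2) by (auto simp: ratfun_def)
  show ?thesis
    unfolding ratfun_def using f g
    by (intro exI[of _ "n * d' - n' * d"] exI[of _ "d * d'"]) (simp add: diff_frac_eq)
qed

lemma ratfun_mult:
  assumes "ratfun X f" "ratfun X g"
  shows "ratfun X (\<lambda>t. f t * g t)"
proof -
  obtain n d where f: "\<forall>t\<in>X. poly d t \<noteq> 0 \<and> f t = poly n t / poly d t"
    using assms(1) by (auto simp: ratfun_def)
  obtain n' d' where g: "\<forall>t\<in>X. poly d' t \<noteq> 0 \<and> g t = poly n' t / poly d' t"
    using assms(2) by (auto simp: ratfun_def)
  show ?thesis
    unfolding ratfun_def using f g
    by (intro exI[of _ "n * n'"] exI[of _ "d * d'"]) simp
qed

lemma ratfun_inverse:
  assumes "ratfun X f" "\<And>t. t \<in> X \<Longrightarrow> f t \<noteq> 0"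
  shows "ratfun X (\<lambda>t. inverse (f t))"
proof -
  obtain n d where f: "\<forall>t\<in>X. poly d t \<noteq> 0 \<and> f t = poly n t / poly d t"
    using assms(1) by (auto simp: ratfun_def)
  show ?thesis
    unfolding ratfun_def
  proof (rule exI[of _ d], rule exI[of _ n], intro ballI conjI)
    fix t assume t: "t \<in> X"
    then show "poly n t \<noteq> 0" using f assms(2)[OF t] by auto
    show "inverse (f t) = poly d t / poly n t" using f t by simp
  qed
qed

lemma ratfun_prod: "(\<And>i. i \<in> S \<Longrightarrow> ratfun X (f i)) \<Longrightarrow> ratfun X (\<lambda>t. \<Prod>i\<in>S. f i t)"
  by (induction S rule: infinite_finite_induct) (auto intro: ratfun_mult)

lemma ratfun_coeff_prod:
  assumes "\<And>v. v \<in> S \<Longrightarrow> ratfun X (\<beta> v)"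
  shows "ratfun X (\<lambda>t. coeff (\<Prod>v\<in>S. [:1, - \<beta> v t:]) k)"
  using assms
proof (induction S arbitrary: k rule: infinite_finite_induct)
  case (insert v S)
  have c: "coeff ([:1, - x:] * p) k = coeff p k - x * (if k = 0 then 0 else coeff p (k - 1))" for x :: 'c and p
    by (cases k) simp_all
  have IH: "ratfun X (\<lambda>t. coeff (\<Prod>v\<in>S. [:1, - \<beta> v t:]) j)" for j
    using insert by auto
  have "ratfun X (\<lambda>t. if k = 0 then 0 else coeff (\<Prod>v\<in>S. [:1, - \<beta> v t:]) (k - 1))"
    by (cases "k = 0") (simp_all add: IH)
  then show ?case
    unfolding prod.insert[OF insert.hyps] c
    using insert.prems IH by (intro ratfun_diff ratfun_mult) auto
qed simp_all

lemma poly_prod_mset_linear: "poly (\<Prod>x\<in>#A. [:- x, 1:]) t = (\<Prod>x\<in>#A. t - x :: 'c)"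
  by (induction A) (simp_all add: left_diff_distrib)

lemma absC_prod_mset: "absC (\<Prod>x\<in>#A. f x :: 'c) = (\<Prod>x\<in>#A. absC (f x))"
  by (induction A) (simp_all add: abs_mult)

lemma prod_mset_const_real: "(\<And>x. x \<in># A \<Longrightarrow> f x = (c :: real)) \<Longrightarrow> (\<Prod>x\<in>#A. f x) = c ^ size A"
  by (induction A) simp_all

lemma prod_mset_mono_real:
  "(\<And>x. x \<in># A \<Longrightarrow> 0 \<le> f x \<and> f x \<le> (g x :: real)) \<Longrightarrow> 0 \<le> (\<Prod>x\<in>#A. f x) \<and> (\<Prod>x\<in>#A. f x) \<le> (\<Prod>x\<in>#A. g x)"
  by (induction A) (auto intro!: mult_mono intro: order_trans)

lemma prod_mset_pos_real: "(\<And>x. x \<in># A \<Longrightarrow> 0 < (f x :: real)) \<Longrightarrow> 0 < (\<Prod>x\<in>#A. f x)"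
  by (induction A) simp_all

lemma poly_factor_abs:
  assumes "p \<noteq> (0 :: 'c poly)"
  shows "\<exists>A l. 0 < l \<and> (\<forall>t. absC (poly p t) = l * (\<Prod>x\<in>#A. absC (t - x))) \<and> (\<forall>x\<in>#A. poly p x = 0)"
proof -
  obtain A where A: "p = smult (lead_coeff p) (\<Prod>x\<in>#A. [:- x, 1:])"
    using alg_closed_imp_factorization[OF assms] by blast
  have eq: "poly p t = lead_coeff p * (\<Prod>x\<in>#A. t - x)" for t
    by (subst A) (simp add: poly_prod_mset_linear)
  show ?thesis
  proof (intro exI[of _ A] exI[of _ "absC (lead_coeff p)"] conjI allI ballI)
    show "0 < absC (lead_coeff p)" using assms by simp
    show "absC (poly p t) = absC (lead_coeff p) * (\<Prod>x\<in>#A. absC (t - x))" for t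
      unfolding eq[of t] abs_mult absC_prod_mset ..
    show "poly p x = 0" if "x \<in># A" for x
      unfolding eq[of x] using that by (simp add: image_iff)
  qed
qed

text \<open>
  The zeros and poles of \<open>f\<close> outside the open disc around \<open>t0\<close> contribute a constant to
  \<open>\<bar>f\<bar>\<close> on that disc; hence only the multiset of zeros in the disc matters.
\<close>

lemma ratfun_factor:
  assumes X: "\<And>s. s \<notin> X \<Longrightarrow> \<exists>c. \<forall>t\<in>X. absC (t - s) = c"
    and f: "ratfun X f" and t: "t0 \<in> X" "t1 \<in> X" and nz: "f t1 \<noteq> 0" and r: "r = absC (t1 - t0)" "0 < r"
  shows "\<exists>M G. 0 < G \<and> (\<forall>\<rho>\<in>#M. absC (\<rho> - t0) < r \<and> f \<rho> = 0)
    \<and> (\<forall>t. absC (t - t0) < r \<longrightarrow> absC (f t) = G * (\<Prod>\<rho>\<in>#M. absC (t - \<rho>)))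
    \<and> absC (f t1) \<le> G * r ^ size M"
proof -
  \<comment> \<open>A point outside \<open>X\<close> is equally far from \<open>t0\<close> and
    \<open>t1\<close>, so by the ultrametric inequality this distance is at least r.\<close>
  have D: "s \<in> X" if "absC (s - t0) < r" for s
  proof (rule ccontr)
    assume "s \<notin> X"
    then have "absC (t1 - s) = absC (t0 - s)" using X t by fastforce
    moreover have "absC (t1 - s) = r"
      using absC_diff_eq[of "s - t0" "t1 - t0"] that r
      by (metis absC_minus_commute diff_diff_eq2 diff_add_cancel)
    ultimately show False using that by (simp add: absC_minus_commute)
  qed
  obtain n d where nd: "\<forall>t\<in>X. poly d t \<noteq> 0 \<and> f t = poly n t / poly d t"
    using f by (auto simp: ratfun_def)
  have "d \<noteq> 0" using nd t by auto
  then obtain P l where P: "0 < l" "\<And>t. absC (poly d t) = l * (\<Prod>x\<in>#P. absC (t - x))" "\<forall>x\<in>#P. poly d x = 0"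
    using poly_factor_abs by metis
  \<comment> \<open>Every pole lies outside \<open>X\<close> and therefore has constant distance
    from the points of \<open>X\<close>.\<close>
  have d_const: "absC (poly d t) = absC (poly d t0)" if "t \<in> X" for t
  proof -
    have "absC (t - x) = absC (t0 - x)" if "x \<in># P" for x
    proof -
      have "x \<notin> X" using that P nd by blast
      then show ?thesis using X \<open>t0 \<in> X\<close> \<open>t \<in> X\<close> by fastforce
    qed
    then show ?thesis unfolding P by (metis (no_types, lifting) image_mset_cong)
  qed
  have "n \<noteq> 0" using nd t nz by auto
  then obtain A l' where A: "0 < l'" "\<And>t. absC (poly n t) = l' * (\<Prod>x\<in>#A. absC (t - x))" "\<forall>x\<in>#A. poly n x = 0"
    using poly_factor_abs by metis
  define M where "M = filter_mset (\<lambda>\<rho>. absC (\<rho> - t0) < r) A"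
  define R where "R = filter_mset (\<lambda>\<rho>. \<not> absC (\<rho> - t0) < r) A"
  have AMR: "A = M + R" unfolding M_def R_def by (rule multiset_partition)
  define G where "G = l' * (\<Prod>x\<in>#R. absC (t0 - x)) / absC (poly d t0)"
  have fabs: "absC (f t) = l' * (\<Prod>x\<in>#M. absC (t - x)) * (\<Prod>x\<in>#R. absC (t - x)) / absC (poly d t0)" if "t \<in> X" for t
    using nd that A(2)[of t] d_const[OF that] by (simp add: AMR mult.assoc)
  have R: "r \<le> absC (t0 - x)" if "x \<in># R" for x
    using that by (auto simp: R_def absC_minus_commute)
  show ?thesis
  proof (intro exI[of _ M] exI[of _ G] conjI ballI allI impI)
    have "0 < absC (poly d t0)" using nd t by simp
    moreover have "0 < (\<Prod>x\<in>#R. absC (t0 - x))"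
      using R r by (intro prod_mset_pos_real) (meson order.strict_trans2)
    ultimately show "0 < G" unfolding G_def using A(1) by (intro divide_pos_pos mult_pos_pos)
  next
    fix \<rho> assume rho: "\<rho> \<in># M"
    then show "absC (\<rho> - t0) < r" by (simp add: M_def)
    then have "\<rho> \<in> X" by (rule D)
    then show "f \<rho> = 0" using nd A rho by (simp add: AMR)
  next
    fix t assume tr: "absC (t - t0) < r"
    have "absC (t - x) = absC (t0 - x)" if "x \<in># R" for x
      using R[OF that] tr absC_add_eq[of "t - t0" "t0 - x"] by simp
    then have "(\<Prod>x\<in>#R. absC (t - x)) = (\<Prod>x\<in>#R. absC (t0 - x))"
      by (metis (no_types, lifting) image_mset_cong)
    then show "absC (f t) = G * (\<Prod>\<rho>\<in>#M. absC (t - \<rho>))"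
      unfolding fabs[OF D[OF tr]] G_def by simp
  next
    have "(\<Prod>x\<in>#M. absC (t1 - x)) = r ^ size M"
    proof (rule prod_mset_const_real)
      fix x assume "x \<in># M"
      then have "absC (t0 - x) < absC (t1 - t0)" by (simp add: M_def r absC_minus_commute)
      then show "absC (t1 - x) = r" using absC_add_eq[of "t0 - x" "t1 - t0"] r by simp
    qed
    \<comment> \<open>Only an inequality: a zero at distance exactly r from \<open>t0\<close> may be
      closer to \<open>t1\<close>.\<close>
    moreover have "(\<Prod>x\<in>#R. absC (t1 - x)) \<le> (\<Prod>x\<in>#R. absC (t0 - x))"
    proof (rule conjunct2[OF prod_mset_mono_real], intro conjI)
      fix x assume "x \<in># R"
      then show "absC (t1 - x) \<le> absC (t0 - x)"
        using absC_add_le[of "t1 - t0" "absC (t0 - x)" "t0 - x"] R r by simp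
    qed simp
    ultimately show "absC (f t1) \<le> G * r ^ size M"
      unfolding fabs[OF t(2)] G_def using A(1) r
      by (simp add: divide_right_mono mult_left_mono mult.commute mult.left_commute)
  qed
qed

text \<open>The value group is divisible: an N-th root of T has absolute value q^(1/N), which lies
  below c for large N.\<close>

lemma small_values: "1 < c \<Longrightarrow> \<exists>y :: 'c. 1 < absC y \<and> absC y < c"
proof -
  assume c: "1 < c"
  obtain N where N: "real CARD('f) < c ^ N" using real_arch_pow[OF c] by blast
  then have "0 < N" using q_real_gt_1 by (cases N) auto
  then obtain y where y: "y ^ N = \<iota> T" using nth_root_exists by blast
  have yN: "absC y ^ N = real CARD('f)"
    using arg_cong[OF y, of absC] by (simp add: embed_abs)
  have "absC y < c"
    using yN N c by (intro power_less_imp_less_base[of "absC y" N c]) simp_all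
  moreover have "1 < absC y"
    using yN by (intro power_less_imp_less_base[of 1 N "absC y"]) simp_all
  ultimately show ?thesis by blast
qed

text \<open>The different sizes at \<open>t0\<close> and \<open>t1\<close> force every late
  \<open>F n\<close> to have a zero in the disc of radius |t1 - t0|. On an annulus in this disc all
  these functions have the same absolute value, so the number of zeros and the leading constant do
  not depend on n. Hence a small value of \<open>F n\<close> means a nearby zero, and zeros can be
  chained to a Cauchy sequence.\<close>

lemma rational_limit_zero:
  assumes X: "\<And>s. s \<notin> X \<Longrightarrow> \<exists>c. \<forall>t\<in>X. absC (t - s) = c"
    and rat: "\<And>n. ratfun X (F n)" and conv: "uconv X F L"
    and t: "t0 \<in> X" "t1 \<in> X" and less: "absC (L t0) < absC (L t1)"
  shows "\<exists>t\<in>X. L t = 0"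
proof (cases "L t0 = 0")
  case False
  define r where "r = absC (t1 - t0)"
  have r: "0 < r" using less by (auto simp: r_def)
  have D: "s \<in> X" if "absC (s - t0) < r" for s
  proof (rule ccontr)
    assume "s \<notin> X"
    then have "absC (t1 - s) = absC (t0 - s)" using X t by fastforce
    moreover have "absC (t1 - s) = r"
      using absC_add_eq[of "t0 - s" "t1 - t0"] that by (simp add: absC_minus_commute r_def)
    ultimately show False using that by (simp add: absC_minus_commute)
  qed
  define \<delta>0 where "\<delta>0 = absC (L t0)"
  have \<delta>0: "0 < \<delta>0" using False by (simp add: \<delta>0_def)
  obtain n0 where n0: "\<forall>n\<ge>n0. \<forall>t\<in>X. absC (F n t - L t) < \<delta>0" using uconvD[OF conv \<delta>0] by blast
  have F0: "absC (F n t0) = \<delta>0" and F1: "absC (F n t1) = absC (L t1)" if "n0 \<le> n" for n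
  proof -
    have "absC (F n t0 - L t0) < \<delta>0" "absC (F n t1 - L t1) < \<delta>0" using n0 that t by auto
    then show "absC (F n t0) = \<delta>0" "absC (F n t1) = absC (L t1)"
      using less by (auto simp: \<delta>0_def intro!: absC_near)
  qed
  have "\<forall>n\<in>{n0..}. \<exists>M G. 0 < G \<and> (\<forall>\<rho>\<in>#M. absC (\<rho> - t0) < r \<and> F n \<rho> = 0)
      \<and> (\<forall>t. absC (t - t0) < r \<longrightarrow> absC (F n t) = G * (\<Prod>\<rho>\<in>#M. absC (t - \<rho>)))
      \<and> absC (F n t1) \<le> G * r ^ size M"
  proof
    fix n assume "n \<in> {n0..}"
    then have "0 < absC (F n t1)" using F1[of n] less absC_nonneg[of "L t0"] by (simp del: absC_nonneg absC_pos_iff)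
    then have "F n t1 \<noteq> 0" by auto
    from ratfun_factor[OF X rat t this r_def r]
    show "\<exists>M G. 0 < G \<and> (\<forall>\<rho>\<in>#M. absC (\<rho> - t0) < r \<and> F n \<rho> = 0)
      \<and> (\<forall>t. absC (t - t0) < r \<longrightarrow> absC (F n t) = G * (\<Prod>\<rho>\<in>#M. absC (t - \<rho>)))
      \<and> absC (F n t1) \<le> G * r ^ size M" by blast
  qed
  then obtain M G where MG: "\<forall>n\<in>{n0..}. 0 < G n \<and> (\<forall>\<rho>\<in>#M n. absC (\<rho> - t0) < r \<and> F n \<rho> = 0)
      \<and> (\<forall>t. absC (t - t0) < r \<longrightarrow> absC (F n t) = G n * (\<Prod>\<rho>\<in>#M n. absC (t - \<rho>)))
      \<and> absC (F n t1) \<le> G n * r ^ size (M n)"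
    unfolding bchoice_iff by blast
  have G: "0 < G n" and Mr: "\<And>\<rho>. \<rho> \<in># M n \<Longrightarrow> absC (\<rho> - t0) < r" and M0: "\<And>\<rho>. \<rho> \<in># M n \<Longrightarrow> F n \<rho> = 0"
    and FM: "\<And>t. absC (t - t0) < r \<Longrightarrow> absC (F n t) = G n * (\<Prod>\<rho>\<in>#M n. absC (t - \<rho>))"
    and Ft1: "absC (F n t1) \<le> G n * r ^ size (M n)" if "n0 \<le> n" for n
    using bspec[OF MG, of n] that by auto
  \<comment> \<open>Without zeros in the disc, \<open>Ft1\<close> would bound the value at
    \<open>t1\<close> by the value at \<open>t0\<close>.\<close>
  have ne: "M n \<noteq> {#}" if "n0 \<le> n" for n
  proof
    assume "M n = {#}"
    then have "absC (F n t1) \<le> absC (F n t0)" using Ft1[OF that] FM[OF that, of t0] r by simp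
    then show False using F0[OF that] F1[OF that] less by (simp add: \<delta>0_def)
  qed
  \<comment> \<open>The zeros of the first function reach up to \<delta>; the annulus between
    \<delta> and r will turn out to be free of zeros of all later ones.\<close>
  define \<delta> where "\<delta> = Max ((\<lambda>\<rho>. absC (\<rho> - t0)) ` set_mset (M n0))"
  have \<delta>: "\<And>\<rho>. \<rho> \<in># M n0 \<Longrightarrow> absC (\<rho> - t0) \<le> \<delta>" "\<delta> < r" "0 \<le> \<delta>"
  proof -
    have fin: "finite ((\<lambda>\<rho>. absC (\<rho> - t0)) ` set_mset (M n0))" "(\<lambda>\<rho>. absC (\<rho> - t0)) ` set_mset (M n0) \<noteq> {}"
      using ne[of n0] by auto
    show "\<And>\<rho>. \<rho> \<in># M n0 \<Longrightarrow> absC (\<rho> - t0) \<le> \<delta>" using fin by (simp add: \<delta>_def)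
    have "\<delta> \<in> (\<lambda>\<rho>. absC (\<rho> - t0)) ` set_mset (M n0)" unfolding \<delta>_def using fin by (rule Max_in)
    then show "\<delta> < r" "0 \<le> \<delta>" using Mr[of n0] by auto
  qed
  define k where "k = size (M n0)"
  \<comment> \<open>On the annulus \<open>F n0\<close> is at least as large as its value at
    \<open>t0\<close>, which has size \<delta>0, while \<open>F n\<close> and \<open>F n0\<close>
    differ by less than \<delta>0.\<close>
  have annulus: "absC (F n t) = G n0 * absC (t - t0) ^ k \<and> 0 < absC (F n t)"
    if tr: "\<delta> < absC (t - t0)" "absC (t - t0) < r" and n: "n0 \<le> n" for t n
  proof -
    have "(\<Prod>\<rho>\<in>#M n0. absC (t - \<rho>)) = absC (t - t0) ^ k"
      unfolding k_def
    proof (rule prod_mset_const_real)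
      fix x assume "x \<in># M n0"
      then have "absC (t0 - x) < absC (t - t0)" using \<delta>(1)[of x] tr absC_minus_commute[of t0 x] by linarith
      then show "absC (t - x) = absC (t - t0)" using absC_add_eq[of "t0 - x" "t - t0"] by simp
    qed
    then have eq: "absC (F n0 t) = G n0 * absC (t - t0) ^ k" using FM[of n0 t] tr by simp
    have "\<delta>0 = G n0 * (\<Prod>\<rho>\<in>#M n0. absC (t0 - \<rho>))" using F0[of n0] FM[of n0 t0] r by simp
    also have "\<dots> \<le> G n0 * (\<Prod>\<rho>\<in>#M n0. absC (t - t0))"
    proof (intro mult_left_mono conjunct2[OF prod_mset_mono_real] conjI)
      fix x assume "x \<in># M n0"
      then have "absC (x - t0) \<le> \<delta>" by (rule \<delta>(1))
      then show "absC (t0 - x) \<le> absC (t - t0)" using tr by (simp add: absC_minus_commute)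
    qed (use G[of n0] in auto)
    also have "\<dots> = absC (F n0 t)" using eq by (simp add: k_def)
    finally have ge: "\<delta>0 \<le> absC (F n0 t)" .
    have "t \<in> X" using D tr by blast
    then have "absC (F n t - L t) < \<delta>0" "absC (F n0 t - L t) < \<delta>0" using n0 n by auto
    then have "absC ((F n t - L t) - (F n0 t - L t)) < \<delta>0" by (rule absC_diff_less)
    then have "absC (F n t) = absC (F n0 t)" using ge by (intro absC_near) simp
    then show ?thesis using eq ge \<delta>0 by simp
  qed
  have M\<delta>: "absC (\<rho> - t0) \<le> \<delta>" if "n0 \<le> n" "\<rho> \<in># M n" for n \<rho>
  proof (rule ccontr)
    assume "\<not> absC (\<rho> - t0) \<le> \<delta>"
    then have "0 < absC (F n \<rho>)"
      by (intro conjunct2[OF annulus] Mr[OF that] that) simp_all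
    then show False using M0[OF that] by simp
  qed
  \<comment> \<open>The square root leaves room for two circles: r / |y| and r / |y|^2 both lie
    strictly between \<delta> and r. The maximum with r / 2 avoids a division by \<delta> =
    0.\<close>
  define c where "c = sqrt (r / max \<delta> (r / 2))"
  have "1 < r / max \<delta> (r / 2)" using \<delta> r by (subst pos_less_divide_eq) (auto simp: less_max_iff_disj)
  then have "1 < c" unfolding c_def by simp
  then obtain y :: 'c where y: "1 < absC y" "absC y < c" using small_values by blast
  have yy: "absC y * absC y * max \<delta> (r / 2) < r"
  proof -
    have "absC y * absC y < c * c" using y by (intro mult_strict_mono) auto
    also have "c * c = r / max \<delta> (r / 2)"
      unfolding c_def using \<delta> r by (subst real_sqrt_mult_self) (simp add: less_max_iff_disj abs_of_pos)
    finally show ?thesis using r by (subst (asm) pos_less_divide_eq) (auto simp: less_max_iff_disj)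
  qed
  define s where "s = t0 + (t1 - t0) / (y * y)"
  define s' where "s' = t0 + (t1 - t0) / y"
  have s: "absC (s - t0) = r / (absC y * absC y)" and s': "absC (s' - t0) = r / absC y"
    by (simp_all add: s_def s'_def r_def abs_mult)
  have ypos: "0 < absC y" using y by linarith
  have \<sigma>: "\<delta> < absC (s - t0)"
  proof -
    have "absC y * absC y * \<delta> \<le> absC y * absC y * max \<delta> (r / 2)" by (intro mult_left_mono) auto
    then have "absC y * absC y * \<delta> < r" using yy by linarith
    then show ?thesis unfolding s using ypos by (simp add: pos_less_divide_eq mult.commute)
  qed
  have \<sigma>': "absC (s' - t0) = absC y * absC (s - t0)"
    unfolding s s' using ypos by simp
  have \<sigma>'r: "absC (s' - t0) < r" unfolding s' using y r by (simp add: divide_less_eq)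
  have \<sigma>\<sigma>': "absC (s - t0) < absC (s' - t0)" 
    unfolding \<sigma>' using mult_strict_right_mono[OF y(1), of "absC (s - t0)"] \<sigma> \<delta>(3) by linarith
  \<comment> \<open>On the annulus |F n| is a constant times a power of the distance from
    \<open>t0\<close>; two radii of ratio |y| > 1 determine the exponent and then the
    constant.\<close>
  have kG: "size (M n) = k \<and> G n = G n0" if n: "n0 \<le> n" for n
  proof -
    have val: "absC (F n t) = G n * absC (t - t0) ^ size (M n)" if tr: "\<delta> < absC (t - t0)" "absC (t - t0) < r" for t
    proof -
      have "(\<Prod>\<rho>\<in>#M n. absC (t - \<rho>)) = absC (t - t0) ^ size (M n)"
      proof (rule prod_mset_const_real)
        fix x assume "x \<in># M n"
        then have "absC (t0 - x) < absC (t - t0)" using M\<delta>[OF n, of x] tr absC_minus_commute[of t0 x] by linarith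
        then show "absC (t - x) = absC (t - t0)" using absC_add_eq[of "t0 - x" "t - t0"] by simp
      qed
      then show ?thesis using FM[OF n tr(2)] by simp
    qed
    let ?a = "absC (s - t0)"
    have a: "0 < ?a" using \<sigma> \<delta>(3) by linarith
    have 1: "G n * ?a ^ size (M n) = G n0 * ?a ^ k"
      using val[of s] annulus[OF _ _ n, of s] \<sigma> \<sigma>\<sigma>' \<sigma>'r by simp
    have "G n * (absC y * ?a) ^ size (M n) = G n0 * (absC y * ?a) ^ k"
      using val[of s'] annulus[OF _ _ n, of s'] \<sigma> \<sigma>\<sigma>' \<sigma>'r by (simp add: \<sigma>')
    then have "absC y ^ size (M n) * (G n * ?a ^ size (M n)) = absC y ^ k * (G n0 * ?a ^ k)"
      by (simp add: power_mult_distrib mult.left_commute)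
    then have "absC y ^ size (M n) = absC y ^ k"
      unfolding 1 using G[of n0] a by simp
    then have "size (M n) = k" using power_inject_exp[OF y(1)] by simp
    then show ?thesis using 1 a by simp
  qed
  define g where "g = G n0"
  have g: "0 < g" using G[of n0] by (simp add: g_def)
  have near_zero: "\<exists>\<rho>\<in>#M n. absC (t - \<rho>) < d" if "n0 \<le> n" "absC (t - t0) < r" "absC (F n t) < g * d ^ k" "0 < d" for n t d
  proof (rule ccontr)
    assume "\<not> (\<exists>\<rho>\<in>#M n. absC (t - \<rho>) < d)"
    then have "(\<Prod>\<rho>\<in>#M n. d) \<le> (\<Prod>\<rho>\<in>#M n. absC (t - \<rho>))"
      using that(4) by (intro conjunct2[OF prod_mset_mono_real]) auto
    then have "d ^ k \<le> (\<Prod>\<rho>\<in>#M n. absC (t - \<rho>))" using kG[OF that(1)] by simp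
    then have "g * d ^ k \<le> absC (F n t)"
      unfolding FM[OF that(1,2)] using kG[OF that(1)] g by (simp add: g_def)
    then show False using that(3) by simp
  qed
  have upper: "absC (F n t) \<le> g * absC (t - \<rho>) * r ^ (k - 1)" if n: "n0 \<le> n" and t: "absC (t - t0) < r" and \<rho>: "\<rho> \<in># M n" for n t \<rho>
  proof -
    obtain M' where M': "M n = add_mset \<rho> M'" using \<rho> by (metis multi_member_split)
    have "(\<Prod>x\<in>#M'. absC (t - x)) \<le> (\<Prod>x\<in>#M'. r)"
    proof (rule conjunct2[OF prod_mset_mono_real], intro conjI)
      fix x assume "x \<in># M'"
      then have "absC (x - t0) < r" using Mr[OF n, of x] by (simp add: M')
      then show "absC (t - x) \<le> r" using absC_diff_less[OF t, of "x - t0"] by simp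
    qed simp
    moreover have "size M' = k - 1" using kG[OF n] by (auto simp: M')
    ultimately have "(\<Prod>x\<in>#M'. absC (t - x)) \<le> r ^ (k - 1)" by simp
    then have "g * absC (t - \<rho>) * (\<Prod>x\<in>#M'. absC (t - x)) \<le> g * absC (t - \<rho>) * r ^ (k - 1)"
      using g by (intro mult_left_mono) simp_all
    then show ?thesis unfolding FM[OF n t] using kG[OF n] by (simp add: M' g_def mult.assoc)
  qed
  define d where "d j = (1 / 2 :: real) ^ j" for j :: nat
  have d: "0 < d j" for j by (simp add: d_def)
  have "\<forall>j. \<exists>N. \<forall>n\<ge>N. \<forall>t\<in>X. absC (F n t - L t) < g * d j ^ k"
    using uconvD[OF conv] g d by simp
  then obtain N where N: "\<And>j n t. N j \<le> n \<Longrightarrow> t \<in> X \<Longrightarrow> absC (F n t - L t) < g * d j ^ k" by metis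
  \<comment> \<open>The sum makes \<open>m j\<close> at least every \<open>N i\<close> with i at
    most j, so that both \<open>F (m j)\<close> and \<open>F (m (Suc j))\<close> are within the j-th
    tolerance of \<open>L\<close>.\<close>
  define m where "m j = n0 + (\<Sum>i\<le>j. N i)" for j
  have m0: "n0 \<le> m j" for j by (simp add: m_def)
  have mN: "N i \<le> m j" if "i \<le> j" for i j
    using member_le_sum[of i "{..j}" N] that by (simp add: m_def)
  have "\<exists>\<tau>. \<forall>j. \<tau> j \<in># M (m j) \<and> absC (\<tau> j - \<tau> (Suc j)) < d j"
  proof (rule dependent_nat_choice)
    show "\<exists>x. x \<in># M (m 0)" using ne[OF m0, of 0] by auto
  next
    fix x j assume x: "x \<in># M (m j)"
    then have xr: "absC (x - t0) < r" using Mr[OF m0] by blast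
    then have xX: "x \<in> X" by (rule D)
    have "absC ((F (m (Suc j)) x - L x) - (F (m j) x - L x)) < g * d j ^ k"
      by (rule absC_diff_less; rule N; (rule mN | rule xX); simp)
    then have "absC (F (m (Suc j)) x) < g * d j ^ k" using M0[OF m0 x] by simp
    from near_zero[OF m0 xr this d] show "\<exists>y. y \<in># M (m (Suc j)) \<and> absC (x - y) < d j" by blast
  qed
  then obtain \<tau> where \<tau>: "\<And>j. \<tau> j \<in># M (m j)" "\<And>j. absC (\<tau> j - \<tau> (Suc j)) < d j" by blast
  have dmono: "d j \<le> d i" if "i \<le> j" for i j unfolding d_def using that by (intro power_decreasing) auto
  have close: "absC (\<tau> i - \<tau> (i + l)) < d i" for i l
  proof (induction l)
    case (Suc l)
    have "absC (\<tau> (i + l) - \<tau> (Suc (i + l))) < d i" using \<tau>(2)[of "i + l"] dmono[of i "i + l"] by simp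
    from absC_add_less[OF Suc this] show ?case by simp
  qed (simp add: d)
  have darch: "\<exists>j. d j < e" if "0 < e" for e
    unfolding d_def using real_arch_pow_inv[OF that] by simp
  have "Cauchy \<tau>"
  proof (rule metric_CauchyI)
    fix e :: real assume "0 < e"
    then obtain j where j: "d j < e" using darch by blast
    show "\<exists>J. \<forall>m\<ge>J. \<forall>n\<ge>J. dist (\<tau> m) (\<tau> n) < e"
    proof (intro exI[of _ j] allI impI)
      fix m n assume "j \<le> m" "j \<le> n"
      then have "absC (\<tau> j - \<tau> m) < d j" "absC (\<tau> j - \<tau> n) < d j"
        using close[of j "m - j"] close[of j "n - j"] by simp_all
      from absC_diff_less[OF this(2,1)] show "dist (\<tau> m) (\<tau> n) < e" using j by (simp add: dist_eq_abs)
    qed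
  qed
  then obtain t where "\<tau> \<longlonglongrightarrow> t" using Cauchy_convergent convergent_def by blast
  then have lim: "\<exists>J. \<forall>j\<ge>J. absC (t - \<tau> j) < e" if "0 < e" for e
    using that by (force simp: lim_sequentially dist_eq_abs absC_minus_commute)
  have tr: "absC (t - t0) < r"
  proof -
    obtain J where "absC (t - \<tau> J) < r" using lim[OF r] by blast
    then show ?thesis using Mr[OF m0 \<tau>(1)[of J]] absC_add_less[of "t - \<tau> J" r "\<tau> J - t0"] by simp
  qed
  have tX: "t \<in> X" using D[OF tr] .
  \<comment> \<open>Otherwise \<open>F (m j) t\<close> would have the absolute value of
    \<open>L t\<close> for large j, although its factor at the zero \<tau> j tends to 0 and the k -
    1 other factors are at most r.\<close>
  have "L t = 0"
  proof (rule ccontr)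
    assume "L t \<noteq> 0"
    then have e: "0 < absC (L t)" by simp
    have "0 < absC (L t) / (g * r ^ (k - 1) + 1)" using e g r by (intro divide_pos_pos) (auto intro: add_nonneg_pos)
    then obtain J where J: "\<forall>j\<ge>J. absC (t - \<tau> j) < absC (L t) / (g * r ^ (k - 1) + 1)" using lim by blast
    obtain J' where J': "d J' < absC (L t) / g" using darch e g by (meson divide_pos_pos)
    define j where "j = max J J'"
    have "0 < k" using ne[of n0] by (simp add: k_def nonempty_has_size[symmetric])
    have "d j ^ k \<le> d j"
      using power_decreasing[of 1 k "d j"] \<open>0 < k\<close> d[of j] dmono[of 0 j] by (simp add: d_def)
    have "d j \<le> d J'" by (rule dmono) (simp add: j_def)
    have "g * d j ^ k < absC (L t)"
    proof -
      have "g * d j ^ k \<le> g * d J'" using \<open>d j ^ k \<le> d j\<close> \<open>d j \<le> d J'\<close> g by (intro mult_left_mono) auto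
      also have "\<dots> < absC (L t)" using J' g by (simp add: pos_less_divide_eq mult.commute)
      finally show ?thesis .
    qed
    then have "absC (F (m j) t - L t) < absC (L t)" using N[OF mN[OF order_refl] tX, of j] by linarith
    then have "absC (F (m j) t) = absC (L t)" by (rule absC_near)
    moreover have "absC (F (m j) t) \<le> g * absC (t - \<tau> j) * r ^ (k - 1)"
      by (rule upper[OF m0 tr \<tau>(1)])
    moreover have "g * absC (t - \<tau> j) * r ^ (k - 1) < absC (L t)"
    proof -
      have gr: "0 \<le> g * r ^ (k - 1)" using g r by simp
      have "absC (t - \<tau> j) < absC (L t) / (g * r ^ (k - 1) + 1)" using J by (simp add: j_def)
      then have "absC (t - \<tau> j) * (g * r ^ (k - 1) + 1) < absC (L t)" using gr by (simp add: pos_less_divide_eq)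
      moreover have "g * absC (t - \<tau> j) * r ^ (k - 1) = absC (t - \<tau> j) * (g * r ^ (k - 1))" by simp
      ultimately show ?thesis using absC_nonneg[of "t - \<tau> j"] unfolding distrib_left mult_1_right by linarith
    qed
    ultimately show False by linarith
  qed
  then show ?thesis using tX by blast
qed (use t in blast)

end

section \<open>Norms on a finite-dimensional space\<close>

context C_infty
begin

text \<open>Definiteness is left out so that the notion covers \<open>absC (ev \<omega> v)\<close>
  for every \<omega>, in particular before an isometry is known.\<close>

definition seminorm :: "('f fls ^ 'r::finite \<Rightarrow> real) \<Rightarrow> bool" where
  "seminorm N \<longleftrightarrow> (\<forall>c v. N (c *s v) = absK c * N v) \<and> (\<forall>v w. N (v + w) \<le> max (N v) (N w))"

lemma seminorm_ev: "seminorm (\<lambda>v. absC (ev \<omega> v))"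
  by (simp add: seminorm_def ev_scale ev_add abs_mult embed_abs abs_add)

lemma na_norm_seminorm: "na_norm \<nu> \<Longrightarrow> seminorm \<nu>"
  by (simp add: seminorm_def na_norm_def)

lemma seminorm_scale: "seminorm N \<Longrightarrow> N (c *s v) = absK c * N v"
  by (simp add: seminorm_def)

lemma seminorm_const: "seminorm N \<Longrightarrow> N (fls_const c *s v) = (if c = 0 then 0 else N v)"
  by (simp add: seminorm_scale)

lemma seminorm_0 [simp]: "seminorm N \<Longrightarrow> N 0 = 0"
  using seminorm_scale[of N 0 0] by simp

lemma seminorm_uminus: "seminorm N \<Longrightarrow> N (- v) = N v"
proof -
  assume "seminorm N"
  moreover have "(- 1) *s v = - v" by (simp add: vec_eq_iff)
  ultimately show ?thesis using seminorm_scale[of N "- 1" v] by simp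
qed

lemma seminorm_add: "seminorm N \<Longrightarrow> N (v + w) \<le> max (N v) (N w)"
  by (simp add: seminorm_def)

lemma seminorm_diff: "seminorm N \<Longrightarrow> N (v - w) \<le> max (N v) (N w)"
  using seminorm_add[of N v "- w"] seminorm_uminus[of N w] by simp

lemma seminorm_commute: "seminorm N \<Longrightarrow> N (v - w) = N (w - v)"
  using seminorm_uminus[of N "v - w"] by simp

lemma seminorm_nonneg: "seminorm N \<Longrightarrow> 0 \<le> N v"
  using seminorm_diff[of N v v] seminorm_0[of N] by simp

lemma seminorm_near: "seminorm N \<Longrightarrow> N (v - w) < N w \<Longrightarrow> N v = N w"
  using seminorm_add[of N "v - w" w] seminorm_diff[of N v "v - w"] by (simp add: max_def split: if_splits)

lemma seminorm_add_eq_max: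
  assumes "seminorm N" "N v \<le> N (v + w)"
  shows "N (v + w) = max (N v) (N w)"
proof (cases "N w \<le> N v")
  case True
  then show ?thesis using seminorm_add[OF assms(1), of v w] assms(2) by simp
next
  case False
  then show ?thesis using seminorm_near[OF assms(1), of "v + w" w] by simp
qed

lemma seminorm_sum_le:
  assumes "seminorm N" "\<And>i. i \<in> S \<Longrightarrow> N (f i) \<le> e" "0 \<le> e"
  shows "N (\<Sum>i\<in>S. f i) \<le> e"
  using assms(2)
proof (induction S rule: infinite_finite_induct)
  case (insert i S)
  then have "N (f i) \<le> e" "N (\<Sum>i\<in>S. f i) \<le> e" by auto
  then show ?case using insert.hyps seminorm_add[OF assms(1), of "f i" "\<Sum>i\<in>S. f i"] by simp
qed (use assms in auto)

lemma seminorm_sum_less: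
  assumes "seminorm N" "\<And>i. i \<in> S \<Longrightarrow> N (f i) < e" "0 < e"
  shows "N (\<Sum>i\<in>S. f i) < e"
  using assms(2)
proof (induction S rule: infinite_finite_induct)
  case (insert i S)
  then have "N (f i) < e" "N (\<Sum>i\<in>S. f i) < e" by auto
  then show ?case using insert.hyps seminorm_add[OF assms(1), of "f i" "\<Sum>i\<in>S. f i"] by simp
qed (use assms in auto)

text \<open>The constant is carried along because it becomes the common \<kappa> of
  \<open>good\<close> for all isometric \<omega>.\<close>

definition norm_geq :: "real \<Rightarrow> ('f fls ^ 'r::finite \<Rightarrow> real) \<Rightarrow> bool" where
  "norm_geq \<kappa> \<nu> \<longleftrightarrow> na_norm \<nu> \<and> 0 < \<kappa> \<and> (\<forall>v i. \<kappa> * absK (v $ i) \<le> \<nu> v)"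

lemma norm_geq_seminorm: "norm_geq \<kappa> \<nu> \<Longrightarrow> seminorm \<nu>"
  by (simp add: norm_geq_def na_norm_seminorm)

lemma norm_geq_eq_0: "norm_geq \<kappa> \<nu> \<Longrightarrow> \<nu> v = 0 \<longleftrightarrow> v = 0"
  by (simp add: norm_geq_def na_norm_def)

lemma norm_geq_pos: "norm_geq \<kappa> \<nu> \<Longrightarrow> 0 < \<nu> v \<longleftrightarrow> v \<noteq> 0"
  using norm_geq_eq_0[of \<kappa> \<nu> v] seminorm_nonneg[OF norm_geq_seminorm, of \<kappa> \<nu> v] by linarith

definition iso :: "('f fls ^ 'r::finite \<Rightarrow> real) \<Rightarrow> 'c ^ 'r \<Rightarrow> bool" where
  "iso \<nu> \<omega> \<longleftrightarrow> (\<forall>v. absC (ev \<omega> v) = \<nu> v)"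

lemma iso_good: "norm_geq \<kappa> \<nu> \<Longrightarrow> iso \<nu> \<omega> \<Longrightarrow> good \<kappa> \<omega>"
  by (simp add: norm_geq_def iso_def good_def)

lemma seminorm_upper:
  fixes N :: "'f fls ^ 'r::finite \<Rightarrow> real"
  assumes "seminorm N"
  shows "\<exists>C>0. \<forall>v s. (\<forall>i. absK (v $ i) \<le> s) \<longrightarrow> N v \<le> C * s"
proof -
  let ?C = "(\<Sum>i\<in>UNIV. N (axis i 1)) + 1"
  have nn: "0 \<le> N w" for w using seminorm_nonneg[OF assms] .
  show ?thesis
  proof (intro exI[of _ ?C] conjI allI impI)
    show "0 < ?C" using nn by (intro add_nonneg_pos sum_nonneg) auto
  next
    fix v :: "'f fls ^ 'r" and s assume s: "\<forall>i. absK (v $ i) \<le> s"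
    have s0: "0 \<le> s" using s absK_nonneg order_trans by blast
    have "N (\<Sum>i\<in>UNIV. (v $ i) *s axis i 1) \<le> ?C * s"
    proof (rule seminorm_sum_le[OF assms])
      fix i
      have "N (axis i 1) \<le> (\<Sum>i\<in>UNIV. N (axis i 1))" using nn by (intro member_le_sum) auto
      then have "absK (v $ i) * N (axis i 1) \<le> s * ?C"
        using s nn s0 by (intro mult_mono) auto
      then show "N ((v $ i) *s axis i 1) \<le> ?C * s"
        by (simp add: seminorm_scale[OF assms] mult.commute)
    qed (use nn s0 in \<open>auto intro!: mult_nonneg_nonneg add_nonneg_nonneg sum_nonneg\<close>)
    then show "N v \<le> ?C * s" by (simp add: basis_expansion)
  qed
qed

text \<open>Compactness of balls in finite form: coordinates are rounded to polynomials divided by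
  T^M. \<open>N\<close> bounds the coordinates, \<open>M\<close> the rounding error.\<close>

lemma finite_mod_ball:
  fixes \<nu> :: "'f fls ^ 'r::finite \<Rightarrow> real"
  assumes "norm_geq \<kappa> \<nu>" "0 < \<alpha>"
  shows "\<exists>S. finite S \<and> (\<forall>v. \<nu> v \<le> \<beta> \<longrightarrow> (\<exists>s\<in>S. \<nu> (v - s) < \<alpha>))"
proof -
  have k: "0 < \<kappa>" using assms by (simp add: norm_geq_def)
  obtain C where C: "0 < C" "\<And>v s. (\<forall>i. absK (v $ i) \<le> s) \<Longrightarrow> \<nu> v \<le> C * s"
    using seminorm_upper[OF norm_geq_seminorm[OF assms(1)]] by blast
  obtain M where M: "C < \<alpha> * real CARD('f) ^ M" using large_radius[OF assms(2)] by blast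
  obtain N where N: "\<beta> < \<kappa> * real CARD('f) ^ N" using large_radius[OF k] by blast
  define g where "g p = A_to_K p / T ^ M" for p :: "'f poly"
  let ?S = "{b :: 'f fls ^ 'r. \<forall>i. b $ i \<in> g ` polys_below (M + N)}"
  have qM: "0 < real CARD('f) ^ M" by simp
  have approx: "\<exists>y\<in>g ` polys_below (M + N). absK (x - y) \<le> 1 / real CARD('f) ^ M" if x: "absK x < real CARD('f) ^ N" for x
  proof -
    obtain p where p: "absK (T ^ M * x - A_to_K p) < 1" using polynomial_part by blast
    have "absK (A_to_K p) < real CARD('f) ^ (M + N)"
    proof -
      have "absK (T ^ M * x) < real CARD('f) ^ (M + N)"
        using x by (simp add: absK_mult power_add)
      moreover have "absK (T ^ M * x - A_to_K p) < real CARD('f) ^ (M + N)"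
        using p one_le_power[of "real CARD('f)" "M + N"] q_real_gt_1 by linarith
      ultimately have "absK (T ^ M * x - (T ^ M * x - A_to_K p)) < real CARD('f) ^ (M + N)"
        by (rule absK_diff_less)
      then show ?thesis by simp
    qed
    then have "p \<in> polys_below (M + N)" by (simp add: absK_A_to_K_less_iff polys_below_def)
    moreover have "x - g p = (T ^ M * x - A_to_K p) / T ^ M"
      unfolding g_def diff_divide_distrib by (subst nonzero_mult_div_cancel_left) (rule fls_X_inv_pow_nonzero, rule refl)
    then have "absK (x - g p) = absK (T ^ M * x - A_to_K p) / real CARD('f) ^ M"
      by (simp only: absK_divide absK_power absK_X_inv)
    then have "absK (x - g p) \<le> 1 / real CARD('f) ^ M" using p by (simp add: divide_right_mono)
    ultimately show ?thesis by blast
  qed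
  show ?thesis
  proof (intro exI[of _ ?S] conjI allI impI)
    show "finite ?S" using card_vec[of "g ` polys_below (M + N)"] card_polys_below[of "M + N"] by blast
  next
    fix v assume v: "\<nu> v \<le> \<beta>"
    have "absK (v $ i) < real CARD('f) ^ N" for i
    proof -
      have "\<kappa> * absK (v $ i) \<le> \<nu> v" using assms by (simp add: norm_geq_def)
      then have "\<kappa> * absK (v $ i) < \<kappa> * real CARD('f) ^ N" using v N by linarith
      then show ?thesis using k by simp
    qed
    then have "\<forall>i. \<exists>y. y \<in> g ` polys_below (M + N) \<and> absK (v $ i - y) \<le> 1 / real CARD('f) ^ M"
      using approx by blast
    then obtain y where y: "\<And>i. y i \<in> g ` polys_below (M + N)" "\<And>i. absK (v $ i - y i) \<le> 1 / real CARD('f) ^ M"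
      by metis
    have "\<nu> (v - (\<chi> i. y i)) \<le> C * (1 / real CARD('f) ^ M)" using y by (intro C(2)) simp
    also have "\<dots> < \<alpha>" using M qM by (simp add: pos_divide_less_eq)
    finally show "\<exists>s\<in>?S. \<nu> (v - s) < \<alpha>" using y by (intro bexI[of _ "\<chi> i. y i"]) auto
  qed
qed

section \<open>Linear functionals and orthogonal vectors\<close>

definition dotp :: "'f fls ^ 'r::finite \<Rightarrow> 'f fls ^ 'r \<Rightarrow> 'f fls" where
  "dotp p u = (\<Sum>i\<in>UNIV. p $ i * u $ i)"

lemma dotp_diff: "dotp p (u - w) = dotp p u - dotp p w"
  by (simp add: dotp_def right_diff_distrib sum_subtractf)

lemma dual_vector:
  fixes v :: "'f fls ^ 'r::finite"
  assumes "vec.subspace W" "v \<notin> W"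
  shows "\<exists>p. (\<forall>w\<in>W. dotp p w = 0) \<and> dotp p v = 1"
proof -
  obtain B where B: "B \<subseteq> W" "vec.independent B" "W \<subseteq> vec.span B" using vec.basis_exists by metis
  then have "vec.span B = W" using assms(1) vec.span_minimal[of B W] by blast
  then have v: "v \<notin> vec.span B" using assms by simp
  then have "vec.independent (insert v B)" using B(2) by (simp add: vec.independent_insertI)
  \<comment> \<open>The functional will be one row of an endomorphism that kills \<open>W\<close>
    and sends \<open>v\<close> to a unit vector; the index \<open>undefined\<close> is
    arbitrary.\<close>
  then obtain g where g: "Vector_Spaces.linear (*s) (*s) g"
    "\<forall>x\<in>insert v B. g x = (if x = v then axis undefined 1 else (0 :: 'f fls ^ 'r))"
    using vec.linear_independent_extend[of "insert v B" "\<lambda>x. if x = v then axis undefined 1 else (0 :: 'f fls ^ 'r)"]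
    by blast
  have "v \<notin> B" using v vec.span_base by blast
  have "g w = 0" if "w \<in> W" for w
  proof (rule vec.linear_eq_0_on_span[OF g(1)])
    show "g x = 0" if "x \<in> B" for x
      using g(2) that \<open>v \<notin> B\<close> by auto
    show "w \<in> vec.span B" using that \<open>vec.span B = W\<close> by simp
  qed
  moreover have "g v = axis undefined 1" using g(2) by simp
  moreover have "dotp (matrix g $ undefined) u = g u $ undefined" for u
    by (simp add: matrix_works[OF g(1), symmetric] matrix_vector_mult_def dotp_def)
  ultimately show ?thesis
    by (intro exI[of _ "matrix g $ undefined"]) (simp add: axis_def)
qed

lemma dotp_bound:
  fixes \<nu> :: "'f fls ^ 'r::finite \<Rightarrow> real"
  assumes "norm_geq \<kappa> \<nu>"
  shows "\<exists>P>0. \<forall>u. absK (dotp p u) \<le> P * \<nu> u"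
proof -
  let ?P = "((\<Sum>i\<in>UNIV. absK (p $ i)) + 1) / \<kappa>"
  have k: "0 < \<kappa>" using assms by (simp add: norm_geq_def)
  show ?thesis
  proof (intro exI[of _ ?P] conjI allI)
    show P: "0 < ?P" using k by (intro divide_pos_pos add_nonneg_pos sum_nonneg) auto
    fix u
    have nn: "0 \<le> \<nu> u" using seminorm_nonneg[OF norm_geq_seminorm[OF assms]] .
    show "absK (dotp p u) \<le> ?P * \<nu> u"
      unfolding dotp_def
    proof (rule absK_sum_le)
      fix i
      have "absK (p $ i) \<le> (\<Sum>i\<in>UNIV. absK (p $ i)) + 1"
        using member_le_sum[of i UNIV "\<lambda>i. absK (p $ i)"] by simp
      moreover have "absK (u $ i) \<le> \<nu> u / \<kappa>"
        using assms k by (simp add: norm_geq_def pos_le_divide_eq mult.commute)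
      ultimately have "absK (p $ i) * absK (u $ i) \<le> ((\<Sum>i\<in>UNIV. absK (p $ i)) + 1) * (\<nu> u / \<kappa>)"
        by (intro mult_mono) (auto intro!: add_nonneg_nonneg sum_nonneg)
      then show "absK (p $ i * u $ i) \<le> ?P * \<nu> u" by (simp add: absK_mult)
    next
      show "0 \<le> ?P * \<nu> u" using P nn by (intro mult_nonneg_nonneg) linarith+
    qed
  qed
qed

text \<open>A functional that vanishes on \<open>W\<close> but not at \<open>v0\<close> bounds the
  distances below by 1 / P, and between 1 / P and \<nu> v0 the norm takes only finitely many values.
  So the minimum is attained.\<close>

lemma nearest_point:
  fixes \<nu> :: "'f fls ^ 'r::finite \<Rightarrow> real"
  assumes "norm_geq \<kappa> \<nu>" "vec.subspace W" "v0 \<notin> W"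
  shows "\<exists>w\<in>W. \<forall>w'\<in>W. \<nu> (v0 - w) \<le> \<nu> (v0 - w')"
proof -
  note sn = norm_geq_seminorm[OF assms(1)]
  obtain p where p: "\<forall>w\<in>W. dotp p w = 0" "dotp p v0 = 1" using dual_vector[OF assms(2,3)] by blast
  obtain P where P: "0 < P" "\<forall>u. absK (dotp p u) \<le> P * \<nu> u" using dotp_bound[OF assms(1)] by blast
  have lower: "1 / P \<le> \<nu> (v0 - w)" if "w \<in> W" for w
  proof -
    have "absK (dotp p (v0 - w)) = 1" using p that by (simp add: dotp_diff)
    then have "1 \<le> P * \<nu> (v0 - w)" using P(2) by metis
    then show ?thesis using P(1) by (simp add: pos_divide_le_eq mult.commute)
  qed
  obtain S where S: "finite S" "\<And>v. \<nu> v \<le> \<nu> v0 \<Longrightarrow> \<exists>s\<in>S. \<nu> (v - s) < 1 / P"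
    using finite_mod_ball[OF assms(1), of "1 / P" "\<nu> v0"] P(1) by auto
  let ?Z = "{\<nu> (v0 - w) |w. w \<in> W \<and> \<nu> (v0 - w) \<le> \<nu> v0}"
  have "?Z \<subseteq> \<nu> ` S"
  proof
    fix z assume "z \<in> ?Z"
    then obtain w where w: "w \<in> W" "\<nu> (v0 - w) \<le> \<nu> v0" "z = \<nu> (v0 - w)" by blast
    then obtain s where s: "s \<in> S" "\<nu> (v0 - w - s) < 1 / P" using S by blast
    then have "\<nu> (s - (v0 - w)) < \<nu> (v0 - w)"
      using lower[OF w(1)] seminorm_commute[OF sn, of s "v0 - w"] by linarith
    then have "\<nu> s = \<nu> (v0 - w)" by (rule seminorm_near[OF sn])
    then show "z \<in> \<nu> ` S" using s(1) w(3) by (intro image_eqI[of _ _ s]) simp_all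
  qed
  then have fin: "finite ?Z" using S(1) finite_surj by blast
  have W0: "0 \<in> W" using assms(2) by (simp add: vec.subspace_0)
  then have "\<nu> v0 \<in> ?Z" by (auto intro: exI[of _ 0])
  then have "Min ?Z \<in> ?Z" using fin Min_in by blast
  then obtain w where w: "w \<in> W" "Min ?Z = \<nu> (v0 - w)" "\<nu> (v0 - w) \<le> \<nu> v0" by auto
  show ?thesis
  proof (intro bexI[OF _ w(1)] ballI)
    fix w' assume w': "w' \<in> W"
    show "\<nu> (v0 - w) \<le> \<nu> (v0 - w')"
    proof (cases "\<nu> (v0 - w') \<le> \<nu> v0")
      case True
      then have "\<nu> (v0 - w') \<in> ?Z" using w' by blast
      from Min_le[OF fin this] show ?thesis using w(2) by linarith
    next
      case False
      then show ?thesis using w(3) by linarith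
    qed
  qed
qed

lemma orthogonal_vector:
  fixes \<nu> :: "'f fls ^ 'r::finite \<Rightarrow> real"
  assumes "norm_geq \<kappa> \<nu>" "vec.subspace W" "W \<noteq> UNIV"
  shows "\<exists>v. v \<notin> W \<and> (\<forall>w\<in>W. \<nu> v \<le> \<nu> (v + w))"
proof -
  obtain v0 where v0: "v0 \<notin> W" using assms(3) by auto
  obtain w where w: "w \<in> W" "\<forall>w'\<in>W. \<nu> (v0 - w) \<le> \<nu> (v0 - w')"
    using nearest_point[OF assms(1,2) v0] by blast
  show ?thesis
  proof (intro exI[of _ "v0 - w"] conjI ballI)
    show "v0 - w \<notin> W" using v0 w(1) vec.subspace_add[OF assms(2), of "v0 - w" w] by auto
    fix w' assume "w' \<in> W"
    then have "w - w' \<in> W" using w(1) assms(2) by (simp add: vec.subspace_diff)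
    then show "\<nu> (v0 - w) \<le> \<nu> (v0 - w + w')" using w(2) by (metis diff_diff_eq2 diff_add_eq)
  qed
qed

section \<open>Finite subfields\<close>

definition subfield :: "nat \<Rightarrow> 'c set" where
  "subfield h = {z. z ^ (CARD('f) ^ h) = z}"

lemma frob_add_power: "(x + y :: 'c) ^ (CARD('f) ^ n) = x ^ (CARD('f) ^ n) + y ^ (CARD('f) ^ n)"
  by (induction n arbitrary: x y) (simp_all add: frob_add power_mult)

lemma const_power_qn: "\<iota> (fls_const c) ^ (CARD('f) ^ n) = \<iota> (fls_const c)"
proof -
  have "c ^ (CARD('f) ^ n) = c" for c :: 'f
    by (induction n) (simp_all add: power_mult const_power_q)
  then show ?thesis by (simp add: embed_power[symmetric] fls_const_power[symmetric])
qed

definition fq_poly :: "nat \<Rightarrow> 'c poly" where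
  "fq_poly h = monom 1 (CARD('f) ^ h) - [:0, 1:]"

lemma fq_poly_facts:
  assumes "0 < h"
  shows "degree (fq_poly h) = CARD('f) ^ h" "coeff (fq_poly h) 1 = - 1" "fq_poly h \<noteq> 0"
    "lead_coeff (fq_poly h) = 1"
proof -
  have q: "1 < CARD('f) ^ h" using assms by (intro one_less_power) simp_all
  have d: "degree (monom (1 :: 'c) (CARD('f) ^ h)) = CARD('f) ^ h" by (simp add: degree_monom_eq)
  have "degree (monom 1 (CARD('f) ^ h) + - [:0, 1 :: 'c:]) = degree (monom (1 :: 'c) (CARD('f) ^ h))"
    using q by (intro degree_add_eq_left) (simp add: d)
  then show deg: "degree (fq_poly h) = CARD('f) ^ h" by (simp add: fq_poly_def d del: minus_pCons)
  show "coeff (fq_poly h) 1 = - 1" using q by (simp add: fq_poly_def assms)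
  then show "fq_poly h \<noteq> 0" by auto
  show "lead_coeff (fq_poly h) = 1" unfolding deg using q by (simp add: fq_poly_def coeff_pCons assms split: nat.splits)
qed

lemma fsub_subfield: "0 < h \<Longrightarrow> fsub (subfield h)"
  unfolding fsub_def
proof
  assume h: "0 < h"
  show "F.subspace (subfield h)"
    unfolding F.subspace_def subfield_def
    by (auto simp: frob_add_power F_scale_def power_mult_distrib const_power_qn power_0_left)
  have "subfield h = {z. poly (fq_poly h) z = 0}" by (auto simp: subfield_def fq_poly_def poly_monom)
  then show "finite (subfield h)" using poly_roots_finite[OF fq_poly_facts(3)[OF h]] by simp
qed

text \<open>There is no double root: translation by a root does not change the polynomial, but after
  translation by a double root it would be divisible by X^2, whereas its linear coefficient is
  -1.\<close>

lemma card_subfield: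
  assumes h: "0 < h"
  shows "card (subfield h) = CARD('f) ^ h"
proof -
  let ?p = "fq_poly h"
  obtain A where A: "size A = degree ?p" "?p = smult (lead_coeff ?p) (\<Prod>x\<in>#A. [:- x, 1:])"
    using alg_closed_imp_factorization[OF fq_poly_facts(3)[OF h]] by blast
  then have pA: "?p = (\<Prod>x\<in>#A. [:- x, 1:])" by (simp add: fq_poly_facts(4)[OF h])
  have roots: "subfield h = set_mset A"
  proof -
    have "z \<in> subfield h \<longleftrightarrow> poly ?p z = 0" for z by (auto simp: subfield_def fq_poly_def poly_monom)
    moreover have "poly ?p z = 0 \<longleftrightarrow> z \<in># A" for z
      by (subst pA) (auto simp: poly_prod_mset_linear)
    ultimately show ?thesis by blast
  qed
  have "count A x \<le> 1" for x
  proof (rule ccontr)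
    assume "\<not> count A x \<le> 1"
    then have "x \<in># A" by (simp flip: count_greater_zero_iff)
    then obtain A1 where A1: "A = add_mset x A1" by (rule mset_add)
    then have "x \<in># A1" using \<open>\<not> count A x \<le> 1\<close> by (simp flip: count_greater_zero_iff)
    then obtain A' where "A1 = add_mset x A'" by (rule mset_add)
    with A1 have A': "A = add_mset x (add_mset x A')" by simp
    then have x: "x \<in> subfield h" using roots by simp
    have "?p = ?p \<circ>\<^sub>p [:x, 1:]"
      by (rule poly_ext) (use x in \<open>simp add: fq_poly_def poly_pcompose poly_monom frob_add_power subfield_def algebra_simps\<close>)
    also have "\<dots> = [:0, 1:] * ([:0, 1:] * ((\<Prod>x\<in>#A'. [:- x, 1:]) \<circ>\<^sub>p [:x, 1:]))"
      unfolding pA A' image_mset_add_mset prod_mset.add_mset pcompose_mult by (simp only: pcompose_pCons) simp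
    finally have "coeff ?p 1 = coeff ([:0, 1:] * ([:0, 1:] * ((\<Prod>x\<in>#A'. [:- x, 1:]) \<circ>\<^sub>p [:x, 1:]))) 1" by simp
    then show False by (simp add: fq_poly_facts(2)[OF h, simplified])
  qed
  then have "A = mset_set (set_mset A)"
    by (intro multiset_eqI) (simp add: count_mset_set' le_Suc_eq count_eq_zero_iff)
  then have "size A = card (set_mset A)" by (metis size_mset_set)
  then show ?thesis using roots A fq_poly_facts(1)[OF h] by simp
qed

lemma subfield_abs: "z \<in> subfield h \<Longrightarrow> 0 < h \<Longrightarrow> z \<noteq> 0 \<Longrightarrow> absC z = 1"
proof -
  assume z: "z \<in> subfield h" "0 < h" "z \<noteq> 0"
  have q: "1 < CARD('f) ^ h" using z by (intro one_less_power) simp_all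
  have "absC z ^ (CARD('f) ^ h) = absC z" using z by (simp add: subfield_def flip: absC_power)
  moreover have "CARD('f) ^ h = Suc (CARD('f) ^ h - 1)" using q by simp
  ultimately have "absC z * absC z ^ (CARD('f) ^ h - 1) = absC z" by (metis power_Suc)
  then have "absC z ^ (CARD('f) ^ h - 1) = 1" using z by simp
  then show ?thesis using power_eq_1_iff[of "absC z" "CARD('f) ^ h - 1"] q by auto
qed

lemma subfield_mult: "x \<in> subfield h \<Longrightarrow> y \<in> subfield h \<Longrightarrow> x * y \<in> subfield h"
  by (simp add: subfield_def power_mult_distrib)

lemma subfield_inverse: "x \<in> subfield h \<Longrightarrow> inverse x \<in> subfield h"
  by (simp add: subfield_def power_inverse)

lemma subfield_1: "1 \<in> subfield h"
  by (simp add: subfield_def)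

section \<open>Extension of isometries\<close>

definition iso_on :: "('f fls ^ 'r::finite) set \<Rightarrow> ('f fls ^ 'r \<Rightarrow> real) \<Rightarrow> 'c ^ 'r \<Rightarrow> bool" where
  "iso_on W \<nu> \<omega> \<longleftrightarrow> (\<forall>w\<in>W. absC (ev \<omega> w) = \<nu> w)"

text \<open>The candidates are the multiples of \<open>z0\<close> by units of a finite field. A unit
  is bad if an element of the image of \<open>W\<close> comes too close; different bad units belong
  to different elements of the finite set \<open>S\<close>, so a large field contains a unit that is
  good for both \<omega>.\<close>

lemma generic_value:
  fixes \<nu> :: "'f fls ^ 'r::finite \<Rightarrow> real" and z0 :: 'c
  assumes kn: "norm_geq \<kappa> \<nu>" and W: "vec.subspace W" and v: "v \<notin> W" and val: "absC z0 = \<nu> v"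
    and iso: "iso_on W \<nu> \<omega>0" "iso_on W \<nu> \<omega>1"
  shows "\<exists>z :: 'c. absC z = \<nu> v \<and> (\<forall>w\<in>W. \<nu> v \<le> absC (z + ev \<omega>0 w)) \<and> (\<forall>w\<in>W. \<nu> v \<le> absC (z + ev \<omega>1 w))"
proof -
  note sn = norm_geq_seminorm[OF kn]
  have "v \<noteq> 0" using v vec.subspace_0[OF W] by blast
  then have pos: "0 < \<nu> v" using norm_geq_pos[OF kn] by blast
  then have z0: "z0 \<noteq> 0" using val by auto
  obtain S where S: "finite S" "\<And>u. \<nu> u \<le> \<nu> v \<Longrightarrow> \<exists>s\<in>S. \<nu> (u - s) < \<nu> v"
    using finite_mod_ball[OF kn pos, of "\<nu> v"] by blast
  \<comment> \<open>Room for two sets of bad units and for 0.\<close>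
  obtain h where h: "2 * card S + 2 < CARD('f) ^ h" "0 < h"
  proof -
    obtain h where "real (2 * card S + 2) < real CARD('f) ^ h" using real_arch_pow[OF q_real_gt_1] by blast
    then have "2 * card S + 2 < CARD('f) ^ h" using of_nat_less_iff of_nat_power by metis
    moreover from this have "0 < h" by (cases h) auto
    ultimately show ?thesis using that by blast
  qed
  let ?U = "subfield h - {0}"
  have finU: "finite ?U" "card ?U = CARD('f) ^ h - 1"
    using fsubD(1,2)[OF fsub_subfield[OF h(2)]] card_subfield[OF h(2)] by simp_all
  define bad where "bad \<omega> = {u \<in> ?U. \<exists>w\<in>W. absC (u * z0 + ev \<omega> w) < \<nu> v}" for \<omega> :: "'c ^ 'r"
  have bad: "card (bad \<omega>) \<le> card S" if iso: "iso_on W \<nu> \<omega>" for \<omega>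
  proof -
    have "\<forall>u\<in>bad \<omega>. \<exists>w s. w \<in> W \<and> absC (u * z0 + ev \<omega> w) < \<nu> v \<and> s \<in> S \<and> \<nu> (w - s) < \<nu> v"
    proof
      fix u assume "u \<in> bad \<omega>"
      then obtain w where w: "u \<in> ?U" "w \<in> W" "absC (u * z0 + ev \<omega> w) < \<nu> v" by (auto simp: bad_def)
      have "absC (- (u * z0)) = \<nu> v" using subfield_abs[of u h] w h val by (simp add: abs_mult)
      moreover have "absC (ev \<omega> w - - (u * z0)) < \<nu> v" using w by (simp add: add.commute)
      ultimately have "absC (ev \<omega> w) = \<nu> v" using absC_near by metis
      then have "\<nu> w = \<nu> v" using iso w by (simp add: iso_on_def)
      then show "\<exists>w s. w \<in> W \<and> absC (u * z0 + ev \<omega> w) < \<nu> v \<and> s \<in> S \<and> \<nu> (w - s) < \<nu> v"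
        using S(2)[of w] w by auto
    qed
    then obtain w s where ws: "\<And>u. u \<in> bad \<omega> \<Longrightarrow> w u \<in> W" "\<And>u. u \<in> bad \<omega> \<Longrightarrow> absC (u * z0 + ev \<omega> (w u)) < \<nu> v"
      "\<And>u. u \<in> bad \<omega> \<Longrightarrow> s u \<in> S" "\<And>u. u \<in> bad \<omega> \<Longrightarrow> \<nu> (w u - s u) < \<nu> v"
      by metis
    \<comment> \<open>Two bad units of the same class would make their difference times
      \<open>z0\<close> shorter than \<nu> v, although distinct elements of a finite field differ by
      a unit.\<close>
    have "inj_on s (bad \<omega>)"
    proof (rule inj_onI, rule ccontr)
      fix x y assume xy: "x \<in> bad \<omega>" "y \<in> bad \<omega>" "s x = s y" "x \<noteq> y"
      have "\<nu> ((w x - s x) - (w y - s y)) < \<nu> v"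
        using seminorm_diff[OF sn, of "w x - s x" "w y - s y"] ws(4)[OF xy(1)] ws(4)[OF xy(2)] by linarith
      then have "\<nu> (w x - w y) < \<nu> v" using xy by simp
      moreover have "w x - w y \<in> W" using ws(1) xy W by (simp add: vec.subspace_diff)
      ultimately have "absC (ev \<omega> (w x - w y)) < \<nu> v" using iso by (simp add: iso_on_def)
      moreover have "absC ((x * z0 + ev \<omega> (w x)) - (y * z0 + ev \<omega> (w y))) < \<nu> v"
        using ws(2)[OF xy(1)] ws(2)[OF xy(2)] by (rule absC_diff_less)
      ultimately have "absC (((x * z0 + ev \<omega> (w x)) - (y * z0 + ev \<omega> (w y))) - ev \<omega> (w x - w y)) < \<nu> v"
        using absC_diff_less by blast
      then have "absC ((x - y) * z0) < \<nu> v" by (simp add: ev_diff algebra_simps)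
      moreover have "x - y \<in> subfield h" using xy fsubD(4)[OF fsub_subfield[OF h(2)]] by (simp add: bad_def)
      then have "absC (x - y) = 1" using subfield_abs[of "x - y" h] xy h by simp
      ultimately show False using val by (simp add: abs_mult)
    qed
    then show ?thesis using ws(3) S(1) by (intro card_inj_on_le[of s]) auto
  qed
  have "\<not> ?U \<subseteq> bad \<omega>0 \<union> bad \<omega>1"
  proof
    assume "?U \<subseteq> bad \<omega>0 \<union> bad \<omega>1"
    then have "card ?U \<le> card (bad \<omega>0 \<union> bad \<omega>1)"
      using finU by (intro card_mono) (auto simp: bad_def intro: finite_subset)
    also have "\<dots> \<le> card S + card S"
      using card_Un_le[of "bad \<omega>0" "bad \<omega>1"] bad[OF iso(1)] bad[OF iso(2)] by linarith
    finally show False using h finU by linarith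
  qed
  then obtain u where u: "u \<in> ?U" "u \<notin> bad \<omega>0" "u \<notin> bad \<omega>1" by blast
  show ?thesis
    using u subfield_abs[of u h] h val by (intro exI[of _ "u * z0"]) (auto simp: abs_mult bad_def not_less)
qed

definition shift :: "'c ^ 'r::finite \<Rightarrow> 'c \<Rightarrow> 'f fls ^ 'r \<Rightarrow> 'c ^ 'r" where
  "shift \<omega> \<tau> p = (\<chi> i. \<omega> $ i + \<tau> * \<iota> (p $ i))"

lemma ev_shift: "ev (shift \<omega> \<tau> p) u = ev \<omega> u + \<tau> * \<iota> (dotp p u)"
  by (simp add: ev_def shift_def dotp_def embed_sum embed_mult sum_distrib_left distrib_left sum.distrib algebra_simps)

text \<open>Orthogonality of \<open>v\<close> to \<open>W\<close> and of \<open>z\<close> to the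
  image of \<open>W\<close> expresses both norms on v + W by the same maximum; homogeneity does the
  rest.\<close>

lemma iso_on_extend:
  fixes \<nu> :: "'f fls ^ 'r::finite \<Rightarrow> real"
  assumes sn: "seminorm \<nu>" and W: "vec.subspace W" and iso: "iso_on W \<nu> \<omega>"
    and orth: "\<forall>w\<in>W. \<nu> v \<le> \<nu> (v + w)" and z: "absC z = \<nu> v" "\<forall>w\<in>W. \<nu> v \<le> absC (z + ev \<omega> w)"
    and agree: "\<forall>w\<in>W. ev \<omega>' w = ev \<omega> w" "ev \<omega>' v = z"
  shows "iso_on (vec.span (insert v W)) \<nu> \<omega>'"
  unfolding iso_on_def
proof
  have base: "absC (z + ev \<omega> w) = \<nu> (v + w)" if w: "w \<in> W" for w
  proof -
    have "absC (ev \<omega>' (v + w)) = max (absC (ev \<omega>' v)) (absC (ev \<omega>' w))"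
      using seminorm_add_eq_max[OF seminorm_ev, of \<omega>' v w] z agree w by (simp add: ev_add)
    moreover have "\<nu> (v + w) = max (\<nu> v) (\<nu> w)"
      using seminorm_add_eq_max[OF sn, of v w] orth w by simp
    ultimately show ?thesis using z agree w iso by (simp add: ev_add iso_on_def)
  qed
  fix x assume "x \<in> vec.span (insert v W)"
  then obtain c where "x - c *s v \<in> vec.span W" using vec.span_breakdown_eq by blast
  then have w: "x - c *s v \<in> W" using W vec.span_eq_iff by blast
  show "absC (ev \<omega>' x) = \<nu> x"
  proof (cases "c = 0")
    case True
    then show ?thesis using w iso agree by (simp add: iso_on_def)
  next
    case False
    define w' where "w' = inverse c *s (x - c *s v)"
    have w': "w' \<in> W" unfolding w'_def using W w by (rule vec.subspace_scale)
    have x: "x = c *s (v + w')" using False by (simp add: w'_def vec.scale_right_distrib)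
    have "absC (ev \<omega>' x) = absK c * absC (z + ev \<omega> w')"
      unfolding x ev_scale using agree w' by (simp add: ev_add abs_mult embed_abs)
    also have "\<dots> = \<nu> x" unfolding x base[OF w'] seminorm_scale[OF sn] by (rule refl)
    finally show ?thesis .
  qed
qed

text \<open>A pair is extended at once so that it stays on a line with the same parameter \<tau>. At
  each new orthogonal vector both members receive one common value that is generic for both.\<close>

lemma extend_isometries:
  fixes \<nu> :: "'f fls ^ 'r::finite \<Rightarrow> real"
  assumes kn: "norm_geq \<kappa> \<nu>" and val: "\<forall>v. \<exists>z :: 'c. absC z = \<nu> v"
    and W: "vec.subspace W" and iso: "iso_on W \<nu> \<omega>" "iso_on W \<nu> (shift \<omega> \<tau> p)"
  shows "\<exists>\<omega>' p'. iso \<nu> \<omega>' \<and> iso \<nu> (shift \<omega>' \<tau> p')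
    \<and> (\<forall>w\<in>W. ev \<omega>' w = ev \<omega> w) \<and> (\<forall>w\<in>W. ev (shift \<omega>' \<tau> p') w = ev (shift \<omega> \<tau> p) w)"
  using W iso
proof (induction "vec.dim (UNIV :: ('f fls ^ 'r) set) - vec.dim W" arbitrary: W \<omega> p rule: less_induct)
  case less
  note sn = norm_geq_seminorm[OF kn]
  show ?case
  proof (cases "W = UNIV")
    case True
    then show ?thesis using less.prems by (intro exI[of _ \<omega>] exI[of _ p]) (simp add: iso_on_def iso_def)
  next
    case False
    then obtain v where v: "v \<notin> W" "\<forall>w\<in>W. \<nu> v \<le> \<nu> (v + w)"
      using orthogonal_vector[OF kn less.prems(1)] by blast
    obtain z0 where "absC (z0 :: 'c) = \<nu> v" using val by blast
    from generic_value[OF kn less.prems(1) v(1) this less.prems(2,3)] obtain z where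
      z: "absC z = \<nu> v" "\<forall>w\<in>W. \<nu> v \<le> absC (z + ev \<omega> w)" "\<forall>w\<in>W. \<nu> v \<le> absC (z + ev (shift \<omega> \<tau> p) w)"
      by blast
    obtain e where e: "\<forall>w\<in>W. dotp e w = 0" "dotp e v = 1" using dual_vector[OF less.prems(1) v(1)] by blast
    \<comment> \<open>\<omega>' is corrected to take the value \<open>z\<close> at \<open>v\<close>,
      and \<open>p'\<close> is corrected so that the shift is invisible at \<open>v\<close>; neither
      correction is seen on \<open>W\<close>.\<close>
    define \<omega>' where "\<omega>' = shift \<omega> (z - ev \<omega> v) e"
    define p' where "p' = p - dotp p v *s e"
    have dp': "dotp p' u = dotp p u - dotp p v * dotp e u" for u
      by (simp add: p'_def dotp_def left_diff_distrib sum_subtractf sum_distrib_left mult.assoc)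
    have a0: "\<forall>w\<in>W. ev \<omega>' w = ev \<omega> w" "ev \<omega>' v = z" using e by (simp_all add: \<omega>'_def ev_shift embed_one)
    have a1: "\<forall>w\<in>W. ev (shift \<omega>' \<tau> p') w = ev (shift \<omega> \<tau> p) w" "ev (shift \<omega>' \<tau> p') v = z"
      using e a0 by (simp_all add: ev_shift dp')
    let ?W = "vec.span (insert v W)"
    have WW: "W \<subseteq> ?W" "v \<in> ?W" by (auto intro: vec.span_base)
    have "vec.span W \<subset> vec.span ?W"
    proof -
      have "vec.span W = W" using less.prems(1) vec.span_eq_iff by blast
      then show ?thesis using WW v(1) unfolding vec.span_span by blast
    qed
    then have "vec.dim W < vec.dim ?W" by (rule vec.dim_psubset)
    moreover have "vec.dim ?W \<le> vec.dim (UNIV :: ('f fls ^ 'r) set)" by (rule vec.dim_subset) simp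
    ultimately have "vec.dim (UNIV :: ('f fls ^ 'r) set) - vec.dim ?W < vec.dim (UNIV :: ('f fls ^ 'r) set) - vec.dim W"
      by linarith
    moreover have "iso_on ?W \<nu> \<omega>'" by (rule iso_on_extend[OF sn less.prems(1,2) v(2) z(1,2) a0])
    moreover have "iso_on ?W \<nu> (shift \<omega>' \<tau> p')" by (rule iso_on_extend[OF sn less.prems(1,3) v(2) z(1,3) a1])
    ultimately obtain \<omega>2 p2 where 2: "iso \<nu> \<omega>2" "iso \<nu> (shift \<omega>2 \<tau> p2)" "\<forall>w\<in>?W. ev \<omega>2 w = ev \<omega>' w"
      "\<forall>w\<in>?W. ev (shift \<omega>2 \<tau> p2) w = ev (shift \<omega>' \<tau> p') w"
      using less.hyps[of ?W \<omega>' p'] vec.subspace_span by blast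
    show ?thesis
      by (rule exI[of _ \<omega>2], rule exI[of _ p2]) (use 2 a0(1) a1(1) WW in auto)
  qed
qed

end

section \<open>Successive minima\<close>

context C_infty
begin

definition lt_ball :: "'c set \<Rightarrow> real \<Rightarrow> 'c set" where
  "lt_ball V m = {w \<in> V. absC w < m}"

definition le_ball :: "'c set \<Rightarrow> real \<Rightarrow> 'c set" where
  "le_ball V m = {w \<in> V. absC w \<le> m}"

lemma fsub_lt_ball: "fsub V \<Longrightarrow> 0 < m \<Longrightarrow> fsub (lt_ball V m)"
  by (auto simp: fsub_def F.subspace_def lt_ball_def intro: absC_add_less)

lemma fsub_le_ball: "fsub V \<Longrightarrow> 0 \<le> m \<Longrightarrow> fsub (le_ball V m)"
  by (auto simp: fsub_def F.subspace_def le_ball_def intro: absC_add_le)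

lemma span_insert_adjoin: "F.span (insert y S) = adjoin (F.span S) y"
  unfolding F.span_insert adjoin_def
proof (intro equalityI subsetI)
  fix x assume "x \<in> {x. \<exists>k. x - F_scale \<iota> k y \<in> F.span S}"
  then obtain k where "x - F_scale \<iota> k y \<in> F.span S" by blast
  then show "x \<in> (\<lambda>(v, c). v + F_scale \<iota> c y) ` (F.span S \<times> UNIV)"
    by (intro image_eqI[of _ _ "(x - F_scale \<iota> k y, k)"]) auto
next
  fix x assume "x \<in> (\<lambda>(v, c). v + F_scale \<iota> c y) ` (F.span S \<times> UNIV)"
  then obtain v c where "v \<in> F.span S" "x = v + F_scale \<iota> c y" by auto
  then show "x \<in> {x. \<exists>k. x - F_scale \<iota> k y \<in> F.span S}" by (auto intro!: exI[of _ c])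
qed

text \<open>A successive minimum basis before it spans: the condition on an entry involves only
  earlier entries, so greedy extension preserves it.\<close>

definition partial_smb :: "'c set \<Rightarrow> 'c list \<Rightarrow> bool" where
  "partial_smb V ms \<longleftrightarrow>
     (\<forall>j<length ms. ms ! j \<in> V \<and> ms ! j \<notin> F.span (set (take j ms))
        \<and> (\<forall>z\<in>V. z \<notin> F.span (set (take j ms)) \<longrightarrow> absC (ms ! j) \<le> absC z))"

lemma is_smb_iff: "is_smb \<iota> V ms \<longleftrightarrow> F.span (set ms) = V \<and> partial_smb V ms"
  unfolding is_smb_def partial_smb_def is_arg_min_def by (auto simp: not_less)

context
  fixes V ms
  assumes V: "fsub V" and ms: "partial_smb V ms"
begin

lemma psmb_set: "set ms \<subseteq> V"
  using ms by (auto simp: partial_smb_def in_set_conv_nth)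

lemma psmb_fsub: "fsub (F.span (set (take j ms)))"
proof -
  have "F.span (set (take j ms)) \<subseteq> V"
    using psmb_set V set_take_subset[of j ms] by (intro F.span_minimal) (auto simp: fsub_def)
  then show ?thesis using V by (auto simp: fsub_def intro: finite_subset)
qed

lemma psmb_card: "j \<le> length ms \<Longrightarrow> card (F.span (set (take j ms))) = CARD('f) ^ j"
proof (induction j)
  case (Suc j)
  then have j: "j < length ms" by simp
  then have "set (take (Suc j) ms) = insert (ms ! j) (set (take j ms))"
    by (simp add: take_Suc_conv_app_nth)
  then have "card (F.span (set (take (Suc j) ms))) = CARD('f) * card (F.span (set (take j ms)))"
    using ms j by (simp only: span_insert_adjoin) (intro card_adjoin psmb_fsub, auto simp: partial_smb_def)
  with Suc show ?case by simp
qed (simp add: F.span_empty)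

lemma psmb_mono:
  assumes "i \<le> j" "j < length ms"
  shows "absC (ms ! i) \<le> absC (ms ! j)"
proof -
  have "F.span (set (take i ms)) \<subseteq> F.span (set (take j ms))"
    using assms by (intro F.span_mono set_take_subset_set_take) auto
  moreover have "ms ! j \<in> V" "ms ! j \<notin> F.span (set (take j ms))"
    using ms assms(2) by (auto simp: partial_smb_def)
  moreover have "z \<in> V \<Longrightarrow> z \<notin> F.span (set (take i ms)) \<Longrightarrow> absC (ms ! i) \<le> absC z" for z
    using ms assms by (simp add: partial_smb_def)
  ultimately show ?thesis by blast
qed

lemma psmb_span_subset:
  assumes "j \<le> length ms" "fsub B" "\<And>i. i < j \<Longrightarrow> ms ! i \<in> B"
  shows "F.span (set (take j ms)) \<subseteq> B"
proof (rule F.span_minimal)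
  show "set (take j ms) \<subseteq> B" using assms by (auto simp: in_set_conv_nth)
qed (use assms in \<open>simp add: fsub_def\<close>)

lemma psmb_outside: "j < length ms \<Longrightarrow> z \<in> V \<Longrightarrow> z \<notin> F.span (set (take j ms)) \<Longrightarrow> absC (ms ! j) \<le> absC z"
  using ms by (simp add: partial_smb_def)

lemma psmb_extend:
  assumes "F.span (set ms) \<noteq> V"
  shows "\<exists>x. partial_smb V (ms @ [x])"
proof -
  have "F.span (set ms) \<subseteq> V" using V psmb_set by (intro F.span_minimal) (auto simp: fsub_def)
  then have ne: "V - F.span (set ms) \<noteq> {}" using assms by auto
  have "finite (V - F.span (set ms))" using V by (simp add: fsub_def)
  then obtain x where x: "x \<in> V - F.span (set ms)" "\<And>z. z \<in> V - F.span (set ms) \<Longrightarrow> absC x \<le> absC z"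
    using ne arg_min_least[of "V - F.span (set ms)" _ absC] arg_min_if_finite(1)[of "V - F.span (set ms)" absC] by blast
  have "partial_smb V (ms @ [x])"
    unfolding partial_smb_def
  proof (intro allI impI)
    fix j assume "j < length (ms @ [x])"
    then consider "j < length ms" | "j = length ms" by fastforce
    then show "(ms @ [x]) ! j \<in> V \<and> (ms @ [x]) ! j \<notin> F.span (set (take j (ms @ [x]))) \<and>
        (\<forall>z\<in>V. z \<notin> F.span (set (take j (ms @ [x]))) \<longrightarrow> absC ((ms @ [x]) ! j) \<le> absC z)"
    proof cases
      case 1
      then show ?thesis using ms by (simp add: partial_smb_def nth_append)
    next
      case 2
      then show ?thesis using x by simp
    qed
  qed
  then show ?thesis ..
qed

end

lemma smb_exists:
  assumes "fsub V"
  shows "\<exists>ms. is_smb \<iota> V ms"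
proof -
  \<comment> \<open>The span of a partial basis has q^length elements, which bounds the length; a
    partial basis of maximal length spans by \<open>psmb_extend\<close>.\<close>
  have bound: "length ms < Suc (card V)" if "partial_smb V ms" for ms
  proof -
    have "F.span (set (take (length ms) ms)) \<subseteq> V"
      using psmb_span_subset[OF assms that order_refl assms] that by (simp add: partial_smb_def)
    then have "CARD('f) ^ length ms \<le> card V"
      using psmb_card[OF assms that order_refl] card_mono[OF fsubD(1)[OF assms]] by metis
    moreover have "length ms < CARD('f) ^ length ms" by (rule power_gt_expt) simp
    ultimately show ?thesis by simp
  qed
  have "partial_smb V []" by (simp add: partial_smb_def)
  then obtain ms where ms: "partial_smb V ms" "\<forall>ms'. partial_smb V ms' \<longrightarrow> length ms' \<le> length ms"
    using ex_has_greatest_nat[of "partial_smb V" "[]" length "Suc (card V)"] bound by blast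
  have "F.span (set ms) = V"
  proof (rule ccontr)
    assume "F.span (set ms) \<noteq> V"
    then obtain x where "partial_smb V (ms @ [x])" using psmb_extend[OF assms ms(1)] by blast
    then have "length (ms @ [x]) \<le> length ms" using ms(2) by blast
    then show False by simp
  qed
  then show ?thesis using ms(1) is_smb_iff by blast
qed

text \<open>
  A description of inseparability that does not mention bases: no ball of \<open>V\<close> has exactly
  \<open>q\<^sup>k\<close> elements.
\<close>

lemma k_inseparable_iff:
  assumes V: "fsub V"
  shows "k_inseparable \<iota> k V \<longleftrightarrow>
    (\<exists>m>0. card (lt_ball V m) < CARD('f) ^ k \<and> CARD('f) ^ k < card (le_ball V m))"
proof
  assume "k_inseparable \<iota> k V"
  then obtain ms where ms: "is_smb \<iota> V ms" "1 \<le> k" "k < length ms" "absC (ms ! (k - 1)) = absC (ms ! k)"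
    by (auto simp: k_inseparable_def)
  have p: "partial_smb V ms" using ms(1) by (simp add: is_smb_iff)
  \<comment> \<open>The common value of the k-th and (k+1)-st minima, at indices k - 1 and k.
    Shorter elements already lie in the span of the first k - 1 vectors.\<close>
  define m where "m = absC (ms ! k)"
  have "ms ! k \<noteq> 0" using p ms(3) F.span_zero by (metis partial_smb_def)
  then have m: "0 < m" by (simp add: m_def)
  have "lt_ball V m \<subseteq> F.span (set (take (k - 1) ms))"
  proof
    fix w assume w: "w \<in> lt_ball V m"
    show "w \<in> F.span (set (take (k - 1) ms))"
    proof (rule ccontr)
      assume "w \<notin> F.span (set (take (k - 1) ms))"
      then have "absC (ms ! (k - 1)) \<le> absC w"
        using psmb_outside[OF V p, of "k - 1" w] w ms(3) by (simp add: lt_ball_def)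
      then show False using w ms(4) by (simp add: lt_ball_def m_def)
    qed
  qed
  then have "card (lt_ball V m) \<le> CARD('f) ^ (k - 1)"
    using psmb_card[OF V p, of "k - 1"] card_mono[OF fsubD(1)[OF psmb_fsub[OF V p, of "k - 1"]]] ms(3) by simp
  also have "\<dots> < CARD('f) ^ k" using ms(2) by (intro power_strict_increasing) simp_all
  finally have 1: "card (lt_ball V m) < CARD('f) ^ k" .
  have "F.span (set (take (Suc k) ms)) \<subseteq> le_ball V m"
  proof (rule psmb_span_subset[OF V p])
    show "Suc k \<le> length ms" using ms(3) by simp
    show "fsub (le_ball V m)" using V m by (simp add: fsub_le_ball)
    show "ms ! i \<in> le_ball V m" if "i < Suc k" for i
      using psmb_mono[OF V p, of i k] psmb_set[OF V p] that ms(3) by (auto simp: le_ball_def m_def)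
  qed
  then have "CARD('f) ^ Suc k \<le> card (le_ball V m)"
    using psmb_card[OF V p, of "Suc k"] ms(3) card_mono[OF fsubD(1)[OF fsub_le_ball[OF V, of m]]] m
    by (metis Suc_leI less_imp_le)
  moreover have "CARD('f) ^ k < CARD('f) ^ Suc k" by (intro power_strict_increasing) simp_all
  ultimately have "CARD('f) ^ k < card (le_ball V m)" by linarith
  with 1 m show "\<exists>m>0. card (lt_ball V m) < CARD('f) ^ k \<and> CARD('f) ^ k < card (le_ball V m)" by blast
next
  assume "\<exists>m>0. card (lt_ball V m) < CARD('f) ^ k \<and> CARD('f) ^ k < card (le_ball V m)"
  then obtain m where m: "0 < m" "card (lt_ball V m) < CARD('f) ^ k" "CARD('f) ^ k < card (le_ball V m)" by blast
  obtain ms where ms: "is_smb \<iota> V ms" using smb_exists[OF V] by blast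
  then have p: "partial_smb V ms" and span: "F.span (set ms) = V" by (simp_all add: is_smb_iff)
  have fin: "finite V" using V by (simp add: fsub_def)
  have finb: "finite (lt_ball V m)" "finite (le_ball V m)" using fin by (simp_all add: lt_ball_def le_ball_def)
  have "card V = CARD('f) ^ length ms" using psmb_card[OF V p order_refl] span by simp
  moreover have "card (le_ball V m) \<le> card V" using fin by (intro card_mono) (auto simp: le_ball_def)
  ultimately have "CARD('f) ^ k < CARD('f) ^ length ms" using m by linarith
  then have k: "k < length ms" by (rule power_less_imp_less_exp[rotated]) simp
  have "0 \<in> lt_ball V m" using m fsubD(2)[OF V] by (simp add: lt_ball_def)
  then have "0 < card (lt_ball V m)" using finb card_gt_0_iff by blast
  then have k1: "1 \<le> k" using m by (cases k) auto
  have "m \<le> absC (ms ! (k - 1))"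
  proof (rule ccontr)
    assume *: "\<not> m \<le> absC (ms ! (k - 1))"
    have "F.span (set (take k ms)) \<subseteq> lt_ball V m"
    proof (rule psmb_span_subset[OF V p])
      show "ms ! i \<in> lt_ball V m" if "i < k" for i
      proof -
        have "absC (ms ! i) \<le> absC (ms ! (k - 1))" using that k by (intro psmb_mono[OF V p]) simp_all
        moreover have "ms ! i \<in> V" using psmb_set[OF V p] that k by auto
        ultimately show ?thesis using * by (simp add: lt_ball_def)
      qed
    qed (use k fsub_lt_ball[OF V m(1)] in auto)
    then have "CARD('f) ^ k \<le> card (lt_ball V m)"
      using psmb_card[OF V p, of k] k card_mono[OF finb(1), of "F.span (set (take k ms))"] by simp
    then show False using m by simp
  qed
  moreover have "absC (ms ! k) \<le> m"
  proof (rule ccontr)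
    assume *: "\<not> absC (ms ! k) \<le> m"
    have "le_ball V m \<subseteq> F.span (set (take k ms))"
      using psmb_outside[OF V p k] * by (force simp: le_ball_def)
    then have "card (le_ball V m) \<le> CARD('f) ^ k"
      using psmb_card[OF V p, of k] k card_mono[OF fsubD(1)[OF psmb_fsub[OF V p, of k]]] by simp
    then show False using m by simp
  qed
  moreover have "absC (ms ! (k - 1)) \<le> absC (ms ! k)" using psmb_mono[OF V p, of "k - 1" k] k by simp
  ultimately show "k_inseparable \<iota> k V"
    unfolding k_inseparable_def using ms k k1 by (intro exI[of _ ms]) auto
qed

section \<open>Approximation of polynomials in the Gauss norm\<close>

text \<open>Equal residues in the Gauss norm of radius s, relative to a common bound
  \<open>B\<close>. Since \<open>B\<close> may exceed the norms, products are handled by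
  submultiplicativity of the Gauss norm alone.\<close>

definition gcong :: "real \<Rightarrow> real \<Rightarrow> 'c poly \<Rightarrow> 'c poly \<Rightarrow> bool" where
  "gcong s B p r \<longleftrightarrow> (\<forall>i. absC (coeff p i) * s ^ i \<le> B) \<and> (\<forall>i. absC (coeff r i) * s ^ i \<le> B)
     \<and> (\<forall>i. absC (coeff (p - r) i) * s ^ i < B)"

lemma gcong_pos: "gcong s B p r \<Longrightarrow> 0 < s \<Longrightarrow> 0 < B"
proof -
  assume "gcong s B p r" "0 < s"
  then have "absC (coeff (p - r) 0) * s ^ 0 < B" unfolding gcong_def by blast
  then have "absC (coeff (p - r) 0) < B" by simp
  then show ?thesis using absC_nonneg[of "coeff (p - r) 0"] by linarith
qed

lemma gauss_mult_le:
  fixes p r :: "'c poly"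
  assumes "0 < s" "\<And>i. absC (coeff p i) * s ^ i \<le> B" "\<And>i. absC (coeff r i) * s ^ i \<le> C"
  shows "absC (coeff (p * r) i) * s ^ i \<le> B * C"
proof -
  have B: "0 \<le> B" using assms(2)[of 0] absC_nonneg[of "coeff p 0"] by (simp del: absC_nonneg)
  have C: "0 \<le> C" using assms(3)[of 0] absC_nonneg[of "coeff r 0"] by (simp del: absC_nonneg)
  have "absC (coeff (p * r) i) \<le> B * C / s ^ i"
    unfolding coeff_mult
  proof (rule absC_sum_le)
    fix j assume "j \<in> {..i}"
    then have "s ^ i = s ^ j * s ^ (i - j)" by (simp flip: power_add)
    then have "absC (coeff p j * coeff r (i - j)) * s ^ i = (absC (coeff p j) * s ^ j) * (absC (coeff r (i - j)) * s ^ (i - j))"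
      by (simp add: abs_mult)
    also have "\<dots> \<le> B * C" using assms B by (intro mult_mono) auto
    finally show "absC (coeff p j * coeff r (i - j)) \<le> B * C / s ^ i" using assms(1) by (simp add: pos_le_divide_eq)
  qed (use assms(1) B C in simp)
  then show ?thesis using assms(1) by (simp add: pos_le_divide_eq)
qed

lemma gauss_mult_less:
  fixes p r :: "'c poly"
  assumes "0 < s" "\<And>i. absC (coeff p i) * s ^ i < B" "\<And>i. absC (coeff r i) * s ^ i \<le> C" "0 < C"
  shows "absC (coeff (p * r) i) * s ^ i < B * C"
proof -
  have B: "0 < B" using assms(2)[of 0] absC_nonneg[of "coeff p 0"] by (simp del: absC_nonneg)
  have "absC (coeff (p * r) i) < B * C / s ^ i"
    unfolding coeff_mult
  proof (rule absC_sum_less)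
    fix j assume "j \<in> {..i}"
    then have "s ^ i = s ^ j * s ^ (i - j)" by (simp flip: power_add)
    then have "absC (coeff p j * coeff r (i - j)) * s ^ i = (absC (coeff p j) * s ^ j) * (absC (coeff r (i - j)) * s ^ (i - j))"
      by (simp add: abs_mult)
    also have "\<dots> \<le> (absC (coeff p j) * s ^ j) * C" using assms by (intro mult_left_mono) auto
    also have "\<dots> < B * C" using assms by (intro mult_strict_right_mono) auto
    finally show "absC (coeff p j * coeff r (i - j)) < B * C / s ^ i" using assms(1) by (simp add: pos_less_divide_eq)
  qed (use assms(1,4) B in simp)
  then show ?thesis using assms(1) by (simp add: pos_less_divide_eq)
qed

lemma gcong_mult:
  assumes s: "0 < s" and 1: "gcong s B p r" and 2: "gcong s B' p' r'"
  shows "gcong s (B * B') (p * p') (r * r')"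
proof -
  have B: "0 < B" "0 < B'" using gcong_pos s 1 2 by blast+
  have "absC (coeff (p * p' - r * r') i) * s ^ i < B * B'" for i
  proof -
    have "absC (coeff ((p - r) * p') i) * s ^ i < B * B'"
      using s 1 2 B by (intro gauss_mult_less) (simp_all add: gcong_def)
    moreover have "absC (coeff ((p' - r') * r) i) * s ^ i < B' * B"
      using s 1 2 B by (intro gauss_mult_less) (simp_all add: gcong_def)
    ultimately have "absC (coeff ((p - r) * p') i) < B * B' / s ^ i" "absC (coeff ((p' - r') * r) i) < B * B' / s ^ i"
      using s by (simp_all add: pos_less_divide_eq mult.commute)
    then have "absC (coeff ((p - r) * p') i + coeff ((p' - r') * r) i) < B * B' / s ^ i" by (rule absC_add_less)
    moreover have "p * p' - r * r' = (p - r) * p' + (p' - r') * r" by (simp add: algebra_simps)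
    ultimately show ?thesis using s by (simp only: coeff_add) (simp add: pos_less_divide_eq)
  qed
  then show ?thesis
    using gauss_mult_le[of s p B p' B'] gauss_mult_le[of s r B r' B'] s 1 2 by (simp add: gcong_def)
qed

lemma gcong_prod:
  assumes "0 < s" "\<And>v. v \<in> S \<Longrightarrow> gcong s (B v) (p v) (r v)"
  shows "gcong s (\<Prod>v\<in>S. B v) (\<Prod>v\<in>S. p v) (\<Prod>v\<in>S. r v)"
  using assms(2)
proof (induction S rule: infinite_finite_induct)
  case (insert v S)
  then show ?case using gcong_mult[OF assms(1)] by simp
qed (auto simp: gcong_def coeff_1 power_0_left)

lemma coeff_linear: "coeff [:a, b:] i = (if i = 0 then a else if i = 1 then b else 0)"
  by (auto simp: coeff_pCons split: nat.splits)

lemma coeff_const: "coeff [:a:] i = (if i = 0 then a else 0)"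
  by (auto simp: coeff_pCons split: nat.splits)

text \<open>This lemma, \<open>gcong_small\<close> and \<open>gcong_equal\<close> treat the three
  kinds of linear factors: zeros outside the circle of radius s reduce to 1, zeros inside to a
  multiple of X, and zeros on the circle may be moved by less than s.\<close>

lemma gcong_large: "0 < s \<Longrightarrow> s < absC v \<Longrightarrow> gcong s 1 [:1, - inverse v:] 1"
  by (auto simp: gcong_def coeff_linear coeff_const one_pCons divide_simps)

lemma gcong_small: "0 < s \<Longrightarrow> v \<noteq> 0 \<Longrightarrow> absC v < s \<Longrightarrow> gcong s (s / absC v) [:1, - inverse v:] [:0, - inverse v:]"
  by (auto simp: gcong_def coeff_linear coeff_const divide_simps)

lemma gcong_refl_small: "0 < s \<Longrightarrow> v \<noteq> 0 \<Longrightarrow> absC v \<le> s \<Longrightarrow> gcong s (s / absC v) [:1, - inverse v:] [:1, - inverse v:]"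
  by (auto simp: gcong_def coeff_linear divide_simps)

lemma gcong_equal:
  assumes "0 < s" "absC v = s" "absC (v - v') < s"
  shows "gcong s 1 [:1, - inverse v:] [:1, - inverse v':]"
proof -
  have v': "absC v' = s" using absC_near[of v' v] assms by (simp add: absC_minus_commute)
  then have nz: "v \<noteq> 0" "v' \<noteq> 0" using assms by auto
  then have "inverse v' - inverse v = (v - v') / (v * v')" by (simp add: divide_inverse algebra_simps)
  then have "absC (inverse v' - inverse v) * s < 1"
    using assms v' by (simp only: absC_divide abs_mult) (simp add: pos_divide_less_eq)
  moreover have "absC (inverse v) * s = 1" "absC (inverse v') * s = 1" using nz assms v' by simp_all
  ultimately show ?thesis
    unfolding gcong_def by (simp add: coeff_linear coeff_const del: absC_inverse)
qed

lemma gcong_X: "0 < s \<Longrightarrow> gcong s s [:0, 1:] [:0, 1 :: 'c:]"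
  by (auto simp: gcong_def coeff_linear)

lemma lead_coeff_lpoly:
  fixes V :: "'c set"
  assumes "finite V" "0 \<in> V"
  shows "absC (coeff (lpoly V) (card V)) = (\<Prod>v\<in>V - {0}. inverse (absC v))"
proof -
  have "lead_coeff (\<Prod>v\<in>V - {0}. [:1, - inverse v:]) = (\<Prod>v\<in>V - {0}. lead_coeff [:1, - inverse v:])"
    by (rule lead_coeff_prod)
  also have "\<dots> = (\<Prod>v\<in>V - {0}. - inverse v)" by (rule prod.cong) auto
  finally have "lead_coeff (lpoly V) = (\<Prod>v\<in>V - {0}. - inverse v)"
    unfolding lpoly_def lead_coeff_mult by simp
  then have "coeff (lpoly V) (card V) = (\<Prod>v\<in>V - {0}. - inverse v)"
    using degree_lpoly[OF assms] by simp
  then show ?thesis by (simp only: absC_prod absC_uminus absC_inverse)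
qed

text \<open>In the separable case some ball has exactly q^k elements. At its radius the zeros
  outside reduce to 1, so \<open>V\<close> and the ball have the same polynomial up to smaller
  terms; at X^{q^k} that of the ball has its leading coefficient, which attains the bound.\<close>

lemma separable_coeff:
  assumes V: "fsub V" and n: "card V = CARD('f) ^ n" "k \<le> n" and sep: "\<not> k_inseparable \<iota> k V"
  shows "qcoeff V k \<noteq> 0"
proof -
  have fin: "finite V" and V0: "0 \<in> V" using fsubD[OF V] by auto
  let ?R = "absC ` V"
  let ?A = "{r \<in> ?R. card (le_ball V r) \<le> CARD('f) ^ k}"
  have le0: "le_ball V 0 = {0}"
    using V0 by (auto simp: le_ball_def) (metis absC_eq_0_iff absC_nonneg order_antisym)
  have finA: "finite ?A" using fin by simp
  have q: "1 \<le> CARD('f) ^ k" by (simp add: Suc_le_eq)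
  have "0 \<in> ?A" using V0 q by (auto simp: le0 intro: image_eqI[of _ _ 0])
  then have mA: "Max ?A \<in> ?A" using finA Max_in by blast
  define m where "m = Max ?A"
  have m: "0 \<le> m" "card (le_ball V m) \<le> CARD('f) ^ k" using mA by (auto simp: m_def)
  have card: "card (le_ball V m) = CARD('f) ^ k"
  proof (rule ccontr)
    assume "card (le_ball V m) \<noteq> CARD('f) ^ k"
    then have less: "card (le_ball V m) < CARD('f) ^ k" using m by simp
    also have "\<dots> \<le> card V" unfolding n using n(2) by (intro power_increasing) (simp_all add: Suc_le_eq)
    finally have "le_ball V m \<noteq> V" by auto
    then have ne: "{r \<in> ?R. m < r} \<noteq> {}" by (auto simp: le_ball_def not_le)
    \<comment> \<open>The next absolute value after \<open>m\<close>. If the count jumped past q^k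
      between the two, \<open>V\<close> would be k-inseparable.\<close>
    define m' where "m' = Min {r \<in> ?R. m < r}"
    have m': "m' \<in> ?R" "m < m'" using Min_in[OF _ ne] fin by (auto simp: m'_def)
    have "lt_ball V m' = le_ball V m"
    proof (intro equalityI subsetI)
      fix w assume w: "w \<in> lt_ball V m'"
      show "w \<in> le_ball V m"
      proof (rule ccontr)
        assume "w \<notin> le_ball V m"
        then have "m' \<le> absC w"
          unfolding m'_def using w fin by (intro Min_le) (auto simp: lt_ball_def le_ball_def)
        then show False using w by (simp add: lt_ball_def)
      qed
    qed (use m' in \<open>auto simp: lt_ball_def le_ball_def\<close>)
    moreover have "CARD('f) ^ k < card (le_ball V m')"
    proof (rule ccontr)
      assume "\<not> CARD('f) ^ k < card (le_ball V m')"
      then have "m' \<in> ?A" using m' by auto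
      then have "m' \<le> m" unfolding m_def using finA by (rule Max_ge[rotated])
      then show False using m' by simp
    qed
    ultimately have "k_inseparable \<iota> k V"
      using k_inseparable_iff[OF V] less m m'(2) by (metis order.strict_trans1)
    then show False using sep by simp
  qed
  show ?thesis
  proof (cases "m = 0")
    case True
    then have "CARD('f) ^ k = CARD('f) ^ 0" using card le0 by simp
    then have "k = 0" by simp
    then show ?thesis using fin by simp
  next
    case False
    then have m0: "0 < m" using m by simp
    let ?B = "le_ball V m"
    have B: "finite ?B" "0 \<in> ?B" "?B \<subseteq> V" using fin V0 m0 by (auto simp: le_ball_def)
    have 1: "gcong m (\<Prod>v\<in>?B - {0}. m / absC v) (\<Prod>v\<in>?B - {0}. [:1, - inverse v:]) (\<Prod>v\<in>?B - {0}. [:1, - inverse v:])"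
      by (rule gcong_prod[OF m0]) (rule gcong_refl_small, use m0 in \<open>auto simp: le_ball_def\<close>)
    have 2: "gcong m (\<Prod>v\<in>V - ?B. 1) (\<Prod>v\<in>V - ?B. [:1, - inverse v:]) (\<Prod>v\<in>V - ?B. 1)"
      by (rule gcong_prod[OF m0]) (rule gcong_large, use m0 in \<open>auto simp: le_ball_def\<close>)
    \<comment> \<open>The product of the bounds of all factors; it turns out to be the size of the
      leading term of the ball's polynomial at radius m.\<close>
    let ?bd = "m * ((\<Prod>v\<in>?B - {0}. m / absC v) * (\<Prod>v\<in>V - ?B. 1))"
    have "gcong m ?bd
       ([:0, 1:] * ((\<Prod>v\<in>?B - {0}. [:1, - inverse v:]) * (\<Prod>v\<in>V - ?B. [:1, - inverse v:])))
       ([:0, 1:] * ((\<Prod>v\<in>?B - {0}. [:1, - inverse v:]) * (\<Prod>v\<in>V - ?B. 1)))"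
      by (intro gcong_mult gcong_X m0 1 2)
    moreover have "(\<Prod>v\<in>?B - {0}. [:1, - inverse v:]) * (\<Prod>v\<in>V - ?B. [:1, - inverse v:]) = (\<Prod>v\<in>V - {0}. [:1, - inverse v:])"
    proof -
      have "V - {0} = (?B - {0}) \<union> (V - ?B)" using B by auto
      moreover have "(?B - {0}) \<inter> (V - ?B) = {}" by auto
      ultimately show ?thesis using fin B by (simp add: prod.union_disjoint)
    qed
    ultimately have "gcong m ?bd (lpoly V) (lpoly ?B)" by (simp add: lpoly_def)
    then have "absC (coeff (lpoly V - lpoly ?B) (CARD('f) ^ k)) * m ^ (CARD('f) ^ k) < ?bd"
      unfolding gcong_def by blast
    also have "?bd = absC (coeff (lpoly ?B) (CARD('f) ^ k)) * m ^ (CARD('f) ^ k)"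
    proof -
      have "absC (coeff (lpoly ?B) (CARD('f) ^ k)) = (\<Prod>v\<in>?B - {0}. inverse (absC v))"
        using lead_coeff_lpoly[OF B(1,2)] card by simp
      moreover have "m ^ (CARD('f) ^ k) = m * (\<Prod>v\<in>?B - {0}. m)"
        using card B q by (simp add: power_Suc[symmetric] del: power_Suc)
      moreover have "(\<Prod>v\<in>?B - {0}. m / absC v) = (\<Prod>v\<in>?B - {0}. m) * (\<Prod>v\<in>?B - {0}. inverse (absC v))"
        by (simp only: divide_inverse prod.distrib)
      ultimately show ?thesis by simp
    qed
    finally have "absC (coeff (lpoly V) (CARD('f) ^ k) - coeff (lpoly ?B) (CARD('f) ^ k)) < absC (coeff (lpoly ?B) (CARD('f) ^ k))"
      using m0 by simp
    then have "absC (qcoeff V k) = absC (coeff (lpoly ?B) (CARD('f) ^ k))"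
      unfolding qcoeff_def by (rule absC_near)
    moreover have "0 < absC (coeff (lpoly ?B) (CARD('f) ^ k))"
    proof -
      have "0 < inverse (absC v)" if "v \<in> ?B - {0}" for v using that by simp
      then have "0 < (\<Prod>v\<in>?B - {0}. inverse (absC v))" by (rule prod_pos)
      then show ?thesis using card lead_coeff_lpoly[OF B(1,2)] by simp
    qed
    ultimately show ?thesis by auto
  qed
qed

section \<open>Dependence on the norm only\<close>

text \<open>Every factor is a quotient of values of \<open>ev \<omega>\<close>, so an isometry turns
  the product into one in \<nu> alone, and \<omega> disappears.\<close>

lemma lexp_abs_formula:
  fixes \<nu> :: "'f fls ^ 'r::finite \<Rightarrow> real"
  assumes "norm_geq \<kappa> \<nu>" "iso \<nu> \<omega>" "\<nu> v < \<kappa> * real CARD('f) ^ n"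
  shows "absC (lexp \<omega> (ev \<omega> v)) = \<nu> v * (\<Prod>b\<in>A_box n - {0}. \<nu> (b - v) / \<nu> b)"
proof -
  have good: "good \<kappa> \<omega>" using assms by (simp add: iso_good)
  have nu: "absC (ev \<omega> u) = \<nu> u" for u using assms by (simp add: iso_def)
  have "absC (lexp \<omega> (ev \<omega> v)) = absC (box_exp \<omega> n (ev \<omega> v))"
    using assms by (intro box_exp_abs[OF good]) (simp add: nu)
  also have "box_exp \<omega> n (ev \<omega> v) = ev \<omega> v * (\<Prod>b\<in>A_box n - {0}. 1 - ev \<omega> v / ev \<omega> b)"
    unfolding box_exp_def by (rule fexp_image_eq(1)) (auto simp: good_inj[OF good] A_box_def)
  also have "absC \<dots> = \<nu> v * (\<Prod>b\<in>A_box n - {0}. absC (1 - ev \<omega> v / ev \<omega> b))"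
    by (simp add: abs_mult absC_prod nu)
  also have "(\<Prod>b\<in>A_box n - {0}. absC (1 - ev \<omega> v / ev \<omega> b)) = (\<Prod>b\<in>A_box n - {0}. \<nu> (b - v) / \<nu> b)"
  proof (rule prod.cong)
    fix b :: "'f fls ^ 'r" assume "b \<in> A_box n - {0}"
    then have "ev \<omega> b \<noteq> 0" using good_ev_eq_0[OF good] by auto
    then have "1 - ev \<omega> v / ev \<omega> b = ev \<omega> (b - v) / ev \<omega> b" by (simp add: ev_diff diff_divide_distrib)
    then show "absC (1 - ev \<omega> v / ev \<omega> b) = \<nu> (b - v) / \<nu> b" by (simp add: nu)
  qed simp
  finally show ?thesis .
qed

lemma lexp_abs_eq:
  assumes "norm_geq \<kappa> \<nu>" "iso \<nu> \<omega>" "iso \<nu> \<omega>'"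
  shows "absC (lexp \<omega> (ev \<omega> v)) = absC (lexp \<omega>' (ev \<omega>' v))"
proof -
  have "0 < \<kappa>" using assms by (simp add: norm_geq_def)
  then obtain n where "\<nu> v < \<kappa> * real CARD('f) ^ n" using large_radius by blast
  from lexp_abs_formula[OF assms(1,2) this] lexp_abs_formula[OF assms(1,3) this] show ?thesis by simp
qed

lemma card_tors_filter:
  assumes "good \<kappa> \<omega>" "a \<noteq> 0"
  shows "card {w \<in> tors a \<omega>. P (absC w)} = card {v \<in> tors_coords a. P (absC (lexp \<omega> (ev \<omega> v)))}"
proof -
  have "{w \<in> tors a \<omega>. P (absC w)} = (\<lambda>v. lexp \<omega> (ev \<omega> v)) ` {v \<in> tors_coords a. P (absC (lexp \<omega> (ev \<omega> v)))}"
    by (auto simp: tors_def)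
  moreover have "inj_on (\<lambda>v. lexp \<omega> (ev \<omega> v)) {v \<in> tors_coords a. P (absC (lexp \<omega> (ev \<omega> v)))}"
    by (rule inj_on_subset[OF inj_tors[OF assms]]) auto
  ultimately show ?thesis by (simp add: card_image)
qed

text \<open>Inseparability is a statement about sizes of balls, and these can be counted on
  \<open>tors_coords\<close>, where the absolute values depend only on \<nu>.\<close>

lemma k_inseparable_iso:
  assumes "norm_geq \<kappa> \<nu>" "iso \<nu> \<omega>" "iso \<nu> \<omega>'" "a \<noteq> 0"
  shows "k_inseparable \<iota> k (tors a \<omega>) \<longleftrightarrow> k_inseparable \<iota> k (tors a \<omega>')"
proof -
  note good = iso_good[OF assms(1,2)] iso_good[OF assms(1,3)]
  have "card {w \<in> tors a \<omega>. P (absC w)} = card {w \<in> tors a \<omega>'. P (absC w)}" for P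
    using card_tors_filter[OF good(1) assms(4)] card_tors_filter[OF good(2) assms(4)]
    by (simp only: lexp_abs_eq[OF assms(1-3)])
  from this[of "\<lambda>x. x < _"] this[of "\<lambda>x. x \<le> _"] show ?thesis
    unfolding k_inseparable_iff[OF fsub_tors[OF good(1) assms(4)]]
        k_inseparable_iff[OF fsub_tors[OF good(2) assms(4)]] lt_ball_def le_ball_def by simp
qed

end

section \<open>A pair of subspaces of a finite field\<close>

context C_infty
begin

definition fcomb :: "nat \<Rightarrow> (nat \<Rightarrow> 'c) \<Rightarrow> (nat \<Rightarrow> 'f) \<Rightarrow> 'c" where
  "fcomb h \<tau> \<gamma> = (\<Sum>l<h. F_scale \<iota> (\<gamma> l) (\<tau> l))"

lemma fcomb_add: "fcomb h \<tau> (\<lambda>l. \<gamma> l + \<delta> l) = fcomb h \<tau> \<gamma> + fcomb h \<tau> \<delta>"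
  by (simp add: fcomb_def F.scale_left_distrib sum.distrib)

lemma fcomb_scale: "fcomb h \<tau> (\<lambda>l. c * \<gamma> l) = F_scale \<iota> c (fcomb h \<tau> \<gamma>)"
  by (simp add: fcomb_def F.scale_sum_right)

lemma fcomb_0: "fcomb h \<tau> (\<lambda>l. 0) = 0"
  by (simp add: fcomb_def)

lemma fcomb_cong: "(\<And>l. l < h \<Longrightarrow> \<gamma> l = \<delta> l) \<Longrightarrow> fcomb h \<tau> \<gamma> = fcomb h \<tau> \<delta>"
  by (simp add: fcomb_def)

lemma F_scale_mult_right: "F_scale \<iota> c (s * z) = s * F_scale \<iota> c z"
  by (simp add: F_scale_def mult.left_commute)

lemma fcomb_mult: "fcomb h (\<lambda>l. s * \<tau> l) \<gamma> = s * fcomb h \<tau> \<gamma>"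
  by (simp add: fcomb_def F_scale_mult_right sum_distrib_left)

definition fspan :: "nat \<Rightarrow> (nat \<Rightarrow> 'c) \<Rightarrow> 'c set" where
  "fspan h \<tau> = fcomb h \<tau> ` ({..<h} \<rightarrow>\<^sub>E UNIV)"

lemma fcomb_in_fspan: "fcomb h \<tau> \<gamma> \<in> fspan h \<tau>"
proof -
  have "fcomb h \<tau> \<gamma> = fcomb h \<tau> (restrict \<gamma> {..<h})" by (rule fcomb_cong) simp
  moreover have "restrict \<gamma> {..<h} \<in> {..<h} \<rightarrow>\<^sub>E UNIV" by (simp only: restrict_PiE_iff) simp
  ultimately show ?thesis unfolding fspan_def by (rule image_eqI)
qed

lemma fspan_eq: "fspan h \<tau> = range (fcomb h \<tau>)"
  using fcomb_in_fspan by (auto simp: fspan_def)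

lemma fsub_fspan: "fsub (fspan h \<tau>)"
  unfolding fsub_def F.subspace_def
proof (intro conjI ballI allI)
  show "0 \<in> fspan h \<tau>" unfolding fspan_eq using fcomb_0[of h \<tau>] by (metis rangeI)
  show "finite (fspan h \<tau>)" by (simp add: fspan_def finite_PiE)
next
  fix x y assume "x \<in> fspan h \<tau>" "y \<in> fspan h \<tau>"
  then show "x + y \<in> fspan h \<tau>" by (auto simp: fspan_eq fcomb_add[symmetric])
next
  fix c x assume "x \<in> fspan h \<tau>"
  then show "F_scale \<iota> c x \<in> fspan h \<tau>" by (auto simp: fspan_eq fcomb_scale[symmetric])
qed

lemma fspan_Suc: "fspan (Suc h) \<tau> = adjoin (fspan h \<tau>) (\<tau> h)"
proof (intro equalityI subsetI)
  fix x assume "x \<in> fspan (Suc h) \<tau>"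
  then obtain \<gamma> where "x = fcomb h \<tau> \<gamma> + F_scale \<iota> (\<gamma> h) (\<tau> h)" by (auto simp: fspan_eq fcomb_def)
  then show "x \<in> adjoin (fspan h \<tau>) (\<tau> h)" using fcomb_in_fspan by (auto simp: adjoin_iff)
next
  fix x assume "x \<in> adjoin (fspan h \<tau>) (\<tau> h)"
  then obtain \<gamma> c where "x = fcomb h \<tau> \<gamma> + F_scale \<iota> c (\<tau> h)" by (auto simp: adjoin_iff fspan_eq)
  then have "x = fcomb (Suc h) \<tau> (\<gamma>(h := c))" by (simp add: fcomb_def)
  then show "x \<in> fspan (Suc h) \<tau>" using fcomb_in_fspan by simp
qed

lemma fspan_cong: "(\<And>l. l < h \<Longrightarrow> \<tau> l = \<tau>' l) \<Longrightarrow> fspan h \<tau> = fspan h \<tau>'"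
  by (simp add: fspan_eq fcomb_def)

text \<open>Independence over F of the residue classes of the \<tau> l, expressed by absolute
  values; it survives perturbation by smaller terms.\<close>

definition fully_indep :: "nat \<Rightarrow> (nat \<Rightarrow> 'c) \<Rightarrow> bool" where
  "fully_indep h \<tau> \<longleftrightarrow> (\<forall>\<gamma>. (\<exists>l<h. \<gamma> l \<noteq> 0) \<longrightarrow> absC (fcomb h \<tau> \<gamma>) = 1)"

lemma fully_indep_inj:
  assumes "fully_indep h \<tau>"
  shows "inj_on (fcomb h \<tau>) ({..<h} \<rightarrow>\<^sub>E UNIV)"
proof (rule inj_onI)
  fix \<gamma> \<delta> :: "nat \<Rightarrow> 'f"
  assume *: "\<gamma> \<in> {..<h} \<rightarrow>\<^sub>E UNIV" "\<delta> \<in> {..<h} \<rightarrow>\<^sub>E UNIV" "fcomb h \<tau> \<gamma> = fcomb h \<tau> \<delta>"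
  have "fcomb h \<tau> (\<lambda>l. \<gamma> l + (- 1) * \<delta> l) = fcomb h \<tau> \<gamma> + F_scale \<iota> (- 1) (fcomb h \<tau> \<delta>)"
    by (simp only: fcomb_add fcomb_scale)
  also have "\<dots> = 0" using * by (simp add: F.scale_minus_left)
  finally have "\<forall>l<h. \<gamma> l + (- 1) * \<delta> l = 0"
    using assms unfolding fully_indep_def by (metis absC_0 zero_neq_one)
  then show "\<gamma> = \<delta>" using * by (intro PiE_ext[of \<gamma> "{..<h}" _ \<delta>]) auto
qed

lemma subfield_basis:
  assumes "0 < h"
  shows "\<exists>\<tau>. fspan h \<tau> = subfield h \<and> fully_indep h \<tau>"
proof -
  have "card (subfield h) = CARD('f) ^ h * card {0 :: 'c}" using card_subfield[OF assms] by simp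
  then obtain \<tau> where \<tau>: "\<forall>l<h. \<tau> l \<in> subfield h" "\<forall>x\<in>subfield h. \<exists>\<gamma>. \<exists>v\<in>{0}. x = (\<Sum>l<h. F_scale \<iota> (\<gamma> l) (\<tau> l)) + v"
    "\<forall>\<gamma>. (\<Sum>l<h. F_scale \<iota> (\<gamma> l) (\<tau> l)) \<in> {0} \<longrightarrow> (\<forall>l<h. \<gamma> l = 0)"
    using relative_basis[of "{0}" "subfield h" h] fsub_subfield[OF assms] fsubD(2) by auto
  have in_subfield: "fcomb h \<tau> \<gamma> \<in> subfield h" for \<gamma>
    using \<tau>(1) fsub_subfield[OF assms] unfolding fcomb_def fsub_def
    by (intro F.subspace_sum) (auto intro: F.subspace_scale)
  show ?thesis
  proof (intro exI[of _ \<tau>] conjI)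
    show "fspan h \<tau> = subfield h"
    proof
      show "fspan h \<tau> \<subseteq> subfield h" using in_subfield by (auto simp: fspan_eq)
      show "subfield h \<subseteq> fspan h \<tau>"
      proof
        fix x assume "x \<in> subfield h"
        then obtain \<gamma> where "x = fcomb h \<tau> \<gamma>" using \<tau>(2) by (auto simp: fcomb_def)
        then show "x \<in> fspan h \<tau>" using fcomb_in_fspan by simp
      qed
    qed
    show "fully_indep h \<tau>"
      unfolding fully_indep_def
    proof (intro allI impI)
      fix \<gamma> :: "nat \<Rightarrow> 'f" assume "\<exists>l<h. \<gamma> l \<noteq> 0"
      then have "fcomb h \<tau> \<gamma> \<noteq> 0" using \<tau>(3) by (auto simp: fcomb_def)
      then show "absC (fcomb h \<tau> \<gamma>) = 1" using subfield_abs[OF in_subfield assms] by simp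
    qed
  qed
qed

text \<open>The polynomial of the field with q^h elements is a multiple of X^{q^h} - X, which has
  nothing between its two ends.\<close>

lemma qcoeff_subfield:
  assumes "0 < l" "l < h"
  shows "qcoeff (subfield h) l = 0"
proof -
  have h: "0 < h" using assms by simp
  have fin: "finite (subfield h)" "0 \<in> subfield h" using fsubD[OF fsub_subfield[OF h]] by auto
  define c where "c = coeff (lpoly (subfield h)) (CARD('f) ^ h)"
  have "lpoly (subfield h) = smult c (fq_poly h)"
  proof (rule poly_eqI_degree_lead_coeff[where n = "CARD('f) ^ h" and A = "subfield h"])
    show "coeff (lpoly (subfield h)) (CARD('f) ^ h) = coeff (smult c (fq_poly h)) (CARD('f) ^ h)"
      using fq_poly_facts(1,4)[OF h] by (simp add: c_def)
    show "degree (lpoly (subfield h)) \<le> CARD('f) ^ h" using degree_lpoly[OF fin] card_subfield[OF h] by simp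
    show "degree (smult c (fq_poly h)) \<le> CARD('f) ^ h"
      using fq_poly_facts(1)[OF h] degree_smult_le[of c "fq_poly h"] by simp
    fix z assume "z \<in> subfield h"
    then show "poly (lpoly (subfield h)) z = poly (smult c (fq_poly h)) z"
      using fexp_eq_0_iff[OF fin] by (simp add: fq_poly_def poly_monom) (simp add: subfield_def)
  qed (use card_subfield[OF h] in simp)
  moreover have "coeff (fq_poly h) (CARD('f) ^ l) = 0"
  proof -
    have "CARD('f) ^ l \<noteq> CARD('f) ^ h" using assms by simp
    moreover have "1 < CARD('f) ^ l" using assms by (intro one_less_power) simp_all
    ultimately show ?thesis by (simp add: fq_poly_def coeff_linear assms del: q_power_inject)
  qed
  ultimately show ?thesis by (simp add: qcoeff_def)
qed

lemma fexp_root: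
  assumes "fsub V"
  shows "\<exists>x. fexp V x = y"
proof -
  have d: "degree (lpoly V) = card V" by (rule degree_lpoly[OF fsubD(1,2)[OF assms]])
  have "0 < card V" using fsubD(1,2)[OF assms] by (auto simp: card_gt_0_iff)
  then have "degree (lpoly V + [:- y:]) = card V"
    using d by (subst degree_add_eq_left) simp_all
  then have "0 < degree (lpoly V + [:- y:])" using \<open>0 < card V\<close> by simp
  then obtain x where "poly (lpoly V + [:- y:]) x = 0"
    using alg_closed_imp_poly_has_root by blast
  then show ?thesis by auto
qed

text \<open>Both parts serve in contraposition: if \<open>fexp V x\<close> has absolute value r,
  then so has x.\<close>

lemma fexp_unit_abs:
  assumes V: "fsub V" and unit: "\<And>v. v \<in> V - {0} \<Longrightarrow> absC v = r" and r: "0 < r"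
  shows "absC x < r \<Longrightarrow> absC (fexp V x) < r"
    and "r < absC x \<Longrightarrow> r < absC (fexp V x)"
proof -
  have abs: "absC (fexp V x) = absC x * (\<Prod>v\<in>V - {0}. absC (1 - x / v))"
    by (simp add: fexp_def abs_mult absC_prod)
  show "absC (fexp V x) < r" if x: "absC x < r"
  proof -
    have "(\<Prod>v\<in>V - {0}. absC (1 - x / v)) = (\<Prod>v\<in>V - {0}. 1)"
    proof (rule prod.cong)
      fix v assume "v \<in> V - {0}"
      then have "absC (x / v) < absC (1 :: 'c)" using unit[of v] x r by simp
      then show "absC (1 - x / v) = 1" using absC_diff_eq[of "x / v" 1] by (simp add: absC_minus_commute)
    qed simp
    then show ?thesis using abs x by simp
  qed
  show "r < absC (fexp V x)" if x: "r < absC x"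
  proof -
    have "1 \<le> (\<Prod>v\<in>V - {0}. absC (1 - x / v))"
    proof (rule prod_ge_1)
      fix v assume "v \<in> V - {0}"
      then have 1: "absC (1 :: 'c) < absC (x / v)" using unit[of v] x r by simp
      then show "1 \<le> absC (1 - x / v)" using absC_diff_eq[OF 1] by simp
    qed
    then have "absC x * 1 \<le> absC (fexp V x)" unfolding abs by (intro mult_left_mono) auto
    then show ?thesis using x by simp
  qed
qed

text \<open>\<open>?Y\<close> is a hyperplane of the field, and w is the image under
  \<open>fexp ?Y\<close> of the remaining basis vector. As the middle coefficients of the field
  vanish, a recursion shows that those of \<open>?Y\<close> are units. Replacing w by z w multiplies
  the correction term in \<open>qcoeff_adjoin\<close> by \<zeta> = z^(1-q), which leaves the k-th
  coefficient of \<open>?Y\<close> times 1 - \<zeta>.\<close>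

lemma finite_field_pair:
  assumes k: "0 < k" "k < h"
  shows "\<exists>\<tau> y. fully_indep h \<tau> \<and> fully_indep h (\<tau>(h - 1 := y))
    \<and> qcoeff (fspan h \<tau>) k = 0 \<and> absC (qcoeff (fspan h (\<tau>(h - 1 := y))) k) = 1"
proof -
  obtain n where n: "h = Suc n" using k by (cases h) auto
  obtain \<tau> where \<tau>: "fspan h \<tau> = subfield h" "fully_indep h \<tau>" using subfield_basis[of h] k by auto
  let ?Y = "fspan n \<tau>"
  have Y: "fsub ?Y" by (rule fsub_fspan)
  have subfield_adj: "subfield h = adjoin ?Y (\<tau> n)" using \<tau>(1) fspan_Suc[of n \<tau>] by (simp add: n)
  have YF: "?Y \<subseteq> subfield h" unfolding subfield_adj by (rule adjoin_superset)
  have Y1: "absC v = 1" if "v \<in> ?Y - {0}" for v using subfield_abs[of v h] that YF k by auto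
  have tF: "\<tau> n \<in> subfield h" unfolding subfield_adj by (rule adjoin_self[OF Y])
  have tY: "\<tau> n \<notin> ?Y"
  proof
    assume "\<tau> n \<in> ?Y"
    then obtain \<gamma> where g: "\<tau> n = fcomb n \<tau> \<gamma>" by (auto simp: fspan_eq)
    have "fcomb h \<tau> (\<gamma>(n := - 1)) = 0" using g by (simp add: n fcomb_def F.scale_minus_left)
    moreover have "absC (fcomb h \<tau> (\<gamma>(n := - 1))) = 1"
    proof -
      have "\<exists>l<h. (\<gamma>(n := - 1)) l \<noteq> 0" by (intro exI[of _ n]) (simp add: n)
      then show ?thesis using \<tau>(2) unfolding fully_indep_def by blast
    qed
    ultimately show False by simp
  qed
  define w where "w = fexp ?Y (\<tau> n)"
  have wF: "w \<in> subfield h"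
    unfolding w_def fexp_def
  proof -
    have "(\<Prod>v\<in>S. 1 - \<tau> n / v) \<in> subfield h" if "S \<subseteq> subfield h" for S
      using that
    proof (induction S rule: infinite_finite_induct)
      case (insert v S)
      have "1 - \<tau> n / v \<in> subfield h"
        using fsubD(4)[OF fsub_subfield[of h] subfield_1 subfield_mult[OF tF subfield_inverse[of v]]] insert.prems k by (simp add: divide_inverse)
      then show ?case using insert by (simp add: subfield_mult)
    qed (simp_all add: subfield_1)
    then show "\<tau> n * (\<Prod>v\<in>?Y - {0}. 1 - \<tau> n / v) \<in> subfield h" using YF by (intro subfield_mult tF) blast
  qed
  have w0: "w \<noteq> 0" unfolding w_def using fexp_eq_0_iff[of ?Y] fsubD[OF Y] tY by simp
  have w1: "absC w = 1" using subfield_abs[OF wF _ w0] k by simp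
  \<comment> \<open>The coefficients of the whole field vanish strictly between 0 and h, so the two
    terms of \<open>qcoeff_adjoin\<close> cancel.\<close>
  have rec: "qcoeff ?Y (Suc j) * w ^ (CARD('f) - 1) = qcoeff ?Y j ^ CARD('f)" if "Suc j < h" for j
  proof -
    have "qcoeff (subfield h) (Suc j) = 0" using that by (intro qcoeff_subfield) simp_all
    then have "qcoeff ?Y (Suc j) - qcoeff ?Y j ^ CARD('f) / w ^ (CARD('f) - 1) = 0"
      using qcoeff_adjoin[OF Y tY, of j] by (simp add: subfield_adj w_def)
    then show ?thesis using w0 by (simp add: field_simps)
  qed
  have full: "absC (qcoeff ?Y j) = 1" if "j < h" for j
    using that
  proof (induction j)
    case 0
    then show ?case using fsubD(1)[OF Y] by simp
  next
    case (Suc j)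
    have "absC (qcoeff ?Y (Suc j) * w ^ (CARD('f) - 1)) = absC (qcoeff ?Y j ^ CARD('f))" using rec[OF Suc.prems] by simp
    then show ?case using Suc w1 by (simp add: abs_mult)
  qed
  \<comment> \<open>For z of degree 2 over F, \<zeta> is an element other than 1 of a finite field,
    so 1 - \<zeta> is a unit.\<close>
  obtain z where z: "z \<in> subfield 2" "z \<notin> subfield 1"
  proof -
    have "card (subfield 1) < card (subfield 2)" by (simp add: card_subfield power2_eq_square)
    then have "\<not> subfield 2 \<subseteq> subfield 1" using card_mono[of "subfield 1" "subfield 2"] fsubD(1)[OF fsub_subfield[of 1]] by auto
    then show ?thesis using that by blast
  qed
  have z0: "z \<noteq> 0" using z(2) by (auto simp: subfield_def power_0_left)
  have z1: "absC z = 1" using subfield_abs[OF z(1) _ z0] by simp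
  define \<zeta> where "\<zeta> = inverse (z ^ (CARD('f) - 1))"
  have "\<zeta> \<noteq> 1"
  proof
    assume "\<zeta> = 1"
    then have "z * z ^ (CARD('f) - 1) = z" by (simp add: \<zeta>_def)
    then have "z ^ CARD('f) = z" by (simp add: power_Suc[symmetric] del: power_Suc)
    then show False using z(2) by (simp add: subfield_def)
  qed
  moreover have "z ^ j \<in> subfield 2" for j by (induction j) (simp_all add: subfield_1 subfield_mult z(1))
  then have "\<zeta> \<in> subfield 2" unfolding \<zeta>_def by (rule subfield_inverse)
  ultimately have \<zeta>: "absC (1 - \<zeta>) = 1"
    using subfield_abs[of "1 - \<zeta>" 2] fsubD(4)[OF fsub_subfield[of 2] subfield_1, of \<zeta>] by simp
  obtain y where y: "fexp ?Y y = z * w" using fexp_root[OF Y] by blast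
  have zw: "absC (z * w) = 1" using z1 w1 by (simp add: abs_mult)
  have yY: "y \<notin> ?Y" using y zw fexp_eq_0_iff[of ?Y y] fsubD[OF Y] by auto
  let ?\<tau>' = "\<tau>(h - 1 := y)"
  have span': "fspan h ?\<tau>' = adjoin ?Y y"
  proof -
    have "fspan n ?\<tau>' = ?Y" by (rule fspan_cong) (simp add: n)
    then show ?thesis unfolding n fspan_Suc by simp
  qed
  obtain j where j: "k = Suc j" using k by (cases k) auto
  have "qcoeff (fspan h ?\<tau>') k = qcoeff ?Y k * (1 - \<zeta>)"
  proof -
    have "qcoeff (fspan h ?\<tau>') k = qcoeff ?Y k - qcoeff ?Y j ^ CARD('f) / (z * w) ^ (CARD('f) - 1)"
      unfolding span' j using qcoeff_adjoin[OF Y yY, of j] y by simp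
    also have "qcoeff ?Y j ^ CARD('f) = qcoeff ?Y k * w ^ (CARD('f) - 1)" using rec[of j] k by (simp add: j)
    also have "qcoeff ?Y k * w ^ (CARD('f) - 1) / (z * w) ^ (CARD('f) - 1) = qcoeff ?Y k * \<zeta>"
      using w0 z0 by (simp add: \<zeta>_def power_mult_distrib divide_inverse)
    finally show ?thesis by (simp only: right_diff_distrib mult_1_right)
  qed
  then have q1: "absC (qcoeff (fspan h ?\<tau>') k) = 1" using full[OF k(2)] \<zeta> by (simp add: abs_mult)
  \<comment> \<open>A combination that involves \<open>y\<close> is mapped by \<open>fexp ?Y\<close>
    to a constant multiple of z w, which is a unit; so it is a unit itself.\<close>
  have ind: "fully_indep h ?\<tau>'"
    unfolding fully_indep_def
  proof (intro allI impI)
    fix \<gamma> :: "nat \<Rightarrow> 'f" assume g: "\<exists>l<h. \<gamma> l \<noteq> 0"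
    define v where "v = fcomb n \<tau> \<gamma>"
    have v: "v \<in> ?Y" by (simp add: v_def fcomb_in_fspan)
    have eq: "fcomb h ?\<tau>' \<gamma> = v + F_scale \<iota> (\<gamma> n) y" by (simp add: n fcomb_def v_def)
    show "absC (fcomb h ?\<tau>' \<gamma>) = 1"
    proof (cases "\<gamma> n = 0")
      case True
      then have "fcomb h ?\<tau>' \<gamma> = fcomb h \<tau> \<gamma>" unfolding eq by (simp add: n fcomb_def v_def)
      then show ?thesis using \<tau>(2) g by (simp add: fully_indep_def)
    next
      case False
      have "fexp ?Y (fcomb h ?\<tau>' \<gamma>) = F_scale \<iota> (\<gamma> n) (z * w)"
        unfolding eq using fexp_eq_0_iff[of ?Y v] fsubD(1,2)[OF Y] v by (simp add: fexp_add[OF Y] fexp_F_scale[OF Y] y)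
      then have "absC (fexp ?Y (fcomb h ?\<tau>' \<gamma>)) = 1" using False zw by simp
      then show ?thesis
        using fexp_unit_abs[OF Y Y1 zero_less_one, of "fcomb h ?\<tau>' \<gamma>"] by (metis linorder_neqE_linordered_idom less_irrefl)
    qed
  qed
  have "qcoeff (fspan h \<tau>) k = 0" unfolding \<tau>(1) using k by (rule qcoeff_subfield)
  with q1 ind \<tau>(2) show ?thesis by blast
qed

section \<open>Leading terms of the coefficients\<close>

definition kcomb :: "nat \<Rightarrow> (nat \<Rightarrow> 'f fls ^ 'r::finite) \<Rightarrow> (nat \<Rightarrow> 'f) \<Rightarrow> 'f fls ^ 'r" where
  "kcomb h G \<gamma> = (\<Sum>l<h. fls_const (\<gamma> l) *s G l)"

lemma ev_kcomb: "ev \<omega> (kcomb h G \<gamma>) = fcomb h (\<lambda>l. ev \<omega> (G l)) \<gamma>"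
  by (simp add: kcomb_def fcomb_def ev_sum ev_const)

abbreviation exp_ev :: "'c ^ 'r::finite \<Rightarrow> 'f fls ^ 'r \<Rightarrow> 'c" where
  "exp_ev \<omega> v \<equiv> lexp \<omega> (ev \<omega> v)"

lemma exp_ev_kcomb: "good \<kappa> \<omega> \<Longrightarrow> exp_ev \<omega> (kcomb h G \<gamma>) = fcomb h (\<lambda>l. exp_ev \<omega> (G l)) \<gamma>"
  by (simp add: ev_kcomb fcomb_def lexp_sum lexp_F_scale)

lemma kcomb_cong: "(\<And>l. l < h \<Longrightarrow> \<gamma> l = \<delta> l) \<Longrightarrow> kcomb h G \<gamma> = kcomb h G \<delta>"
  by (simp add: kcomb_def)

text \<open>
  If the torsion points of absolute value exactly \<open>m\<close> are, up to smaller terms,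
  \<open>\<sigma>\<close> times the elements of a space \<open>Y\<close> of units, then the polynomial with these zeros is,
  up to smaller terms in the Gauss norm of radius \<open>m\<close>, a power of the polynomial of
  \<open>\<sigma> Y\<close>.
\<close>

lemma leading_coefficient:
  fixes \<omega> :: "'c ^ 'r::finite"
  assumes good: "good \<kappa> \<omega>" and a: "a \<noteq> 0" and m: "0 < m"
    and E0: "E0 = {v \<in> tors_coords a. absC (exp_ev \<omega> v) < m}" and E1: "E1 = {v \<in> tors_coords a. absC (exp_ev \<omega> v) \<le> m}"
    and card0: "card E0 = CARD('f) ^ i"
    and surj: "\<forall>v\<in>E1. \<exists>\<gamma>. \<exists>u\<in>E0. v = kcomb h G \<gamma> + u"
    and indep: "\<forall>\<gamma>. absC (exp_ev \<omega> (kcomb h G \<gamma>)) < m \<longrightarrow> (\<forall>l<h. \<gamma> l = 0)"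
    and G: "\<forall>l<h. G l \<in> E1"
    and \<sigma>: "absC \<sigma> = m" and \<tau>: "fully_indep h \<tau>"
    and approx: "\<forall>l<h. absC (exp_ev \<omega> (G l) - \<sigma> * \<tau> l) < m"
  shows "qcoeff (fspan h \<tau>) k = 0 \<Longrightarrow>
      absC (qcoeff (tors a \<omega>) (k + i)) * m ^ CARD('f) ^ (k + i) < m * (\<Prod>v\<in>E0 - {0}. m / absC (exp_ev \<omega> v))"
    and "absC (qcoeff (fspan h \<tau>) k) = 1 \<Longrightarrow>
      absC (qcoeff (tors a \<omega>) (k + i)) * m ^ CARD('f) ^ (k + i) = m * (\<Prod>v\<in>E0 - {0}. m / absC (exp_ev \<omega> v))"
proof -
  let ?e = "exp_ev \<omega>"
  let ?\<Gamma> = "{..<h} \<rightarrow>\<^sub>E (UNIV :: 'f set)"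
  let ?z = "restrict (\<lambda>_. 0 :: 'f) {..<h}"
  have finE: "finite (tors_coords a :: ('f fls ^ 'r) set)" by (rule card_tors_coords(1)[OF a])
  have fin: "finite E0" "finite E1" using finE by (auto simp: E0 E1)
  have fin\<Gamma>: "finite ?\<Gamma>" by (simp add: finite_PiE)
  have sub: "E0 \<subseteq> E1" "E1 \<subseteq> tors_coords a" by (auto simp: E0 E1)
  have kE: "fsub_vec (tors_coords a)" by (rule fsub_vec_tors_coords[OF a])
  have e0: "?e v \<noteq> 0" if "v \<in> tors_coords a - {0}" for v by (rule lexp_tors_coords_nonzero[OF good that])
  have zero: "0 \<in> E0" using m by (simp add: E0)
  have cardS: "card E0 = Suc (card E0 - 1)" using fin zero card_gt_0_iff[of E0] by auto
  have e_add: "?e (v + w) = ?e v + ?e w" for v w by (simp add: ev_add lexp_add[OF good])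
  have kcombE: "kcomb h G \<gamma> \<in> tors_coords a" for \<gamma>
  proof -
    have "(\<Sum>l\<in>S. fls_const (\<gamma> l) *s G l) \<in> tors_coords a" if "S \<subseteq> {..<h}" for S
      using that
    proof (induction S rule: infinite_finite_induct)
      case (insert l S)
      then have "fls_const (\<gamma> l) *s G l \<in> tors_coords a" using G sub kE unfolding fsub_vec_def by blast
      moreover have "(\<Sum>l\<in>S. fls_const (\<gamma> l) *s G l) \<in> tors_coords a" using insert by auto
      ultimately show ?case using insert.hyps kE unfolding fsub_vec_def by (subst sum.insert) blast+
    qed simp_all
    then show ?thesis by (simp add: kcomb_def)
  qed
  \<comment> \<open>The coefficients \<gamma> determine the torsion point up to terms smaller than
    m; the component in \<open>E0\<close> is absorbed.\<close>
  have near: "absC (?e (kcomb h G \<gamma> + u) - \<sigma> * fcomb h \<tau> \<gamma>) < m" if u: "u \<in> E0" for \<gamma> u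
  proof -
    have "?e (kcomb h G \<gamma>) - \<sigma> * fcomb h \<tau> \<gamma> = (\<Sum>l<h. F_scale \<iota> (\<gamma> l) (?e (G l) - \<sigma> * \<tau> l))"
      unfolding exp_ev_kcomb[OF good] fcomb_mult[symmetric] fcomb_def
      by (simp add: F.scale_right_diff_distrib sum_subtractf F_scale_mult_right sum_distrib_left)
    also have "absC \<dots> < m" using approx m by (intro absC_sum_less) auto
    finally have 1: "absC (?e (kcomb h G \<gamma>) - \<sigma> * fcomb h \<tau> \<gamma>) < m" .
    have "absC (?e u) < m" using u by (simp add: E0)
    from absC_add_less[OF 1 this] show ?thesis by (simp add: e_add algebra_simps)
  qed
  have ne0: "\<exists>l<h. \<gamma> l \<noteq> 0" if "\<gamma> \<in> ?\<Gamma> - {?z}" for \<gamma>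
  proof (rule ccontr)
    assume "\<not> (\<exists>l<h. \<gamma> l \<noteq> 0)"
    then have "\<gamma> = ?z" using that by (intro PiE_ext[of \<gamma> "{..<h}" _ ?z]) auto
    then show False using that by simp
  qed
  have k0: "kcomb h G ?z = 0" by (simp add: kcomb_def)
  have unit: "absC (\<sigma> * fcomb h \<tau> \<gamma>) = m" if "\<gamma> \<in> ?\<Gamma> - {?z}" for \<gamma>
    using \<tau> ne0[OF that] \<sigma> by (simp add: fully_indep_def abs_mult)
  have exact: "absC (?e (kcomb h G \<gamma> + u)) = m" if "\<gamma> \<in> ?\<Gamma> - {?z}" "u \<in> E0" for \<gamma> u
    using absC_near[of "?e (kcomb h G \<gamma> + u)" "\<sigma> * fcomb h \<tau> \<gamma>"] near[OF that(2), of \<gamma>] unit[OF that(1)] by simp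
  \<comment> \<open>The points of absolute value exactly m, sorted by residue: every nonzero
    \<gamma> is taken \<open>card E0\<close> times. This multiplicity is the source of the power
    q^i.\<close>
  have bij: "bij_betw (\<lambda>(\<gamma>, u). kcomb h G \<gamma> + u) ((?\<Gamma> - {?z}) \<times> E0) (E1 - E0)"
    unfolding bij_betw_def
  proof
    show "inj_on (\<lambda>(\<gamma>, u). kcomb h G \<gamma> + u) ((?\<Gamma> - {?z}) \<times> E0)"
    proof (rule inj_onI)
      fix x y assume xy: "x \<in> (?\<Gamma> - {?z}) \<times> E0" "y \<in> (?\<Gamma> - {?z}) \<times> E0"
        "(\<lambda>(\<gamma>, u). kcomb h G \<gamma> + u) x = (\<lambda>(\<gamma>, u). kcomb h G \<gamma> + u) y"
      obtain \<gamma> u \<delta> w where p: "x = (\<gamma>, u)" "y = (\<delta>, w)" by (metis surj_pair)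
      have *: "\<gamma> \<in> ?\<Gamma>" "\<delta> \<in> ?\<Gamma>" "u \<in> E0" "w \<in> E0" "kcomb h G \<gamma> + u = kcomb h G \<delta> + w"
        using xy unfolding p by (auto simp del: PiE_iff)
      have "fcomb h \<tau> \<gamma> = fcomb h \<tau> \<delta>"
      proof (rule ccontr)
        assume ne: "fcomb h \<tau> \<gamma> \<noteq> fcomb h \<tau> \<delta>"
        have "fcomb h \<tau> \<gamma> - fcomb h \<tau> \<delta> = fcomb h \<tau> (\<lambda>l. \<gamma> l + (- 1) * \<delta> l)"
          by (simp only: fcomb_add fcomb_scale) (simp add: F.scale_minus_left)
        moreover from this ne have "\<exists>l<h. \<gamma> l + (- 1) * \<delta> l \<noteq> 0"
          by (metis (no_types, lifting) fcomb_0 fcomb_cong right_minus_eq)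
        ultimately have "absC (\<sigma> * (fcomb h \<tau> \<gamma> - fcomb h \<tau> \<delta>)) = m"
          using \<tau> \<sigma> unfolding fully_indep_def by (simp add: abs_mult)
        moreover have "absC ((?e (kcomb h G \<delta> + w) - \<sigma> * fcomb h \<tau> \<delta>) - (?e (kcomb h G \<gamma> + u) - \<sigma> * fcomb h \<tau> \<gamma>)) < m"
          by (rule absC_diff_less[OF near near]) (use * in auto)
        ultimately show False using *(5) by (simp add: algebra_simps)
      qed
      then have "\<gamma> = \<delta>" using inj_onD[OF fully_indep_inj[OF \<tau>] _ *(1,2)] by simp
      then show "x = y" using *(5) p by simp
    qed
    show "(\<lambda>(\<gamma>, u). kcomb h G \<gamma> + u) ` ((?\<Gamma> - {?z}) \<times> E0) = E1 - E0"
    proof (intro equalityI subsetI)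
      fix v assume "v \<in> (\<lambda>(\<gamma>, u). kcomb h G \<gamma> + u) ` ((?\<Gamma> - {?z}) \<times> E0)"
      then obtain \<gamma> u where v: "\<gamma> \<in> ?\<Gamma> - {?z}" "u \<in> E0" "v = kcomb h G \<gamma> + u" by auto
      have "v \<in> tors_coords a" using kcombE v(2,3) sub kE unfolding fsub_vec_def by blast
      then show "v \<in> E1 - E0" using exact[OF v(1,2)] v(3) by (simp add: E0 E1)
    next
      fix v assume v: "v \<in> E1 - E0"
      then obtain \<gamma> u where gu: "u \<in> E0" "v = kcomb h G \<gamma> + u" using surj by blast
      have eq: "kcomb h G \<gamma> = kcomb h G (restrict \<gamma> {..<h})" by (rule kcomb_cong) simp
      have "restrict \<gamma> {..<h} \<noteq> ?z"
      proof
        assume "restrict \<gamma> {..<h} = ?z"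
        then have "v = u" using gu eq k0 by simp
        then show False using v gu by simp
      qed
      then show "v \<in> (\<lambda>(\<gamma>, u). kcomb h G \<gamma> + u) ` ((?\<Gamma> - {?z}) \<times> E0)"
        using gu eq by (intro image_eqI[of _ _ "(restrict \<gamma> {..<h}, u)"]) auto
    qed
  qed
  let ?L = "\<lambda>x. [:1, - inverse x:]"
  let ?P = "\<Prod>\<gamma>\<in>?\<Gamma> - {?z}. ?L (\<sigma> * fcomb h \<tau> \<gamma>)"
  have 1: "gcong m (\<Prod>v\<in>E0 - {0}. m / absC (?e v)) (\<Prod>v\<in>E0 - {0}. ?L (?e v)) (\<Prod>v\<in>E0 - {0}. [:0, - inverse (?e v):])"
  proof (rule gcong_prod[OF m])
    fix v assume v: "v \<in> E0 - {0}"
    then have "?e v \<noteq> 0" using e0 sub by blast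
    then show "gcong m (m / absC (?e v)) (?L (?e v)) [:0, - inverse (?e v):]"
      using v m by (intro gcong_small) (auto simp: E0)
  qed
  have "gcong m (\<Prod>x\<in>(?\<Gamma> - {?z}) \<times> E0. 1) (\<Prod>x\<in>(?\<Gamma> - {?z}) \<times> E0. ?L (?e (kcomb h G (fst x) + snd x)))
      (\<Prod>x\<in>(?\<Gamma> - {?z}) \<times> E0. ?L (\<sigma> * fcomb h \<tau> (fst x)))"
  proof (rule gcong_prod[OF m])
    fix x assume x: "x \<in> (?\<Gamma> - {?z}) \<times> E0"
    then have x': "fst x \<in> ?\<Gamma> - {?z}" "snd x \<in> E0" by (simp_all only: mem_Times_iff)
    show "gcong m 1 (?L (?e (kcomb h G (fst x) + snd x))) (?L (\<sigma> * fcomb h \<tau> (fst x)))"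
      by (rule gcong_equal[OF m exact[OF x'] near[OF x'(2)]])
  qed
  moreover have "(\<Prod>x\<in>(?\<Gamma> - {?z}) \<times> E0. ?L (?e (kcomb h G (fst x) + snd x))) = (\<Prod>v\<in>E1 - E0. ?L (?e v))"
    using prod.reindex_bij_betw[OF bij, of "\<lambda>v. ?L (?e v)"] by (simp add: case_prod_beta)
  moreover have "(\<Prod>x\<in>(?\<Gamma> - {?z}) \<times> E0. ?L (\<sigma> * fcomb h \<tau> (fst x))) = ?P ^ card E0"
  proof -
    have "(\<Prod>x\<in>(?\<Gamma> - {?z}) \<times> E0. ?L (\<sigma> * fcomb h \<tau> (fst x))) = (\<Prod>\<gamma>\<in>?\<Gamma> - {?z}. \<Prod>u\<in>E0. ?L (\<sigma> * fcomb h \<tau> \<gamma>))"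
      by (simp only: prod.cartesian_product case_prod_unfold)
    then show ?thesis by (simp only: prod_constant prod_power_distrib)
  qed
  ultimately have 2: "gcong m 1 (\<Prod>v\<in>E1 - E0. ?L (?e v)) (?P ^ card E0)" by simp
  have "gcong m (\<Prod>v\<in>tors_coords a - E1. 1) (\<Prod>v\<in>tors_coords a - E1. ?L (?e v)) (\<Prod>v\<in>tors_coords a - E1. 1)"
    by (rule gcong_prod[OF m]) (rule gcong_large[OF m], auto simp: E1)
  then have 3: "gcong m 1 (\<Prod>v\<in>tors_coords a - E1. ?L (?e v)) 1" by simp
  let ?B = "m * (\<Prod>v\<in>E0 - {0}. m / absC (?e v))"
  have "gcong m (m * ((\<Prod>v\<in>E0 - {0}. m / absC (?e v)) * (1 * 1)))
     ([:0, 1:] * ((\<Prod>v\<in>E0 - {0}. ?L (?e v)) * ((\<Prod>v\<in>E1 - E0. ?L (?e v)) * (\<Prod>v\<in>tors_coords a - E1. ?L (?e v)))))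
     ([:0, 1:] * ((\<Prod>v\<in>E0 - {0}. [:0, - inverse (?e v):]) * (?P ^ card E0 * 1)))"
    by (intro gcong_mult gcong_X 1 2 3 m)
  moreover have "[:0, 1:] * ((\<Prod>v\<in>E0 - {0}. ?L (?e v)) * ((\<Prod>v\<in>E1 - E0. ?L (?e v)) * (\<Prod>v\<in>tors_coords a - E1. ?L (?e v)))) = lpoly (tors a \<omega>)"
  proof -
    have "tors_coords a - {0} = (E0 - {0}) \<union> ((E1 - E0) \<union> (tors_coords a - E1))" using sub zero by auto
    moreover have "(E0 - {0}) \<inter> ((E1 - E0) \<union> (tors_coords a - E1)) = {}" "(E1 - E0) \<inter> (tors_coords a - E1) = {}" using sub by auto
    ultimately have "(\<Prod>v\<in>tors_coords a - {0}. ?L (?e v)) = (\<Prod>v\<in>E0 - {0}. ?L (?e v)) * ((\<Prod>v\<in>E1 - E0. ?L (?e v)) * (\<Prod>v\<in>tors_coords a - E1. ?L (?e v)))"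
      using fin finE by (simp add: prod.union_disjoint)
    then show ?thesis unfolding tors_def fexp_image_eq(2)[OF inj_tors[OF good a] zero_in_tors_coords, simplified] by simp
  qed
  moreover define \<kappa>0 where "\<kappa>0 = (\<Prod>v\<in>E0 - {0}. - inverse (?e v))"
  let ?Y = "(*) \<sigma> ` fspan h \<tau>"
  have "\<sigma> \<noteq> 0" using \<sigma> m by auto
  \<comment> \<open>The factor X and the \<open>card E0 - 1\<close> inner factors, each a multiple
    of X, supply one X for every copy of \<open>?P\<close>; together they give a power of the
    polynomial of \<open>?Y\<close>.\<close>
  have "[:0, 1:] * ((\<Prod>v\<in>E0 - {0}. [:0, - inverse (?e v):]) * (?P ^ card E0 * 1)) = smult \<kappa>0 (lpoly ?Y ^ card E0)"
  proof -
    let ?f = "\<lambda>\<gamma>. \<sigma> * fcomb h \<tau> \<gamma>"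
    have Y: "?Y = ?f ` ?\<Gamma>" by (simp only: fspan_def image_image)
    have inj: "inj_on ?f ?\<Gamma>"
      using fully_indep_inj[OF \<tau>] \<open>\<sigma> \<noteq> 0\<close> unfolding inj_on_def by (simp only: mult_cancel_left) blast
    have z: "{?z} \<subseteq> ?\<Gamma>" by (simp only: insert_subset restrict_PiE_iff) simp
    have "?f ` (?\<Gamma> - {?z}) = ?f ` ?\<Gamma> - ?f ` {?z}" by (rule inj_on_image_set_diff[OF inj Diff_subset z])
    also have "?f ` {?z} = {0}" by (simp add: fcomb_def)
    finally have "?Y - {0} = ?f ` (?\<Gamma> - {?z})" unfolding Y by (rule sym)
    moreover have "inj_on ?f (?\<Gamma> - {?z})" by (rule inj_on_subset[OF inj Diff_subset])
    ultimately have "(\<Prod>y\<in>?Y - {0}. ?L y) = ?P"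
      by (simp only: prod.reindex comp_def)
    then have lY: "lpoly ?Y = [:0, 1:] * ?P" by (simp add: lpoly_def)
    have "(\<Prod>v\<in>S. [:0, - inverse (?e v):]) = smult (\<Prod>v\<in>S. - inverse (?e v)) ([:0, 1:] ^ card S)" if "finite S" for S
      using that
    proof (induction S rule: finite_induct)
      case (insert v S)
      show ?case
        unfolding prod.insert[OF insert.hyps] card_insert_disjoint[OF insert.hyps] insert.IH by (simp add: mult.commute)
    qed simp
    note * = this[of "E0 - {0}", folded \<kappa>0_def]
    have *: "(\<Prod>v\<in>E0 - {0}. [:0, - inverse (?e v):]) = smult \<kappa>0 ([:0, 1:] ^ (card E0 - 1))"
      using * fin zero by (simp only: finite_Diff card_Diff_singleton)
    have "[:0, 1:] * [:0, 1:] ^ (card E0 - 1) = ([:0, 1:] :: 'c poly) ^ card E0"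
      using cardS by (metis power_Suc)
    then have X: "[:0, 1:] * ([:0, 1:] ^ (card E0 - 1) * Q) = ([:0, 1:] :: 'c poly) ^ card E0 * Q" for Q
      by (simp only: mult.assoc[symmetric])
    show ?thesis
      unfolding lY power_mult_distrib mult_1_right *
      by (simp only: mult_smult_left mult_smult_right X)
  qed
  ultimately have "gcong m ?B (lpoly (tors a \<omega>)) (smult \<kappa>0 (lpoly ?Y ^ (CARD('f) ^ i)))" by (simp add: card0)
  then have "absC (coeff (lpoly (tors a \<omega>) - smult \<kappa>0 (lpoly ?Y ^ (CARD('f) ^ i))) (CARD('f) ^ (k + i))) * m ^ CARD('f) ^ (k + i) < ?B"
    unfolding gcong_def by blast
  moreover have Ysub: "fsub ?Y"
    using fsub_fspan[of h "\<lambda>l. \<sigma> * \<tau> l"] by (simp add: fspan_eq fcomb_mult image_image)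
  ultimately have main: "absC (qcoeff (tors a \<omega>) (k + i) - \<kappa>0 * qcoeff ?Y k ^ (CARD('f) ^ i)) * m ^ CARD('f) ^ (k + i) < ?B"
    by (simp add: coeff_lpoly_power) (simp add: qcoeff_def)
  have qcY: "qcoeff ?Y k = qcoeff (fspan h \<tau>) k / \<sigma> ^ (CARD('f) ^ k - 1)"
    unfolding qcoeff_def using \<open>\<sigma> \<noteq> 0\<close> by (intro coeff_lpoly_scale) simp_all
  show "absC (qcoeff (tors a \<omega>) (k + i)) * m ^ CARD('f) ^ (k + i) < ?B" if "qcoeff (fspan h \<tau>) k = 0"
    using main that by (simp add: qcY power_0_left)
  show "absC (qcoeff (tors a \<omega>) (k + i)) * m ^ CARD('f) ^ (k + i) = ?B" if one: "absC (qcoeff (fspan h \<tau>) k) = 1"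
  proof -
    have \<kappa>0: "absC \<kappa>0 * m ^ card E0 = ?B"
    proof -
      have "absC \<kappa>0 = (\<Prod>v\<in>E0 - {0}. inverse (absC (?e v)))" unfolding \<kappa>0_def by (simp only: absC_prod absC_uminus absC_inverse)
      moreover have "m ^ card E0 = m * (\<Prod>v\<in>E0 - {0}. m)"
      proof -
        have "(\<Prod>v\<in>E0 - {0}. m) = m ^ (card E0 - 1)" using fin zero by simp
        then show ?thesis using cardS by (metis power_Suc)
      qed
      moreover have "(\<Prod>v\<in>E0 - {0}. m / absC (?e v)) = (\<Prod>v\<in>E0 - {0}. m) * (\<Prod>v\<in>E0 - {0}. inverse (absC (?e v)))"
        by (simp only: divide_inverse prod.distrib)
      ultimately show ?thesis by simp
    qed
    \<comment> \<open>The first part cancels the power of \<sigma> that comes from scaling the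
      residual space; the second is \<open>card E0\<close>, as needed for \<kappa>0.\<close>
    have exp: "CARD('f) ^ (k + i) = (CARD('f) ^ k - 1) * CARD('f) ^ i + CARD('f) ^ i"
      by (simp add: power_add diff_mult_distrib)
    have mp: "m ^ CARD('f) ^ (k + i) = (m ^ (CARD('f) ^ k - 1)) ^ CARD('f) ^ i * m ^ CARD('f) ^ i"
      by (subst exp) (simp only: power_add power_mult)
    have "absC (\<kappa>0 * qcoeff ?Y k ^ (CARD('f) ^ i)) * m ^ CARD('f) ^ (k + i) = absC \<kappa>0 * m ^ card E0"
      unfolding mp using one \<sigma> m
      by (simp add: qcY abs_mult card0 power_divide)
    then have "absC (\<kappa>0 * qcoeff ?Y k ^ (CARD('f) ^ i)) * m ^ CARD('f) ^ (k + i) = ?B" using \<kappa>0 by simp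
    with main have "absC (qcoeff (tors a \<omega>) (k + i) - \<kappa>0 * qcoeff ?Y k ^ (CARD('f) ^ i)) < absC (\<kappa>0 * qcoeff ?Y k ^ (CARD('f) ^ i))"
      using m by (metis mult_less_cancel_right_pos zero_less_power)
    then have "absC (qcoeff (tors a \<omega>) (k + i)) = absC (\<kappa>0 * qcoeff ?Y k ^ (CARD('f) ^ i))" by (rule absC_near)
    then show ?thesis using \<open>absC (\<kappa>0 * qcoeff ?Y k ^ (CARD('f) ^ i)) * m ^ CARD('f) ^ (k + i) = ?B\<close> by simp
  qed
qed

end

section \<open>Minimal representatives\<close>

context C_infty
begin

lemma finite_A_vecs_ball:
  fixes \<nu> :: "'f fls ^ 'r::finite \<Rightarrow> real"
  assumes "norm_geq \<kappa> \<nu>" "s < \<kappa> * real CARD('f) ^ n"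
  shows "{b \<in> A_vecs. \<nu> b \<le> s} \<subseteq> A_box n" "finite {b \<in> A_vecs. \<nu> b \<le> s}"
proof -
  have k: "0 < \<kappa>" using assms by (simp add: norm_geq_def)
  show sub: "{b \<in> A_vecs. \<nu> b \<le> s} \<subseteq> A_box n"
  proof
    fix b :: "'f fls ^ 'r" assume b: "b \<in> {b \<in> A_vecs. \<nu> b \<le> s}"
    have "absK (b $ i) < real CARD('f) ^ n" for i
    proof -
      have "\<kappa> * absK (b $ i) \<le> \<nu> b" using assms by (simp add: norm_geq_def)
      then have "\<kappa> * absK (b $ i) < \<kappa> * real CARD('f) ^ n" using assms(2) b by simp
      then show ?thesis using k by simp
    qed
    then show "b \<in> A_box n" using b by (simp add: A_box_def)
  qed
  show "finite {b \<in> A_vecs. \<nu> b \<le> s}" using sub finite_A_box by (rule finite_subset)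
qed

lemma finite_A_vecs_ball':
  assumes "norm_geq \<kappa> \<nu>"
  shows "finite {b \<in> A_vecs. \<nu> b \<le> s}"
proof -
  have "0 < \<kappa>" using assms by (simp add: norm_geq_def)
  then obtain n where "s < \<kappa> * real CARD('f) ^ n" using large_radius by blast
  then show ?thesis by (rule finite_A_vecs_ball(2)[OF assms])
qed

text \<open>Only lattice vectors of norm at most \<nu> v have to be compared, and these are finite
  in number. At minimal vectors the size of the exponential is a function of the norm
  (\<open>exp_ev_abs_minimal\<close>).\<close>

lemma minimal_representative:
  fixes \<nu> :: "'f fls ^ 'r::finite \<Rightarrow> real"
  assumes kn: "norm_geq \<kappa> \<nu>"
  shows "\<exists>u. u - v \<in> A_vecs \<and> (\<forall>b\<in>A_vecs. \<nu> u \<le> \<nu> (u - b)) \<and> \<nu> u \<le> \<nu> v"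
proof -
  note sn = norm_geq_seminorm[OF kn]
  let ?S = "{b \<in> A_vecs. \<nu> b \<le> \<nu> v}"
  have fin: "finite ?S" by (rule finite_A_vecs_ball'[OF kn])
  have "0 \<in> ?S" using sn seminorm_nonneg[OF sn] by simp
  then have ne: "?S \<noteq> {}" by blast
  let ?Z = "(\<lambda>b. \<nu> (v - b)) ` ?S"
  have "Min ?Z \<in> ?Z" using fin ne by (intro Min_in) auto
  then obtain b where b: "b \<in> ?S" "\<nu> (v - b) = Min ?Z" by auto
  have min: "\<nu> (v - b) \<le> \<nu> (v - b')" if "b' \<in> ?S" for b'
    unfolding b(2) using fin that by (intro Min_le) auto
  have le: "\<nu> (v - b) \<le> \<nu> v" using min[OF \<open>0 \<in> ?S\<close>] by simp
  show ?thesis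
  proof (intro exI[of _ "v - b"] conjI ballI)
    show "v - b - v \<in> A_vecs" using b(1) A_vecs_uminus[of b] by simp
    show "\<nu> (v - b) \<le> \<nu> v" by (rule le)
    fix b' :: "'f fls ^ 'r" assume b': "b' \<in> A_vecs"
    show "\<nu> (v - b) \<le> \<nu> (v - b - b')"
    proof (cases "\<nu> (b + b') \<le> \<nu> v")
      case True
      then have "b + b' \<in> ?S" using b(1) b' A_vecs_add by auto
      then show ?thesis using min[of "b + b'"] by (simp add: diff_diff_add)
    next
      case False
      have "(v - b - b') - - (b + b') = v" by simp
      then have "\<nu> ((v - b - b') - - (b + b')) < \<nu> (- (b + b'))"
        using False seminorm_uminus[OF sn, of "b + b'"] by (simp only: not_le)
      from seminorm_near[OF sn this] have "\<nu> (v - b - b') = \<nu> (b + b')"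
        using seminorm_uminus[OF sn, of "b + b'"] by simp
      then show ?thesis using False le by simp
    qed
  qed
qed

text \<open>The absolute value of the exponential at a vector of norm s that is minimal in its
  coset, and an upper bound at other vectors of norm s, once the box is large enough.\<close>

definition \<Psi> :: "('f fls ^ 'r::finite \<Rightarrow> real) \<Rightarrow> nat \<Rightarrow> real \<Rightarrow> real" where
  "\<Psi> \<nu> n s = s * (\<Prod>b\<in>A_box n - {0}. max 1 (s / \<nu> b))"

lemma \<Psi>_strict_mono:
  fixes \<nu> :: "'f fls ^ 'r::finite \<Rightarrow> real"
  assumes kn: "norm_geq \<kappa> \<nu>" and s: "0 \<le> s" "s < t"
  shows "\<Psi> \<nu> n s < \<Psi> \<nu> n t"
proof -
  have pos: "0 < \<nu> b" if "b \<in> A_box n - {0}" for b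
    using norm_geq_pos[OF kn] that by simp
  have "(\<Prod>b\<in>A_box n - {0}. max 1 (s / \<nu> b)) \<le> (\<Prod>b\<in>A_box n - {0}. max 1 (t / \<nu> b))"
  proof (rule prod_mono)
    fix b :: "'f fls ^ 'r" assume "b \<in> A_box n - {0}"
    then have "s / \<nu> b \<le> t / \<nu> b" using pos s by (intro divide_right_mono) (auto simp: order_less_imp_le)
    then show "0 \<le> max 1 (s / \<nu> b) \<and> max 1 (s / \<nu> b) \<le> max 1 (t / \<nu> b)" by auto
  qed
  moreover have "1 \<le> (\<Prod>b\<in>A_box n - {0}. max 1 (t / \<nu> b))" by (rule prod_ge_1) simp
  ultimately have "s * (\<Prod>b\<in>A_box n - {0}. max 1 (s / \<nu> b)) \<le> s * (\<Prod>b\<in>A_box n - {0}. max 1 (t / \<nu> b))"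
    "s * (\<Prod>b\<in>A_box n - {0}. max 1 (t / \<nu> b)) < t * (\<Prod>b\<in>A_box n - {0}. max 1 (t / \<nu> b))"
    using s by (auto intro: mult_left_mono mult_strict_right_mono)
  then show ?thesis by (simp add: \<Psi>_def)
qed

lemma exp_ev_abs_le:
  fixes \<nu> :: "'f fls ^ 'r::finite \<Rightarrow> real"
  assumes kn: "norm_geq \<kappa> \<nu>" and iso: "iso \<nu> \<omega>" and n: "\<nu> u < \<kappa> * real CARD('f) ^ n"
  shows "absC (exp_ev \<omega> u) \<le> \<Psi> \<nu> n (\<nu> u)"
  unfolding lexp_abs_formula[OF assms] \<Psi>_def
proof (intro mult_left_mono prod_mono conjI)
  note sn = norm_geq_seminorm[OF kn]
  fix b :: "'f fls ^ 'r" assume "b \<in> A_box n - {0}"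
  then have b: "0 < \<nu> b" using norm_geq_pos[OF kn] by simp
  show "0 \<le> \<nu> (b - u) / \<nu> b" using b seminorm_nonneg[OF sn] by simp
  have "\<nu> (b - u) \<le> max (\<nu> b) (\<nu> u)" by (rule seminorm_diff[OF sn])
  then have "\<nu> (b - u) / \<nu> b \<le> max (\<nu> b) (\<nu> u) / \<nu> b" using b by (intro divide_right_mono) auto
  also have "\<dots> = max 1 (\<nu> u / \<nu> b)" using b by (simp add: max_def)
  finally show "\<nu> (b - u) / \<nu> b \<le> max 1 (\<nu> u / \<nu> b)" .
qed (rule seminorm_nonneg[OF norm_geq_seminorm[OF kn]])

lemma exp_ev_abs_minimal:
  fixes \<nu> :: "'f fls ^ 'r::finite \<Rightarrow> real"
  assumes kn: "norm_geq \<kappa> \<nu>" and iso: "iso \<nu> \<omega>" and n: "\<nu> u < \<kappa> * real CARD('f) ^ n"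
    and min: "\<forall>b\<in>A_vecs. \<nu> u \<le> \<nu> (u - b)"
  shows "absC (exp_ev \<omega> u) = \<Psi> \<nu> n (\<nu> u)"
proof -
  note sn = norm_geq_seminorm[OF kn]
  have "(\<Prod>b\<in>A_box n - {0}. \<nu> (b - u) / \<nu> b) = (\<Prod>b\<in>A_box n - {0}. max 1 (\<nu> u / \<nu> b))"
  proof (rule prod.cong)
    fix b :: "'f fls ^ 'r" assume b: "b \<in> A_box n - {0}"
    then have pos: "0 < \<nu> b" using norm_geq_pos[OF kn] by simp
    have "\<nu> u \<le> \<nu> (- u + b)"
      using min b seminorm_commute[OF sn, of u b] by (auto simp: A_box_def add.commute)
    then have "\<nu> (- u + b) = max (\<nu> (- u)) (\<nu> b)"
      by (intro seminorm_add_eq_max[OF sn]) (simp add: seminorm_uminus[OF sn])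
    then have "\<nu> (b - u) = max (\<nu> u) (\<nu> b)" by (simp add: seminorm_uminus[OF sn])
    then show "\<nu> (b - u) / \<nu> b = max 1 (\<nu> u / \<nu> b)" using pos by (auto simp: max_def)
  qed simp
  then show ?thesis unfolding lexp_abs_formula[OF kn iso n] \<Psi>_def by simp
qed

lemma exp_ev_translate:
  assumes "good \<kappa> \<omega>" "u - v \<in> A_vecs"
  shows "exp_ev \<omega> u = exp_ev \<omega> v"
  using lexp_translate[OF assms(1,2), of v] by simp

section \<open>Orthogonality from residual independence\<close>

text \<open>From residual independence at radius \<rho> to orthogonality over F((1/T)). After
  division by the largest coefficient, either the part in \<open>W\<close> dominates, or the
  coefficients can be rounded to constants and the part in \<open>W\<close> to an element of
  \<open>L\<close>: the error is less than \<rho>, the rounded vector has norm at least \<rho>.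
  Stated for seminorms, it applies to \<nu> and to the norm induced by \<omega> alike.\<close>

lemma orth_combination:
  fixes N :: "'f fls ^ 'r::finite \<Rightarrow> real"
  assumes sn: "seminorm N" and \<rho>: "0 < \<rho>" and W: "vec.subspace W"
    and L: "\<And>w. w \<in> W \<Longrightarrow> N w \<le> \<rho> \<Longrightarrow> \<exists>b\<in>L. N (w - b) < \<rho>"
    and U: "\<And>l. l < h \<Longrightarrow> N (U l) \<le> \<rho>"
    and indep: "\<And>\<gamma> b. (\<exists>l<h. \<gamma> l \<noteq> 0) \<Longrightarrow> b \<in> L \<Longrightarrow> \<rho> \<le> N (kcomb h U \<gamma> + b)"
    and w: "w \<in> W"
  shows "N ((\<Sum>l<h. c l *s U l) + w) = max (Max (insert 0 ((\<lambda>l. absK (c l)) ` {..<h})) * \<rho>) (N w)"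
proof -
  let ?M = "Max (insert 0 ((\<lambda>l. absK (c l)) ` {..<h}))"
  have le: "absK (c l) \<le> ?M" if "l < h" for l using that by (intro Max_ge) auto
  show ?thesis
  proof (cases "\<exists>l<h. c l \<noteq> 0")
    case False
    then have "insert 0 ((\<lambda>l. absK (c l)) ` {..<h}) = {0}" by auto
    then have "?M = 0" by (simp only: Max_singleton)
    moreover have "(\<Sum>l<h. c l *s U l) = 0" using False by (intro sum.neutral) simp
    ultimately show ?thesis using seminorm_nonneg[OF sn, of w] by (simp only: mult_zero_left add_0 max_absorb2)
  next
    case True
    have "?M \<in> insert 0 ((\<lambda>l. absK (c l)) ` {..<h})" by (rule Max_in) auto
    moreover have "0 < ?M" using True le absK_pos_iff by (meson less_le_trans)
    ultimately obtain l0 where l0: "l0 < h" "absK (c l0) = ?M" by auto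
    have c0: "c l0 \<noteq> 0" using l0 \<open>0 < ?M\<close> by auto
    define c' where "c' l = c l / c l0" for l
    define w' where "w' = inverse (c l0) *s w"
    have w': "w' \<in> W" unfolding w'_def by (rule vec.subspace_scale[OF W w])
    have c'le: "absK (c' l) \<le> 1" if "l < h" for l
      using le[OF that] l0 \<open>0 < ?M\<close> by (simp add: c'_def)
    have eq: "(\<Sum>l<h. c l *s U l) + w = c l0 *s ((\<Sum>l<h. c' l *s U l) + w')"
      using c0 by (simp add: c'_def w'_def vec.scale_right_distrib vec.scale_sum_right)
    have "w = c l0 *s w'" using c0 by (simp add: w'_def)
    then have Nw: "N w = ?M * N w'" using seminorm_scale[OF sn, of "c l0" w'] l0(2) by simp
    have S: "N (\<Sum>l<h. c' l *s U l) \<le> \<rho>"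
    proof (rule seminorm_sum_le[OF sn])
      fix l assume l: "l \<in> {..<h}"
      have "absK (c' l) * N (U l) \<le> 1 * \<rho>"
        using c'le[of l] U[of l] l seminorm_nonneg[OF sn] by (intro mult_mono) auto
      then show "N (c' l *s U l) \<le> \<rho>" by (simp add: seminorm_scale[OF sn])
    qed (use \<rho> in simp)
    have "N ((\<Sum>l<h. c' l *s U l) + w') = max \<rho> (N w')"
    proof (cases "N w' \<le> \<rho>")
      case False
      then have "N (((\<Sum>l<h. c' l *s U l) + w') - w') < N w'" using S by simp
      then have "N ((\<Sum>l<h. c' l *s U l) + w') = N w'" by (rule seminorm_near[OF sn])
      then show ?thesis using False by simp
    next
      case True
      then obtain b where b: "b \<in> L" "N (w' - b) < \<rho>" using L w' by blast
      have "\<exists>\<gamma>. absK (c' l - fls_const \<gamma>) < 1" if l: "l < h" for l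
      proof -
        obtain p where p: "absK (c' l - A_to_K p) < 1" using polynomial_part by blast
        have "absK (c' l - (c' l - A_to_K p)) \<le> 1"
          using absK_diff[of "c' l" "c' l - A_to_K p"] c'le[OF l] p by simp
        then have A: "absK (A_to_K p) \<le> 1" by simp
        have "degree p = 0"
        proof (rule ccontr)
          assume d: "degree p \<noteq> 0"
          then have "p \<noteq> 0" by auto
          then have "absK (A_to_K p) = real CARD('f) ^ degree p" by (rule absK_A_to_K)
          moreover have "1 < real CARD('f) ^ degree p" using d by (intro one_less_power) simp_all
          ultimately show False using A by simp
        qed
        then obtain \<gamma> where "p = [:\<gamma>:]" by (rule degree_eq_zeroE)
        then show ?thesis using p by (auto simp: A_to_K_const)
      qed
      then obtain \<gamma> where \<gamma>: "\<And>l. l < h \<Longrightarrow> absK (c' l - fls_const (\<gamma> l)) < 1" by metis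
      \<comment> \<open>The coefficient at \<open>l0\<close> is 1 after the division, so it cannot
        be rounded to 0.\<close>
      have "\<gamma> l0 \<noteq> 0" using \<gamma>[OF l0(1)] c0 by (auto simp: c'_def)
      then have ge: "\<rho> \<le> N (kcomb h U \<gamma> + b)" using indep b(1) l0(1) by blast
      have "N ((\<Sum>l<h. (c' l - fls_const (\<gamma> l)) *s U l)) < \<rho>"
      proof (rule seminorm_sum_less[OF sn _ \<rho>])
        fix l assume "l \<in> {..<h}"
        then have l: "l < h" by simp
        have "absK (c' l - fls_const (\<gamma> l)) * N (U l) \<le> absK (c' l - fls_const (\<gamma> l)) * \<rho>"
          using U[OF l] by (intro mult_left_mono) simp_all
        also have "\<dots> < 1 * \<rho>" using \<gamma>[OF l] \<rho> by (intro mult_strict_right_mono)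
        finally show "N ((c' l - fls_const (\<gamma> l)) *s U l) < \<rho>" unfolding seminorm_scale[OF sn] by simp
      qed
      then have small: "N ((\<Sum>l<h. (c' l - fls_const (\<gamma> l)) *s U l) + (w' - b)) < \<rho>"
        using b(2) seminorm_add[OF sn, of "\<Sum>l<h. (c' l - fls_const (\<gamma> l)) *s U l" "w' - b"] by simp
      have split: "(\<Sum>l<h. (c' l - fls_const (\<gamma> l)) *s U l) + (w' - b) = ((\<Sum>l<h. c' l *s U l) + w') - (kcomb h U \<gamma> + b)"
        by (simp add: kcomb_def vec.scale_left_diff_distrib sum_subtractf algebra_simps)
      have "N (((\<Sum>l<h. c' l *s U l) + w') - (kcomb h U \<gamma> + b)) < N (kcomb h U \<gamma> + b)"
        using small ge unfolding split by linarith
      then have "N ((\<Sum>l<h. c' l *s U l) + w') = N (kcomb h U \<gamma> + b)" by (rule seminorm_near[OF sn])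
      then have "\<rho> \<le> N ((\<Sum>l<h. c' l *s U l) + w')" using ge by simp
      moreover have "N ((\<Sum>l<h. c' l *s U l) + w') \<le> \<rho>"
        using seminorm_add[OF sn, of "\<Sum>l<h. c' l *s U l" w'] S True by simp
      ultimately show ?thesis using True by simp
    qed
    then show ?thesis
      unfolding eq seminorm_scale[OF sn] Nw l0(2) using \<open>0 < ?M\<close> by (simp add: max_mult_distrib_left)
  qed
qed

text \<open>Rounding the coefficients with respect to short lattice vectors to polynomials costs
  less than \<rho>, and the result is again a short lattice vector. This supplies assumption
  \<open>L\<close> of \<open>orth_combination\<close>.\<close>

lemma lattice_span_approx:
  fixes \<nu> :: "'f fls ^ 'r::finite \<Rightarrow> real"
  assumes kn: "norm_geq \<kappa> \<nu>" and \<rho>: "0 < \<rho>" and w: "w \<in> vec.span {b \<in> A_vecs. \<nu> b \<le> \<rho>}" "\<nu> w \<le> \<rho>"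
  shows "\<exists>b\<in>{b \<in> A_vecs. \<nu> b \<le> \<rho>}. \<nu> (w - b) < \<rho>"
proof -
  note sn = norm_geq_seminorm[OF kn]
  let ?L = "{b \<in> A_vecs. \<nu> b \<le> \<rho>}"
  have fin: "finite ?L" by (rule finite_A_vecs_ball'[OF kn])
  then obtain c where c: "w = (\<Sum>b\<in>?L. c b *s b)" using w(1) vec.span_finite[OF fin] by auto
  have "\<forall>b. \<exists>p. absK (c b - A_to_K p) < 1" using polynomial_part by blast
  then obtain p where p: "\<And>b. absK (c b - A_to_K (p b)) < 1" by metis
  define b0 where "b0 = (\<Sum>b\<in>?L. A_to_K (p b) *s b)"
  have "(\<Sum>b\<in>S. A_to_K (p b) *s b) \<in> A_vecs" if "S \<subseteq> A_vecs" for S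
    using that by (induction S rule: infinite_finite_induct) (auto intro: A_vecs_add A_vecs_scale)
  then have b0L: "b0 \<in> A_vecs" by (auto simp: b0_def)
  have "w - b0 = (\<Sum>b\<in>?L. (c b - A_to_K (p b)) *s b)"
    by (simp add: c b0_def vec.scale_left_diff_distrib sum_subtractf)
  also have "\<nu> \<dots> < \<rho>"
  proof (rule seminorm_sum_less[OF sn _ \<rho>])
    fix b :: "'f fls ^ 'r" assume b: "b \<in> ?L"
    have "absK (c b - A_to_K (p b)) * \<nu> b \<le> absK (c b - A_to_K (p b)) * \<rho>" using b by (intro mult_left_mono) simp_all
    also have "\<dots> < 1 * \<rho>" using p \<rho> by (intro mult_strict_right_mono)
    finally show "\<nu> ((c b - A_to_K (p b)) *s b) < \<rho>" unfolding seminorm_scale[OF sn] by simp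
  qed
  finally have less: "\<nu> (w - b0) < \<rho>" .
  have "\<nu> (w - (w - b0)) \<le> \<rho>" using seminorm_diff[OF sn, of w "w - b0"] w(2) less by simp
  then have "b0 \<in> ?L" using b0L by simp
  then show ?thesis using less by blast
qed

section \<open>The exponential at the critical radius\<close>

lemma fsub_vec_A_vecs_ball:
  assumes "norm_geq \<kappa> \<nu>" "0 \<le> \<rho>"
  shows "fsub_vec {b \<in> A_vecs. \<nu> b \<le> \<rho>}"
  unfolding fsub_vec_def
proof (intro conjI ballI allI)
  note sn = norm_geq_seminorm[OF assms(1)]
  show "finite {b \<in> A_vecs. \<nu> b \<le> \<rho>}" by (rule finite_A_vecs_ball'[OF assms(1)])
  show "0 \<in> {b \<in> A_vecs. \<nu> b \<le> \<rho>}" using assms sn by simp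
  show "x + y \<in> {b \<in> A_vecs. \<nu> b \<le> \<rho>}" if "x \<in> {b \<in> A_vecs. \<nu> b \<le> \<rho>}" "y \<in> {b \<in> A_vecs. \<nu> b \<le> \<rho>}" for x y
    using that A_vecs_add seminorm_add[OF sn, of x y] by auto
  show "fls_const c *s x \<in> {b \<in> A_vecs. \<nu> b \<le> \<rho>}" if "x \<in> {b \<in> A_vecs. \<nu> b \<le> \<rho>}" for c x
    using that A_vecs_const assms(2) seminorm_const[OF sn] by auto
qed

lemma fexp_abs:
  assumes "good \<kappa> \<omega>" "0 \<in> S"
  shows "absC (fexp (ev \<omega> ` S) z) = absC z * (\<Prod>b\<in>S - {0}. absC (1 - z / ev \<omega> b))"
  using fexp_image_eq(1)[OF good_inj[OF assms(1)] assms(2), of z] by (simp add: abs_mult absC_prod)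

text \<open>\<open>\<mu>\<close> is the absolute value that the exponential takes at minimal vectors of norm \<open>\<rho>\<close>.\<close>

context
  fixes \<nu> :: "'f fls ^ 'r::finite \<Rightarrow> real" and \<kappa> \<rho> \<mu> :: real and L
  assumes kn: "norm_geq \<kappa> \<nu>" and \<rho>: "0 < \<rho>" and L: "L = {b \<in> A_vecs. \<nu> b \<le> \<rho>}"
    and \<mu>: "\<mu> = \<rho> * (\<Prod>b\<in>L - {0}. \<rho> / \<nu> b)"
begin

text \<open>Box vectors longer than \<rho> contribute the factor 1, so the box may be replaced by
  \<open>L\<close>.\<close>

lemma \<Psi>_eq: "\<rho> < \<kappa> * real CARD('f) ^ n \<Longrightarrow> \<Psi> \<nu> n \<rho> = \<mu>"
proof -
  assume n: "\<rho> < \<kappa> * real CARD('f) ^ n"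
  have "(\<Prod>b\<in>A_box n - {0}. max 1 (\<rho> / \<nu> b)) = (\<Prod>b\<in>L - {0}. max 1 (\<rho> / \<nu> b))"
  proof (rule prod.mono_neutral_right)
    show "finite (A_box n - {0})" using finite_A_box by simp
    show "L - {0} \<subseteq> A_box n - {0}" using finite_A_vecs_ball(1)[OF kn n] by (auto simp: L)
    show "\<forall>b\<in>A_box n - {0} - (L - {0}). max 1 (\<rho> / \<nu> b) = 1"
      using norm_geq_pos[OF kn] by (auto simp: L A_box_def max_def divide_le_eq)
  qed
  also have "\<dots> = (\<Prod>b\<in>L - {0}. \<rho> / \<nu> b)"
    using norm_geq_pos[OF kn] by (intro prod.cong) (auto simp: L max_def le_divide_eq)
  finally show ?thesis by (simp add: \<Psi>_def \<mu>)
qed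

lemma \<mu>_pos: "0 < \<mu>"
  unfolding \<mu> using \<rho> norm_geq_pos[OF kn] by (intro mult_pos_pos prod_pos) auto

text \<open>The factors are compared with \<rho> / \<nu> b one by one. The two strict cases force
  |x| = \<rho> whenever the value has size \<mu>.\<close>

lemma critical_fexp:
  assumes iso: "iso \<nu> \<omega>"
  shows "absC x \<le> \<rho> \<Longrightarrow> absC (fexp (ev \<omega> ` L) x) \<le> \<mu>"
    and "absC x < \<rho> \<Longrightarrow> absC (fexp (ev \<omega> ` L) x) < \<mu>"
    and "\<rho> < absC x \<Longrightarrow> \<mu> < absC (fexp (ev \<omega> ` L) x)"
proof -
  have good: "good \<kappa> \<omega>" by (rule iso_good[OF kn iso])
  have L0: "0 \<in> L" using \<rho> norm_geq_seminorm[OF kn] by (simp add: L)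
  have nu: "absC (ev \<omega> b) = \<nu> b" for b using iso by (simp add: iso_def)
  note abs = fexp_abs[OF good L0, of x]
  have pos: "0 < \<nu> b" "\<nu> b \<le> \<rho>" if "b \<in> L - {0}" for b using that norm_geq_pos[OF kn] by (auto simp: L)
  have ppos: "0 < (\<Prod>b\<in>L - {0}. \<rho> / \<nu> b)" using pos \<rho> by (intro prod_pos) simp
  have up: "(\<Prod>b\<in>L - {0}. absC (1 - x / ev \<omega> b)) \<le> (\<Prod>b\<in>L - {0}. \<rho> / \<nu> b)" if "absC x \<le> \<rho>"
  proof (intro prod_mono conjI)
    fix b :: "'f fls ^ 'r" assume b: "b \<in> L - {0}"
    have "1 \<le> \<rho> / \<nu> b" using pos[OF b] by (simp add: le_divide_eq)
    moreover have "absC (x / ev \<omega> b) \<le> \<rho> / \<nu> b" using pos[OF b] that by (simp add: nu divide_right_mono)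
    ultimately show "absC (1 - x / ev \<omega> b) \<le> \<rho> / \<nu> b" by (intro absC_diff_le) simp_all
  qed simp
  show "absC (fexp (ev \<omega> ` L) x) \<le> \<mu>" if "absC x \<le> \<rho>"
    unfolding abs \<mu> using up that \<rho> by (intro mult_mono) (auto intro: prod_nonneg)
  show "absC (fexp (ev \<omega> ` L) x) < \<mu>" if x: "absC x < \<rho>"
  proof -
    have "absC x * (\<Prod>b\<in>L - {0}. absC (1 - x / ev \<omega> b)) \<le> absC x * (\<Prod>b\<in>L - {0}. \<rho> / \<nu> b)"
      using up x by (intro mult_left_mono) auto
    also have "\<dots> < \<mu>" unfolding \<mu> using x ppos by (rule mult_strict_right_mono)
    finally show ?thesis unfolding abs .
  qed
  show "\<mu> < absC (fexp (ev \<omega> ` L) x)" if x: "\<rho> < absC x"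
  proof -
    have "(\<Prod>b\<in>L - {0}. \<rho> / \<nu> b) \<le> (\<Prod>b\<in>L - {0}. absC (1 - x / ev \<omega> b))"
    proof (intro prod_mono conjI)
      fix b :: "'f fls ^ 'r" assume b: "b \<in> L - {0}"
      show "0 \<le> \<rho> / \<nu> b" using pos[OF b] \<rho> by simp
      have gt: "absC (1 :: 'c) < absC (x / ev \<omega> b)" using pos[OF b] x by (simp add: nu less_divide_eq)
      then have "absC (1 - x / ev \<omega> b) = absC x / \<nu> b" using absC_diff_eq[OF gt] by (simp add: nu)
      also have "\<rho> / \<nu> b \<le> \<dots>" using pos[OF b] x by (intro divide_right_mono) auto
      finally show "\<rho> / \<nu> b \<le> absC (1 - x / ev \<omega> b)" .
    qed
    then have "absC x * (\<Prod>b\<in>L - {0}. \<rho> / \<nu> b) \<le> absC x * (\<Prod>b\<in>L - {0}. absC (1 - x / ev \<omega> b))"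
      by (intro mult_left_mono) auto
    moreover have "\<mu> < absC x * (\<Prod>b\<in>L - {0}. \<rho> / \<nu> b)"
      unfolding \<mu> using x ppos by (rule mult_strict_right_mono)
    ultimately show ?thesis unfolding abs by linarith
  qed
qed

text \<open>The lattice vectors outside \<open>L\<close> have norm at least some R > \<rho>, so the
  relative error is at most \<rho> / R < 1. Hence \<open>L\<close> alone determines the residue of
  the exponential at size \<mu>.\<close>

lemma critical_lexp:
  assumes iso: "iso \<nu> \<omega>" and x: "absC x \<le> \<rho>"
  shows "absC (lexp \<omega> x - fexp (ev \<omega> ` L) x) < \<mu>"
proof -
  have good: "good \<kappa> \<omega>" by (rule iso_good[OF kn iso])
  have nu: "absC (ev \<omega> b) = \<nu> b" for b using iso by (simp add: iso_def)
  have finL: "finite L" unfolding L by (rule finite_A_vecs_ball'[OF kn])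
  let ?S = "{b \<in> A_vecs. \<nu> b \<le> \<rho> + 1} - L"
  have fin: "finite ?S" using finite_A_vecs_ball'[OF kn, of "\<rho> + 1"] by simp
  \<comment> \<open>The cap \<rho> + 1 makes this a minimum over a finite nonempty set.\<close>
  define R where "R = Min (insert (\<rho> + 1) (\<nu> ` ?S))"
  have "R \<in> insert (\<rho> + 1) (\<nu> ` ?S)" unfolding R_def using fin by (intro Min_in) auto
  then have R: "\<rho> < R" by (auto simp: L)
  have far: "R \<le> absC (ev \<omega> b)" if "b \<in> A_vecs - L" for b
  proof (cases "\<nu> b \<le> \<rho> + 1")
    case True
    then show ?thesis unfolding R_def nu using that fin by (intro Min_le) auto
  next
    case False
    have "R \<le> \<rho> + 1" unfolding R_def using fin by (intro Min_le) auto
    then show ?thesis using False nu by simp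
  qed
  have "absC (lexp \<omega> x - fexp (ev \<omega> ` L) x) \<le> absC (fexp (ev \<omega> ` L) x) * (absC x / R)"
  proof (rule lexp_approx[OF good finL])
    show "0 \<in> L" using \<rho> norm_geq_seminorm[OF kn] by (simp add: L)
  qed (use L far R \<rho> x in auto)
  also have "\<dots> \<le> \<mu> * (absC x / R)"
    using critical_fexp(1)[OF iso x] R \<rho> by (intro mult_right_mono) auto
  also have "\<dots> < \<mu> * 1"
    using \<mu>_pos R \<rho> x by (intro mult_strict_left_mono) (auto simp: divide_less_eq)
  finally show ?thesis by simp
qed

end

end

section \<open>Zeros in a one-parameter family\<close>

context C_infty
begin

lemma ratfun_cong: "ratfun X g \<Longrightarrow> (\<And>t. t \<in> X \<Longrightarrow> f t = g t) \<Longrightarrow> ratfun X f"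
  unfolding ratfun_def by metis

text \<open>\<open>rational_limit_zero\<close> is applied to the parameters for which the point of
  the line is still isometric. On this set the torsion points have constant absolute values, which
  makes their inverses converge uniformly.\<close>

lemma zero_in_family:
  fixes \<nu> :: "'f fls ^ 'r::finite \<Rightarrow> real"
  assumes kn: "norm_geq \<kappa> \<nu>" and a: "a \<noteq> 0"
    and t: "iso \<nu> (shift \<omega> t0 p)" "iso \<nu> (shift \<omega> t1 p)"
    and less: "absC (qcoeff (tors a (shift \<omega> t0 p)) k) < absC (qcoeff (tors a (shift \<omega> t1 p)) k)"
  shows "\<exists>t. iso \<nu> (shift \<omega> t p) \<and> qcoeff (tors a (shift \<omega> t p)) k = 0"
proof -
  define X where "X = {t. iso \<nu> (shift \<omega> t p)}"
  let ?w = "\<lambda>t. shift \<omega> t p"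
  have k: "0 < \<kappa>" using kn by (simp add: norm_geq_def)
  have good: "good \<kappa> (?w t)" if "t \<in> X" for t using that iso_good[OF kn] by (simp add: X_def)
  have tX: "t0 \<in> X" "t1 \<in> X" using t by (simp_all add: X_def)
  have nu: "absC (ev (?w t) v) = \<nu> v" if "t \<in> X" for t v using that by (simp add: X_def iso_def)
  \<comment> \<open>For s outside, some u has the wrong absolute value at s and the right one at
    every t in \<open>X\<close>. The difference of the two values is t - s times a constant, and its
    absolute value is the larger of the two.\<close>
  have outside: "\<exists>c. \<forall>t\<in>X. absC (t - s) = c" if s: "s \<notin> X" for s
  proof -
    obtain u where u: "absC (ev (?w s) u) \<noteq> \<nu> u" using s unfolding X_def iso_def by blast
    let ?d = "\<iota> (dotp p u)"
    have diff: "(t - s) * ?d = ev (?w t) u - ev (?w s) u" for t by (simp add: ev_shift algebra_simps)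
    have d: "?d \<noteq> 0"
    proof
      assume "?d = 0"
      then have "ev (?w s) u = ev (?w t0) u" by (simp add: ev_shift)
      then show False using u nu[OF tX(1)] by simp
    qed
    have "absC (t - s) = max (\<nu> u) (absC (ev (?w s) u)) / absC ?d" if "t \<in> X" for t
    proof -
      have "absC (ev (?w t) u - ev (?w s) u) = max (\<nu> u) (absC (ev (?w s) u))"
        using u nu[OF that, of u] absC_diff_eq[of "ev (?w t) u" "ev (?w s) u"] absC_diff_eq[of "ev (?w s) u" "ev (?w t) u"]
        by (cases "absC (ev (?w s) u) < \<nu> u") (auto simp: absC_minus_commute max_def)
      then have "absC (t - s) * absC ?d = max (\<nu> u) (absC (ev (?w s) u))"
        using diff[of t] by (simp flip: abs_mult)
      then show ?thesis using d by (simp add: field_simps)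
    qed
    then show ?thesis by blast
  qed
  let ?S = "tors_coords a - {0 :: 'f fls ^ 'r}"
  have finS: "finite ?S" using card_tors_coords(1)[OF a] by simp
  \<comment> \<open>The factor X of \<open>lpoly\<close> is split off, hence the exponent q^k -
    1.\<close>
  define F where "F n t = coeff (\<Prod>v\<in>?S. [:1, - inverse (box_exp (?w t) n (ev (?w t) v)):]) (CARD('f) ^ k - 1)" for n t
  define Lf where "Lf t = coeff (\<Prod>v\<in>?S. [:1, - inverse (exp_ev (?w t) v):]) (CARD('f) ^ k - 1)" for t
  have qcL: "qcoeff (tors a (?w t)) k = Lf t" if "t \<in> X" for t
  proof -
    have "CARD('f) ^ k = Suc (CARD('f) ^ k - 1)" by simp
    then have "coeff ([:0, 1:] * P) (CARD('f) ^ k) = coeff P (CARD('f) ^ k - 1)" for P :: "'c poly"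
    proof -
      have "[:0, 1:] * P = pCons 0 P" by simp
      then show ?thesis using coeff_pCons_Suc[of 0 P "CARD('f) ^ k - 1"] \<open>CARD('f) ^ k = Suc (CARD('f) ^ k - 1)\<close> by simp
    qed
    then show ?thesis
      unfolding qcoeff_def Lf_def tors_def fexp_image_eq(2)[OF inj_tors[OF good[OF that] a] zero_in_tors_coords, simplified] by simp
  qed
  have affine: "ratfun X (\<lambda>t. ev (?w t) v)" for v
    unfolding ev_shift by (rule ratfun_affine)
  have box_exp_form: "box_exp (?w t) n (ev (?w t) v) = ev (?w t) v * (\<Prod>b\<in>A_box n - {0}. 1 - ev (?w t) v * inverse (ev (?w t) b))"
    if "t \<in> X" for t n v
    unfolding box_exp_def divide_inverse[symmetric]
    by (rule fexp_image_eq(1)) (auto simp: good_inj[OF good[OF that]] A_box_def)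
  have box_exp_rat: "ratfun X (\<lambda>t. box_exp (?w t) n (ev (?w t) v))" for n v
  proof (rule ratfun_cong[OF _ box_exp_form])
    show "ratfun X (\<lambda>t. ev (?w t) v * (\<Prod>b\<in>A_box n - {0}. 1 - ev (?w t) v * inverse (ev (?w t) b)))"
    proof (intro ratfun_mult ratfun_prod ratfun_diff ratfun_const affine ratfun_inverse)
      fix b t assume "b \<in> A_box n - {0 :: 'f fls ^ 'r}" "t \<in> X"
      then show "ev (?w t) b \<noteq> 0" using good_ev_eq_0[OF good] by auto
    qed
  qed
  have rat: "ratfun X (F n)" for n
    unfolding F_def
  proof (intro ratfun_coeff_prod ratfun_inverse box_exp_rat)
    fix v t assume v: "v \<in> ?S" and t: "t \<in> X"
    have "box_exp (?w t) n (ev (?w t) v) \<noteq> box_exp (?w t) n (ev (?w t) 0)"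
      using inj_onD[OF box_exp_inj[OF good[OF t] a, of n], of v 0] v by auto
    then show "box_exp (?w t) n (ev (?w t) v) \<noteq> 0" by (simp add: box_exp_def)
  qed
  have conv: "uconv X F Lf"
    unfolding F_def Lf_def
  proof (rule conjunct1[OF uconv_coeff_prod[OF finS]])
    fix v assume v: "v \<in> ?S"
    define e where "e = absC (exp_ev (?w t0) v)"
    have e: "absC (exp_ev (?w t) v) = e" if "t \<in> X" for t
      using lexp_abs_eq[OF kn, of "?w t" "?w t0" v] that t by (simp add: e_def X_def)
    have e0: "0 < e" using lexp_tors_coords_nonzero[OF good[OF tX(1)] v] by (simp add: e_def)
    have "uconv X (\<lambda>n t. box_exp (?w t) n (ev (?w t) v)) (\<lambda>t. exp_ev (?w t) v)"
      by (rule uconv_lexp[where b = "\<nu> v" and B = e, OF good _ _ k]) (simp_all add: nu e)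
    then show "uconv X (\<lambda>n t. inverse (box_exp (?w t) n (ev (?w t) v))) (\<lambda>t. inverse (exp_ev (?w t) v))"
      by (rule uconv_inverse[OF _ e0]) (simp add: e)
    show "ubdd X (\<lambda>t. inverse (exp_ev (?w t) v))"
      by (rule ubdd_inverse[OF e0]) (simp add: e)
  qed
  have "absC (Lf t0) < absC (Lf t1)" using less qcL tX by simp
  from rational_limit_zero[OF outside rat conv tX this] obtain t where "t \<in> X" "Lf t = 0" by blast
  then show ?thesis using qcL by (auto simp: X_def)
qed

section \<open>Vanishing of an inseparable coefficient\<close>

text \<open>i and i + h are the dimensions of the open and closed balls at the critical radius, and
  k lies strictly between them. The basis of the quotient is lifted from torsion points to division
  vectors.\<close>

lemma torsion_basis:
  fixes \<omega> :: "'c ^ 'r::finite"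
  assumes good: "good \<kappa> \<omega>" and a: "a \<noteq> 0" and ins: "k_inseparable \<iota> k (tors a \<omega>)"
  shows "\<exists>m i j h G. k = j + i \<and> 0 < j \<and> j < h \<and> 0 < m
    \<and> card {v \<in> tors_coords a. absC (exp_ev \<omega> v) < m} = CARD('f) ^ i
    \<and> (\<forall>v\<in>{v \<in> tors_coords a. absC (exp_ev \<omega> v) \<le> m}. \<exists>\<gamma>. \<exists>u\<in>{v \<in> tors_coords a. absC (exp_ev \<omega> v) < m}. v = kcomb h G \<gamma> + u)
    \<and> (\<forall>\<gamma>. absC (exp_ev \<omega> (kcomb h G \<gamma>)) < m \<longrightarrow> (\<forall>l<h. \<gamma> l = 0))
    \<and> (\<forall>l<h. G l \<in> {v \<in> tors_coords a. absC (exp_ev \<omega> v) \<le> m})"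
proof -
  let ?V = "tors a \<omega>"
  have V: "fsub ?V" by (rule fsub_tors[OF good a])
  obtain m where m: "0 < m" "card (lt_ball ?V m) < CARD('f) ^ k" "CARD('f) ^ k < card (le_ball ?V m)"
    using ins k_inseparable_iff[OF V] by blast
  have V0: "fsub (lt_ball ?V m)" and V1: "fsub (le_ball ?V m)"
    using fsub_lt_ball[OF V] fsub_le_ball[OF V] m(1) by simp_all
  obtain i where i: "card (lt_ball ?V m) = CARD('f) ^ i" using card_fsub[OF V0] by blast
  obtain j where j: "card (le_ball ?V m) = CARD('f) ^ j" using card_fsub[OF V1] by blast
  have "i < k" using m(2) unfolding i by (rule power_less_imp_less_exp[rotated]) simp
  have "k < j" using m(3) unfolding j by (rule power_less_imp_less_exp[rotated]) simp
  define h where "h = j - i"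
  have sub: "lt_ball ?V m \<subseteq> le_ball ?V m" by (auto simp: lt_ball_def le_ball_def)
  have "card (le_ball ?V m) = CARD('f) ^ h * card (lt_ball ?V m)"
    using \<open>i < k\<close> \<open>k < j\<close> by (simp add: i j h_def flip: power_add)
  from relative_basis[OF V0 V1 sub this] obtain g where gg: "(\<forall>l<h. g l \<in> le_ball ?V m)
    \<and> (\<forall>x\<in>le_ball ?V m. \<exists>\<gamma>. \<exists>v\<in>lt_ball ?V m. x = (\<Sum>l<h. F_scale \<iota> (\<gamma> l) (g l)) + v)
    \<and> (\<forall>\<gamma>. (\<Sum>l<h. F_scale \<iota> (\<gamma> l) (g l)) \<in> lt_ball ?V m \<longrightarrow> (\<forall>l<h. \<gamma> l = 0))"
    by (rule exE)
  note g = conjunct1[OF gg] conjunct1[OF conjunct2[OF gg]] conjunct2[OF conjunct2[OF gg]]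
  have "\<forall>l. \<exists>v. l < h \<longrightarrow> v \<in> tors_coords a \<and> exp_ev \<omega> v = g l"
    using g(1) by (fastforce simp: le_ball_def tors_def)
  then obtain G where G: "\<And>l. l < h \<Longrightarrow> G l \<in> tors_coords a" "\<And>l. l < h \<Longrightarrow> exp_ev \<omega> (G l) = g l" by metis
  have comb: "exp_ev \<omega> (kcomb h G \<gamma>) = (\<Sum>l<h. F_scale \<iota> (\<gamma> l) (g l))" for \<gamma>
    unfolding exp_ev_kcomb[OF good] fcomb_def by (rule sum.cong) (simp_all add: G)
  have kE: "fsub_vec (tors_coords a :: ('f fls ^ 'r) set)" by (rule fsub_vec_tors_coords[OF a])
  have kcombE: "kcomb h G \<gamma> \<in> tors_coords a" for \<gamma>
  proof -
    have "(\<Sum>l\<in>S. fls_const (\<gamma> l) *s G l) \<in> tors_coords a" if "S \<subseteq> {..<h}" for S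
      using that
    proof (induction S rule: infinite_finite_induct)
      case (insert l S)
      then have "fls_const (\<gamma> l) *s G l \<in> tors_coords a" using G(1) kE unfolding fsub_vec_def by blast
      moreover have "(\<Sum>l\<in>S. fls_const (\<gamma> l) *s G l) \<in> tors_coords a" using insert by auto
      ultimately show ?case using insert.hyps kE unfolding fsub_vec_def by (subst sum.insert) blast+
    qed simp_all
    then show ?thesis by (simp add: kcomb_def)
  qed
  show ?thesis
  proof (rule exI[of _ m], rule exI[of _ i], rule exI[of _ "k - i"], rule exI[of _ h], rule exI[of _ G], intro conjI)
    show "k = k - i + i" "0 < k - i" "k - i < h" using \<open>i < k\<close> \<open>k < j\<close> by (simp_all add: h_def)
    show "card {v \<in> tors_coords a. absC (exp_ev \<omega> v) < m} = CARD('f) ^ i"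
      using card_tors_filter[OF good a, of "\<lambda>x. x < m"] i by (simp add: lt_ball_def)
    show "\<forall>v\<in>{v \<in> tors_coords a. absC (exp_ev \<omega> v) \<le> m}. \<exists>\<gamma>. \<exists>u\<in>{v \<in> tors_coords a. absC (exp_ev \<omega> v) < m}. v = kcomb h G \<gamma> + u"
    proof
      fix v assume v: "v \<in> {v \<in> tors_coords a. absC (exp_ev \<omega> v) \<le> m}"
      then have "exp_ev \<omega> v \<in> le_ball ?V m" by (auto simp: le_ball_def tors_def)
      then obtain \<gamma> x where x: "x \<in> lt_ball ?V m" "exp_ev \<omega> v = exp_ev \<omega> (kcomb h G \<gamma>) + x"
        using g(2) comb by metis
      then obtain u where u: "u \<in> tors_coords a" "x = exp_ev \<omega> u" by (auto simp: lt_ball_def tors_def)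
      have "exp_ev \<omega> v = exp_ev \<omega> (kcomb h G \<gamma> + u)" using x u by (simp add: ev_add lexp_add[OF good])
      moreover have "kcomb h G \<gamma> + u \<in> tors_coords a" using kcombE u kE unfolding fsub_vec_def by blast
      ultimately have "v = kcomb h G \<gamma> + u" using inj_onD[OF inj_tors[OF good a]] v by blast
      moreover have "absC (exp_ev \<omega> u) < m" using x(1) u by (simp add: lt_ball_def)
      ultimately show "\<exists>\<gamma>. \<exists>u\<in>{v \<in> tors_coords a. absC (exp_ev \<omega> v) < m}. v = kcomb h G \<gamma> + u" using u by blast
    qed
    show "\<forall>\<gamma>. absC (exp_ev \<omega> (kcomb h G \<gamma>)) < m \<longrightarrow> (\<forall>l<h. \<gamma> l = 0)"
    proof (intro allI impI)
      fix \<gamma> :: "nat \<Rightarrow> 'f" and l assume "absC (exp_ev \<omega> (kcomb h G \<gamma>)) < m" "l < h"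
      then have "(\<Sum>l<h. F_scale \<iota> (\<gamma> l) (g l)) \<in> lt_ball ?V m"
        unfolding comb[symmetric] lt_ball_def tors_def using kcombE[of \<gamma>] by blast
      then show "\<gamma> l = 0" using g(3) \<open>l < h\<close> by blast
    qed
    show "\<forall>l<h. G l \<in> {v \<in> tors_coords a. absC (exp_ev \<omega> v) \<le> m}" using G g(1) by (auto simp: le_ball_def)
  qed (rule m(1))
qed

text \<open>\<open>Z\<close> lists the indices that are left out: with \<open>{l}\<close> this is
  the space from which a functional separates \<open>U l\<close>, with \<open>{}\<close> the domain
  of the first isometries.\<close>

lemma comb_subspace:
  fixes U :: "nat \<Rightarrow> 'f fls ^ 'r::finite"
  assumes K: "vec.subspace K"
  shows "vec.subspace {x. \<exists>c w. w \<in> K \<and> (\<forall>l\<in>Z. c l = 0) \<and> x = (\<Sum>l<h. c l *s U l) + w}"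
  unfolding vec.subspace_def
proof (intro conjI ballI allI)
  show "0 \<in> {x. \<exists>c w. w \<in> K \<and> (\<forall>l\<in>Z. c l = 0) \<and> x = (\<Sum>l<h. c l *s U l) + w}"
    using vec.subspace_0[OF K] by (intro CollectI exI[of _ "\<lambda>_. 0"] exI[of _ 0]) simp
next
  fix x y assume "x \<in> {x. \<exists>c w. w \<in> K \<and> (\<forall>l\<in>Z. c l = 0) \<and> x = (\<Sum>l<h. c l *s U l) + w}"
    "y \<in> {x. \<exists>c w. w \<in> K \<and> (\<forall>l\<in>Z. c l = 0) \<and> x = (\<Sum>l<h. c l *s U l) + w}"
  then obtain c w c' w' where "w \<in> K" "w' \<in> K" "\<forall>l\<in>Z. c l = 0" "\<forall>l\<in>Z. c' l = 0"
    "x = (\<Sum>l<h. c l *s U l) + w" "y = (\<Sum>l<h. c' l *s U l) + w'" by blast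
  then show "x + y \<in> {x. \<exists>c w. w \<in> K \<and> (\<forall>l\<in>Z. c l = 0) \<and> x = (\<Sum>l<h. c l *s U l) + w}"
    using vec.subspace_add[OF K]
    by (intro CollectI exI[of _ "\<lambda>l. c l + c' l"] exI[of _ "w + w'"])
      (simp add: vec.scale_left_distrib sum.distrib algebra_simps)
next
  fix d x assume "x \<in> {x. \<exists>c w. w \<in> K \<and> (\<forall>l\<in>Z. c l = 0) \<and> x = (\<Sum>l<h. c l *s U l) + w}"
  then obtain c w where "w \<in> K" "\<forall>l\<in>Z. c l = 0" "x = (\<Sum>l<h. c l *s U l) + w" by blast
  then show "d *s x \<in> {x. \<exists>c w. w \<in> K \<and> (\<forall>l\<in>Z. c l = 0) \<and> x = (\<Sum>l<h. c l *s U l) + w}"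
    using vec.subspace_scale[OF K]
    by (intro CollectI exI[of _ "\<lambda>l. d * c l"] exI[of _ "d *s w"])
      (simp add: vec.scale_right_distrib vec.scale_sum_right)
qed

lemma dotp_kcomb_shift:
  "ev (\<chi> i. \<omega> $ i + (\<Sum>l<h. d l * \<iota> (p l $ i))) u = ev \<omega> u + (\<Sum>l<(h::nat). d l * \<iota> (dotp (p l) u))"
proof -
  have "ev (\<chi> i. \<omega> $ i + (\<Sum>l<h. d l * \<iota> (p l $ i))) u
      = ev \<omega> u + (\<Sum>i\<in>UNIV. \<Sum>l<h. \<iota> (u $ i) * (d l * \<iota> (p l $ i)))"
    by (simp add: ev_def distrib_left sum.distrib sum_distrib_left)
  also have "(\<Sum>i\<in>UNIV. \<Sum>l<h. \<iota> (u $ i) * (d l * \<iota> (p l $ i))) = (\<Sum>l<h. \<Sum>i\<in>UNIV. \<iota> (u $ i) * (d l * \<iota> (p l $ i)))"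
    by (rule sum.swap)
  also have "\<dots> = (\<Sum>l<h. d l * \<iota> (dotp (p l) u))"
    by (simp add: dotp_def embed_sum embed_mult sum_distrib_left mult_ac)
  finally show ?thesis .
qed

text \<open>Two isometric \<omega> on one line are built with the residual spaces of
  \<open>finite_field_pair\<close>. They keep the values of \<omega>0 on the short lattice vectors,
  hence the same finite exponential \<open>?f\<close>, and take prescribed preimages under
  \<open>?f\<close> as values at minimal vectors. \<open>leading_coefficient\<close> compares the
  two coefficients, and \<open>zero_in_family\<close> gives the zero.\<close>

lemma inseparable_zero:
  fixes \<nu> :: "'f fls ^ 'r::finite \<Rightarrow> real"
  assumes kn: "norm_geq \<kappa> \<nu>" and a: "a \<noteq> 0" and iso: "iso \<nu> \<omega>0"
    and ins: "k_inseparable \<iota> k (tors a \<omega>0)"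
  shows "\<exists>\<omega>. iso \<nu> \<omega> \<and> qcoeff (tors a \<omega>) k = 0"
proof -
  note sn = norm_geq_seminorm[OF kn]
  have good0: "good \<kappa> \<omega>0" by (rule iso_good[OF kn iso])
  have nu: "absC (ev \<omega>0 v) = \<nu> v" for v using iso by (simp add: iso_def)
  obtain m i j h G where k: "k = j + i" and j: "0 < j" "j < h" and m: "0 < m"
    and card0: "card {v \<in> tors_coords a. absC (exp_ev \<omega>0 v) < m} = CARD('f) ^ i"
    and surj: "\<forall>v\<in>{v \<in> tors_coords a. absC (exp_ev \<omega>0 v) \<le> m}. \<exists>\<gamma>. \<exists>u\<in>{v \<in> tors_coords a. absC (exp_ev \<omega>0 v) < m}. v = kcomb h G \<gamma> + u"
    and indep: "\<forall>\<gamma>. absC (exp_ev \<omega>0 (kcomb h G \<gamma>)) < m \<longrightarrow> (\<forall>l<h. \<gamma> l = 0)"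
    and G: "\<forall>l<h. G l \<in> {v \<in> tors_coords a. absC (exp_ev \<omega>0 v) \<le> m}"
    using torsion_basis[OF good0 a ins] by blast
  \<comment> \<open>At minimal representatives the size of the exponential is strictly increasing in
    the norm; as all these sizes are m, all \<open>U l\<close> will have one norm \<rho>.\<close>
  have "\<forall>l. \<exists>u. u - G l \<in> A_vecs \<and> (\<forall>b\<in>A_vecs. \<nu> u \<le> \<nu> (u - b)) \<and> \<nu> u \<le> \<nu> (G l)"
    using minimal_representative[OF kn] by blast
  then obtain U where U: "\<And>l. U l - G l \<in> A_vecs" "\<And>l. \<forall>b\<in>A_vecs. \<nu> (U l) \<le> \<nu> (U l - b)" "\<And>l. \<nu> (U l) \<le> \<nu> (G l)"
    by metis
  have kpos: "0 < \<kappa>" using kn by (simp add: norm_geq_def)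
  obtain n where n: "(\<Sum>l<h. \<nu> (G l)) < \<kappa> * real CARD('f) ^ n" using large_radius[OF kpos] by blast
  have Un: "\<nu> (U l) < \<kappa> * real CARD('f) ^ n" if "l < h" for l
  proof -
    have "\<nu> (G l) \<le> (\<Sum>l<h. \<nu> (G l))" using that seminorm_nonneg[OF sn] by (intro member_le_sum) auto
    then show ?thesis using n U(3)[of l] by linarith
  qed
  have eGU: "exp_ev \<omega> (G l) = exp_ev \<omega> (U l)" if "good \<kappa> \<omega>" for \<omega> l
    using exp_ev_translate[OF that U(1)[of l]] by simp
  have eG: "absC (exp_ev \<omega>0 (G l)) = m" if l: "l < h" for l
  proof -
    have "kcomb h G (\<lambda>j. if j = l then 1 else 0) = (\<Sum>j<h. if j = l then G l else 0)"
      unfolding kcomb_def by (rule sum.cong) auto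
    also have "\<dots> = G l" using l by simp
    finally have "\<not> absC (exp_ev \<omega>0 (G l)) < m"
      using indep[rule_format, of "\<lambda>j. if j = l then 1 else 0" l] l by auto
    then show ?thesis using G l by auto
  qed
  have \<Psi>U: "\<Psi> \<nu> n (\<nu> (U l)) = m" if "l < h" for l
    using exp_ev_abs_minimal[OF kn iso Un[OF that] U(2)] eG[OF that] eGU[OF good0, of l] by simp
  have h: "0 < h" using j by simp
  define \<rho> where "\<rho> = \<nu> (U 0)"
  have Ur: "\<nu> (U l) = \<rho>" if "l < h" for l
  proof (rule ccontr)
    assume "\<nu> (U l) \<noteq> \<rho>"
    then consider "\<nu> (U l) < \<nu> (U 0)" | "\<nu> (U 0) < \<nu> (U l)" unfolding \<rho>_def by linarith
    then show False
      using \<Psi>_strict_mono[OF kn seminorm_nonneg[OF sn], of "U l" "\<nu> (U 0)" n]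
        \<Psi>_strict_mono[OF kn seminorm_nonneg[OF sn], of "U 0" "\<nu> (U l)" n] \<Psi>U[OF that] \<Psi>U[OF h] by cases auto
  qed
  have \<rho>: "0 < \<rho>"
  proof (rule ccontr)
    assume "\<not> 0 < \<rho>"
    then have "\<nu> (U 0) = 0" using seminorm_nonneg[OF sn, of "U 0"] by (simp add: \<rho>_def)
    then show False using \<Psi>U[OF h] m by (simp add: \<Psi>_def)
  qed
  define L where "L = {b \<in> A_vecs. \<nu> b \<le> \<rho>}"
  have \<mu>: "m = \<rho> * (\<Prod>b\<in>L - {0}. \<rho> / \<nu> b)"
    using \<Psi>_eq[OF kn \<rho> L_def refl, of n] \<Psi>U[OF h] Un[OF h] by (simp add: \<rho>_def)
  have kL: "fsub_vec L" unfolding L_def using fsub_vec_A_vecs_ball[OF kn] \<rho> by simp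
  \<comment> \<open>A shorter combination would have a smaller exponential, contrary to the
    independence of the torsion points modulo those below m.\<close>
  have indep_nu: "\<rho> \<le> \<nu> (kcomb h U \<gamma> + b)" if g: "\<exists>l<h. \<gamma> l \<noteq> 0" and b: "b \<in> A_vecs" for \<gamma> b
  proof (rule ccontr)
    let ?y = "kcomb h U \<gamma> + b"
    assume "\<not> \<rho> \<le> \<nu> ?y"
    then have less: "\<nu> ?y < \<rho>" by simp
    then have "\<nu> ?y < \<kappa> * real CARD('f) ^ n" using Un[OF h] by (simp add: \<rho>_def)
    then have "absC (exp_ev \<omega>0 ?y) \<le> \<Psi> \<nu> n (\<nu> ?y)" by (rule exp_ev_abs_le[OF kn iso])
    also have "\<dots> < \<Psi> \<nu> n \<rho>" by (rule \<Psi>_strict_mono[OF kn seminorm_nonneg[OF sn] less])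
    also have "\<dots> = m" using \<Psi>U[OF h] by (simp add: \<rho>_def)
    finally have "absC (exp_ev \<omega>0 ?y) < m" .
    moreover have "?y - kcomb h G \<gamma> \<in> A_vecs"
    proof -
      have "(\<Sum>l\<in>S. fls_const (\<gamma> l) *s (U l - G l)) \<in> A_vecs" for S
      proof (induction S rule: infinite_finite_induct)
        case (insert l S)
        show ?case unfolding sum.insert[OF insert.hyps] by (rule A_vecs_add[OF A_vecs_const[OF U(1)] insert.IH])
      qed simp_all
      then have "(\<Sum>l<h. fls_const (\<gamma> l) *s (U l - G l)) + b \<in> A_vecs" using b by (intro A_vecs_add)
      then show ?thesis by (simp add: kcomb_def vec.scale_right_diff_distrib sum_subtractf algebra_simps)
    qed
    ultimately have "absC (exp_ev \<omega>0 (kcomb h G \<gamma>)) < m" using exp_ev_translate[OF good0] by metis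
    then show False using indep g by blast
  qed
  let ?f = "fexp (ev \<omega>0 ` L)"
  have V: "fsub (ev \<omega>0 ` L)" by (rule fsub_ev[OF kL])
  define \<sigma> where "\<sigma> = exp_ev \<omega>0 (G 0)"
  have \<sigma>: "absC \<sigma> = m" using eG[OF h] by (simp add: \<sigma>_def)
  obtain \<tau> y where ty: "fully_indep h \<tau>" "fully_indep h (\<tau>(h - 1 := y))"
    "qcoeff (fspan h \<tau>) j = 0" "absC (qcoeff (fspan h (\<tau>(h - 1 := y))) j) = 1"
    using finite_field_pair[OF j] by blast
  \<comment> \<open>The values to be prescribed at the \<open>U l\<close>; \<open>x1\<close>
    replaces the last of them in the second \<omega>.\<close>
  have "\<forall>l. \<exists>x. ?f x = \<sigma> * \<tau> l" using fexp_root[OF V] by blast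
  then obtain x where x: "\<And>l. ?f (x l) = \<sigma> * \<tau> l" by metis
  obtain x1 where x1: "?f x1 = \<sigma> * y" using fexp_root[OF V] by blast
  have unit: "absC (fcomb h X' \<gamma> + ev \<omega>0 b) = \<rho>"
    if X': "\<And>l. l < h \<Longrightarrow> ?f (X' l) = \<sigma> * \<tau>' l" and \<tau>': "fully_indep h \<tau>'" and g: "\<exists>l<h. \<gamma> l \<noteq> 0" and b: "b \<in> L"
    for X' \<tau>' \<gamma> b
  proof -
    have fsum: "?f (\<Sum>l\<in>S. F_scale \<iota> (\<gamma> l) (X' l)) = (\<Sum>l\<in>S. F_scale \<iota> (\<gamma> l) (?f (X' l)))" for S
      by (induction S rule: infinite_finite_induct) (simp_all add: fexp_add[OF V] fexp_F_scale[OF V])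
    have "?f (fcomb h X' \<gamma> + ev \<omega>0 b) = ?f (fcomb h X' \<gamma>)" using fexp_translate[OF V] b by blast
    also have "\<dots> = (\<Sum>l<h. F_scale \<iota> (\<gamma> l) (\<sigma> * \<tau>' l))" unfolding fcomb_def fsum using X' by simp
    also have "\<dots> = \<sigma> * fcomb h \<tau>' \<gamma>" by (simp add: fcomb_def F_scale_mult_right sum_distrib_left)
    finally have "absC (?f (fcomb h X' \<gamma> + ev \<omega>0 b)) = m"
      using \<tau>' g \<sigma> by (simp add: fully_indep_def abs_mult)
    then show ?thesis
      using critical_fexp(2,3)[OF kn \<rho> L_def \<mu> iso, of "fcomb h X' \<gamma> + ev \<omega>0 b"] by linarith
  qed
  have unit1: "absC (X' l) = \<rho>"
    if X': "\<And>l. l < h \<Longrightarrow> ?f (X' l) = \<sigma> * \<tau>' l" and \<tau>': "fully_indep h \<tau>'" and l: "l < h" for X' \<tau>' l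
  proof -
    let ?\<gamma> = "\<lambda>j. if j = l then 1 else 0 :: 'f"
    have "fcomb h X' ?\<gamma> = (\<Sum>j<h. if j = l then X' l else 0)" unfolding fcomb_def by (rule sum.cong) auto
    then have "fcomb h X' ?\<gamma> = X' l" using l by simp
    moreover have "0 \<in> L" using kL by (simp add: fsub_vec_def)
    ultimately show ?thesis using unit[OF X' \<tau>', of ?\<gamma> 0] l by auto
  qed
  let ?K = "vec.span L"
  have K: "vec.subspace ?K" by (rule vec.subspace_span)
  have LK: "L \<subseteq> ?K" using vec.span_superset by blast
  have approxK: "\<exists>b\<in>L. \<nu> (w - b) < \<rho>" if "w \<in> ?K" "\<nu> w \<le> \<rho>" for w
    using lattice_span_approx[OF kn \<rho>] that by (simp add: L_def)
  let ?Max = "\<lambda>c :: nat \<Rightarrow> 'f fls. Max (insert 0 ((\<lambda>l. absK (c l)) ` {..<h}))"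
  have orth_nu: "\<nu> ((\<Sum>l<h. c l *s U l) + w) = max (?Max c * \<rho>) (\<nu> w)" if "w \<in> ?K" for c w
    by (rule orth_combination[OF sn \<rho> K approxK _ _ that]) (use Ur indep_nu L_def in auto)
  have "\<forall>l. \<exists>p. l < h \<longrightarrow> (\<forall>w\<in>?K. dotp p w = 0) \<and> (\<forall>l'<h. dotp p (U l') = (if l' = l then 1 else 0))"
  proof
    fix l
    show "\<exists>p. l < h \<longrightarrow> (\<forall>w\<in>?K. dotp p w = 0) \<and> (\<forall>l'<h. dotp p (U l') = (if l' = l then 1 else 0))"
    proof (cases "l < h")
      case True
      let ?W = "{x. \<exists>c w. w \<in> ?K \<and> (\<forall>l\<in>{l}. c l = 0) \<and> x = (\<Sum>l<h. c l *s U l) + w}"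
      have W: "vec.subspace ?W" by (rule comb_subspace[OF K])
      have notin: "U l \<notin> ?W"
      proof
        assume "U l \<in> ?W"
        then obtain c w where cw: "w \<in> ?K" "c l = 0" "U l = (\<Sum>l<h. c l *s U l) + w" by auto
        \<comment> \<open>The coefficient -1 turns the supposed relation into a combination equal to
          0, whose norm is at least \<rho> by \<open>orth_nu\<close>.\<close>
        define c' where "c' = c(l := - 1)"
        have "(\<Sum>j<h. c' j *s U j) = c' l *s U l + (\<Sum>j\<in>{..<h} - {l}. c' j *s U j)"
          using True by (intro sum.remove) auto
        also have "(\<Sum>j\<in>{..<h} - {l}. c' j *s U j) = (\<Sum>j\<in>{..<h} - {l}. c j *s U j)"
          by (rule sum.cong) (auto simp: c'_def)
        also have "\<dots> = (\<Sum>j<h. c j *s U j)" using cw(2) True by (subst (2) sum.remove[of _ l]) auto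
        finally have "(\<Sum>j<h. c' j *s U j) + w = c' l *s U l + U l" using cw(3) by (simp add: add.assoc)
        also have "\<dots> = 0" by (simp add: c'_def vec_eq_iff)
        finally have "\<nu> ((\<Sum>j<h. c' j *s U j) + w) = 0" using seminorm_0[OF sn] by simp
        then have le: "?Max c' * \<rho> \<le> 0" using orth_nu[OF cw(1), of c'] by simp
        have "absK (c' l) \<le> ?Max c'" using True by (intro Max_ge) auto
        then have "1 \<le> ?Max c'" by (simp add: c'_def)
        then have "1 * \<rho> \<le> ?Max c' * \<rho>" using \<rho> by (intro mult_right_mono) simp_all
        then show False using le \<rho> by linarith
      qed
      obtain p where p: "\<forall>w\<in>?W. dotp p w = 0" "dotp p (U l) = 1" using dual_vector[OF W notin] by blast
      have KW: "w \<in> ?W" if "w \<in> ?K" for w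
        using that by (intro CollectI exI[of _ "\<lambda>_. 0"] exI[of _ w]) simp
      have UW: "U l' \<in> ?W" if "l' < h" "l' \<noteq> l" for l'
      proof -
        have "(\<Sum>j<h. (if j = l' then 1 else 0) *s U j) = (\<Sum>j<h. if j = l' then U l' else 0)" by (rule sum.cong) auto
        then show ?thesis using that vec.span_zero
          by (intro CollectI exI[of _ "\<lambda>j. if j = l' then 1 else 0"] exI[of _ 0]) auto
      qed
      show ?thesis using p KW UW by (intro exI[of _ p]) auto
    qed auto
  qed
  then obtain p where p: "\<And>l w. l < h \<Longrightarrow> w \<in> ?K \<Longrightarrow> dotp (p l) w = 0"
    "\<And>l l'. l < h \<Longrightarrow> l' < h \<Longrightarrow> dotp (p l) (U l') = (if l' = l then 1 else 0)"
    by metis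
  \<comment> \<open>The functionals \<open>p l\<close> are dual to the \<open>U l\<close> and vanish
    on the short lattice vectors, so each value at \<open>U l\<close> is corrected
    separately.\<close>
  define \<omega>A where "\<omega>A = (\<chi> i. \<omega>0 $ i + (\<Sum>l<h. (x l - ev \<omega>0 (U l)) * \<iota> (p l $ i)))"
  have A: "ev \<omega>A w = ev \<omega>0 w" if "w \<in> ?K" for w
    unfolding \<omega>A_def dotp_kcomb_shift using p(1) that by simp
  have AU: "ev \<omega>A (U l) = x l" if l: "l < h" for l
  proof -
    have "(\<Sum>j<h. (x j - ev \<omega>0 (U j)) * \<iota> (dotp (p j) (U l))) = (\<Sum>j<h. if j = l then x l - ev \<omega>0 (U l) else 0)"
      using p(2) l by (intro sum.cong) (auto simp: embed_one)
    then show ?thesis unfolding \<omega>A_def dotp_kcomb_shift using l by simp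
  qed
  \<comment> \<open>The second \<omega> changes only the value at the last vector, hence lies on a
    line through the first one.\<close>
  define \<theta> where "\<theta> = x1 - x (h - 1)"
  define pB where "pB = p (h - 1)"
  let ?x1 = "x(h - 1 := x1)"
  have B: "ev (shift \<omega>A \<theta> pB) w = ev \<omega>0 w" if "w \<in> ?K" for w
    using A that p(1)[of "h - 1" w] h by (simp add: ev_shift pB_def)
  have BU: "ev (shift \<omega>A \<theta> pB) (U l) = ?x1 l" if "l < h" for l
    using AU[OF that] p(2)[of "h - 1" l] that h by (simp add: ev_shift pB_def \<theta>_def embed_one)
  have x1': "?f (?x1 l) = \<sigma> * (\<tau>(h - 1 := y)) l" for l using x x1 by simp
  let ?W = "{z. \<exists>c w. w \<in> ?K \<and> (\<forall>l\<in>{}. c l = 0) \<and> z = (\<Sum>l<h. c l *s U l) + w}"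
  have W: "vec.subspace ?W" by (rule comb_subspace[OF K])
  \<comment> \<open>\<open>orth_combination\<close>, for \<nu> and for the norm induced by \<omega>,
    expresses both sides by the same maximum.\<close>
  have isoW: "iso_on ?W \<nu> \<omega>"
    if agree: "\<And>w. w \<in> ?K \<Longrightarrow> ev \<omega> w = ev \<omega>0 w" and XU: "\<And>l. l < h \<Longrightarrow> ev \<omega> (U l) = X' l"
      and X': "\<And>l. l < h \<Longrightarrow> ?f (X' l) = \<sigma> * \<tau>' l" and \<tau>': "fully_indep h \<tau>'" for \<omega> X' \<tau>'
    unfolding iso_on_def
  proof
    fix z assume "z \<in> ?W"
    then obtain c w where cw: "w \<in> ?K" "z = (\<Sum>l<h. c l *s U l) + w" by blast
    have nuK: "absC (ev \<omega> w) = \<nu> w" if "w \<in> ?K" for w using agree[OF that] nu by simp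
    have "absC (ev \<omega> ((\<Sum>l<h. c l *s U l) + w)) = max (?Max c * \<rho>) (absC (ev \<omega> w))"
    proof (rule orth_combination[OF seminorm_ev \<rho> K _ _ _ cw(1), where L = L])
      fix w assume w: "w \<in> ?K" "absC (ev \<omega> w) \<le> \<rho>"
      then obtain b where b: "b \<in> L" "\<nu> (w - b) < \<rho>" using approxK nuK by auto
      then have "absC (ev \<omega> (w - b)) < \<rho>" using nuK[of "w - b"] w LK vec.subspace_diff[OF K] by auto
      then show "\<exists>b\<in>L. absC (ev \<omega> (w - b)) < \<rho>" using b by blast
    next
      fix l assume "l < h"
      then show "absC (ev \<omega> (U l)) \<le> \<rho>" using unit1[OF X' \<tau>'] XU by simp
    next
      fix \<gamma> :: "nat \<Rightarrow> 'f" and b assume g: "\<exists>l<h. \<gamma> l \<noteq> 0" and b: "b \<in> L"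
      have "ev \<omega> (kcomb h U \<gamma> + b) = fcomb h X' \<gamma> + ev \<omega>0 b"
        using b LK agree by (auto simp: ev_add ev_kcomb fcomb_def XU)
      then show "\<rho> \<le> absC (ev \<omega> (kcomb h U \<gamma> + b))" using unit[OF X' \<tau>' g b] by simp
    qed
    then show "absC (ev \<omega> z) = \<nu> z" using orth_nu[OF cw(1)] nuK[OF cw(1)] cw(2) by simp
  qed
  have "\<forall>v. \<exists>z :: 'c. absC z = \<nu> v" using nu by blast
  from extend_isometries[OF kn this W isoW[OF A AU x ty(1)] isoW[OF B BU x1' ty(2)]]
  obtain \<omega>' p' where ext: "iso \<nu> \<omega>'" "iso \<nu> (shift \<omega>' \<theta> p')"
    "\<And>w. w \<in> ?W \<Longrightarrow> ev \<omega>' w = ev \<omega>A w" "\<And>w. w \<in> ?W \<Longrightarrow> ev (shift \<omega>' \<theta> p') w = ev (shift \<omega>A \<theta> pB) w"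
    by blast
  have KW: "w \<in> ?W" if "w \<in> ?K" for w
    using that by (intro CollectI exI[of _ "\<lambda>_. 0"] exI[of _ w]) simp
  have UW: "U l \<in> ?W" if "l < h" for l
  proof -
    have "(\<Sum>j<h. (if j = l then 1 else 0) *s U j) = (\<Sum>j<h. if j = l then U l else 0)" by (rule sum.cong) auto
    then show ?thesis using that vec.span_zero
      by (intro CollectI exI[of _ "\<lambda>j. if j = l then 1 else 0"] exI[of _ 0]) auto
  qed
  let ?E0 = "{v \<in> tors_coords a. absC (exp_ev \<omega>0 v) < m}"
  let ?B = "m * (\<Prod>v\<in>?E0 - {0}. m / absC (exp_ev \<omega>0 v))"
  \<comment> \<open>The bound \<open>?B\<close> involves only absolute values at division vectors,
    so it is the same for both \<omega>.\<close>
  have lead: "(qcoeff (fspan h \<tau>') j = 0 \<longrightarrow> absC (qcoeff (tors a \<omega>) k) * m ^ CARD('f) ^ k < ?B)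
      \<and> (absC (qcoeff (fspan h \<tau>') j) = 1 \<longrightarrow> absC (qcoeff (tors a \<omega>) k) * m ^ CARD('f) ^ k = ?B)"
    if iso': "iso \<nu> \<omega>" and agree: "\<And>w. w \<in> ?K \<Longrightarrow> ev \<omega> w = ev \<omega>0 w" and XU: "\<And>l. l < h \<Longrightarrow> ev \<omega> (U l) = X' l"
      and X': "\<And>l. l < h \<Longrightarrow> ?f (X' l) = \<sigma> * \<tau>' l" and \<tau>': "fully_indep h \<tau>'" for \<omega> X' \<tau>'
  proof -
    have good: "good \<kappa> \<omega>" by (rule iso_good[OF kn iso'])
    have e: "absC (exp_ev \<omega>0 v) = absC (exp_ev \<omega> v)" for v by (rule lexp_abs_eq[OF kn iso iso'])
    have "ev \<omega> ` L = ev \<omega>0 ` L" using agree LK by (intro image_cong) auto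
    then have crit: "absC (lexp \<omega> z - ?f z) < m" if "absC z \<le> \<rho>" for z
      using critical_lexp[OF kn \<rho> L_def \<mu> iso' that] by simp
    have approx: "\<forall>l<h. absC (exp_ev \<omega> (G l) - \<sigma> * \<tau>' l) < m"
    proof (intro allI impI)
      fix l assume l: "l < h"
      have "absC (lexp \<omega> (X' l) - ?f (X' l)) < m" using unit1[OF X' \<tau>' l] by (intro crit) simp
      then show "absC (exp_ev \<omega> (G l) - \<sigma> * \<tau>' l) < m" by (simp add: eGU[OF good] XU[OF l] X'[OF l])
    qed
    note lc = leading_coefficient[OF good a m refl refl _ _ _ _ \<sigma> \<tau>' approx, where i = i and k = j]
    show ?thesis
      using lc[OF card0[unfolded e] surj[unfolded e] indep[unfolded e] G[unfolded e]] unfolding k e by blast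
  qed
  have "absC (qcoeff (tors a \<omega>') k) * m ^ CARD('f) ^ k < ?B"
    using lead[OF ext(1) _ _ x ty(1)] ext(3) KW UW A AU ty(3) by simp
  moreover have "absC (qcoeff (tors a (shift \<omega>' \<theta> p')) k) * m ^ CARD('f) ^ k = ?B"
    using lead[OF ext(2) _ _ x1' ty(2)] ext(4) KW UW B BU ty(4) by simp
  ultimately have "absC (qcoeff (tors a \<omega>') k) * m ^ CARD('f) ^ k < absC (qcoeff (tors a (shift \<omega>' \<theta> p')) k) * m ^ CARD('f) ^ k"
    by simp
  then have less: "absC (qcoeff (tors a \<omega>') k) < absC (qcoeff (tors a (shift \<omega>' \<theta> p')) k)"
    using m by simp
  have s0: "shift \<omega>' 0 p' = \<omega>'" by (simp add: shift_def)
  show ?thesis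
    using zero_in_family[OF kn a, of \<omega>' 0 p' \<theta> k] ext(1,2) less unfolding s0 by blast
qed

end

section \<open>Rational points of the building\<close>

context C_infty
begin

text \<open>Roots of powers of T realize every rational exponent; this is where the rationality of
  the barycentric coordinates enters.\<close>

lemma rational_value:
  assumes "r \<in> \<rat>"
  shows "\<exists>y :: 'c. absC y = real CARD('f) powr r"
proof -
  obtain a b :: int where ab: "0 < b" "r = of_int a / of_int b"
    using assms by (rule Rats_cases')
  define n where "n = nat b"
  have n: "0 < n" "real n = of_int b" using ab(1) by (simp_all add: n_def)
  have q: "0 < real CARD('f)" by simp
  have "\<exists>u :: 'c. absC u = real CARD('f) powr of_int a"
  proof (cases "0 \<le> a")
    case True
    have "absC (\<iota> (T ^ nat a)) = real CARD('f) ^ nat a" by (simp add: embed_abs)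
    also have "\<dots> = real CARD('f) powr of_int a" using True by (simp flip: powr_realpow)
    finally show ?thesis by blast
  next
    case False
    have "absC (inverse (\<iota> (T ^ nat (- a)))) = inverse (real CARD('f) ^ nat (- a))" by (simp add: embed_abs)
    also have "\<dots> = real CARD('f) powr of_int a" using False by (simp add: powr_minus flip: powr_realpow)
    finally show ?thesis by blast
  qed
  then obtain u :: 'c where u: "absC u = real CARD('f) powr of_int a" by blast
  obtain y where y: "y ^ n = u" using nth_root_exists[OF n(1)] by blast
  have "absC y ^ n = (real CARD('f) powr r) ^ n"
  proof -
    have "(real CARD('f) powr r) ^ n = real CARD('f) powr (r * real n)"
      by (simp add: powr_powr flip: powr_realpow)
    also have "r * real n = of_int a" using ab n(2) by simp
    finally show ?thesis using u y absC_power[of y n] by simp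
  qed
  then have "absC y = real CARD('f) powr r"
    by (rule power_eq_imp_eq_base) (use n in simp_all)
  then show ?thesis by blast
qed

section \<open>Lattice norms and their values\<close>

lemma O_lattice_bounded:
  fixes L :: "('f fls ^ 'r::finite) set"
  assumes "O_lattice L"
  shows "\<exists>C>0. \<forall>u\<in>L. \<forall>i. absK (u $ i) \<le> C"
proof -
  obtain e :: "'r \<Rightarrow> 'f fls ^ 'r" where L: "L = {\<Sum>i\<in>UNIV. c i *s e i | c. \<forall>i. c i \<in> O_infty}"
    using assms by (auto simp: O_lattice_def)
  let ?C = "(\<Sum>j\<in>UNIV. \<Sum>i\<in>UNIV. absK (e j $ i)) + 1"
  have pos: "0 < ?C" by (intro add_nonneg_pos sum_nonneg) auto
  show ?thesis
  proof (intro exI[of _ ?C] conjI ballI allI)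
    fix u i assume "u \<in> L"
    then obtain c where c: "u = (\<Sum>j\<in>UNIV. c j *s e j)" "\<And>j. absK (c j) \<le> 1"
      by (auto simp: L O_infty_def)
    have "u $ i = (\<Sum>j\<in>UNIV. c j * e j $ i)" by (simp add: c(1))
    also have "absK \<dots> \<le> ?C"
    proof (rule absK_sum_le)
      fix j
      have "absK (e j $ i) \<le> (\<Sum>i\<in>UNIV. absK (e j $ i))" by (intro member_le_sum) auto
      also have "\<dots> \<le> (\<Sum>j\<in>UNIV. \<Sum>i\<in>UNIV. absK (e j $ i))" by (intro member_le_sum sum_nonneg) auto
      finally have "absK (e j $ i) \<le> ?C" by simp
      moreover have "absK (c j) * absK (e j $ i) \<le> 1 * absK (e j $ i)" using c(2) by (intro mult_right_mono) auto
      ultimately show "absK (c j * e j $ i) \<le> ?C" by (simp add: absK_mult)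
    qed (use pos in simp)
    finally show "absK (u $ i) \<le> ?C" .
  qed (rule pos)
qed

lemma O_lattice_absorbs:
  fixes L :: "('f fls ^ 'r::finite) set"
  assumes "O_lattice L"
  shows "\<exists>x. v \<in> (*s) x ` L"
proof -
  obtain e :: "'r \<Rightarrow> 'f fls ^ 'r" where e: "inj e" "vec.independent (range e)"
    and L: "L = {\<Sum>i\<in>UNIV. c i *s e i | c. \<forall>i. c i \<in> O_infty}"
    using assms by (auto simp: O_lattice_def)
  have "card (range e) = CARD('r)" using e(1) by (simp add: card_image)
  then have "vec.dim (UNIV :: ('f fls ^ 'r) set) \<le> card (range e)" by (simp only: vec_dim_card order_refl)
  then have "UNIV \<subseteq> vec.span (range e)"
    by (intro vec.card_ge_dim_independent[OF _ e(2)]) simp_all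
  then have "v \<in> vec.span (range e)" by blast
  then obtain b where "v = (\<Sum>x\<in>range e. b x *s x)" using vec.span_finite[of "range e"] by auto
  then have v: "v = (\<Sum>i\<in>UNIV. b (e i) *s e i)" using e(1) by (simp add: sum.reindex)
  obtain N where N: "(\<Sum>i\<in>UNIV. absK (b (e i))) < real CARD('f) ^ N"
    using real_arch_pow[OF q_real_gt_1] by blast
  have "absK (b (e i) / T ^ N) \<le> 1" for i
  proof -
    have "absK (b (e i)) \<le> (\<Sum>i\<in>UNIV. absK (b (e i)))" by (intro member_le_sum) auto
    then have "absK (b (e i)) \<le> real CARD('f) ^ N" using N by linarith
    then show ?thesis unfolding absK_divide absK_power absK_X_inv by (simp add: divide_le_eq)
  qed
  then have "(\<Sum>i\<in>UNIV. (b (e i) / T ^ N) *s e i) \<in> L"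
    unfolding L O_infty_def by (intro CollectI exI[of _ "\<lambda>i. b (e i) / T ^ N"]) simp
  moreover have "v = T ^ N *s (\<Sum>i\<in>UNIV. (b (e i) / T ^ N) *s e i)"
  proof -
    have "T ^ N * (y / T ^ N) = y" for y :: "'f fls"
      using fls_X_inv_pow_nonzero by (subst times_divide_eq_right) (rule nonzero_mult_div_cancel_left)
    then show ?thesis by (simp only: v vec.scale_sum_right vec.scale_scale)
  qed
  ultimately show ?thesis by blast
qed

lemma lattice_norm_lower:
  fixes L :: "('f fls ^ 'r::finite) set"
  assumes "O_lattice L" and C: "0 < C" "\<forall>u\<in>L. \<forall>i. absK (u $ i) \<le> C"
  shows "v \<in> (*s) x ` L \<Longrightarrow> absK (v $ i) / C \<le> absK x"
    and "absK (v $ i) / C \<le> lattice_norm L v"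
proof -
  show bound: "absK (v $ i) / C \<le> absK x" if mem: "v \<in> (*s) x ` L" for x
  proof -
    obtain u where "u \<in> L" "v = x *s u" using mem by auto
    then have "absK (v $ i) \<le> absK x * C" using C(2) by (simp add: absK_mult mult_left_mono)
    then show ?thesis using C(1) by (simp add: pos_divide_le_eq)
  qed
  show "absK (v $ i) / C \<le> lattice_norm L v"
    unfolding lattice_norm_def
  proof (rule cInf_greatest)
    show "{absK x |x. v \<in> (*s) x ` L} \<noteq> {}" using O_lattice_absorbs[OF assms(1)] by blast
  qed (use bound in auto)
qed

text \<open>For nonzero \<open>v\<close> the admissible scalars are bounded away from 0 because
  \<open>L\<close> is bounded, and the values of \<open>absK\<close> are discrete; so the infimum is
  a minimum.\<close>

lemma lattice_norm_attained:
  fixes L :: "('f fls ^ 'r::finite) set"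
  assumes L: "O_lattice L"
  shows "\<exists>x :: 'f fls. lattice_norm L v = absK x"
proof (cases "v = 0")
  case True
  obtain u where "u \<in> L" using O_lattice_absorbs[OF L, of 0] by auto
  then have "v \<in> (*s) 0 ` L" using True by (intro image_eqI[of _ _ u]) simp_all
  then have "0 \<in> {absK x |x. v \<in> (*s) x ` L}" using absK_0 by (metis (mono_tags, lifting) mem_Collect_eq)
  then have "lattice_norm L v = 0"
    unfolding lattice_norm_def by (rule cInf_eq_minimum) auto
  then show ?thesis by (intro exI[of _ 0]) simp
next
  case False
  then obtain i where i: "v $ i \<noteq> 0" by (auto simp: vec_eq_iff)
  obtain C where C: "0 < C" "\<forall>u\<in>L. \<forall>i. absK (u $ i) \<le> C" using O_lattice_bounded[OF L] by blast
  let ?b = "absK (v $ i) / C"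
  have b: "0 < ?b" using i C by simp
  obtain N where N: "1 / ?b < real CARD('f) ^ N" using real_arch_pow[OF q_real_gt_1] by blast
  let ?P = "\<lambda>x. v \<in> (*s) x ` L"
  have nz: "x \<noteq> 0" if "?P x" for x using that False by auto
  have lower: "- int N < - fls_subdegree x" if "?P x" for x
  proof (rule ccontr)
    assume "\<not> - int N < - fls_subdegree x"
    then have "real CARD('f) powi (- fls_subdegree x) \<le> real CARD('f) powi (- int N)"
      by (intro power_int_increasing) (simp_all add: order_less_imp_le)
    then have "absK x \<le> inverse (real CARD('f) ^ N)"
      using nz[OF that] by (simp add: absK_def power_int_minus)
    moreover have "0 < 1 / ?b" using b by (rule divide_pos_pos[OF zero_less_one])
    then have "inverse (real CARD('f) ^ N) < ?b"
      using less_imp_inverse_less[OF N] by simp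
    ultimately show False using lattice_norm_lower(1)[OF L C that, of i] by linarith
  qed
  obtain x0 where "?P x0" using O_lattice_absorbs[OF L] by blast
  \<comment> \<open>By \<open>lower\<close> the integers under \<open>nat\<close> are positive, so
    the least natural number means the largest subdegree.\<close>
  then obtain x where x: "?P x" "\<And>y. ?P y \<Longrightarrow> nat (int N - fls_subdegree x) \<le> nat (int N - fls_subdegree y)"
    using ex_has_least_nat[of ?P x0 "\<lambda>x. nat (int N - fls_subdegree x)"] by blast
  have min: "absK x \<le> absK y" if y: "?P y" for y
  proof -
    have "- fls_subdegree x \<le> - fls_subdegree y"
      using x(2)[OF y] lower[OF x(1)] lower[OF y] by linarith
    then have "real CARD('f) powi (- fls_subdegree x) \<le> real CARD('f) powi (- fls_subdegree y)"
      by (intro power_int_increasing) (simp_all add: order_less_imp_le)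
    then show ?thesis using nz[OF x(1)] nz[OF y] by (simp add: absK_def)
  qed
  have "lattice_norm L v = absK x"
    unfolding lattice_norm_def by (rule cInf_eq_minimum) (use x(1) min in auto)
  then show ?thesis by blast
qed

text \<open>The maximum dominates its term for j = 0, the norm of \<open>L 0\<close>; and it is one
  of its terms, a rational power of q times a value of \<open>absK\<close>.\<close>

lemma barycentric_facts:
  fixes L :: "nat \<Rightarrow> ('f fls ^ 'r::finite) set"
  assumes ch: "simplex_chain m L" and t: "\<forall>i\<le>m. 0 \<le> t i \<and> t i \<in> \<rat>"
  shows "\<exists>\<kappa>>0. \<forall>v i. \<kappa> * absK (v $ i) \<le> barycentric_norm m L t v"
    and "\<exists>z :: 'c. absC z = barycentric_norm m L t v"
proof -
  have OL: "O_lattice (L j)" if "j \<le> m" for j using ch that by (simp add: simplex_chain_def)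
  let ?g = "\<lambda>v j. real CARD('f) powr (- (\<Sum>i<j. t i)) * lattice_norm (L j) v"
  obtain C where C: "0 < C" "\<forall>u\<in>L 0. \<forall>i. absK (u $ i) \<le> C" using O_lattice_bounded[OF OL[of 0]] by auto
  show "\<exists>\<kappa>>0. \<forall>v i. \<kappa> * absK (v $ i) \<le> barycentric_norm m L t v"
  proof (intro exI[of _ "1 / C"] conjI allI)
    fix v i
    have "1 / C * absK (v $ i) \<le> ?g v 0" using lattice_norm_lower(2)[OF OL[of 0] C, of v i] by simp
    also have "\<dots> \<le> barycentric_norm m L t v" unfolding barycentric_norm_def
    proof (rule Max_ge)
      show "?g v 0 \<in> ?g v ` {..m}" by (rule image_eqI[of _ _ 0]) simp_all
    qed simp
    finally show "1 / C * absK (v $ i) \<le> barycentric_norm m L t v" .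
  qed (use C in simp)
  have "barycentric_norm m L t v \<in> ?g v ` {..m}" unfolding barycentric_norm_def by (intro Max_in) auto
  then obtain j where j: "j \<le> m" "barycentric_norm m L t v = ?g v j" by auto
  have "(\<Sum>i<n. t i) \<in> \<rat>" if "n \<le> m" for n using that t by (induction n) (auto intro: Rats_add)
  then obtain y :: 'c where y: "absC y = real CARD('f) powr (- (\<Sum>i<j. t i))"
    using rational_value[of "- (\<Sum>i<j. t i)"] j(1) by auto
  obtain x :: "'f fls" where "lattice_norm (L j) v = absK x" using lattice_norm_attained[OF OL[OF j(1)]] by blast
  then have "absC (y * \<iota> x) = barycentric_norm m L t v" using y j(2) by (simp add: abs_mult embed_abs)
  then show "\<exists>z :: 'c. absC z = barycentric_norm m L t v" by blast
qed

section \<open>Rescaling\<close>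

definition rescale :: "'c \<Rightarrow> 'c ^ 'r::finite \<Rightarrow> 'c ^ 'r" where
  "rescale s \<omega> = (\<chi> i. s * \<omega> $ i)"

lemma ev_rescale: "ev (rescale s \<omega>) v = s * ev \<omega> v"
  by (simp add: ev_def rescale_def sum_distrib_left mult.left_commute)

text \<open>Scaling \<omega> by s scales the lattice, the exponential and the torsion by s and
  divides the coefficient by a power of s.\<close>

lemma qcoeff_rescale:
  fixes \<omega> :: "'c ^ 'r::finite"
  assumes kn: "norm_geq \<kappa> \<nu>" and iso: "iso \<nu> \<omega>" and s: "absC s = 1"
  shows "iso \<nu> (rescale s \<omega>)" and "qcoeff (tors a \<omega>) k = 0 \<Longrightarrow> qcoeff (tors a (rescale s \<omega>)) k = 0"
proof -
  have s0: "s \<noteq> 0" using s by auto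
  show iso': "iso \<nu> (rescale s \<omega>)" using iso s by (simp add: iso_def ev_rescale abs_mult)
  note good = iso_good[OF kn iso] iso_good[OF kn iso']
  have "lexp (rescale s \<omega>) (s * z) = s * lexp \<omega> z" for z
  proof -
    have "ev (rescale s \<omega>) ` A_box n = (*) s ` (ev \<omega> ` A_box n)" for n
      by (simp add: image_image ev_rescale cong: image_cong)
    then have "box_exp (rescale s \<omega>) n (s * z) = s * box_exp \<omega> n z" for n
      unfolding box_exp_def by (simp add: fexp_scale[OF s0])
    moreover have "uconv (UNIV :: unit set) (\<lambda>n t. s * box_exp \<omega> n z) (\<lambda>t. s * lexp \<omega> z)"
      by (intro uconv_mult uconv_const lexp_lim[OF good(1)]) simp_all
    ultimately have "uconv (UNIV :: unit set) (\<lambda>n t. box_exp (rescale s \<omega>) n (s * z)) (\<lambda>t. s * lexp \<omega> z)" by simp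
    from uconv_unique[OF lexp_lim[OF good(2)] this] show ?thesis by simp
  qed
  then have "tors a (rescale s \<omega>) = (*) s ` tors a \<omega>"
    by (simp add: tors_def image_image ev_rescale)
  moreover assume "qcoeff (tors a \<omega>) k = 0"
  ultimately show "qcoeff (tors a (rescale s \<omega>)) k = 0"
    unfolding qcoeff_def by (simp add: coeff_lpoly_scale[OF s0])
qed

text \<open>The extension of pairs is applied to the zero space with \<tau> = 0, where both members
  coincide.\<close>

lemma iso_exists:
  assumes kn: "norm_geq \<kappa> \<nu>" and val: "\<forall>v. \<exists>z :: 'c. absC z = \<nu> v"
  shows "\<exists>\<omega>. iso \<nu> \<omega>"
proof -
  have "iso_on {0} \<nu> (shift 0 0 0)" "iso_on {0} \<nu> 0"
    using norm_geq_seminorm[OF kn] by (simp_all add: iso_on_def)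
  then show ?thesis
    using extend_isometries[OF kn val, of "{0}" 0 0 0] vec.subspace_single_0 by blast
qed

text \<open>Similarity leaves a scalar free. The last coordinate of every \<omega> is 1, so the norm
  with value 1 at the last unit vector is the only one in the class that can be induced, and the
  fibre consists of its isometries.\<close>

lemma fibre_norm:
  fixes x :: "('f fls ^ 'r::{finite,linorder} \<Rightarrow> real) set"
  assumes "x \<in> BT_rat"
  shows "\<exists>\<kappa> \<nu>. norm_geq \<kappa> \<nu> \<and> (\<forall>v. \<exists>z :: 'c. absC z = \<nu> v) \<and> \<nu> (axis (Max UNIV) 1) = 1
    \<and> Omega_fibre \<iota> x = {\<omega>. iso \<nu> \<omega> \<and> \<omega> $ Max UNIV = 1}"
proof -
  obtain m L t where ch: "simplex_chain m L" and t: "\<forall>i\<le>m. 0 \<le> t i \<and> t i \<in> \<rat>"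
    and \<beta>x: "barycentric_norm m L t \<in> x" and x: "x \<in> BT"
    using assms by (auto simp: BT_rat_def)
  define \<beta> where "\<beta> = barycentric_norm m L t"
  obtain \<nu>0 where \<nu>0: "na_norm \<nu>0" "x = norm_similarity `` {\<nu>0}"
    using x by (auto simp: BT_def quotient_def)
  then have "(\<nu>0, \<beta>) \<in> norm_similarity" using \<beta>x by (simp add: \<beta>_def)
  then obtain s where \<beta>: "na_norm \<beta>" "0 < s" "\<And>v. \<beta> v = s * \<nu>0 v" by (auto simp: norm_similarity_def)
  obtain \<kappa> where \<kappa>: "0 < \<kappa>" "\<And>v i. \<kappa> * absK (v $ i) \<le> \<beta> v"
    using barycentric_facts(1)[OF ch t] by (auto simp: \<beta>_def)
  let ?e = "axis (Max UNIV) 1 :: 'f fls ^ ('r::{finite,linorder})"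
  define d where "d = \<beta> ?e"
  have kn\<beta>: "norm_geq \<kappa> \<beta>" using \<beta>(1) \<kappa> by (simp add: norm_geq_def)
  have "?e \<noteq> 0" by (simp add: axis_eq_0_iff)
  then have d: "0 < d" using norm_geq_pos[OF kn\<beta>] by (simp add: d_def)
  define \<nu> where "\<nu> v = \<beta> v / d" for v
  have "\<nu> (v + w) \<le> max (\<nu> v) (\<nu> w)" for v w
  proof -
    have "\<beta> (v + w) \<le> max (\<beta> v) (\<beta> w)" using \<beta>(1) by (simp add: na_norm_def)
    then show ?thesis using d by (auto simp: \<nu>_def max_def divide_le_cancel split: if_splits)
  qed
  then have na: "na_norm \<nu>"
    using \<beta>(1) d by (auto simp: na_norm_def \<nu>_def)
  have kn: "norm_geq (\<kappa> / d) \<nu>"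
    using na \<kappa> d by (simp add: norm_geq_def \<nu>_def divide_right_mono)
  have val: "\<forall>v. \<exists>z :: 'c. absC z = \<nu> v"
  proof
    fix v
    obtain z1 z2 :: 'c where "absC z1 = \<beta> v" "absC z2 = d"
      using barycentric_facts(2)[OF ch t] unfolding \<beta>_def d_def by metis
    then have "absC (z1 / z2) = \<nu> v" by (simp add: \<nu>_def)
    then show "\<exists>z :: 'c. absC z = \<nu> v" by blast
  qed
  have \<nu>e: "\<nu> ?e = 1" using d by (simp add: \<nu>_def d_def)
  have \<nu>\<nu>0: "\<nu> v = (s / d) * \<nu>0 v" for v using \<beta>(3) by (simp add: \<nu>_def)
  have x\<nu>: "x = norm_similarity `` {\<nu>}"
  proof -
    have "(\<nu>0, \<mu>) \<in> norm_similarity \<longleftrightarrow> (\<nu>, \<mu>) \<in> norm_similarity" for \<mu>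
    proof
      assume "(\<nu>0, \<mu>) \<in> norm_similarity"
      then obtain u where "na_norm \<mu>" "0 < u" "\<And>v. \<mu> v = u * \<nu>0 v" by (auto simp: norm_similarity_def)
      then show "(\<nu>, \<mu>) \<in> norm_similarity"
        using na \<beta>(2) d by (auto simp: norm_similarity_def \<nu>\<nu>0 intro!: exI[of _ "u * d / s"])
    next
      assume "(\<nu>, \<mu>) \<in> norm_similarity"
      then obtain u where "na_norm \<mu>" "0 < u" "\<And>v. \<mu> v = u * \<nu> v" by (auto simp: norm_similarity_def)
      then show "(\<nu>0, \<mu>) \<in> norm_similarity"
        using \<nu>0(1) \<beta>(2) d by (auto simp: norm_similarity_def \<nu>\<nu>0 intro!: exI[of _ "u * (s / d)"])
    qed
    then show ?thesis unfolding \<nu>0(2) by blast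
  qed
  have bm: "building_map \<iota> \<omega> = norm_similarity `` {\<lambda>v. absC (ev \<omega> v)}" for \<omega> :: "'c ^ ('r::{finite,linorder})"
    by (simp add: building_map_def ev_def)
  have fib: "Omega_fibre \<iota> x = {\<omega>. iso \<nu> \<omega> \<and> \<omega> $ Max UNIV = 1}"
  proof (intro equalityI subsetI)
    fix \<omega> assume "\<omega> \<in> Omega_fibre \<iota> x"
    then have \<omega>: "\<omega> $ Max UNIV = 1" "norm_similarity `` {\<lambda>v. absC (ev \<omega> v)} = x"
      by (auto simp: Omega_fibre_def Omega_def bm)
    have "(\<nu>, \<nu>) \<in> norm_similarity" using na by (auto simp: norm_similarity_def intro!: exI[of _ 1])
    then have "((\<lambda>v. absC (ev \<omega> v)), \<nu>) \<in> norm_similarity" using \<omega>(2) x\<nu> by blast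
    then obtain u where u: "\<And>v. \<nu> v = u * absC (ev \<omega> v)" by (auto simp: norm_similarity_def)
    from u[of ?e] have "u = 1" using \<nu>e \<omega>(1) by (simp add: ev_axis)
    then show "\<omega> \<in> {\<omega>. iso \<nu> \<omega> \<and> \<omega> $ Max UNIV = 1}" using u \<omega>(1) by (simp add: iso_def)
  next
    fix \<omega> assume "\<omega> \<in> {\<omega>. iso \<nu> \<omega> \<and> \<omega> $ Max UNIV = 1}"
    then have \<omega>: "iso \<nu> \<omega>" "\<omega> $ Max UNIV = 1" by auto
    then have eq: "(\<lambda>v. absC (ev \<omega> v)) = \<nu>" by (auto simp: iso_def)
    have "v = 0" if "(\<Sum>i\<in>UNIV. \<iota> (v $ i) * \<omega> $ i) = 0" for v
      using that good_ev_eq_0[OF iso_good[OF kn \<omega>(1)], of v] by (simp add: ev_def)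
    then have "\<omega> \<in> Omega \<iota>" using \<omega>(2) by (simp add: Omega_def)
    moreover have "building_map \<iota> \<omega> = x" unfolding bm eq x\<nu> by (rule refl)
    ultimately show "\<omega> \<in> Omega_fibre \<iota> x" by (simp add: Omega_fibre_def)
  qed
  show ?thesis using kn val \<nu>e fib by blast
qed

end

theorem theorem3p2:
  fixes \<iota> :: "'f::{field,finite} fls \<Rightarrow> 'c::{alg_closed_field,complete_space}"
    and a :: "'f poly"
    and k :: nat
    and x :: "('f fls ^ 'r::{finite,linorder} \<Rightarrow> real) set"
  assumes "C_infty \<iota>"
    and "CARD('r) \<ge> 2"
    and "degree a \<ge> 1"
    and "k \<le> CARD('r) * degree a"
    and "x \<in> BT_rat"
  shows "((\<exists>\<omega>\<in>Omega_fibre \<iota> x. coeff_form \<iota> a k \<omega> = 0)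
            \<longleftrightarrow> (\<exists>\<omega>\<in>Omega_fibre \<iota> x. k_inseparable \<iota> k (torsion \<iota> a \<omega>)))
       \<and> ((\<exists>\<omega>\<in>Omega_fibre \<iota> x. k_inseparable \<iota> k (torsion \<iota> a \<omega>))
            \<longleftrightarrow> (\<forall>\<omega>\<in>Omega_fibre \<iota> x. k_inseparable \<iota> k (torsion \<iota> a \<omega>)))"
proof -
  interpret C_infty \<iota> by fact
  have a: "a \<noteq> 0" using assms(3) by auto
  obtain \<kappa> \<nu> where kn: "norm_geq \<kappa> \<nu>" and val: "\<forall>v. \<exists>z :: 'c. absC z = \<nu> v"
    and \<nu>e: "\<nu> (axis (Max UNIV) 1) = 1"
    and fib: "Omega_fibre \<iota> x = {\<omega>. iso \<nu> \<omega> \<and> \<omega> $ Max UNIV = 1}"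
    using fibre_norm[OF assms(5)] by blast
  note good = iso_good[OF kn]
  \<comment> \<open>\<open>inseparable_zero\<close> does not keep the last coordinate equal to 1,
    but an isometry makes it a unit, so rescaling brings the point into the fibre.\<close>
  have normalise: "\<exists>\<omega>'\<in>Omega_fibre \<iota> x. qcoeff (tors a \<omega>) k = 0 \<longrightarrow> qcoeff (tors a \<omega>') k = 0" if iso: "iso \<nu> \<omega>" for \<omega>
  proof -
    let ?s = "inverse (\<omega> $ Max UNIV)"
    have 1: "absC (\<omega> $ Max UNIV) = 1" using iso \<nu>e ev_axis[of \<omega> "Max UNIV"] by (metis iso_def)
    then have s: "absC ?s = 1" by simp
    have "\<omega> $ Max UNIV \<noteq> 0" using 1 by auto
    then have "rescale ?s \<omega> $ Max UNIV = 1" by (simp add: rescale_def)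
    then have "rescale ?s \<omega> \<in> Omega_fibre \<iota> x" using qcoeff_rescale(1)[OF kn iso s] fib by simp
    then show ?thesis using qcoeff_rescale(2)[OF kn iso s] by blast
  qed
  have coeff: "coeff_form \<iota> a k \<omega> = 0 \<longleftrightarrow> qcoeff (tors a \<omega>) k = 0" if "\<omega> \<in> Omega_fibre \<iota> x" for \<omega>
    using that a fib by (simp add: coeff_form_eq[OF good])
  have tors: "torsion \<iota> a \<omega> = tors a \<omega>" if "\<omega> \<in> Omega_fibre \<iota> x" for \<omega>
    using that a fib by (simp add: torsion_eq[OF good])
  obtain \<omega>1 where "iso \<nu> \<omega>1" using iso_exists[OF kn val] by blast
  \<comment> \<open>In an empty fibre (C) would hold vacuously.\<close>
  then have nonempty: "\<exists>\<omega>. \<omega> \<in> Omega_fibre \<iota> x" using normalise by blast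
  have same: "k_inseparable \<iota> k (tors a \<omega>) \<longleftrightarrow> k_inseparable \<iota> k (tors a \<omega>')"
    if "\<omega> \<in> Omega_fibre \<iota> x" "\<omega>' \<in> Omega_fibre \<iota> x" for \<omega> \<omega>'
    using that fib by (intro k_inseparable_iso[OF kn _ _ a]) auto
  \<comment> \<open>The bound on k enters here: above the degree the coefficient would be 0 without
    any inseparability.\<close>
  have AB: "k_inseparable \<iota> k (tors a \<omega>)" if "\<omega> \<in> Omega_fibre \<iota> x" "qcoeff (tors a \<omega>) k = 0" for \<omega>
  proof (rule ccontr)
    assume "\<not> k_inseparable \<iota> k (tors a \<omega>)"
    moreover have g: "good \<kappa> \<omega>" using that fib good by simp
    ultimately have "qcoeff (tors a \<omega>) k \<noteq> 0"
      using separable_coeff[OF fsub_tors[OF g a] card_tors[OF g a] assms(4)] by simp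
    then show False using that(2) by simp
  qed
  have BA: "\<exists>\<omega>'\<in>Omega_fibre \<iota> x. qcoeff (tors a \<omega>') k = 0"
    if "\<omega> \<in> Omega_fibre \<iota> x" "k_inseparable \<iota> k (tors a \<omega>)" for \<omega>
  proof -
    have "iso \<nu> \<omega>" using that fib by simp
    from inseparable_zero[OF kn a this that(2)] obtain \<omega>' where "iso \<nu> \<omega>'" "qcoeff (tors a \<omega>') k = 0" by blast
    then show ?thesis using normalise by blast
  qed
  let ?A = "\<exists>\<omega>\<in>Omega_fibre \<iota> x. coeff_form \<iota> a k \<omega> = 0"
  let ?B = "\<exists>\<omega>\<in>Omega_fibre \<iota> x. k_inseparable \<iota> k (torsion \<iota> a \<omega>)"
  let ?C = "\<forall>\<omega>\<in>Omega_fibre \<iota> x. k_inseparable \<iota> k (torsion \<iota> a \<omega>)"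
  have "?A \<Longrightarrow> ?B"
  proof -
    assume ?A
    then obtain \<omega> where \<omega>: "\<omega> \<in> Omega_fibre \<iota> x" "coeff_form \<iota> a k \<omega> = 0" by blast
    have "k_inseparable \<iota> k (torsion \<iota> a \<omega>)"
      unfolding tors[OF \<omega>(1)] by (rule AB[OF \<omega>(1) coeff[OF \<omega>(1), THEN iffD1, OF \<omega>(2)]])
    then show ?B using \<omega>(1) by blast
  qed
  moreover have "?B \<Longrightarrow> ?A"
  proof -
    assume ?B
    then obtain \<omega> where \<omega>: "\<omega> \<in> Omega_fibre \<iota> x" "k_inseparable \<iota> k (torsion \<iota> a \<omega>)" by blast
    from BA[OF \<omega>(1) \<omega>(2)[unfolded tors[OF \<omega>(1)]]] coeff show ?A by blast
  qed
  moreover have "?B \<Longrightarrow> ?C"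
  proof -
    assume ?B
    then obtain \<omega> where \<omega>: "\<omega> \<in> Omega_fibre \<iota> x" "k_inseparable \<iota> k (torsion \<iota> a \<omega>)" by blast
    have "k_inseparable \<iota> k (torsion \<iota> a \<omega>')" if "\<omega>' \<in> Omega_fibre \<iota> x" for \<omega>'
      using \<omega>(2) unfolding tors[OF \<omega>(1)] tors[OF that] same[OF \<omega>(1) that] .
    then show ?C by blast
  qed
  moreover have "?C \<Longrightarrow> ?B" using nonempty by blast
  ultimately show ?thesis by blast
qed

end
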